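(* Let $0\le\kappa\le n$ and $(\epsilon_1,\ldots,\epsilon_n)=(\underbrace{1,\ldots,1}_{\kappa},\underbrace{0,\ldots,0}_{n-\kappa})$. Then $$S^{\mathrm{tr}}(z|\epsilon_1,\ldots,\epsilon_n)=R_A(z|\epsilon_1,\ldots,\epsilon_n)\quad (n\ge 2),\qquad S^{1,1}(z|\epsilon_1,\ldots,\epsilon_n)=\tilde R_B(z|\epsilon_1,\ldots,\epsilon_n)\quad (n\ge 1),$$ where the first equality holds in $\mathrm{End}(\mathcal W_l\otimes\mathcal W_m)$ for every $l,m$ (with $0\le l,m\le n$ if $\kappa=n$, and $l,m\in\mathbb Z_{\ge0}$ if $\kappa<n$), and the second equality holds in $\mathrm{End}(\mathcal W\otimes\mathcal W)$.
   Context: **Notation.** $q^{1/2},x,y$ are generic (algebraically independent indeterminates over $\mathbb C$); vector spaces are over $\mathbb C(q^{1/2},x,y)$; $z=x/y$. $(a;q)_m=\prod_{k=1}^m(1-aq^{k-1})$, $(q)_m=(q;q)_m$, $(q^2)_m=(q^2;q^2)_m$, $\binom{m}{k}_{q^2}=\frac{(q^2)_m}{(q^2)_k(q^2)_{m-k}}$ (zero unless $0\le k\le m$), $[m]=\frac{q^m-q^{-m}}{q-q^{-1}}$, $(a)_+=\max(a,0)$, $p=\mathrm i q^{-1/2}$ with $\mathrm i=\sqrt{-1}$. **Spaces.** $F$ has basis $|m\rangle$, $m\in\mathbb Z_{\ge0}$; $V$ has basis $|0\rangle,|1\rangle$. $W^{(0)}=F$, $W^{(1)}=V$. For $(\epsilon_1,\ldots,\epsilon_n)\in\{0,1\}^n$,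 $\mathcal W=W^{(\epsilon_1)}\otimes\cdots\otimes W^{(\epsilon_n)}$ has basis $|\mathbf m\rangle=|m_1,\ldots,m_n\rangle$ ($m_i\in\mathbb Z_{\ge0}$ if $\epsilon_i=0$, $m_i\in\{0,1\}$ if $\epsilon_i=1$). $|\mathbf m|=m_1+\cdots+m_n$; $\mathcal W_l\subset\mathcal W$ is the span of $|\mathbf m\rangle$ with $|\mathbf m|=l$. $\mathbf e_i$ is the $i$th standard basis vector of $\mathbb Z^n$, $\mathbf e_{>k}=\mathbf e_{k+1}+\cdots+\mathbf e_n$, $\mathbf 0=(0,\ldots,0)$. **3D $R$ and 3D $L$.** For nonnegative integer indices $$\mathscr S^{(0)\,a,b,c}_{\ \ \ \,i,j,k}=\delta_{a+b,i+j}\delta_{b+c,j+k}\sum_{\lambda,\mu\ge0,\ \lambda+\mu=b}(-1)^\lambda q^{i(c-j)+(k+1)\lambda+\mu(\mu-k)}\frac{(q^2)_{c+\mu}}{(q^2)_c}\binom{i}{\mu}_{q^2}\binom{j}{\lambda}_{q^2}.$$ $\mathscr S^{(1)\,a,b,c}_{\ \ \ \,i,j,k}$ ($a,b,i,j\in\{0,1\}$, $c,k\in\mathbb Z_{\ge0}$) is zero except $\mathscr S^{(1)0,0,c}_{\ \ \ 0,0,k}=\mathscr S^{(1)1,1,c}_{\ \ \ 1,1,k}=\delta_{c,k}$, $\mathscr S^{(1)0,1,c}_{\ \ \ 0,1,k}=-\delta_{c,k}q^{k+1}$, $\mathscr S^{(1)1,0,c}_{\ \ \ 1,0,k}=\delta_{c,k}q^k$,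 $\mathscr S^{(1)0,1,c}_{\ \ \ 1,0,k}=\delta_{c,k-1}(1-q^{2k})$, $\mathscr S^{(1)1,0,c}_{\ \ \ 0,1,k}=\delta_{c,k+1}$. **$S^{\mathrm{tr}}$ and $S^{1,1}$.** $S(z)(|\mathbf i\rangle\otimes|\mathbf j\rangle)=\sum_{\mathbf a,\mathbf b}S(z)^{\mathbf a,\mathbf b}_{\mathbf i,\mathbf j}|\mathbf a\rangle\otimes|\mathbf b\rangle$ with (sums over nonnegative integers, understood as power series in $z$; after normalization they are rational in $z$) $$S^{\mathrm{tr}}(z)^{\mathbf a,\mathbf b}_{\mathbf i,\mathbf j}=\varrho(z)\sum_{c_0,\ldots,c_{n-1}}z^{c_0}\prod_{k=1}^n\mathscr S^{(\epsilon_k)\,a_k,b_k,c_{k-1}}_{\ \ \ \ \,i_k,j_k,c_k}\quad(c_n:=c_0),$$ $$S^{1,1}(z)^{\mathbf a,\mathbf b}_{\mathbf i,\mathbf j}=\varrho(z)\sum_{c_0,\ldots,c_n}\frac{z^{c_0}(q^2)_{c_0}}{(q)_{c_0}(q)_{c_n}}\prod_{k=1}^n\mathscr S^{(\epsilon_k)\,a_k,b_k,c_{k-1}}_{\ \ \ \ \,i_k,j_k,c_k}.$$ $S^{\mathrm{tr}}(z)$ preserves each $\mathcal W_l\otimes\mathcal W_m$. Normalization: for $S^{\mathrm{tr}}$ on $\mathcal W_l\otimes\mathcal W_m$, $\varrho(z)=(-q)^{-(m-l)_+}(1-q^{|l-m|}z)$ if all $\epsilon_i=1$ (so that $|\mathbf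 e_{>n-l}\rangle\otimes|\mathbf e_{>n-m}\rangle$ is fixed), and $\varrho(z)=\frac{z^{-m}(q^{l-m}z;q^2)_{m+1}}{(q^{l-m+2}z^{-1};q^2)_m}$ if some $\epsilon_i=0$ (so that $|l\mathbf e_i\rangle\otimes|m\mathbf e_i\rangle$ is fixed for any $i$ with $\epsilon_i=0$); for $S^{1,1}$, $\varrho(z)=\frac{(z;q)_\infty}{(-qz;q)_\infty}$ (so that $|\mathbf 0\rangle\otimes|\mathbf 0\rangle$ is fixed). **Algebras.** $q_i=q$ if $\epsilon_i=0$, $q_i=-q^{-1}$ if $\epsilon_i=1$. $\tilde n=n-1$ for $\mathcal U_A(\epsilon_1,\ldots,\epsilon_n)$, $\tilde n=n$ for $\mathcal U_B(\epsilon_1,\ldots,\epsilon_n)$, with $\tilde n\ge1$; for $\mathcal U_A$ all indices are in $\mathbb Z/n\mathbb Z$. $\langle i\rangle=\{i,i+1\}$ for $\mathcal U_A$, $\langle i\rangle=\{i,i+1\}\cap[1,n]$ for $\mathcal U_B$; $D_{i,j}=\prod_{k\in\langle i\rangle\cap\langle j\rangle}q_k^{2\delta_{i,j}-1}$; $r_i=q$ for $\mathcal U_A$; for $\mathcal U_B$, $r_0=r_n=p$ and $r_i=q$ for $0<i<n$. $\mathcal U_A,\mathcal U_B$ are generated by $e_i,f_i,k_i^{\pm1}$ ($0\le i\le\tilde n$) with relations $k_ik_i^{-1}=k_i^{-1}k_i=1$, $[k_i,k_j]=0$, $k_ie_j=D_{i,j}e_jk_i$, $k_if_j=D_{i,j}^{-1}f_jk_i$,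 $[e_i,f_j]=\delta_{i,j}\frac{k_i-k_i^{-1}}{r_i-r_i^{-1}}$, and coproduct $\Delta k_i^{\pm1}=k_i^{\pm1}\otimes k_i^{\pm1}$, $\Delta e_i=1\otimes e_i+e_i\otimes k_i$, $\Delta f_i=f_i\otimes1+k_i^{-1}\otimes f_i$. $\Delta'$ is the opposite coproduct. **Representations $\pi_x$.** (Vectors $|\mathbf m'\rangle$ with indices out of range are zero.) $\mathcal U_A$ on $\mathcal W_l$, $i\in\mathbb Z/n\mathbb Z$: $e_i|\mathbf m\rangle=x^{\delta_{i,0}}[m_i]|\mathbf m-\mathbf e_i+\mathbf e_{i+1}\rangle$, $f_i|\mathbf m\rangle=x^{-\delta_{i,0}}[m_{i+1}]|\mathbf m+\mathbf e_i-\mathbf e_{i+1}\rangle$, $k_i|\mathbf m\rangle=q_i^{-m_i}q_{i+1}^{m_{i+1}}|\mathbf m\rangle$. $\mathcal U_B$ on $\mathcal W$: for $0<i<n$ the same formulas (no $x$), and $e_0|\mathbf m\rangle=x|\mathbf m+\mathbf e_1\rangle$, $f_0|\mathbf m\rangle=x^{-1}[m_1]|\mathbf m-\mathbf e_1\rangle$, $k_0|\mathbf m\rangle=p^{-1}q_1^{m_1}|\mathbf m\rangle$, $e_n|\mathbf m\rangle=[m_n]|\mathbf m-\mathbf e_n\rangle$, $f_n|\mathbf m\rangle=|\mathbf m+\mathbf e_n\rangle$, $k_n|\mathbf m\rangle=p\,q_n^{-m_n}|\mathbf m\rangle$. **Quantum $R$ matrices.** $R(z)$, $z=x/y$, is the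 operator on $\mathcal W_l\otimes\mathcal W_m$ (for $\mathcal U_A$), resp. $\mathcal W\otimes\mathcal W$ (for $\mathcal U_B$), determined by $(\pi_x\otimes\pi_y)\Delta'(g)\,R(z)=R(z)\,(\pi_x\otimes\pi_y)\Delta(g)$ for all $g$ in the algebra, together with the normalization below. For $\mathcal U_A$ write $R_A(z|\epsilon_1,\ldots,\epsilon_n)=R(z)$, normalized by $R(z)(|\mathbf e_{>n-l}\rangle\otimes|\mathbf e_{>n-m}\rangle)=|\mathbf e_{>n-l}\rangle\otimes|\mathbf e_{>n-m}\rangle$ if all $\epsilon_i=1$, and by $R(z)(|l\mathbf e_i\rangle\otimes|m\mathbf e_i\rangle)=|l\mathbf e_i\rangle\otimes|m\mathbf e_i\rangle$ for an index $i$ with $\epsilon_i=0$ otherwise. For $\mathcal U_B$ put $\tilde R_B(z|\epsilon_1,\ldots,\epsilon_n)=(K^{-1}\otimes1)R(z)(1\otimes K)$ with $K|\mathbf m\rangle=p^{-|\mathbf m|}|\mathbf m\rangle$, normalized by $\tilde R_B(z)(|\mathbf 0\rangle\otimes|\mathbf 0\rangle)=|\mathbf 0\rangle\otimes|\mathbf 0\rangle$. *)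

theory Defs
  imports
    "HOL-Computational_Algebra.Computational_Algebra"
    "HOL-Library.Poly_Mapping"
    "HOL-Library.FuncSet"
begin

section \<open>The ground field \<open>C(q^(1/2), x, y)\<close>\<close>

type_synonym gfield = "complex poly poly poly fract"

definition cK :: "complex \<Rightarrow> gfield" where "cK c = to_fract [:[:[:c:]:]:]"
definition qhK :: gfield where "qhK = to_fract [:[:[:0, 1:]:]:]"
definition xK :: gfield where "xK = to_fract [:[:0, 1:]:]"
definition yK :: gfield where "yK = to_fract [:0, 1:]"

definition qK :: gfield where "qK = qhK ^ 2"
definition zK :: gfield where "zK = xK / yK"
definition pK :: gfield where "pK = cK \<i> * inverse qhK"

definition qint :: "nat \<Rightarrow> gfield" where
  "qint m = (qK powi int m - qK powi (- int m)) / (qK - inverse qK)"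

section \<open>Formal series and their rational values\<close>

text \<open>
  Matrix elements of \<open>S(z)\<close> are computed as Laurent series in \<open>z\<close> whose coefficients are
  Laurent series in \<open>q^(1/2)\<close>.  The inner Laurent series (instead of rational functions of
  \<open>q^(1/2)\<close>) give a meaning to the infinite product \<open>(z;q)_\<infinity>\<close>.
\<close>

type_synonym lser = "complex fls fls"

definition qhs :: "complex fls" where "qhs = fls_X"
definition qs :: "complex fls" where "qs = qhs ^ 2"
definition qL :: lser where "qL = fls_const qs"
definition zL :: lser where "zL = fls_X"

definition zseries :: "(nat \<Rightarrow> complex fls) \<Rightarrow> lser" where
  "zseries A = fps_to_fls (Abs_fps A)"

text \<open>Value at \<open>(s, t)\<close> of \<open>P \<in> C[q^(1/2)][z]\<close>, with scalars embedded by \<open>emb\<close>.\<close>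

definition eval2 :: "(complex \<Rightarrow> 'a::comm_ring_1) \<Rightarrow> 'a \<Rightarrow> 'a \<Rightarrow> complex poly poly \<Rightarrow> 'a" where
  "eval2 emb s t P = poly (map_poly (\<lambda>c. poly (map_poly emb c) s) P) t"

definition evalL :: "complex poly poly \<Rightarrow> lser" where
  "evalL = eval2 (\<lambda>c. fls_const (fls_const c)) (fls_const qhs) zL"

definition evalK :: "complex poly poly \<Rightarrow> gfield" where
  "evalK = eval2 cK qhK zK"

text \<open>
  The series \<open>f\<close> is the expansion of a rational function \<open>P/Q\<close> of \<open>q^(1/2)\<close> and \<open>z\<close>, and
  \<open>r\<close> is this rational function at \<open>z = x/y\<close>.  As \<open>q^(1/2)\<close> and \<open>x/y\<close> are algebraically
  independent, \<open>evalK Q\<close> is nonzero and \<open>r\<close> is determined by \<open>f\<close>.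
\<close>

definition expansion_of :: "lser \<Rightarrow> gfield \<Rightarrow> bool" where
  "expansion_of f r \<longleftrightarrow>
     (\<exists>P Q. Q \<noteq> 0 \<and> evalL Q * f = evalL P \<and> r = evalK P / evalK Q)"

definition rational_series :: "lser \<Rightarrow> bool" where
  "rational_series f \<longleftrightarrow> (\<exists>r. expansion_of f r)"

definition rat_value :: "lser \<Rightarrow> gfield" where
  "rat_value f = (THE r. expansion_of f r)"

definition qpoch :: "'a::comm_ring_1 \<Rightarrow> 'a \<Rightarrow> nat \<Rightarrow> 'a" where
  "qpoch a q m = (\<Prod>k=1..m. 1 - a * q ^ (k - 1))"

text \<open>
  \<open>(a;q)_\<infinity>\<close>: each coefficient of a power of \<open>z\<close> is the limit, in the topology of formal
  Laurent series in \<open>q^(1/2)\<close>, of that coefficient of the finite products.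
\<close>

definition qpoch_inf :: "lser \<Rightarrow> lser \<Rightarrow> lser" where
  "qpoch_inf a q = Abs_fls (\<lambda>d. lim (\<lambda>m. fls_nth (qpoch a q m) d))"

definition qbinom :: "'a::field \<Rightarrow> nat \<Rightarrow> nat \<Rightarrow> 'a" where
  "qbinom q m k = (if k \<le> m then qpoch q q m / (qpoch q q k * qpoch q q (m - k)) else 0)"

section \<open>3D R and 3D L\<close>

text \<open>Arguments after \<open>q\<close>: the upper indices \<open>a b c\<close>, then the lower indices \<open>i j k\<close>.\<close>

definition scrS0 :: "'a::field \<Rightarrow> nat \<Rightarrow> nat \<Rightarrow> nat \<Rightarrow> nat \<Rightarrow> nat \<Rightarrow> nat \<Rightarrow> 'a" where
  "scrS0 q a b c i j k =
    (if a + b = i + j \<and> b + c = j + k then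
       (\<Sum>(lam, mu) \<in> {(lam, mu). lam + mu = b}.
          (-1) ^ lam
          * q powi (int i * (int c - int j) + (int k + 1) * int lam + int mu * (int mu - int k))
          * (qpoch (q^2) (q^2) (c + mu) / qpoch (q^2) (q^2) c)
          * qbinom (q^2) i mu * qbinom (q^2) j lam)
     else 0)"

definition scrS1 :: "'a::field \<Rightarrow> nat \<Rightarrow> nat \<Rightarrow> nat \<Rightarrow> nat \<Rightarrow> nat \<Rightarrow> nat \<Rightarrow> 'a" where
  "scrS1 q a b c i j k =
    (if (a, b, i, j) = (0, 0, 0, 0) \<or> (a, b, i, j) = (1, 1, 1, 1) then of_bool (c = k)
     else if (a, b, i, j) = (0, 1, 0, 1) then - of_bool (c = k) * q ^ (k + 1)
     else if (a, b, i, j) = (1, 0, 1, 0) then of_bool (c = k) * q ^ k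
     else if (a, b, i, j) = (0, 1, 1, 0) then of_bool (c + 1 = k) * (1 - q ^ (2 * k))
     else if (a, b, i, j) = (1, 0, 0, 1) then of_bool (c = k + 1)
     else 0)"

definition scrS ::
  "nat \<Rightarrow> 'a::field \<Rightarrow> nat \<Rightarrow> nat \<Rightarrow> nat \<Rightarrow> nat \<Rightarrow> nat \<Rightarrow> nat \<Rightarrow> 'a" where
  "scrS e = (if e = 0 then scrS0 else scrS1)"

section \<open>Spaces\<close>

text \<open>
  The labels \<open>m = (m_1,...,m_n)\<close> and the signature \<open>\<epsilon>\<close> are functions of the index \<open>1,...,n\<close>;
  labels vanish at all other arguments.  A vector is a finitely supported coefficient
  function on labels (on pairs of labels for tensor products).
\<close>

type_synonym label = "nat \<Rightarrow> nat"

definition states :: "nat \<Rightarrow> (nat \<Rightarrow> nat) \<Rightarrow> label set" where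
  "states n eps = {m. (\<forall>k. k \<notin> {1..n} \<longrightarrow> m k = 0) \<and> (\<forall>k\<in>{1..n}. eps k = 1 \<longrightarrow> m k \<le> 1)}"

definition lsum :: "nat \<Rightarrow> label \<Rightarrow> nat" where
  "lsum n m = (\<Sum>k=1..n. m k)"

definition states_of :: "nat \<Rightarrow> (nat \<Rightarrow> nat) \<Rightarrow> nat \<Rightarrow> label set" where
  "states_of n eps l = {m \<in> states n eps. lsum n m = l}"

definition space_on :: "'b set \<Rightarrow> ('b \<Rightarrow>\<^sub>0 gfield) set" where
  "space_on B = {v. Poly_Mapping.keys v \<subseteq> B}"

definition smul :: "gfield \<Rightarrow> ('b \<Rightarrow>\<^sub>0 gfield) \<Rightarrow> ('b \<Rightarrow>\<^sub>0 gfield)" where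
  "smul c v = Poly_Mapping.map (\<lambda>d. c * d) v"

definition ket :: "'b \<Rightarrow> ('b \<Rightarrow>\<^sub>0 gfield)" where
  "ket b = Poly_Mapping.single b 1"

definition lin_ext :: "('b \<Rightarrow> ('c \<Rightarrow>\<^sub>0 gfield)) \<Rightarrow> ('b \<Rightarrow>\<^sub>0 gfield) \<Rightarrow> ('c \<Rightarrow>\<^sub>0 gfield)" where
  "lin_ext f v = (\<Sum>b\<in>Poly_Mapping.keys v. smul (Poly_Mapping.lookup v b) (f b))"

text \<open>\<open>|m'\<rangle>\<close> for an integer vector \<open>m'\<close>, which is zero if an index is out of range.\<close>

definition iket :: "nat \<Rightarrow> (nat \<Rightarrow> nat) \<Rightarrow> (nat \<Rightarrow> int) \<Rightarrow> (label \<Rightarrow>\<^sub>0 gfield)" where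
  "iket n eps m' =
     (if (\<forall>k. 0 \<le> m' k) \<and> (\<lambda>k. nat (m' k)) \<in> states n eps then ket (\<lambda>k. nat (m' k)) else 0)"

text \<open>Linear endomorphisms of a subspace, undefined outside of it.\<close>

definition End :: "('b \<Rightarrow>\<^sub>0 gfield) set \<Rightarrow> (('b \<Rightarrow>\<^sub>0 gfield) \<Rightarrow> ('b \<Rightarrow>\<^sub>0 gfield)) set" where
  "End V = {T \<in> V \<rightarrow>\<^sub>E V. (\<forall>v\<in>V. \<forall>w\<in>V. T (v + w) = T v + T w) \<and>
                        (\<forall>c. \<forall>v\<in>V. T (smul c v) = smul c (T v))}"

definition tens :: "('b \<Rightarrow>\<^sub>0 gfield) \<Rightarrow> ('c \<Rightarrow>\<^sub>0 gfield) \<Rightarrow> ('b \<times> 'c \<Rightarrow>\<^sub>0 gfield)" where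
  "tens v w = (\<Sum>a\<in>Poly_Mapping.keys v. \<Sum>b\<in>Poly_Mapping.keys w.
                 Poly_Mapping.single (a, b) (Poly_Mapping.lookup v a * Poly_Mapping.lookup w b))"

definition tens_op ::
  "(('b \<Rightarrow>\<^sub>0 gfield) \<Rightarrow> ('b \<Rightarrow>\<^sub>0 gfield)) \<Rightarrow> (('c \<Rightarrow>\<^sub>0 gfield) \<Rightarrow> ('c \<Rightarrow>\<^sub>0 gfield)) \<Rightarrow>
   ('b \<times> 'c \<Rightarrow>\<^sub>0 gfield) \<Rightarrow> ('b \<times> 'c \<Rightarrow>\<^sub>0 gfield)" where
  "tens_op A B = lin_ext (\<lambda>(i, j). tens (A (ket i)) (B (ket j)))"

definition WW_A :: "nat \<Rightarrow> (nat \<Rightarrow> nat) \<Rightarrow> nat \<Rightarrow> nat \<Rightarrow> (label \<times> label \<Rightarrow>\<^sub>0 gfield) set" where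
  "WW_A n eps l m = space_on (states_of n eps l \<times> states_of n eps m)"

definition WW_B :: "nat \<Rightarrow> (nat \<Rightarrow> nat) \<Rightarrow> (label \<times> label \<Rightarrow>\<^sub>0 gfield) set" where
  "WW_B n eps = space_on (states n eps \<times> states n eps)"

section \<open>\<open>S^tr\<close> and \<open>S^{1,1}\<close>\<close>

definition scrS_prod ::
  "nat \<Rightarrow> (nat \<Rightarrow> nat) \<Rightarrow> label \<Rightarrow> label \<Rightarrow> label \<Rightarrow> label \<Rightarrow> (nat \<Rightarrow> nat) \<Rightarrow> complex fls" where
  "scrS_prod n eps a b i j c =
     (\<Prod>k=1..n. scrS (eps k) qs (a k) (b k) (c (k - 1)) (i k) (j k) (c k))"

text \<open>
  For given \<open>a, b, i, j\<close> and \<open>c_0\<close> at most one sequence \<open>c\<close> gives a nonzero term (a nonzero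
  product forces \<open>b_k + c_(k-1) = j_k + c_k\<close>); \<open>sum'\<close> adds up the nonzero terms.
\<close>

definition Str_coeff ::
  "nat \<Rightarrow> (nat \<Rightarrow> nat) \<Rightarrow> label \<Rightarrow> label \<Rightarrow> label \<Rightarrow> label \<Rightarrow> nat \<Rightarrow> complex fls" where
  "Str_coeff n eps a b i j c0 =
     sum' (scrS_prod n eps a b i j) {c. c 0 = c0 \<and> c n = c0 \<and> (\<forall>k>n. c k = 0)}"

definition S11_coeff ::
  "nat \<Rightarrow> (nat \<Rightarrow> nat) \<Rightarrow> label \<Rightarrow> label \<Rightarrow> label \<Rightarrow> label \<Rightarrow> nat \<Rightarrow> complex fls" where
  "S11_coeff n eps a b i j c0 =
     sum' (\<lambda>c. qpoch (qs^2) (qs^2) c0 / (qpoch qs qs c0 * qpoch qs qs (c n))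
                * scrS_prod n eps a b i j c)
          {c. c 0 = c0 \<and> (\<forall>k>n. c k = 0)}"

definition rho_tr :: "nat \<Rightarrow> (nat \<Rightarrow> nat) \<Rightarrow> nat \<Rightarrow> nat \<Rightarrow> lser" where
  "rho_tr n eps l m =
     (if \<forall>k\<in>{1..n}. eps k = 1 then
        (- qL) powi (- max (int m - int l) 0) * (1 - qL powi \<bar>int l - int m\<bar> * zL)
      else
        zL powi (- int m) * qpoch (qL powi (int l - int m) * zL) (qL^2) (m + 1)
        / qpoch (qL powi (int l - int m + 2) * inverse zL) (qL^2) m)"

definition rho_11 :: lser where
  "rho_11 = qpoch_inf zL qL / qpoch_inf (- qL * zL) qL"

definition Str_elem ::
  "nat \<Rightarrow> (nat \<Rightarrow> nat) \<Rightarrow> nat \<Rightarrow> nat \<Rightarrow> label \<Rightarrow> label \<Rightarrow> label \<Rightarrow> label \<Rightarrow> lser" where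
  "Str_elem n eps l m a b i j = rho_tr n eps l m * zseries (Str_coeff n eps a b i j)"

definition S11_elem ::
  "nat \<Rightarrow> (nat \<Rightarrow> nat) \<Rightarrow> label \<Rightarrow> label \<Rightarrow> label \<Rightarrow> label \<Rightarrow> lser" where
  "S11_elem n eps a b i j = rho_11 * zseries (S11_coeff n eps a b i j)"

definition Str ::
  "nat \<Rightarrow> (nat \<Rightarrow> nat) \<Rightarrow> nat \<Rightarrow> nat \<Rightarrow>
   (label \<times> label \<Rightarrow>\<^sub>0 gfield) \<Rightarrow> (label \<times> label \<Rightarrow>\<^sub>0 gfield)" where
  "Str n eps l m = restrict
     (lin_ext (\<lambda>(i, j). sum' (\<lambda>(a, b). smul (rat_value (Str_elem n eps l m a b i j)) (ket (a, b)))
                              (states_of n eps l \<times> states_of n eps m)))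
     (WW_A n eps l m)"

definition S11 ::
  "nat \<Rightarrow> (nat \<Rightarrow> nat) \<Rightarrow> (label \<times> label \<Rightarrow>\<^sub>0 gfield) \<Rightarrow> (label \<times> label \<Rightarrow>\<^sub>0 gfield)" where
  "S11 n eps = restrict
     (lin_ext (\<lambda>(i, j). sum' (\<lambda>(a, b). smul (rat_value (S11_elem n eps a b i j)) (ket (a, b)))
                              (states n eps \<times> states n eps)))
     (WW_B n eps)"

section \<open>The algebras \<open>U_A\<close> and \<open>U_B\<close>\<close>

datatype gen = GE nat | GF nat | GK nat | GKinv nat

datatype uexp = Gen gen | Sc gfield | Add uexp uexp | Mul uexp uexp

abbreviation Neg :: "uexp \<Rightarrow> uexp" where "Neg t \<equiv> Mul (Sc (-1)) t"

primrec gen_index :: "gen \<Rightarrow> nat" where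
  "gen_index (GE i) = i" | "gen_index (GF i) = i" | "gen_index (GK i) = i" | "gen_index (GKinv i) = i"

primrec uindices :: "uexp \<Rightarrow> nat set" where
  "uindices (Gen g) = {gen_index g}"
| "uindices (Sc c) = {}"
| "uindices (Add s t) = uindices s \<union> uindices t"
| "uindices (Mul s t) = uindices s \<union> uindices t"

text \<open>
  Congruence generated by the axioms of a unital associative algebra over the ground field
  and by the relations for \<open>e_i, f_i, k_i, k_i^(-1)\<close> (\<open>i \<le> N\<close>).
\<close>

inductive ueq :: "nat \<Rightarrow> (nat \<Rightarrow> nat \<Rightarrow> gfield) \<Rightarrow> (nat \<Rightarrow> gfield) \<Rightarrow> uexp \<Rightarrow> uexp \<Rightarrow> bool"
  for N :: nat and D :: "nat \<Rightarrow> nat \<Rightarrow> gfield" and r :: "nat \<Rightarrow> gfield" where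
  refl: "ueq N D r t t"
| sym: "ueq N D r s t \<Longrightarrow> ueq N D r t s"
| trans: "ueq N D r s t \<Longrightarrow> ueq N D r t u \<Longrightarrow> ueq N D r s u"
| add_cong: "ueq N D r s s' \<Longrightarrow> ueq N D r t t' \<Longrightarrow> ueq N D r (Add s t) (Add s' t')"
| mul_cong: "ueq N D r s s' \<Longrightarrow> ueq N D r t t' \<Longrightarrow> ueq N D r (Mul s t) (Mul s' t')"
| add_assoc: "ueq N D r (Add (Add s t) u) (Add s (Add t u))"
| add_comm: "ueq N D r (Add s t) (Add t s)"
| add_zero: "ueq N D r (Add (Sc 0) t) t"
| add_neg: "ueq N D r (Add t (Neg t)) (Sc 0)"
| mul_assoc: "ueq N D r (Mul (Mul s t) u) (Mul s (Mul t u))"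
| mul_one: "ueq N D r (Mul (Sc 1) t) t"
| distrib_l: "ueq N D r (Mul s (Add t u)) (Add (Mul s t) (Mul s u))"
| distrib_r: "ueq N D r (Mul (Add s t) u) (Add (Mul s u) (Mul t u))"
| sc_add: "ueq N D r (Sc (c + d)) (Add (Sc c) (Sc d))"
| sc_mul: "ueq N D r (Sc (c * d)) (Mul (Sc c) (Sc d))"
| sc_central: "ueq N D r (Mul (Sc c) t) (Mul t (Sc c))"
| k_kinv: "i \<le> N \<Longrightarrow> ueq N D r (Mul (Gen (GK i)) (Gen (GKinv i))) (Sc 1)"
| kinv_k: "i \<le> N \<Longrightarrow> ueq N D r (Mul (Gen (GKinv i)) (Gen (GK i))) (Sc 1)"
| k_k: "i \<le> N \<Longrightarrow> j \<le> N \<Longrightarrow>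
    ueq N D r (Mul (Gen (GK i)) (Gen (GK j))) (Mul (Gen (GK j)) (Gen (GK i)))"
| k_e: "i \<le> N \<Longrightarrow> j \<le> N \<Longrightarrow>
    ueq N D r (Mul (Gen (GK i)) (Gen (GE j)))
              (Mul (Sc (D i j)) (Mul (Gen (GE j)) (Gen (GK i))))"
| k_f: "i \<le> N \<Longrightarrow> j \<le> N \<Longrightarrow>
    ueq N D r (Mul (Gen (GK i)) (Gen (GF j)))
              (Mul (Sc (inverse (D i j))) (Mul (Gen (GF j)) (Gen (GK i))))"
| e_f: "i \<le> N \<Longrightarrow> j \<le> N \<Longrightarrow>
    ueq N D r (Add (Mul (Gen (GE i)) (Gen (GF j))) (Neg (Mul (Gen (GF j)) (Gen (GE i)))))
              (Mul (Sc (of_bool (i = j) / (r i - inverse (r i))))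
                   (Add (Gen (GK i)) (Neg (Gen (GKinv i)))))"

text \<open>The elements of the algebra are the classes of expressions modulo \<open>ueq\<close>.\<close>

definition ualg :: "nat \<Rightarrow> (nat \<Rightarrow> nat \<Rightarrow> gfield) \<Rightarrow> (nat \<Rightarrow> gfield) \<Rightarrow> uexp set set" where
  "ualg N D r = {t. uindices t \<subseteq> {..N}} //
     {(s, t). uindices s \<subseteq> {..N} \<and> uindices t \<subseteq> {..N} \<and> ueq N D r s t}"

definition q_i :: "(nat \<Rightarrow> nat) \<Rightarrow> nat \<Rightarrow> gfield" where
  "q_i eps i = (if eps i = 0 then qK else - inverse qK)"

text \<open>Representative in \<open>{1..n}\<close> of the class of \<open>i \<le> n\<close> in \<open>Z/nZ\<close>.\<close>

definition cyc :: "nat \<Rightarrow> nat \<Rightarrow> nat" where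
  "cyc n i = (if i = 0 then n else i)"

definition D_of :: "(nat \<Rightarrow> nat) \<Rightarrow> (nat \<Rightarrow> nat set) \<Rightarrow> nat \<Rightarrow> nat \<Rightarrow> gfield" where
  "D_of eps br i j = (\<Prod>k \<in> br i \<inter> br j. q_i eps k powi (2 * of_bool (i = j) - 1))"

text \<open>Indices of \<open>U_A\<close> in \<open>Z/nZ\<close> are represented by \<open>0,...,n-1\<close>.\<close>

definition U_A :: "nat \<Rightarrow> (nat \<Rightarrow> nat) \<Rightarrow> uexp set set" where
  "U_A n eps = ualg (n - 1) (D_of eps (\<lambda>i. {cyc n i, i + 1})) (\<lambda>i. qK)"

definition U_B :: "nat \<Rightarrow> (nat \<Rightarrow> nat) \<Rightarrow> uexp set set" where
  "U_B n eps = ualg n (D_of eps (\<lambda>i. {i, i + 1} \<inter> {1..n}))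
     (\<lambda>i. if i = 0 \<or> i = n then pK else qK)"

text \<open>The coproduct, with elements of the tensor square written as formal sums of pure tensors.\<close>

primrec coprod_gen :: "gen \<Rightarrow> (uexp \<times> uexp) list" where
  "coprod_gen (GE i) = [(Sc 1, Gen (GE i)), (Gen (GE i), Gen (GK i))]"
| "coprod_gen (GF i) = [(Gen (GF i), Sc 1), (Gen (GKinv i), Gen (GF i))]"
| "coprod_gen (GK i) = [(Gen (GK i), Gen (GK i))]"
| "coprod_gen (GKinv i) = [(Gen (GKinv i), Gen (GKinv i))]"

primrec coprod :: "uexp \<Rightarrow> (uexp \<times> uexp) list" where
  "coprod (Gen g) = coprod_gen g"
| "coprod (Sc c) = [(Sc c, Sc 1)]"
| "coprod (Add s t) = coprod s @ coprod t"
| "coprod (Mul s t) = [(Mul a c, Mul b d). (a, b) \<leftarrow> coprod s, (c, d) \<leftarrow> coprod t]"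

definition coprod_op :: "uexp \<Rightarrow> (uexp \<times> uexp) list" where
  "coprod_op t = map prod.swap (coprod t)"

section \<open>Representations\<close>

text \<open>
  The action of \<open>e_i, f_i, k_i, k_i^(-1)\<close> common to both algebras: \<open>a\<close>, \<open>b\<close> are the
  positions \<open>i\<close>, \<open>i+1\<close> (modulo \<open>n\<close>), and \<open>u\<close> stands for \<open>x\<close> if \<open>i = 0\<close> in \<open>U_A\<close>
  and for 1 otherwise.
\<close>

definition hop ::
  "nat \<Rightarrow> (nat \<Rightarrow> nat) \<Rightarrow> gfield \<Rightarrow> nat \<Rightarrow> nat \<Rightarrow> gen \<Rightarrow> (label \<Rightarrow>\<^sub>0 gfield) \<Rightarrow> (label \<Rightarrow>\<^sub>0 gfield)" where
  "hop n eps u a b g = lin_ext (\<lambda>m. case g of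
      GE i \<Rightarrow> smul (u * qint (m a))
                  (iket n eps (\<lambda>k. int (m k) - of_bool (k = a) + of_bool (k = b)))
    | GF i \<Rightarrow> smul (inverse u * qint (m b))
                  (iket n eps (\<lambda>k. int (m k) + of_bool (k = a) - of_bool (k = b)))
    | GK i \<Rightarrow> smul (q_i eps a powi (- int (m a)) * q_i eps b powi int (m b)) (ket m)
    | GKinv i \<Rightarrow> smul (inverse (q_i eps a powi (- int (m a)) * q_i eps b powi int (m b))) (ket m))"

definition pi_A ::
  "nat \<Rightarrow> (nat \<Rightarrow> nat) \<Rightarrow> gfield \<Rightarrow> gen \<Rightarrow> (label \<Rightarrow>\<^sub>0 gfield) \<Rightarrow> (label \<Rightarrow>\<^sub>0 gfield)" where
  "pi_A n eps x g =
     (let i = gen_index g in hop n eps (if i = 0 then x else 1) (cyc n i) (i + 1) g)"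

definition pi_B0 ::
  "nat \<Rightarrow> (nat \<Rightarrow> nat) \<Rightarrow> gfield \<Rightarrow> gen \<Rightarrow> (label \<Rightarrow>\<^sub>0 gfield) \<Rightarrow> (label \<Rightarrow>\<^sub>0 gfield)" where
  "pi_B0 n eps x g = lin_ext (\<lambda>m. case g of
      GE i \<Rightarrow> smul x (iket n eps (\<lambda>k. int (m k) + of_bool (k = 1)))
    | GF i \<Rightarrow> smul (inverse x * qint (m 1)) (iket n eps (\<lambda>k. int (m k) - of_bool (k = 1)))
    | GK i \<Rightarrow> smul (inverse pK * q_i eps 1 powi int (m 1)) (ket m)
    | GKinv i \<Rightarrow> smul (inverse (inverse pK * q_i eps 1 powi int (m 1))) (ket m))"

definition pi_Bn ::
  "nat \<Rightarrow> (nat \<Rightarrow> nat) \<Rightarrow> gen \<Rightarrow> (label \<Rightarrow>\<^sub>0 gfield) \<Rightarrow> (label \<Rightarrow>\<^sub>0 gfield)" where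
  "pi_Bn n eps g = lin_ext (\<lambda>m. case g of
      GE i \<Rightarrow> smul (qint (m n)) (iket n eps (\<lambda>k. int (m k) - of_bool (k = n)))
    | GF i \<Rightarrow> iket n eps (\<lambda>k. int (m k) + of_bool (k = n))
    | GK i \<Rightarrow> smul (pK * q_i eps n powi (- int (m n))) (ket m)
    | GKinv i \<Rightarrow> smul (inverse (pK * q_i eps n powi (- int (m n)))) (ket m))"

definition pi_B ::
  "nat \<Rightarrow> (nat \<Rightarrow> nat) \<Rightarrow> gfield \<Rightarrow> gen \<Rightarrow> (label \<Rightarrow>\<^sub>0 gfield) \<Rightarrow> (label \<Rightarrow>\<^sub>0 gfield)" where
  "pi_B n eps x g =
     (let i = gen_index g in
      if i = 0 then pi_B0 n eps x g
      else if i = n then pi_Bn n eps g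
      else hop n eps 1 i (i + 1) g)"

text \<open>Extension of an action of the generators to expressions.\<close>

primrec uact ::
  "(gen \<Rightarrow> ('b \<Rightarrow>\<^sub>0 gfield) \<Rightarrow> ('b \<Rightarrow>\<^sub>0 gfield)) \<Rightarrow> uexp \<Rightarrow> ('b \<Rightarrow>\<^sub>0 gfield) \<Rightarrow> ('b \<Rightarrow>\<^sub>0 gfield)" where
  "uact \<pi> (Gen g) = \<pi> g"
| "uact \<pi> (Sc c) = smul c"
| "uact \<pi> (Add s t) = (\<lambda>v. uact \<pi> s v + uact \<pi> t v)"
| "uact \<pi> (Mul s t) = (\<lambda>v. uact \<pi> s (uact \<pi> t v))"

definition tens_act ::
  "(gen \<Rightarrow> ('b \<Rightarrow>\<^sub>0 gfield) \<Rightarrow> ('b \<Rightarrow>\<^sub>0 gfield)) \<Rightarrow> (gen \<Rightarrow> ('b \<Rightarrow>\<^sub>0 gfield) \<Rightarrow> ('b \<Rightarrow>\<^sub>0 gfield)) \<Rightarrow>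
   (uexp \<times> uexp) list \<Rightarrow> ('b \<times> 'b \<Rightarrow>\<^sub>0 gfield) \<Rightarrow> ('b \<times> 'b \<Rightarrow>\<^sub>0 gfield)" where
  "tens_act \<pi>1 \<pi>2 X v = (\<Sum>(s, t)\<leftarrow>X. tens_op (uact \<pi>1 s) (uact \<pi>2 t) v)"

section \<open>Quantum R matrices\<close>

text \<open>
  The representations respect the defining relations, so an element \<open>g\<close> of the algebra acts
  through any of its representatives \<open>t\<close>.
\<close>

definition intertwines ::
  "uexp set set \<Rightarrow> (gen \<Rightarrow> ('b \<Rightarrow>\<^sub>0 gfield) \<Rightarrow> ('b \<Rightarrow>\<^sub>0 gfield)) \<Rightarrow>
   (gen \<Rightarrow> ('b \<Rightarrow>\<^sub>0 gfield) \<Rightarrow> ('b \<Rightarrow>\<^sub>0 gfield)) \<Rightarrow> ('b \<times> 'b \<Rightarrow>\<^sub>0 gfield) set \<Rightarrow>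
   (('b \<times> 'b \<Rightarrow>\<^sub>0 gfield) \<Rightarrow> ('b \<times> 'b \<Rightarrow>\<^sub>0 gfield)) \<Rightarrow> bool" where
  "intertwines U \<pi>1 \<pi>2 V R \<longleftrightarrow>
     (\<forall>g\<in>U. \<forall>t\<in>g. \<forall>v\<in>V.
        tens_act \<pi>1 \<pi>2 (coprod_op t) (R v) = R (tens_act \<pi>1 \<pi>2 (coprod t) v))"

text \<open>The normalization of \<open>R_A\<close> refers to an index \<open>i\<close> with \<open>\<epsilon>_i = 0\<close> unless all
  \<open>\<epsilon>_k\<close> are 1, in which case \<open>i\<close> is irrelevant.\<close>

definition ref_state :: "nat \<Rightarrow> (nat \<Rightarrow> nat) \<Rightarrow> nat \<Rightarrow> nat \<Rightarrow> label" where
  "ref_state n eps i l =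
     (if \<forall>k\<in>{1..n}. eps k = 1 then (\<lambda>k. of_bool (n - l < k \<and> k \<le> n))
      else (\<lambda>k. if k = i then l else 0))"

definition is_R_A ::
  "nat \<Rightarrow> (nat \<Rightarrow> nat) \<Rightarrow> nat \<Rightarrow> nat \<Rightarrow> nat \<Rightarrow>
   ((label \<times> label \<Rightarrow>\<^sub>0 gfield) \<Rightarrow> (label \<times> label \<Rightarrow>\<^sub>0 gfield)) \<Rightarrow> bool" where
  "is_R_A n eps l m i R \<longleftrightarrow>
     R \<in> End (WW_A n eps l m) \<and>
     intertwines (U_A n eps) (pi_A n eps xK) (pi_A n eps yK) (WW_A n eps l m) R \<and>
     R (ket (ref_state n eps i l, ref_state n eps i m)) =
       ket (ref_state n eps i l, ref_state n eps i m)"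

definition R_A ::
  "nat \<Rightarrow> (nat \<Rightarrow> nat) \<Rightarrow> nat \<Rightarrow> nat \<Rightarrow> nat \<Rightarrow>
   (label \<times> label \<Rightarrow>\<^sub>0 gfield) \<Rightarrow> (label \<times> label \<Rightarrow>\<^sub>0 gfield)" where
  "R_A n eps l m i = (THE R. is_R_A n eps l m i R)"

definition K_op :: "nat \<Rightarrow> (label \<Rightarrow>\<^sub>0 gfield) \<Rightarrow> (label \<Rightarrow>\<^sub>0 gfield)" where
  "K_op n = lin_ext (\<lambda>m. smul (pK powi (- int (lsum n m))) (ket m))"

definition Kinv_op :: "nat \<Rightarrow> (label \<Rightarrow>\<^sub>0 gfield) \<Rightarrow> (label \<Rightarrow>\<^sub>0 gfield)" where
  "Kinv_op n = lin_ext (\<lambda>m. smul (pK powi int (lsum n m)) (ket m))"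

text \<open>\<open>(K^(-1) \<otimes> 1) R (1 \<otimes> K)\<close>\<close>

definition twist_B ::
  "nat \<Rightarrow> (nat \<Rightarrow> nat) \<Rightarrow> ((label \<times> label \<Rightarrow>\<^sub>0 gfield) \<Rightarrow> (label \<times> label \<Rightarrow>\<^sub>0 gfield)) \<Rightarrow>
   (label \<times> label \<Rightarrow>\<^sub>0 gfield) \<Rightarrow> (label \<times> label \<Rightarrow>\<^sub>0 gfield)" where
  "twist_B n eps R =
     restrict (\<lambda>v. tens_op (Kinv_op n) id (R (tens_op id (K_op n) v))) (WW_B n eps)"

definition is_R_B ::
  "nat \<Rightarrow> (nat \<Rightarrow> nat) \<Rightarrow>
   ((label \<times> label \<Rightarrow>\<^sub>0 gfield) \<Rightarrow> (label \<times> label \<Rightarrow>\<^sub>0 gfield)) \<Rightarrow> bool" where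
  "is_R_B n eps R \<longleftrightarrow>
     R \<in> End (WW_B n eps) \<and>
     intertwines (U_B n eps) (pi_B n eps xK) (pi_B n eps yK) (WW_B n eps) R \<and>
     twist_B n eps R (ket (\<lambda>_. 0, \<lambda>_. 0)) = ket (\<lambda>_. 0, \<lambda>_. 0)"

definition R_B_tilde ::
  "nat \<Rightarrow> (nat \<Rightarrow> nat) \<Rightarrow> (label \<times> label \<Rightarrow>\<^sub>0 gfield) \<Rightarrow> (label \<times> label \<Rightarrow>\<^sub>0 gfield)" where
  "R_B_tilde n eps = twist_B n eps (THE R. is_R_B n eps R)"

end

theory Submission
  imports Defs
begin

text \<open>
  The matrix elements of \<open>S\<close> are sums over paths \<open>c_0, ..., c_n\<close> of products of site elements, and
  the theorem rests on linear relations between the elements of a single site in which one of the labels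
  \<open>a, b, i, j\<close> moves by one (\<open>site_X_e1\<close> to \<open>site_Y_f2\<close>).  They have the same form for the 3D R and
  the 3D L.  A generator \<open>e_r\<close> or \<open>f_r\<close> moves one particle between two neighbouring sites.  The
  contributions of the two terms of its coproduct change the path only at the link between these
  sites, and one relation at each end of the link shows that the two sides of the intertwining
  relation agree (\<open>two_site_e\<close>, \<open>two_site_f\<close>).  Summation over \<open>c_0\<close> with weight \<open>z^(c_0)\<close> turns
  this into \<open>\<Delta>'(g) S = S \<Delta>(g)\<close> for the trace, where \<open>z\<close> appears when the link is the one that
  closes the cycle.  For the boundary weights \<open>(-q)_c\<close> and \<open>1/(q)_c\<close> of \<open>S^{1,1}\<close>, the recursions
  \<open>(-q)_(c+1) = (1 + q^(c+1)) (-q)_c\<close> and \<open>1/(q)_c = (1 - q^(c+1))/(q)_(c+1)\<close> replace the missing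
  site at an end of the chain, and the operator \<open>K\<close> absorbs the powers of \<open>p\<close>.

  So the series satisfy the intertwining relation over the field of Laurent series in \<open>z\<close>.  What
  remains is that they are rational, and that an intertwiner with the given normalization is unique.
  Both are instances of one statement (\<open>generated_entries\<close>).  Take a valuation \<open>v\<close> with
  \<open>v(x) > v(y)\<close>.  After a gauge transformation by the positions of the particles, the dominant
  term of \<open>\<Delta>(e_r) = 1 \<otimes> e_r + e_r \<otimes> k_r\<close> is the hop of the second factor, and that of
  \<open>\<Delta>(f_r) = f_r \<otimes> 1 + k_r^(-1) \<otimes> f_r\<close> is the hop of the first factor.  Any state can be reached
  from the reference state by hops (\<open>hop_steps_connected\<close>), so for every basis vector there is a
  vector generated from the reference vector that has it as its unique dominant term; such vectors
  are linearly independent.  An intertwiner is known on them as soon as it is known on the reference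
  vector.  Hence each of its entries lies in the field generated by \<open>q, p, x, y\<close>, and the difference
  of two normalized intertwiners is zero.

  The normalizing factors are the reciprocals of explicit sums: a geometric series if all sites
  are fermionic, the diagonal entries of the 3D R summed over the auxiliary label (\<open>diag_series_formula\<close>)
  if some site is bosonic, and the \<open>q\<close>-binomial series for \<open>S^{1,1}\<close> (\<open>q_binomial\<close>).  Finally the
  value of a rational series at \<open>z = x/y\<close> is a field homomorphism, which carries the relations to
  \<open>C(q^(1/2), x, y)\<close>.
\<close>

section \<open>The 3D R and the 3D L at one site\<close>

text \<open>
  Integer labels, with value zero at negative ones, let the relations below be stated without case
  distinctions at the ends of the label ranges.  The argument \<open>e\<close> selects the 3D R or the 3D L.
\<close>
definition site_elem :: "nat \<Rightarrow> 'a::field \<Rightarrow> int \<Rightarrow> int \<Rightarrow> int \<Rightarrow> int \<Rightarrow> int \<Rightarrow> int \<Rightarrow> 'a" where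
  "site_elem e q a b c i j k =
    (if 0 \<le> a \<and> 0 \<le> b \<and> 0 \<le> c \<and> 0 \<le> i \<and> 0 \<le> j \<and> 0 \<le> k
     then scrS e q (nat a) (nat b) (nat c) (nat i) (nat j) (nat k) else 0)"

lemma site_elem_neg:
  "a < 0 \<or> b < 0 \<or> c < 0 \<or> i < 0 \<or> j < 0 \<or> k < 0 \<Longrightarrow> site_elem e q a b c i j k = 0"
  by (auto simp: site_elem_def)

lemma scrS1_weight: "scrS1 q a b c i j k \<noteq> 0 \<Longrightarrow> a + b = i + j \<and> b + c = j + k"
  unfolding scrS1_def of_bool_def
  by (simp only: split: if_split_asm) auto

text \<open>
  These conservation laws leave one free label in a chain of sites: \<open>c_0\<close> determines the whole path.
\<close>
lemma site_elem_weight: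
  assumes "a + b \<noteq> i + j \<or> b + c \<noteq> j + k" "e \<le> 1"
  shows "site_elem e q a b c i j k = 0"
proof (rule ccontr)
  assume nz: "site_elem e q a b c i j k \<noteq> 0"
  then have "0 \<le> a" "0 \<le> b" "0 \<le> c" "0 \<le> i" "0 \<le> j" "0 \<le> k"
    by (auto simp: site_elem_def split: if_splits)
  then obtain a' b' c' i' j' k' where n: "a = int a'" "b = int b'" "c = int c'" "i = int i'" "j = int j'" "k = int k'"
    by (metis nonneg_eq_int)
  have "a' + b' = i' + j' \<and> b' + c' = j' + k'"
  proof (cases "e = 0")
    case True
    with nz n show ?thesis by (simp add: site_elem_def scrS_def scrS0_def split: if_splits)
  next
    case False
    with nz n show ?thesis by (intro scrS1_weight) (simp add: site_elem_def scrS_def)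
  qed
  with n assms show False by auto
qed

lemma qpoch_0 [simp]: "qpoch a q 0 = 1"
  by (simp add: qpoch_def)

lemma qpoch_Suc: "qpoch a q (Suc m) = qpoch a q m * (1 - a * q ^ m)"
  by (simp add: qpoch_def)

locale generic_q =
  fixes q :: "'a::field"
  assumes q_nz [simp]: "q \<noteq> 0"
    and q_no_root: "m > 0 \<Longrightarrow> q ^ m \<noteq> 1"
begin

text \<open>\<open>(q^2)_m\<close>\<close>
abbreviation po :: "nat \<Rightarrow> 'a" where "po \<equiv> qpoch (q\<^sup>2) (q\<^sup>2)"

lemma po_Suc: "po (Suc m) = po m * (1 - q ^ (2 * Suc m))"
proof -
  have "q\<^sup>2 * (q\<^sup>2) ^ m = q ^ (2 * Suc m)" by (simp only: power_mult power_Suc)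
  then show ?thesis by (simp only: qpoch_Suc)
qed

lemma po_nz [simp]: "po m \<noteq> 0"
  by (induction m) (use q_no_root[of "2 * Suc _"] in \<open>auto simp: po_Suc simp del: mult_Suc_right\<close>)

abbreviation qb :: "nat \<Rightarrow> nat \<Rightarrow> 'a" where "qb \<equiv> qbinom (q\<^sup>2)"

lemma qb_0 [simp]: "qb m 0 = 1" by (simp add: qbinom_def)

lemma qb_gt: "k > m \<Longrightarrow> qb m k = 0" by (simp add: qbinom_def)

lemma qb_Pascal:
  "qb (Suc m) (Suc k) = qb m (Suc k) + q powi (2 * (int m - int k)) * qb m k"
proof -
  consider "k > m" | "k = m" | "k < m" by linarith
  then show ?thesis
  proof cases
    case 1 then show ?thesis by (simp add: qbinom_def)
  next
    case 2 then show ?thesis by (simp add: qbinom_def)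
  next
    case 3
    define r where "r = m - Suc k"
    have m: "m = k + r + 1" using 3 by (simp add: r_def)
    have pw: "q powi (2 * (int m - int k)) = q ^ (2 * Suc r)"
    proof -
      have "2 * (int m - int k) = int (2 * Suc r)" using m by simp
      then show ?thesis by (metis power_int_of_nat)
    qed
    have e: "q ^ (2 * Suc m) = q ^ (2 * Suc k) * q ^ (2 * Suc r)"
      using m by (simp add: power_add[symmetric])
    have d: "Suc m - Suc k = Suc r" "m - k = Suc r" "m - Suc k = r" using m by auto
    have "1 - q ^ (2 * Suc k) \<noteq> 0" "1 - q ^ (2 * Suc r) \<noteq> 0"
      using q_no_root[of "2 * Suc k"] q_no_root[of "2 * Suc r"] by auto
    moreover have "1 - q ^ (2 * Suc m) = (1 - q ^ (2 * Suc r)) + q ^ (2 * Suc r) * (1 - q ^ (2 * Suc k))"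
      by (simp only: e) algebra
    moreover have "P * A / (K * D * (R * B)) = P / (K * D * R) + C * (P / (K * (R * B)))"
      if "A = B + C * D" "B \<noteq> 0" "D \<noteq> 0" "K \<noteq> 0" "R \<noteq> 0" for P A K D R B C :: 'a
      using that by (simp add: field_simps)
    ultimately have "po m * (1 - q ^ (2 * Suc m)) / (po k * (1 - q ^ (2 * Suc k)) * (po r * (1 - q ^ (2 * Suc r))))
      = po m / (po k * (1 - q ^ (2 * Suc k)) * po r)
        + q ^ (2 * Suc r) * (po m / (po k * (po r * (1 - q ^ (2 * Suc r)))))"
      using po_nz by blast
    then show ?thesis using 3
      unfolding qbinom_def d pw po_Suc by (simp del: mult_Suc_right)
  qed
qed

text \<open>
  The sum of the 3D R without the Kronecker deltas, with \<open>\<lambda> = b - \<mu>\<close>.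
\<close>
definition G :: "nat \<Rightarrow> nat \<Rightarrow> nat \<Rightarrow> nat \<Rightarrow> nat \<Rightarrow> 'a" where
  "G b c i j k = (\<Sum>\<mu>\<le>b. (-1) ^ (b - \<mu>)
      * q powi (int i * (int c - int j) + (int k + 1) * int (b - \<mu>) + int \<mu> * (int \<mu> - int k))
      * (po (c + \<mu>) / po c) * qb i \<mu> * qb j (b - \<mu>))"

text \<open>
  The summation range of \<open>\<mu>\<close> may be taken independent of \<open>i\<close> and \<open>j\<close>; this value makes up for it.
\<close>
lemma G_large: "b > i + j \<Longrightarrow> G b c i j k = 0"
  unfolding G_def
proof (rule sum.neutral, safe)
  fix \<mu> assume "i + j < b" "\<mu> \<le> b"
  then have "qb i \<mu> = 0 \<or> qb j (b - \<mu>) = 0"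
    by (cases "\<mu> > i") (auto intro: qb_gt)
  then show "(-1) ^ (b - \<mu>) * q powi (int i * (int c - int j) + (int k + 1) * int (b - \<mu>) +
      int \<mu> * (int \<mu> - int k)) * (po (c + \<mu>) / po c) * qb i \<mu> * qb j (b - \<mu>) = 0" by auto
qed

lemma sum_pairs: "(\<Sum>(lam, mu) \<in> {(lam, mu). lam + mu = b}. f lam mu) = (\<Sum>\<mu>\<le>b. f (b - \<mu>) \<mu>)"
  for f :: "nat \<Rightarrow> nat \<Rightarrow> 'a"
  by (rule sum.reindex_bij_witness[where i = "\<lambda>\<mu>. (b - \<mu>, \<mu>)" and j = snd]) auto

lemma site_elem_G:
  assumes "a + int b = int i + int j" "b + c = j + k"
  shows "site_elem 0 q a (int b) (int c) (int i) (int j) (int k) = G b c i j k"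
proof (cases "a \<ge> 0")
  case True
  then have "nat a + b = i + j" using assms by linarith
  then show ?thesis using assms True
    by (simp add: site_elem_def scrS_def scrS0_def sum_pairs G_def)
next
  case False
  then show ?thesis using assms by (simp add: site_elem_neg G_large)
qed

lemma q_power_powi: "q ^ m * q powi x = q powi (int m + x)"
  by (simp add: power_int_add)

lemma mult_front: "x * y = z \<Longrightarrow> x * (s * y * u * v * w) = z * (s * u * w) * v"
  for x y z s u v w :: 'a
  by (drule HOL.sym) (simp add: mult_ac)

text \<open>
  The \<open>q\<close>-Pascal rule for \<open>binom(i + 1, \<mu>)\<close> splits the sum; the second part is a sum of the same kind after
  the shift \<open>\<mu> \<rightarrow> \<mu> + 1\<close>, \<open>c \<rightarrow> c + 1\<close>.
\<close>
lemma G_rec: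
  assumes "b + c = j + k"
  shows "q ^ j * G b c (Suc i) j k = q ^ c * G b c i j k +
     q powi (int i + 1 + int j - int b) * (1 - q ^ (2 * Suc c)) * (if b = 0 then 0 else G (b - 1) (Suc c) i j k)"
proof (cases b)
  case 0
  have "int j + int (Suc i) * (int c - int j) = int c + int i * (int c - int j)"
    by (simp add: algebra_simps)
  then have "q ^ j * q powi (int (Suc i) * (int c - int j)) = q ^ c * q powi (int i * (int c - int j))"
    by (simp only: q_power_powi)
  then show ?thesis using 0 by (simp add: G_def)
next
  case (Suc b')
  define t where "t = (\<lambda>i b c \<mu>. (-1) ^ (b - \<mu>)
      * q powi (int i * (int c - int j) + (int k + 1) * int (b - \<mu>) + int \<mu> * (int \<mu> - int k))
      * (po (c + \<mu>) / po c) * qb i \<mu> * qb j (b - \<mu>))"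
  have G: "G b c i j k = (\<Sum>\<mu>\<le>b. t i b c \<mu>)" for b c i by (simp add: G_def t_def)
  have t0: "q ^ j * t (Suc i) b c 0 = q ^ c * t i b c 0"
  proof -
    have "q ^ j * q powi (int (Suc i) * (int c - int j) + (int k + 1) * int b)
        = q ^ c * q powi (int i * (int c - int j) + (int k + 1) * int b)"
      unfolding q_power_powi by (rule arg_cong[of _ _ "power_int q"]) (simp add: algebra_simps)
    then show ?thesis unfolding t_def
      by (subst (1 2) mult_front[OF HOL.refl]) simp
  qed
  have ts: "q ^ j * t (Suc i) b c (Suc \<mu>) = q ^ c * t i b c (Suc \<mu>) +
      q powi (int i + 1 + int j - int b) * (1 - q ^ (2 * Suc c)) * t i b' (Suc c) \<mu>"
    if "\<mu> \<le> b'" for \<mu>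
  proof -
    have nz: "1 - q ^ (2 * Suc c) \<noteq> 0" using q_no_root[of "2 * Suc c"] by auto
    define E where "E = int i * (int c - int j) + (int k + 1) * int (b - Suc \<mu>) + int (Suc \<mu>) * (int (Suc \<mu>) - int k)"
    define X where "X = (-1) ^ (b - Suc \<mu>) * (po (c + Suc \<mu>) / po c) * qb j (b - Suc \<mu>)"
    have A: "q ^ j * t (Suc i) b c (Suc \<mu>) = q powi (E + int c) * X * qb (Suc i) (Suc \<mu>)"
    proof -
      have "q ^ j * q powi (int (Suc i) * (int c - int j) + (int k + 1) * int (b - Suc \<mu>) + int (Suc \<mu>) * (int (Suc \<mu>) - int k))
        = q powi (E + int c)"
        unfolding q_power_powi E_def by (rule arg_cong[of _ _ "power_int q"]) (simp add: algebra_simps)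
      then show ?thesis unfolding t_def X_def by (rule mult_front)
    qed
    have B: "q ^ c * t i b c (Suc \<mu>) = q powi (E + int c) * X * qb i (Suc \<mu>)"
    proof -
      have "q ^ c * q powi E = q powi (E + int c)"
        unfolding q_power_powi by (simp add: add.commute)
      then show ?thesis unfolding t_def X_def E_def[symmetric] by (rule mult_front)
    qed
    have C: "q powi (int i + 1 + int j - int b) * (1 - q ^ (2 * Suc c)) * t i b' (Suc c) \<mu>
        = q powi (E + int c) * q powi (2 * (int i - int \<mu>)) * X * qb i \<mu>"
    proof -
      define E' where "E' = int i * (int (Suc c) - int j) + (int k + 1) * int (b' - \<mu>) + int \<mu> * (int \<mu> - int k)"
      have k: "int k = int b + int c - int j" using assms by linarith
      have "q powi (int i + 1 + int j - int b) * q powi E' = q powi (E + int c) * q powi (2 * (int i - int \<mu>))"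
        unfolding power_int_add[OF disjI1[OF q_nz], symmetric] E_def E'_def k
        using that Suc by (simp add: of_nat_diff algebra_simps)
      moreover have "t i b' (Suc c) \<mu> * (1 - q ^ (2 * Suc c)) = q powi E' * X * qb i \<mu>"
        using nz Suc by (simp add: t_def E'_def X_def po_Suc field_simps del: mult_Suc_right)
      moreover have "x * d * t = z * X * b" if "x * y = z" "t * d = y * X * b" for x y z t d b :: 'a
      proof -
        have "x * d * t = x * (t * d)" by (simp add: mult_ac)
        also have "\<dots> = (x * y) * X * b" by (simp only: that(2) mult.assoc)
        finally show ?thesis by (simp only: that(1))
      qed
      ultimately show ?thesis by (metis (no_types))
    qed
    show ?thesis unfolding A B C qb_Pascal by (simp add: algebra_simps)
  qed
  define K where "K = q powi (int i + 1 + int j - int b) * (1 - q ^ (2 * Suc c))"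
  have "q ^ j * G b c (Suc i) j k = q ^ j * t (Suc i) b c 0 + (\<Sum>\<mu>\<le>b'. q ^ j * t (Suc i) b c (Suc \<mu>))"
    unfolding G unfolding Suc sum.atMost_Suc_shift by (simp only: distrib_left sum_distrib_left)
  also have "(\<Sum>\<mu>\<le>b'. q ^ j * t (Suc i) b c (Suc \<mu>)) =
      (\<Sum>\<mu>\<le>b'. q ^ c * t i b c (Suc \<mu>) + K * t i b' (Suc c) \<mu>)"
    unfolding K_def by (rule sum.cong[OF HOL.refl], rule ts) simp
  also have "\<dots> = q ^ c * (\<Sum>\<mu>\<le>b'. t i b c (Suc \<mu>)) + K * G b' (Suc c) i j k"
    unfolding G sum.distrib sum_distrib_left ..
  also have "q ^ j * t (Suc i) b c 0 + (q ^ c * (\<Sum>\<mu>\<le>b'. t i b c (Suc \<mu>)) + K * G b' (Suc c) i j k)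
      = q ^ c * (t i b c 0 + (\<Sum>\<mu>\<le>b'. t i b c (Suc \<mu>))) + K * G b' (Suc c) i j k"
    unfolding t0 by (simp only: distrib_left add.assoc)
  also have "t i b c 0 + (\<Sum>\<mu>\<le>b'. t i b c (Suc \<mu>)) = G b c i j k"
    unfolding G unfolding Suc sum.atMost_Suc_shift ..
  finally have *: "q ^ j * G b c (Suc i) j k = q ^ c * G b c i j k + K * G b' (Suc c) i j k" .
  have b: "(if b = 0 then 0 else G (b - 1) (Suc c) i j k) = G b' (Suc c) i j k" unfolding Suc by simp
  show ?thesis unfolding b using * unfolding K_def .
qed

text \<open>
  This recursion in \<open>i\<close> is the only consequence of the explicit sum that is needed: together with
  the values at \<open>i = 0\<close> it determines the 3D R, and every further relation follows from it by
  induction.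
\<close>
lemma S0_up_i:
  assumes "i \<ge> 0"
  shows "q powi j * site_elem 0 q a b c (i + 1) j k =
    q powi c * site_elem 0 q (a - 1) b c i j k + (1 - q powi (2 * c + 2)) * q powi a * site_elem 0 q a (b - 1) (c + 1) i j k"
proof (cases "a + b = i + 1 + j \<and> b + c = j + k")
  case False
  then show ?thesis by (auto simp: site_elem_weight)
next
  case True
  consider "b < 0 \<or> j < 0 \<or> k < 0 \<or> c < -1" | "c = -1" | "b \<ge> 0" "j \<ge> 0" "k \<ge> 0" "c \<ge> 0" by linarith
  then show ?thesis
  proof cases
    case 1 then show ?thesis by (auto simp: site_elem_neg)
  next
    case 2 then show ?thesis by (auto simp: site_elem_neg)
  next
    case 3
    then obtain b' j' k' c' i' where n: "b = int b'" "j = int j'" "k = int k'" "c = int c'" "i = int i'"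
      using assms by (metis nonneg_eq_int)
    have w: "b' + c' = j' + k'" using True n by linarith
    have 1: "site_elem 0 q a b c (i + 1) j k = G b' c' (Suc i') j' k'"
      using site_elem_G[of a b' "Suc i'" j' c' k'] True w n by (simp add: add.commute)
    have 2: "site_elem 0 q (a - 1) b c i j k = G b' c' i' j' k'"
      using site_elem_G[of "a - 1" b' i' j' c' k'] True w n by simp
    have 3: "site_elem 0 q a (b - 1) (c + 1) i j k = (if b' = 0 then 0 else G (b' - 1) (Suc c') i' j' k')"
      using site_elem_G[of a "b' - 1" i' j' "Suc c'" k'] True w n by (auto simp: site_elem_neg of_nat_diff add.commute)
    have a: "a = int i' + 1 + int j' - int b'" using True n by linarith
    have c: "q powi (2 * c + 2) = q ^ (2 * Suc c')"
    proof -
      have "2 * c + 2 = int (2 * Suc c')" using n by simp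
      then show ?thesis by (simp only: power_int_of_nat)
    qed
    have p: "q powi j = q ^ j'" "q powi c = q ^ c'" unfolding n by (simp_all only: power_int_of_nat)
    show ?thesis using G_rec[OF w, of i'] unfolding 1 2 3 c p a[symmetric]
      by (simp only: mult.commute[of "1 - q ^ (2 * Suc c')"])
  qed
qed

lemma S0_i0:
  assumes "b \<ge> 0" "c \<ge> 0" "j \<ge> 0" "k \<ge> 0"
  shows "site_elem 0 q a b c 0 j k = (if a + b = j \<and> b + c = j + k then
     (-1) ^ nat b * q powi ((k + 1) * b) * qb (nat j) (nat b) else 0)"
proof (cases "a + b = j \<and> b + c = j + k")
  case True
  obtain b' j' k' c' where n: "b = int b'" "j = int j'" "k = int k'" "c = int c'"
      using assms by (metis nonneg_eq_int)
  have "G b' c' 0 j' k' = (\<Sum>\<mu>\<in>{0}. (-1) ^ (b' - \<mu>)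
      * q powi (int 0 * (int c' - int j') + (int k' + 1) * int (b' - \<mu>) + int \<mu> * (int \<mu> - int k'))
      * (po (c' + \<mu>) / po c') * qb 0 \<mu> * qb j' (b' - \<mu>))"
    unfolding G_def
  proof (rule sum.mono_neutral_right, goal_cases)
    case 3
    then show ?case by (auto intro!: disjI2 disjI1 qb_gt)
  qed auto
  also have "\<dots> = (-1) ^ b' * q powi ((int k' + 1) * int b') * qb j' b'"
    by simp
  finally have "G b' c' 0 j' k' = \<dots>" .
  moreover have "site_elem 0 q a b c 0 j k = G b' c' 0 j' k'"
    using site_elem_G[of a b' 0 j' c' k'] True n by simp
  ultimately show ?thesis unfolding if_P[OF True] unfolding n nat_int by (simp only:)
qed (auto simp: site_elem_weight)

end

section \<open>Relations between the elements of the 3D R\<close>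

context generic_q begin

abbreviation S where "S \<equiv> site_elem 0 q"

text \<open>
  Exponents are split into powers of single labels, so that the remaining identities are polynomial and
  can be decided by \<open>algebra\<close>.
\<close>
lemma pw_simps:
  "q powi (x + y) = q powi x * q powi y"
  "q powi (x - y) = q powi x * inverse (q powi y)"
  "q powi (- x) = inverse (q powi x)"
  "q powi (2 * x) = (q powi x)\<^sup>2"
  "q powi (x * 2) = (q powi x)\<^sup>2"
  "q powi (int m) = q ^ m"
      apply (simp_all add: power_int_add power_int_diff divide_inverse power_int_minus)
  by (metis mult.commute power_int_mult power_int_numeral)+

lemma pw_inv: "q powi x * inverse (q powi x) = 1" "q * inverse q = 1"
  by simp_all

lemma S0_explicit:
  "S (int a) (int b) (int (a + k)) 0 (int (a + b)) (int k) = (-1) ^ b * q ^ ((k + 1) * b) * qb (a + b) b"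
proof -
  have "(int k + 1) * int b = int ((k + 1) * b)" by (simp add: algebra_simps)
  moreover have "int a + int b = int (a + b) \<and> int b + int (a + k) = int (a + b) + int k" by simp
  ultimately show ?thesis using S0_i0[of "int b" "int (a + k)" "int (a + b)" "int k" "int a"]
    by (metis nat_int of_nat_0_le_iff power_int_of_nat)
qed

lemma S_0_0: "S a b c 0 0 k = of_bool (a = 0 \<and> b = 0 \<and> c = k \<and> 0 \<le> k)"
proof (cases "a = 0 \<and> b = 0 \<and> c = k \<and> 0 \<le> k")
  case True
  then show ?thesis using S0_explicit[of 0 0 "nat k"] by simp
next
  case False
  then have "a < 0 \<or> b < 0 \<or> k < 0 \<or> a + b \<noteq> 0 + 0 \<or> b + c \<noteq> 0 + k" by linarith
  then show ?thesis using False site_elem_neg[of a b c 0 0 k 0 q] site_elem_weight[of a b 0 0 c k 0 q] by auto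
qed

lemma S0_up_j_0:
  assumes "j \<ge> 0"
  shows "S a b c 0 (j + 1) k = S (a - 1) b (c - 1) 0 j k - q powi (1 + a + c) * S a (b - 1) c 0 j k"
proof (cases "a + b = j + 1 \<and> b + c = j + 1 + k \<and> a \<ge> 0 \<and> b \<ge> 0 \<and> k \<ge> 0")
  case False
  then have "a < 0 \<or> b < 0 \<or> k < 0 \<or> a + b \<noteq> j + 1 \<or> b + c \<noteq> j + 1 + k" by linarith
  then show ?thesis by (auto simp: site_elem_neg site_elem_weight)
next
  case True
  obtain a' b' k' where n: "a = int a'" "b = int b'" "k = int k'"
    using True by (metis nonneg_eq_int)
  have c: "c = int (a' + k')" and j: "j = int (a' + b') - 1" using True n by auto
  have pw: "q powi (1 + a + c) = q ^ (1 + a' + a' + k')"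
  proof -
    have "1 + a + c = int (1 + a' + a' + k')" using n c by simp
    then show ?thesis by (simp only: power_int_of_nat)
  qed
  have L: "S a b c 0 (j + 1) k = (-1) ^ b' * q ^ ((k' + 1) * b') * qb (a' + b') b'"
    using S0_explicit[of a' b' k'] unfolding n c j by simp
  have R1: "S (a - 1) b (c - 1) 0 j k = (if a' = 0 then 0 else (-1) ^ b' * q ^ ((k' + 1) * b') * qb (a' + b' - 1) b')"
  proof (cases a')
    case 0 then show ?thesis using n by (simp add: site_elem_neg)
  next
    case (Suc m)
    then show ?thesis using S0_explicit[of m b' k'] unfolding n c j by (simp add: add_ac)
  qed
  have R2: "S a (b - 1) c 0 j k = (if b' = 0 then 0 else (-1) ^ (b' - 1) * q ^ ((k' + 1) * (b' - 1)) * qb (a' + b' - 1) (b' - 1))"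
  proof (cases b')
    case 0 then show ?thesis using n by (simp add: site_elem_neg)
  next
    case (Suc m)
    then show ?thesis using S0_explicit[of a' m k'] unfolding n c j by (simp add: add_ac)
  qed
  show ?thesis
  proof (cases b')
    case 0
    with True n have "a' \<noteq> 0" using assms by auto
    with 0 show ?thesis unfolding L R1 R2 by simp
  next
    case (Suc m)
    have P: "qb (a' + b') b' = qb (a' + m) (Suc m) + q ^ (2 * a') * qb (a' + m) m"
    proof -
      have "2 * (int (a' + m) - int m) = int (2 * a')" by simp
      then have "q powi (2 * (int (a' + m) - int m)) = q ^ (2 * a')" by (simp only: power_int_of_nat)
      then show ?thesis using qb_Pascal[of "a' + m" m] Suc by simp
    qed
    have Q: "a' = 0 \<Longrightarrow> qb (a' + m) (Suc m) = 0" by (simp add: qb_gt)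
    have E: "(k' + 1) * Suc m + 2 * a' = (1 + a' + a' + k') + (k' + 1) * m" by simp
    have E': "q ^ ((k' + 1) * Suc m) * q ^ (2 * a') = q ^ (1 + a' + a' + k') * q ^ ((k' + 1) * m)"
      unfolding power_add[symmetric] E ..
    define x u where "x = (-1 :: 'a) ^ m" and "u = qb (a' + m) (Suc m)"
    have L': "S a b c 0 (j + 1) k = - x * q ^ ((k' + 1) * Suc m) * (u + q ^ (2 * a') * qb (a' + m) m)"
      unfolding L P unfolding Suc x_def u_def by simp
    have R1': "S (a - 1) b (c - 1) 0 j k = - x * q ^ ((k' + 1) * Suc m) * u"
      unfolding R1 unfolding Suc x_def u_def using Q by simp
    have R2': "S a (b - 1) c 0 j k = x * q ^ ((k' + 1) * m) * qb (a' + m) m"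
      unfolding R2 unfolding Suc x_def by simp
    have alg: "- x * e1 * (u + p * v) = - x * e1 * u - e2 * (x * e3 * v)"
      if "e1 * p = e2 * e3" for x e1 p e2 e3 v :: 'a
      using that by algebra
    show ?thesis unfolding L' R1' R2' pw by (rule alg[OF E'])
  qed
qed

text \<open>
  Induction on \<open>i\<close>: both sides satisfy the recursion \<open>S0_up_i\<close>.
\<close>
lemma S0_up_j:
  assumes "i \<ge> 0" "j \<ge> 0"
  shows "S a b c i (j + 1) k = S (a - 1) b (c - 1) i j k - q powi (1 + a + c) * S a (b - 1) c i j k"
  using assms(1)
proof (induction i arbitrary: a b c k rule: int_ge_induct)
  case base
  show ?case by (rule S0_up_j_0[OF assms(2)])
next
  case (step i)
  define A C where "A = q powi (a - 1)" and "C = q powi (c - 1)"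
  have pws: "q powi a = A * q" "q powi c = C * q" "q powi (c - 1) = C" "q powi (a - 1) = A"
    "q powi (1 + a + c) = A * C * q ^ 3" "q powi (1 + (a - 1) + c) = A * C * q\<^sup>2"
    "q powi (1 + a + (c + 1)) = A * C * q ^ 4"
    "q powi (2 * c + 2) = C\<^sup>2 * q ^ 4" "q powi (2 * (c - 1) + 2) = C\<^sup>2 * q\<^sup>2" "q powi (j + 1) = q powi j * q"
    unfolding A_def C_def
    by (simp_all add: pw_simps field_simps power2_eq_square eval_nat_numeral)
  have H1: "q powi (j + 1) * S a b c (i + 1) (j + 1) k =
     q powi c * S (a - 1) b c i (j + 1) k + (1 - q powi (2 * c + 2)) * q powi a * S a (b - 1) (c + 1) i (j + 1) k"
    by (rule S0_up_i[OF step(1)])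
  have H2: "q powi j * S (a - 1) b (c - 1) (i + 1) j k =
     q powi (c - 1) * S (a - 1 - 1) b (c - 1) i j k + (1 - q powi (2 * (c - 1) + 2)) * q powi (a - 1) * S (a - 1) (b - 1) c i j k"
    using S0_up_i[OF step(1), of j "a - 1" b "c - 1" k] by simp
  have H3: "q powi j * S a (b - 1) c (i + 1) j k =
     q powi c * S (a - 1) (b - 1) c i j k + (1 - q powi (2 * c + 2)) * q powi a * S a (b - 1 - 1) (c + 1) i j k"
    by (rule S0_up_i[OF step(1)])
  have I1: "S (a - 1) b c i (j + 1) k = S (a - 1 - 1) b (c - 1) i j k - q powi (1 + (a - 1) + c) * S (a - 1) (b - 1) c i j k"
    by (rule step.IH)
  have I2: "S a (b - 1) (c + 1) i (j + 1) k = S (a - 1) (b - 1) c i j k - q powi (1 + a + (c + 1)) * S a (b - 1 - 1) (c + 1) i j k"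
    using step.IH[of a "b - 1" "c + 1" k] by simp
  have "q powi j * q * S a b c (i + 1) (j + 1) k =
     q powi j * q * (S (a - 1) b (c - 1) (i + 1) j k - q powi (1 + a + c) * S a (b - 1) c (i + 1) j k)"
    using H1 H2 H3 unfolding I1 I2 pws by algebra
  then show ?case by simp
qed

lemmas pws = pw_simps power_int_1_right power_int_numeral power_int_0_right mult_1_left

text \<open>
  Induction on \<open>j\<close> with \<open>S0_up_j\<close>; the case \<open>j = 0\<close> is an induction on \<open>i\<close> with \<open>S0_up_i\<close>.
\<close>
lemma S0_down_a_left:
  assumes "i \<ge> 0" "j \<ge> 0" "k \<ge> 0"
  shows "q powi b * S (a - 1) b c i j k =
    q powi k * S a b c (i + 1) j k + (1 - q powi (2 * k)) * q powi i * S a b c i (j + 1) (k - 1)"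
  using assms(2)
proof (induction j arbitrary: a b c rule: int_ge_induct)
  case base
  show ?case using assms(1)
  proof (induction i arbitrary: a b c rule: int_ge_induct)
    case base
    show ?case
    proof -
      have U: "S a b c 1 0 k = q powi c * S (a - 1) b c 0 0 k + (1 - q powi (2 * c + 2)) * q powi a * S a (b - 1) (c + 1) 0 0 k"
        using S0_up_i[of 0 0 a b c k] by simp
      have V: "S a b c 0 1 (k - 1) = S (a - 1) b (c - 1) 0 0 (k - 1) - q powi (1 + a + c) * S a (b - 1) c 0 0 (k - 1)"
        using S0_up_j[of 0 0 a b c "k - 1"] by simp
      consider "a = 1" "b = 0" "c = k" "k = 0" | "a = 1" "b = 0" "c = k" "k \<ge> 1"
        | "a = 0" "b = 1" "c = k - 1" "k \<ge> 1" | "\<not> (a = 1 \<and> b = 0 \<and> c = k)" "\<not> (a = 0 \<and> b = 1 \<and> c = k - 1)"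
        | "a = 0" "b = 1" "c = -1" "k = 0"
        using assms(3) by linarith
      then show ?thesis
      proof cases
        case 1
        then show ?thesis using U by (simp add: S_0_0)
      next
        case 2
        then have "S a b c 1 0 k = q powi k" "S a b c 0 1 (k - 1) = 1" "S (a - 1) b c 0 0 k = 1" unfolding U V by (simp_all add: S_0_0)
        then show ?thesis using 2 by (simp add: pws power2_eq_square)
      next
        case 3
        then have *: "S a b c 1 0 k = 1 - q powi (2 * k)" "S a b c 0 1 (k - 1) = - (q powi k)" "S (a - 1) b c 0 0 k = 0"
          unfolding U V by (simp_all add: S_0_0)
        then show ?thesis using 3 by (simp add: mult.commute)
      next
        case 4
        then have "S (a - 1) b c 0 0 k = 0" "S a (b - 1) (c + 1) 0 0 k = 0" "S (a - 1) b (c - 1) 0 0 (k - 1) = 0"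
          "S a (b - 1) c 0 0 (k - 1) = 0" unfolding S_0_0 by (auto simp del: of_bool_eq_0_iff intro!: of_bool_eq(1))
        then show ?thesis using U V by simp
      next
        case 5
        then show ?thesis by (simp add: site_elem_neg)
      qed
    qed
  next
    case (step i)
    have H1: "q powi 0 * S (a - 1) b c (i + 1) 0 k = q powi c * S (a - 1 - 1) b c i 0 k +
        (1 - q powi (2 * c + 2)) * q powi (a - 1) * S (a - 1) (b - 1) (c + 1) i 0 k"
      by (rule S0_up_i[OF step(1)])
    have H2: "q powi 0 * S a b c (i + 1 + 1) 0 k = q powi c * S (a - 1) b c (i + 1) 0 k +
        (1 - q powi (2 * c + 2)) * q powi a * S a (b - 1) (c + 1) (i + 1) 0 k"
      by (rule S0_up_i) (use step(1) in simp)
    have H3: "q powi (0 + 1) * S a b c (i + 1) (0 + 1) (k - 1) = q powi c * S (a - 1) b c i (0 + 1) (k - 1) +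
        (1 - q powi (2 * c + 2)) * q powi a * S a (b - 1) (c + 1) i (0 + 1) (k - 1)"
      by (rule S0_up_i[OF step(1)])
    note I = step.IH[of b "a - 1" c] step.IH[of "b - 1" a "c + 1"]
    have alg: "B * X = K * Y + F * (J * q) * Z"
      if "X = C * u1 + E * (A * iq) * u2" "Y = C * X + E * A * v" "q * Z = C * w1 + E * A * w2"
        "B * u1 = K * X + F * J * w1" "(B * iq) * u2 = K * v + F * J * w2" for B X K Y F J Z C u1 E A iq u2 v w1 w2 :: 'a
    proof -
      have "B * X = C * (B * u1) + E * A * ((B * iq) * u2)" by (simp only: that(1)) algebra
      also have "\<dots> = K * (C * X + E * A * v) + F * J * (C * w1 + E * A * w2)" unfolding that(4,5) by algebra
      also have "\<dots> = K * Y + F * (J * q) * Z" by (simp only: that(2) flip: that(3)) (simp only: mult.assoc)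
      finally show ?thesis .
    qed
    have P: "q powi (a - 1) = q powi a * inverse q" "q powi (b - 1) = q powi b * inverse q" "q powi (i + 1) = q powi i * q"
      "q powi (0 + 1) = q"
      by (simp_all add: pws)
    show ?case unfolding P(3)
      by (rule alg[OF H1[unfolded power_int_0_right mult_1_left P(1)] H2[unfolded power_int_0_right mult_1_left]
        H3[unfolded P(4)] I(1) I(2)[unfolded P(2)]])
  qed
next
  case (step j)
  have u: "S a b c i (j + 1) k = S (a - 1) b (c - 1) i j k - q powi (1 + a + c) * S a (b - 1) c i j k"
    "S a b c (i + 1) (j + 1) k = S (a - 1) b (c - 1) (i + 1) j k - q powi (1 + a + c) * S a (b - 1) c (i + 1) j k"
    "S a b c i (j + 1 + 1) k = S (a - 1) b (c - 1) i (j + 1) k - q powi (1 + a + c) * S a (b - 1) c i (j + 1) k"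
    for a b c k
    by (rule S0_up_j; use assms step(1) in simp)+
  note I = step.IH[of b "a - 1" "c - 1"] step.IH[of "b - 1" a c]
  have alg: "B * X = K * Y + F * J * Z"
    if "X = x1 - R * iq * x2" "Y = y1 - R * y2" "Z = z1 - R * z2" "B * x1 = K * y1 + F * J * z1" "(B * iq) * x2 = K * y2 + F * J * z2" for X Y Z B x1 R iq x2 K y1 y2 F J z1 z2 :: 'a
    unfolding that(1,2,3) using that(4,5) by algebra
  have P: "q powi (1 + (a - 1) + c) = q powi (1 + a + c) * inverse q" "q powi (b - 1) = q powi b * inverse q"
    by (simp_all add: pws)
  show ?case by (rule alg[OF u(1)[of "a - 1" b c k, unfolded P(1)] u(2)[of a b c k] u(3)[of a b c "k - 1"] I(1) I(2)[unfolded P(2)]])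
qed

text \<open>Same inductions as for the preceding relation.\<close>
lemma S0_down_b_left:
  assumes "i \<ge> 0" "j \<ge> 0" "k \<ge> 0"
  shows "S a (b - 1) c i j k = S a b c (i + 1) j (k + 1) - q powi (1 + k + i) * S a b c i (j + 1) k"
  using assms(2)
proof (induction j arbitrary: a b c rule: int_ge_induct)
  case base
  show ?case using assms(1)
  proof (induction i arbitrary: a b c rule: int_ge_induct)
    case base
    show ?case
    proof -
      have U: "S a b c 1 0 (k + 1) = q powi c * S (a - 1) b c 0 0 (k + 1) + (1 - q powi (2 * c + 2)) * q powi a * S a (b - 1) (c + 1) 0 0 (k + 1)"
        using S0_up_i[of 0 0 a b c "k + 1"] by simp
      have V: "S a b c 0 1 k = S (a - 1) b (c - 1) 0 0 k - q powi (1 + a + c) * S a (b - 1) c 0 0 k"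
        using S0_up_j[of 0 0 a b c k] by simp
      consider "a = 1" "b = 0" "c = k + 1"
        | "a = 0" "b = 1" "c = k" | "\<not> (a = 1 \<and> b = 0 \<and> c = k + 1)" "\<not> (a = 0 \<and> b = 1 \<and> c = k)"
        by linarith
      then show ?thesis
      proof cases
        case 1
        then have "S a b c 1 0 (k + 1) = q powi (k + 1)" "S a b c 0 1 k = 1" "S a (b - 1) c 0 0 k = 0"
          unfolding U V using assms(3) by (simp_all add: S_0_0)
        then show ?thesis by (simp add: add.commute)
      next
        case 2
        then have *: "S a b c 1 0 (k + 1) = 1 - q powi (2 * k + 2)" "S a b c 0 1 k = - (q powi (1 + k))" "S a (b - 1) c 0 0 k = 1"
          unfolding U V using assms(3) by (simp_all add: S_0_0)
        then show ?thesis by (simp add: pws power2_eq_square)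
      next
        case 3
        then have "S (a - 1) b c 0 0 (k + 1) = 0" "S a (b - 1) (c + 1) 0 0 (k + 1) = 0" "S (a - 1) b (c - 1) 0 0 k = 0"
          "S a (b - 1) c 0 0 k = 0" unfolding S_0_0 by (auto simp del: of_bool_eq_0_iff intro!: of_bool_eq(1))
        then show ?thesis using U V by simp
      qed
    qed
  next
    case (step i)
    have H1: "q powi 0 * S a (b - 1) c (i + 1) 0 k = q powi c * S (a - 1) (b - 1) c i 0 k +
        (1 - q powi (2 * c + 2)) * q powi a * S a (b - 1 - 1) (c + 1) i 0 k"
      by (rule S0_up_i[OF step(1)])
    have H2: "q powi 0 * S a b c (i + 1 + 1) 0 (k + 1) = q powi c * S (a - 1) b c (i + 1) 0 (k + 1) +
        (1 - q powi (2 * c + 2)) * q powi a * S a (b - 1) (c + 1) (i + 1) 0 (k + 1)"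
      by (rule S0_up_i) (use step(1) in simp)
    have H3: "q powi (0 + 1) * S a b c (i + 1) (0 + 1) k = q powi c * S (a - 1) b c i (0 + 1) k +
        (1 - q powi (2 * c + 2)) * q powi a * S a (b - 1) (c + 1) i (0 + 1) k"
      by (rule S0_up_i[OF step(1)])
    note I = step.IH[of "a - 1" b c] step.IH[of a "b - 1" "c + 1"]
    have alg: "X = Y - (P * q) * Z"
      if "X = C * u1 + E * A * u2" "Y = C * v1 + E * A * v2" "q * Z = C * w1 + E * A * w2"
        "u1 = v1 - P * w1" "u2 = v2 - P * w2" for X P Y Z C u1 E A u2 v1 v2 w1 w2 :: 'a
    proof -
      have "X = (C * v1 + E * A * v2) - P * (C * w1 + E * A * w2)" unfolding that(1,4,5) by algebra
      then show ?thesis by (simp only: flip: that(2,3)) (simp only: mult.assoc)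
    qed
    have P: "q powi (1 + k + (i + 1)) = q powi (1 + k + i) * q" "q powi (0 + 1) = q"
      by (simp_all add: pws power2_eq_square)
    show ?case unfolding P(1)
      by (rule alg[OF H1[unfolded power_int_0_right mult_1_left] H2[unfolded power_int_0_right mult_1_left]
        H3[unfolded P(2)] I])
  qed
next
  case (step j)
  have u: "S a b c i (j + 1) k = S (a - 1) b (c - 1) i j k - q powi (1 + a + c) * S a (b - 1) c i j k"
    "S a b c (i + 1) (j + 1) k = S (a - 1) b (c - 1) (i + 1) j k - q powi (1 + a + c) * S a (b - 1) c (i + 1) j k"
    "S a b c i (j + 1 + 1) k = S (a - 1) b (c - 1) i (j + 1) k - q powi (1 + a + c) * S a (b - 1) c i (j + 1) k"
    for a b c k
    by (rule S0_up_j; use assms step(1) in simp)+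
  note I = step.IH[of "a - 1" b "c - 1"] step.IH[of a "b - 1" c]
  have alg: "X = Y - P * Z"
    if "X = x1 - R * x2" "Y = y1 - R * y2" "Z = z1 - R * z2" "x1 = y1 - P * z1" "x2 = y2 - P * z2" for X Y Z x1 R x2 y1 y2 P z1 z2 :: 'a
    unfolding that by algebra
  show ?case by (rule alg[OF u(1)[of a "b - 1" c k] u(2)[of a b c "k + 1"] u(3)[of a b c k] I])
qed

text \<open>\<open>(q - q^(-1)) [m]\<close>\<close>
definition br :: "int \<Rightarrow> 'a" where "br m = q powi m - q powi (- m)"

lemma br_0 [simp]: "br 0 = 0" by (simp add: br_def)

lemma qb_up: "(1 - q ^ (2 * (a + 1))) * qb (a + b + 1) b = (1 - q ^ (2 * (a + b + 1))) * qb (a + b) b"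
proof -
  have d: "b \<le> a + b + 1" "b \<le> a + b" "a + b + 1 - b = Suc a" "a + b - b = a" "a + b + 1 = Suc (a + b)" by auto
  have "1 - q ^ (2 * Suc a) \<noteq> 0" using q_no_root[of "2 * Suc a"] by auto
  then have "(1 - q ^ (2 * Suc a)) * qb (a + b + 1) b = (1 - q ^ (2 * Suc (a + b))) * qb (a + b) b"
    unfolding qbinom_def d(3,4) if_P[OF d(1)] if_P[OF d(2)] unfolding d(5) po_Suc
    by (simp add: field_simps del: mult_Suc_right)
  then show ?thesis by (simp del: mult_Suc_right)
qed

lemma qb_up_both: "(1 - q ^ (2 * (b + 1))) * qb (a + b + 1) (b + 1) = (1 - q ^ (2 * (a + b + 1))) * qb (a + b) b"
proof -
  have d: "b + 1 \<le> a + b + 1" "b \<le> a + b" "a + b + 1 - (b + 1) = a" "a + b - b = a" "a + b + 1 = Suc (a + b)" "b + 1 = Suc b" by auto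
  have "1 - q ^ (2 * Suc b) \<noteq> 0" using q_no_root[of "2 * Suc b"] by auto
  then have "(1 - q ^ (2 * Suc b)) * qb (a + b + 1) (b + 1) = (1 - q ^ (2 * Suc (a + b))) * qb (a + b) b"
    unfolding qbinom_def d(3,4) if_P[OF d(1)] if_P[OF d(2)] unfolding d(5,6) po_Suc
    by (simp add: field_simps del: mult_Suc_right)
  then show ?thesis by (simp del: mult_Suc_right)
qed

lemma br_q: "q powi m * br m = q powi (2 * m) - 1"
  by (simp add: br_def pws power2_eq_square algebra_simps)

lemma sub_one_flip: "(1 - x) * u = (1 - y) * v \<Longrightarrow> (x - 1) * u = (y - 1) * v" for x y u v :: 'a
  by algebra

lemma br_up: "br (int a + 1) * qb (a + b + 1) b = q ^ b * br (int a + int b + 1) * qb (a + b) b"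
proof -
  have "q powi (2 * (int a + 1)) = q ^ (2 * (a + 1))" "q powi (2 * (int a + int b + 1)) = q ^ (2 * (a + b + 1))"
    by (metis (mono_tags) of_nat_1 of_nat_add of_nat_mult of_nat_numeral power_int_of_nat)+
  then have "q powi (int a + 1) * br (int a + 1) * qb (a + b + 1) b = q powi (int a + int b + 1) * br (int a + int b + 1) * qb (a + b) b"
    unfolding br_q by (simp only:) (rule sub_one_flip[OF qb_up])
  moreover have "q powi (int a + int b + 1) = q powi (int a + 1) * q ^ b"
    by (simp add: pws mult_ac)
  ultimately have "q powi (int a + 1) * (br (int a + 1) * qb (a + b + 1) b) = q powi (int a + 1) * (q ^ b * br (int a + int b + 1) * qb (a + b) b)"
    by (simp only: mult_ac)
  then show ?thesis by simp
qed

lemma br_up_both: "br (int b + 1) * qb (a + b + 1) (b + 1) = q ^ a * br (int a + int b + 1) * qb (a + b) b"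
proof -
  have "q powi (2 * (int b + 1)) = q ^ (2 * (b + 1))" "q powi (2 * (int a + int b + 1)) = q ^ (2 * (a + b + 1))"
    by (metis (mono_tags) of_nat_1 of_nat_add of_nat_mult of_nat_numeral power_int_of_nat)+
  then have "q powi (int b + 1) * br (int b + 1) * qb (a + b + 1) (b + 1) = q powi (int a + int b + 1) * br (int a + int b + 1) * qb (a + b) b"
    unfolding br_q by (simp only:) (rule sub_one_flip[OF qb_up_both])
  moreover have "q powi (int a + int b + 1) = q powi (int b + 1) * q ^ a"
    by (simp add: pws mult_ac)
  ultimately have "q powi (int b + 1) * (br (int b + 1) * qb (a + b + 1) (b + 1)) = q powi (int b + 1) * (q ^ a * br (int a + int b + 1) * qb (a + b) b)"
    by (simp only: mult_ac)
  then show ?thesis by simp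
qed

lemma S0_explicit':
  assumes "a = int a'" "b = int b'" "c = int a' + int k'" "j = int a' + int b'" "k = int k'"
  shows "S a b c 0 j k = (-1) ^ b' * q ^ ((k' + 1) * b') * qb (a' + b') b'"
  using S0_explicit[of a' b' k'] assms by simp

text \<open>
  This and the next four lemmas are the case \<open>i = 0\<close> of relations below.  The sum has then a single
  term, and all terms of a relation are multiples of one \<open>q\<close>-binomial coefficient.
\<close>
lemma S0_lower_a_right_0:
  assumes "d \<ge> 0"
  shows "br (a + 1) * S (a + 1) b c 0 j d = br j * S a b c 0 (j - 1) (d + 1)"
proof (cases "a + 1 + b = j \<and> b + c = j + d \<and> a \<ge> 0 \<and> b \<ge> 0")
  case False
  then consider "a + 1 + b \<noteq> j \<or> b + c \<noteq> j + d" | "a = - 1" | "a < -1" | "b < 0" by linarith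
  then show ?thesis by cases (auto simp: site_elem_weight site_elem_neg)
next
  case True
  obtain a' b' k' where n: "a = int a'" "b = int b'" "d = int k'"
    using True assms by (metis nonneg_eq_int)
  have "S (a + 1) b c 0 j d = (-1) ^ b' * q ^ ((k' + 1) * b') * qb (Suc a' + b') b'"
    by (rule S0_explicit') (use True n in auto)
  moreover have "S a b c 0 (j - 1) (d + 1) = (-1) ^ b' * q ^ ((Suc k' + 1) * b') * qb (a' + b') b'"
    by (rule S0_explicit') (use True n in auto)
  moreover have "j = int a' + int b' + 1" using True n by simp
  moreover have "q ^ ((Suc k' + 1) * b') = q ^ ((k' + 1) * b') * q ^ b'" by (simp add: power_add mult_ac)
  ultimately show ?thesis using br_up[of a' b'] n by (simp add: mult_ac)
qed

lemma S0_lower_b_right_0: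
  assumes "k \<ge> 0"
  shows "q powi (- a) * br (b + 1) * S a (b + 1) c 0 j k = - (q powi (k + 1)) * br j * S a b c 0 (j - 1) k"
proof (cases "a + 1 + b = j \<and> b + 1 + c = j + k \<and> a \<ge> 0 \<and> b \<ge> 0")
  case False
  then consider "a + 1 + b \<noteq> j \<or> b + 1 + c \<noteq> j + k" | "b = - 1" | "b < -1" | "a < 0" by linarith
  then show ?thesis by cases (auto simp: site_elem_weight site_elem_neg)
next
  case True
  obtain a' b' k' where n: "a = int a'" "b = int b'" "k = int k'"
    using True assms by (metis nonneg_eq_int)
  have 1: "S a (b + 1) c 0 j k = (-1) ^ Suc b' * q ^ ((k' + 1) * Suc b') * qb (a' + Suc b') (Suc b')"
    by (rule S0_explicit') (use True n in auto)
  have 2: "S a b c 0 (j - 1) k = (-1) ^ b' * q ^ ((k' + 1) * b') * qb (a' + b') b'"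
    by (rule S0_explicit') (use True n in auto)
  have j: "j = int a' + int b' + 1" using True n by simp
  have 3: "q ^ ((k' + 1) * Suc b') = q ^ ((k' + 1) * b') * q powi (k + 1)" using n by (simp add: power_add pws mult_ac)
  have 4: "br (b + 1) * qb (a' + Suc b') (Suc b') = q powi a * br j * qb (a' + b') b'"
    using br_up_both[of b' a'] n j by (simp add: mult_ac)
  have 5: "q powi (- a) * q powi a = 1" by (simp add: pws)
  have alg: "p * B * (-1 * s * (e * K) * Q) = - K * J * (s * e * Q')"
    if "B * Q = A * J * Q'" "p * A = 1" for p B s e K Q J A Q' :: 'a
    using that by algebra
  show ?thesis unfolding 1 2 3 power_Suc by (rule alg[OF 4 5])
qed

lemma S0_lower_i_left_0:
  "br (b + 1) * S a (b + 1) c 0 j k = - (q powi (c + 1 - b)) * br (a + 1) * S (a + 1) b (c + 1) 0 j k"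
proof (cases "a + 1 + b = j \<and> b + 1 + c = j + k \<and> a \<ge> 0 \<and> b \<ge> 0 \<and> k \<ge> 0")
  case False
  then consider "a + 1 + b \<noteq> j \<or> b + 1 + c \<noteq> j + k" | "b < 0 \<or> a < 0" "a + 1 + b = j" | "k < 0" by linarith
  then show ?thesis
  proof cases
    case 2
    then consider "b = -1" | "a = -1" | "b < -1" | "a < -1" by linarith
    then show ?thesis by cases (auto simp: site_elem_neg)
  qed (auto simp: site_elem_weight site_elem_neg)
next
  case True
  obtain a' b' k' where n: "a = int a'" "b = int b'" "k = int k'"
    using True by (metis nonneg_eq_int)
  have 1: "S a (b + 1) c 0 j k = (-1) ^ Suc b' * q ^ ((k' + 1) * Suc b') * qb (a' + Suc b') (Suc b')"
    by (rule S0_explicit') (use True n in auto)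
  have 2: "S (a + 1) b (c + 1) 0 j k = (-1) ^ b' * q ^ ((k' + 1) * b') * qb (Suc a' + b') b'"
    by (rule S0_explicit') (use True n in auto)
  have 3: "q ^ ((k' + 1) * Suc b') = q ^ ((k' + 1) * b') * q powi (k + 1)" using n by (simp add: power_add pws mult_ac)
  have 4: "br (b + 1) * qb (a' + Suc b') (Suc b') = q powi a * br j * qb (a' + b') b'"
    using br_up_both[of b' a'] n True by (simp add: mult_ac add_ac)
  have 5: "br (a + 1) * qb (Suc a' + b') b' = q powi b * br j * qb (a' + b') b'"
    using br_up[of a' b'] n True by (simp add: mult_ac add_ac)
  have c: "c = a + k" using True by auto
  have 6: "q powi (k + 1) * q powi a = q powi (c + 1 - b) * q powi b" unfolding c by (simp add: pws)
  have alg: "B * (-1 * s * (e * K) * Q) = - E * B' * (s * e * Q2)"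
    if "B * Q = A * J * Q'" "B' * Q2 = A2 * J * Q'" "K * A = E * A2" for B s e K Q A J Q' B' Q2 A2 E :: 'a
    using that by algebra
  show ?thesis unfolding 1 2 3 power_Suc by (rule alg[OF 4 5 6])
qed

lemma S0_lower_j_left_0:
  "q powi (- b) * br (a + 1) * S (a + 1) b (c + 1) 0 j k = br j * S a b c 0 (j - 1) k"
proof (cases "a + 1 + b = j \<and> b + 1 + c = j + k \<and> a \<ge> 0 \<and> b \<ge> 0 \<and> k \<ge> 0")
  case False
  then consider "a + 1 + b \<noteq> j \<or> b + 1 + c \<noteq> j + k" | "a = -1" | "a < -1" | "b < 0 \<or> k < 0" by linarith
  then show ?thesis by cases (auto simp: site_elem_weight site_elem_neg)
next
  case True
  obtain a' b' k' where n: "a = int a'" "b = int b'" "k = int k'"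
    using True by (metis nonneg_eq_int)
  have 1: "S a b c 0 (j - 1) k = (-1) ^ b' * q ^ ((k' + 1) * b') * qb (a' + b') b'"
    by (rule S0_explicit') (use True n in auto)
  have 2: "S (a + 1) b (c + 1) 0 j k = (-1) ^ b' * q ^ ((k' + 1) * b') * qb (Suc a' + b') b'"
    by (rule S0_explicit') (use True n in auto)
  have 5: "br (a + 1) * qb (Suc a' + b') b' = q powi b * br j * qb (a' + b') b'"
    using br_up[of a' b'] n True by (simp add: mult_ac add_ac)
  have 6: "q powi (- b) * q powi b = 1" by (simp add: pws)
  have alg: "p * B * (s * e * Q) = J * (s * e * Q')" if "B * Q = A * J * Q'" "p * A = 1" for p B s e Q J Q' A :: 'a
    using that by algebra
  show ?thesis unfolding 1 2 by (rule alg[OF 5 6])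
qed

lemma S0_down_k_0:
  assumes "k \<ge> 0"
  shows "(1 - q powi (2 * k)) * S a b c 0 j (k - 1) =
    - (q powi (c - a + 1)) * br (b + 1) * S (a - 1) (b + 1) c 0 j k + (1 - q powi (2 * c + 2)) * q powi (- b) * S a b (c + 1) 0 j k"
proof -
  have E: "br (b + 1) * S (a - 1) (b + 1) c 0 j k = - (q powi (c + 1 - b)) * br a * S a b (c + 1) 0 j k"
    using S0_lower_i_left_0[of b "a - 1" c j k] by simp
  have main: "(1 - q powi (2 * k)) * S a b c 0 j (k - 1) =
     (q powi (c - a + 1) * q powi (c + 1 - b) * br a + (1 - q powi (2 * c + 2)) * q powi (- b)) * S a b (c + 1) 0 j k"
  proof (cases "a + b = j \<and> b + c + 1 = j + k \<and> a \<ge> 0 \<and> b \<ge> 0")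
    case False
    then have "a < 0 \<or> b < 0 \<or> a + b \<noteq> 0 + j \<or> b + (c + 1) \<noteq> j + k \<and> b + c \<noteq> j + (k - 1)" by linarith
    then show ?thesis by (auto simp: site_elem_neg site_elem_weight)
  next
    case True
    have c: "c = a + k - 1" using True by auto
    have K: "q powi (c - a + 1) * q powi (c + 1 - b) * br a + (1 - q powi (2 * c + 2)) * q powi (- b) = (1 - q powi (2 * k)) * q powi (- b)"
      unfolding c using pw_inv(1)[of a] pw_inv(1)[of b] pw_inv(2) unfolding br_def pws by algebra
    show ?thesis
    proof (cases "k = 0")
      case True
      then show ?thesis unfolding K by simp
    next
      case False
      obtain a' b' k' where n: "a = int a'" "b = int b'" "k = int (Suc k')"
      proof
        show "a = int (nat a)" "b = int (nat b)" "k = int (Suc (nat (k - 1)))" using True assms False by auto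
      qed
      have 1: "S a b c 0 j (k - 1) = (-1) ^ b' * q ^ ((k' + 1) * b') * qb (a' + b') b'"
        by (rule S0_explicit') (use True n in auto)
      have 2: "S a b (c + 1) 0 j k = (-1) ^ b' * q ^ ((Suc k' + 1) * b') * qb (a' + b') b'"
        by (rule S0_explicit') (use True n in auto)
      have 3: "q ^ ((Suc k' + 1) * b') = q ^ ((k' + 1) * b') * q powi b" using n by (simp add: power_add mult_ac)
      have 4: "q powi (- b) * q powi b = 1" by (simp add: pws)
      have alg: "x * (s * e * Q) = (x * p) * (s * (e * B) * Q)" if "p * B = 1" for x s e Q p B :: 'a
        using that by algebra
      show ?thesis unfolding K unfolding 1 2 3 by (rule alg[OF 4])
    qed
  qed
  have alg: "x * y = - p * B * s' + e * pb * s"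
    if "x * y = (p * r * A + e * pb) * s" "B * s' = - r * A * s" for x y p r A e pb s B s' :: 'a
    using that by algebra
  show ?thesis by (rule alg[OF main E])
qed

text \<open>
  In the induction for \<open>S0_lower_b_right\<close>, the difference between \<open>[i + 1]\<close> and \<open>q [i]\<close> leaves a term with
  \<open>k - 1\<close>, which this relation expresses through terms with \<open>k\<close>.
\<close>
lemma S0_down_k:
  assumes "i \<ge> 0" "k \<ge> 0"
  shows "q powi (- i) * (1 - q powi (2 * k)) * S a b c i j (k - 1) =
    - (q powi (c - a + 1)) * br (b + 1) * S (a - 1) (b + 1) c i j k
    + (1 - q powi (2 * c + 2)) * q powi (- b) * S a b (c + 1) i j k"
  using assms(1)
proof (induction i arbitrary: a b c rule: int_ge_induct)
  case base
  then show ?case using S0_down_k_0[OF assms(2)] by simp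
next
  case (step i)
  define E F where "E = 1 - q powi (2 * c + 2)" and "F = 1 - q powi (2 * (c + 1) + 2)"
  have H1: "q powi j * S a b c (i + 1) j (k - 1) = q powi c * S (a - 1) b c i j (k - 1) + E * q powi a * S a (b - 1) (c + 1) i j (k - 1)"
    unfolding E_def by (rule S0_up_i[OF step(1)])
  have H2: "q powi j * S (a - 1) (b + 1) c (i + 1) j k = q powi c * S (a - 1 - 1) (b + 1) c i j k + E * q powi (a - 1) * S (a - 1) b (c + 1) i j k"
    using S0_up_i[OF step(1), of j "a - 1" "b + 1" c k] unfolding E_def by simp
  have H3: "q powi j * S a b (c + 1) (i + 1) j k = q powi (c + 1) * S (a - 1) b (c + 1) i j k + F * q powi a * S a (b - 1) (c + 1 + 1) i j k"
    unfolding F_def by (rule S0_up_i[OF step(1)])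
  have I1: "q powi (- i) * (1 - q powi (2 * k)) * S (a - 1) b c i j (k - 1) =
    - (q powi (c - (a - 1) + 1)) * br (b + 1) * S (a - 1 - 1) (b + 1) c i j k + E * q powi (- b) * S (a - 1) b (c + 1) i j k"
    unfolding E_def by (rule step.IH)
  have I2: "q powi (- i) * (1 - q powi (2 * k)) * S a (b - 1) (c + 1) i j (k - 1) =
    - (q powi (c + 1 - a + 1)) * br b * S (a - 1) b (c + 1) i j k + F * q powi (- (b - 1)) * S a (b - 1) (c + 1 + 1) i j k"
    using step.IH[of a "b - 1" "c + 1"] unfolding F_def by simp
  define A B iq C where "A = q powi a" and "B = q powi b" and "iq = inverse q" and "C = q powi c"
  have P: "q powi (a - 1) = A * iq" "q powi (c + 1) = C * q" "q powi (c - (a - 1) + 1) = C * inverse A * q * q"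
    "q powi (c + 1 - a + 1) = C * inverse A * q * q" "q powi (c - a + 1) = C * inverse A * q"
    "q powi (- (b - 1)) = inverse B * q" "q powi (- b) = inverse B" "q powi (- (i + 1)) = q powi (- i) * iq"
    "q powi a = A" "q powi c = C" "br b = B - inverse B" "br (b + 1) = B * q - inverse B * iq"
    unfolding A_def B_def C_def iq_def br_def by (simp_all add: pws power2_eq_square)
  have inv: "A * inverse A = 1" "B * inverse B = 1" "q * iq = 1"
    unfolding A_def B_def iq_def by simp_all
  have "q powi j * (q powi (- (i + 1)) * (1 - q powi (2 * k)) * S a b c (i + 1) j (k - 1)) =
    q powi j * (- (q powi (c - a + 1)) * br (b + 1) * S (a - 1) (b + 1) c (i + 1) j k + E * q powi (- b) * S a b (c + 1) (i + 1) j k)"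
  proof -
    have alg: "J * (I * iq * K * X) = J * (- (C * Ai * q) * (B * q - Bi * iq) * Y + E * Bi * Z)"
      if h: "J * X = C * x1 + E * A * x2" "J * Y = C * y1 + E * (A * iq) * y2" "J * Z = C * q * y2 + F * A * z2"
        "I * K * x1 = - (C * Ai * q * q) * (B * q - Bi * iq) * y1 + E * Bi * y2"
        "I * K * x2 = - (C * Ai * q * q) * (B - Bi) * y2 + F * (Bi * q) * z2"
        "A * Ai = 1" "B * Bi = 1" "q * iq = 1"
      for J I iq K X C Ai q B Bi Y E Z x1 A x2 y1 y2 F z2 :: 'a
    proof -
      have "J * (I * iq * K * X) = iq * (C * (I * K * x1) + E * A * (I * K * x2))"
        using h(1) by algebra
      also have "\<dots> = (q * iq) * (- (C * C * Ai * q) * (B * q - Bi * iq) * y1) + iq * C * E * Bi * y2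
          - (A * Ai) * (q * iq) * E * C * q * (B - Bi) * y2 + (q * iq) * E * F * A * Bi * z2"
        unfolding h(4,5) by algebra
      also have "\<dots> = - (C * C * Ai * q) * (B * q - Bi * iq) * y1 + iq * C * E * Bi * y2 - E * C * q * (B - Bi) * y2 + E * F * A * Bi * z2"
        unfolding h(6,8) by simp
      also have "\<dots> = - (C * C * Ai * q) * (B * q - Bi * iq) * y1 - (A * Ai) * (q * iq) * C * E * (B * q - Bi * iq) * y2 + C * q * E * Bi * y2 + E * F * A * Bi * z2"
        unfolding h(6,8) by algebra
      also have "\<dots> = - (C * Ai * q) * (B * q - Bi * iq) * (C * y1 + E * (A * iq) * y2) + E * Bi * (C * q * y2 + F * A * z2)"
        by algebra
      also have "\<dots> = - (C * Ai * q) * (B * q - Bi * iq) * (J * Y) + E * Bi * (J * Z)"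
        unfolding h(2,3) ..
      also have "\<dots> = J * (- (C * Ai * q) * (B * q - Bi * iq) * Y + E * Bi * Z)" by algebra
      finally show ?thesis .
    qed
    show ?thesis unfolding P
      by (rule alg[OF H1[unfolded P] H2[unfolded P] H3[unfolded P] I1[unfolded P] I2[unfolded P] inv])
  qed
  then show ?case by (simp add: E_def)
qed

end

context generic_q begin

lemma br_Suc: "br (m + 1) = q * br m + (q - inverse q) * q powi (- m)"
  "br (m + 1) = inverse q * br m + (q - inverse q) * q powi m"
  by (simp_all add: br_def pws algebra_simps)

text \<open>
  Induction on \<open>i\<close> with \<open>S0_up_i\<close>, as for the three relations that follow.
\<close>
lemma S0_lower_a_right:
  assumes "i \<ge> 0" "d \<ge> 0"
  shows "br (a + 1) * S (a + 1) b c i j d =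
    br j * S a b c i (j - 1) (d + 1) + q powi (d - j) * br i * S a b c (i - 1) j d"
  using assms(1)
proof (induction i arbitrary: a b c rule: int_ge_induct)
  case base
  then show ?case using S0_lower_a_right_0[OF assms(2)] by simp
next
  case (step i)
  define E A C where "E = 1 - q powi (2 * c + 2)" and "A = q powi a" and "C = q powi c"
  define s where "s = S a b c i j d"
  have P: "q powi (a + 1) = A * q" "q powi (j - 1) = q powi j * inverse q" "q powi a = A" "q powi c = C"
    unfolding A_def C_def by (simp_all add: pws)
  have H1: "q powi j * S (a + 1) b c (i + 1) j d = C * s + E * (A * q) * S (a + 1) (b - 1) (c + 1) i j d"
    using S0_up_i[OF step(1), of j "a + 1" b c d] unfolding E_def s_def P by simp
  have H2: "(q powi j * inverse q) * S a b c (i + 1) (j - 1) (d + 1) =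
      C * S (a - 1) b c i (j - 1) (d + 1) + E * A * S a (b - 1) (c + 1) i (j - 1) (d + 1)"
    using S0_up_i[OF step(1), of "j - 1" a b c "d + 1"] unfolding E_def P by simp
  have H3: "br i * (q powi j * s) = br i * (C * S (a - 1) b c (i - 1) j d + E * A * S a (b - 1) (c + 1) (i - 1) j d)"
    using S0_up_i[of "i - 1" j a b c d] step(1) unfolding E_def P s_def by (cases "i = 0") auto
  have I1: "br a * s = br j * S (a - 1) b c i (j - 1) (d + 1) + q powi (d - j) * br i * S (a - 1) b c (i - 1) j d"
    using step.IH[of "a - 1" b c] unfolding s_def by simp
  have I2: "br (a + 1) * S (a + 1) (b - 1) (c + 1) i j d = br j * S a (b - 1) (c + 1) i (j - 1) (d + 1)
      + q powi (d - j) * br i * S a (b - 1) (c + 1) (i - 1) j d"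
    by (rule step.IH)
  have W: "(br (a + 1) - q * br a) * C * s = q powi j * q powi (d - j) * (br (i + 1) - q * br i) * s"
  proof (cases "s = 0")
    case False
    then have "c = a - i + d" using site_elem_weight[of a b i j c d 0 q] unfolding s_def by force
    then show ?thesis unfolding br_Suc(1) C_def by (simp add: pws)
  qed simp
  have alg: "J * (Ba1 * X) = J * (Bj * Y + G * Bi1 * s)"
    if h: "J * X = C * s + E * (A * q) * x2" "(J * iq) * Y = C * y1 + E * A * y2"
      "Bi * (J * s) = Bi * (C * w1 + E * A * w2)" "Ba * s = Bj * y1 + G * Bi * w1" "Ba1 * x2 = Bj * y2 + G * Bi * w2"
      "(Ba1 - q * Ba) * C * s = J * G * (Bi1 - q * Bi) * s" "q * iq = 1"
    for J Ba1 X Bj Y G Bi1 s C E A x2 iq y1 y2 Bi w1 w2 Ba :: 'a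
  proof -
    have 1: "J * Y = q * (C * y1 + E * A * y2)" unfolding h(2)[symmetric] using h(7) by algebra
    have "J * (Ba1 * X) = Ba1 * (C * s + E * (A * q) * x2)" unfolding h(1)[symmetric] by algebra
    also have "\<dots> = Ba1 * C * s + E * A * q * (Bj * y2 + G * Bi * w2)" unfolding h(5)[symmetric] by algebra
    also have "\<dots> = (Ba1 - q * Ba) * C * s + q * C * (Ba * s) + E * A * q * (Bj * y2 + G * Bi * w2)" by algebra
    also have "\<dots> = J * G * (Bi1 - q * Bi) * s + q * C * (Bj * y1 + G * Bi * w1) + E * A * q * (Bj * y2 + G * Bi * w2)"
      unfolding h(4,6) ..
    also have "\<dots> = J * G * (Bi1 - q * Bi) * s + Bj * (q * (C * y1 + E * A * y2)) + q * G * (Bi * (C * w1 + E * A * w2))"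
      by algebra
    also have "\<dots> = J * G * (Bi1 - q * Bi) * s + Bj * (J * Y) + q * G * (Bi * (J * s))"
      unfolding h(3)[symmetric] 1 ..
    also have "\<dots> = J * (Bj * Y + G * Bi1 * s)" by algebra
    finally show ?thesis .
  qed
  have "q powi j * (br (a + 1) * S (a + 1) b c (i + 1) j d) =
    q powi j * (br j * S a b c (i + 1) (j - 1) (d + 1) + q powi (d - j) * br (i + 1) * s)"
    by (rule alg[OF H1 H2 H3 I1 I2 W]) simp
  then show ?case by (simp add: s_def)
qed

lemma S0_lower_b_right:
  assumes "i \<ge> 0" "k \<ge> 0"
  shows "q powi (- a) * br (b + 1) * S a (b + 1) c i j k =
    - (q powi (k + 1)) * br j * S a b c i (j - 1) k + (1 - q powi (2 * k)) * q powi (- j) * br i * S a b c (i - 1) j (k - 1)"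
  using assms(1)
proof (induction i arbitrary: a b c rule: int_ge_induct)
  case base
  then show ?case using S0_lower_b_right_0[OF assms(2)] by simp
next
  case (step i)
  define E A C where "E = 1 - q powi (2 * c + 2)" and "A = q powi a" and "C = q powi c"
  define s where "s = S a b c i j (k - 1)"
  define F where "F = 1 - q powi (2 * k)"
  have P: "q powi (j - 1) = q powi j * inverse q" "q powi a = A" "q powi c = C" "q powi (- (a - 1)) = q powi (- a) * q"
    "q powi (c - a + 1) = C * q powi (- a) * q"
    unfolding A_def C_def by (simp_all add: pws)
  have H1: "q powi j * S a (b + 1) c (i + 1) j k = C * S (a - 1) (b + 1) c i j k + E * A * S a b (c + 1) i j k"
    using S0_up_i[OF step(1), of j a "b + 1" c k] unfolding E_def P by simp
  have H2: "(q powi j * inverse q) * S a b c (i + 1) (j - 1) k =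
      C * S (a - 1) b c i (j - 1) k + E * A * S a (b - 1) (c + 1) i (j - 1) k"
    using S0_up_i[OF step(1), of "j - 1" a b c k] unfolding E_def P by simp
  have H3: "br i * (q powi j * s) = br i * (C * S (a - 1) b c (i - 1) j (k - 1) + E * A * S a (b - 1) (c + 1) (i - 1) j (k - 1))"
    using S0_up_i[of "i - 1" j a b c "k - 1"] step(1) unfolding E_def P s_def by (cases "i = 0") auto
  have I1: "(q powi (- a) * q) * br (b + 1) * S (a - 1) (b + 1) c i j k =
      - (q powi (k + 1)) * br j * S (a - 1) b c i (j - 1) k + F * q powi (- j) * br i * S (a - 1) b c (i - 1) j (k - 1)"
    using step.IH[of "a - 1" b c] unfolding P F_def .
  have I2: "q powi (- a) * br b * S a b (c + 1) i j k =
      - (q powi (k + 1)) * br j * S a (b - 1) (c + 1) i (j - 1) k + F * q powi (- j) * br i * S a (b - 1) (c + 1) (i - 1) j (k - 1)"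
    using step.IH[of a "b - 1" "c + 1"] unfolding F_def by simp
  have Z: "q powi (- i) * F * s = - (C * q powi (- a) * q) * br (b + 1) * S (a - 1) (b + 1) c i j k
    + E * q powi (- b) * S a b (c + 1) i j k"
    using S0_down_k[OF step(1) assms(2), of a b c j] unfolding F_def s_def E_def P .
  have alg: "J * (Ai * Bb1 * X) = J * (- K * Bj * Y + F * Ji * Bi1 * s)"
    if h: "J * X = C * x1 + E * A * x2" "(J * iq) * Y = C * y1 + E * A * y2"
      "Bi * (J * s) = Bi * (C * w1 + E * A * w2)" "(Ai * q) * Bb1 * x1 = - K * Bj * y1 + F * Ji * Bi * w1"
      "Ai * Bb * x2 = - K * Bj * y2 + F * Ji * Bi * w2"
      "Ii * F * s = - (C * Ai * q) * Bb1 * x1 + E * Bbi * x2"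
      "Bi1 = q * Bi + (q - iq) * Ii" "Bb1 = q * Bb + (q - iq) * Bbi" "q * iq = 1" "J * Ji = 1" "A * Ai = 1"
    for J Ai Bb1 X K Bj Y F Ji Bi1 s C x1 E A x2 iq y1 y2 Bi w1 w2 Bb Ii Bbi :: 'a
  proof -
    have 1: "J * Y = q * (C * y1 + E * A * y2)" unfolding h(2)[symmetric] using h(9) by algebra
    have 2: "- K * Bj * y1 = (Ai * q) * Bb1 * x1 - F * Ji * Bi * w1" "- K * Bj * y2 = Ai * Bb * x2 - F * Ji * Bi * w2"
      unfolding h(4,5) by simp_all
    have "J * (- K * Bj * Y + F * Ji * Bi1 * s) = - K * Bj * (J * Y) + (J * Ji) * F * Bi1 * s" by algebra
    also have "\<dots> = q * C * (- K * Bj * y1) + q * E * A * (- K * Bj * y2) + F * Bi1 * s" unfolding 1 h(10) by algebra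
    also have "\<dots> = q * C * ((Ai * q) * Bb1 * x1) + q * E * (A * Ai) * Bb * x2 - q * F * Ji * (Bi * (C * w1 + E * A * w2)) + F * Bi1 * s"
      unfolding 2 by algebra
    also have "\<dots> = q * C * ((Ai * q) * Bb1 * x1) + q * E * Bb * x2 - q * F * Bi * s * (J * Ji) + F * Bi1 * s"
      unfolding h(3)[symmetric] h(11) by algebra
    also have "\<dots> = q * C * ((Ai * q) * Bb1 * x1) + q * E * Bb * x2 + (q - iq) * (Ii * F * s)"
      unfolding h(10,7) by algebra
    also have "\<dots> = (q * iq) * (C * Ai * Bb1 * x1) + E * Bb1 * x2" unfolding h(6) h(8) by algebra
    also have "\<dots> = (A * Ai) * E * Bb1 * x2 + C * Ai * Bb1 * x1" unfolding h(9,11) by algebra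
    also have "\<dots> = Ai * Bb1 * (C * x1 + E * A * x2)" by algebra
    also have "\<dots> = J * (Ai * Bb1 * X)" unfolding h(1)[symmetric] by algebra
    finally show ?thesis ..
  qed
  have "q powi j * (q powi (- a) * br (b + 1) * S a (b + 1) c (i + 1) j k) =
    q powi j * (- (q powi (k + 1)) * br j * S a b c (i + 1) (j - 1) k + F * q powi (- j) * br (i + 1) * s)"
    by (rule alg[OF H1 H2 H3 I1 I2 Z br_Suc(1) br_Suc(1)]) (simp_all add: A_def pws)
  then show ?case by (simp add: s_def F_def)
qed

lemma S0_lower_i_left:
  assumes "i \<ge> 0"
  shows "br i * S a b (c + 1) (i - 1) j k =
    br (b + 1) * S a (b + 1) c i j k + q powi (c + 1 - b) * br (a + 1) * S (a + 1) b (c + 1) i j k"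
  using assms
proof (induction i arbitrary: a b c rule: int_ge_induct)
  case base
  then show ?case using S0_lower_i_left_0[of b a c j k] by simp
next
  case (step i)
  define E A C B F where "E = 1 - q powi (2 * c + 2)" and "A = q powi a" and "C = q powi c" and "B = q powi b"
    and "F = 1 - q powi (2 * (c + 1) + 2)"
  define s where "s = S a b (c + 1) i j k"
  have P: "q powi (a + 1) = A * q" "q powi (c + 1) = C * q" "q powi a = A" "q powi c = C"
    "q powi (c + 1 - b) = C * inverse B * q" "q powi (c + 1 + 1 - (b - 1)) = C * inverse B * q ^ 3"
    unfolding A_def C_def B_def by (simp_all add: pws eval_nat_numeral)
  have EF: "E = 1 - C\<^sup>2 * q\<^sup>2" "F = 1 - C\<^sup>2 * q ^ 4" unfolding E_def F_def C_def by (simp_all add: pws eval_nat_numeral mult_ac)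
  have H1: "q powi j * S a (b + 1) c (i + 1) j k = C * S (a - 1) (b + 1) c i j k + E * A * s"
    using S0_up_i[OF step(1), of j a "b + 1" c k] unfolding E_def P s_def by simp
  have H2: "q powi j * S (a + 1) b (c + 1) (i + 1) j k = (C * q) * s + F * (A * q) * S (a + 1) (b - 1) (c + 1 + 1) i j k"
    using S0_up_i[OF step(1), of j "a + 1" b "c + 1" k] unfolding F_def P s_def by simp
  have H3: "br i * (q powi j * s) = br i * ((C * q) * S (a - 1) b (c + 1) (i - 1) j k + F * A * S a (b - 1) (c + 1 + 1) (i - 1) j k)"
    using S0_up_i[of "i - 1" j a b "c + 1" k] step(1) unfolding F_def P s_def by (cases "i = 0") auto
  have I1: "br i * S (a - 1) b (c + 1) (i - 1) j k = br (b + 1) * S (a - 1) (b + 1) c i j k + (C * inverse B * q) * br a * s"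
    using step.IH[of "a - 1" b c] unfolding P s_def by simp
  have I2: "br i * S a (b - 1) (c + 1 + 1) (i - 1) j k = br b * s + (C * inverse B * q ^ 3) * br (a + 1) * S (a + 1) (b - 1) (c + 1 + 1) i j k"
    using step.IH[of a "b - 1" "c + 1"] unfolding P s_def by simp
  have W: "(br (i + 1) - inverse q * br i) * q powi j * s = A * B * (q - inverse q) * s"
  proof (cases "s = 0")
    case False
    then have "i = a + b - j" using site_elem_weight[of a b i j "c + 1" k 0 q] unfolding s_def by force
    then show ?thesis unfolding br_Suc(2) A_def B_def by (simp add: pws)
  qed simp
  have alg: "J * (Bi1 * s) = J * (Bb1 * X + (C * Bbi * q) * Ba1 * Y)"
    if h: "J * X = C * x1 + E * A * s" "J * Y = (C * q) * s + F * (A * q) * y2"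
      "Bi * (J * s) = Bi * ((C * q) * w1 + F * A * w2)" "Bi * w1 = Bb1 * x1 + (C * Bbi * q) * Ba * s"
      "Bi * w2 = Bb * s + (C * Bbi * q ^ 3) * Ba1 * y2"
      "(Bi1 - iq * Bi) * J * s = A * B * (q - iq) * s"
      "Bb1 = q * Bb + (q - iq) * Bbi" "Bb1 = iq * Bb + (q - iq) * B" "Ba1 = iq * Ba + (q - iq) * A" "q * iq = 1"
      "E = 1 - C\<^sup>2 * q\<^sup>2" "F = 1 - C\<^sup>2 * q ^ 4"
    for J Bi1 s Bb1 X C Bbi Ba1 Y x1 E A F y2 Bi w1 w2 Ba Bb iq B :: 'a
  proof -
    have r: "E * A * Bb1 - iq * F * A * Bb + C * C * Bbi * q * (q * Ba1 - Ba) = A * B * (q - iq)"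
    proof -
      have a: "q * Ba1 - Ba = (q * q - 1) * A" using h(9,10) by algebra
      have b: "Bb1 - iq * Bb = (q - iq) * B" using h(8) by simp
      have c: "Bb1 - q * Bb = (q - iq) * Bbi" using h(7) by simp
      have "E * A * Bb1 - iq * F * A * Bb = A * (Bb1 - iq * Bb) - C * C * q * q * A * (Bb1 - (q * iq) * q * Bb)"
        unfolding h(11,12) by algebra
      also have "\<dots> = A * B * (q - iq) - C * C * q * q * A * (q - iq) * Bbi" unfolding h(10) mult_1_left b c by algebra
      finally show ?thesis unfolding a using h(10) by algebra
    qed
    have "J * (Bb1 * X + (C * Bbi * q) * Ba1 * Y) = Bb1 * (J * X) + (C * Bbi * q) * Ba1 * (J * Y)" by algebra
    also have "\<dots> = C * (Bb1 * x1) + E * A * Bb1 * s + C * C * Bbi * q * q * Ba1 * s + (C * Bbi * q * q) * F * A * Ba1 * y2"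
      unfolding h(1,2) by algebra
    also have "(C * Bbi * q * q) * F * A * Ba1 * y2 = iq * F * A * ((C * Bbi * q ^ 3) * Ba1 * y2)"
      using h(10) by algebra
    also have "(C * Bbi * q ^ 3) * Ba1 * y2 = Bi * w2 - Bb * s" unfolding h(5) by simp
    also have "Bb1 * x1 = Bi * w1 - (C * Bbi * q) * Ba * s" unfolding h(4) by simp
    also have "C * (Bi * w1 - (C * Bbi * q) * Ba * s) + E * A * Bb1 * s + C * C * Bbi * q * q * Ba1 * s + iq * F * A * (Bi * w2 - Bb * s)
       = (C * Bi * w1 + iq * F * A * Bi * w2) + (E * A * Bb1 - iq * F * A * Bb + C * C * Bbi * q * (q * Ba1 - Ba)) * s" by algebra
    also have "C * Bi * w1 + iq * F * A * Bi * w2 = iq * (Bi * ((C * q) * w1 + F * A * w2))" using h(10) by algebra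
    finally have "J * (Bb1 * X + (C * Bbi * q) * Ba1 * Y) = iq * (Bi * (J * s)) + (Bi1 - iq * Bi) * J * s"
      unfolding r h(3) h(6) .
    then show ?thesis by algebra
  qed
  have "q powi j * (br (i + 1) * s) = q powi j * (br (b + 1) * S a (b + 1) c (i + 1) j k + (C * inverse B * q) * br (a + 1) * S (a + 1) b (c + 1) (i + 1) j k)"
    by (rule alg[OF H1 H2 H3 I1 I2 W _ _ _ _ EF]) (simp_all add: A_def B_def br_Suc[symmetric] flip: pws(3))
  then show ?case unfolding P by (simp add: s_def)
qed

lemma S0_lower_j_left:
  assumes "i \<ge> 0"
  shows "q powi (- i) * br j * S a b c i (j - 1) k =
    - (q powi (1 + c)) * br (b + 1) * S a (b + 1) c i j k
    + (1 - q powi (2 * c + 2)) * q powi (- b) * br (a + 1) * S (a + 1) b (c + 1) i j k"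
  using assms
proof (induction i arbitrary: a b c rule: int_ge_induct)
  case base
  have 1: "br (b + 1) * S a (b + 1) c 0 j k = - (q powi (c + 1 - b)) * br (a + 1) * S (a + 1) b (c + 1) 0 j k" by (rule S0_lower_i_left_0)
  have 2: "q powi (- b) * br (a + 1) * S (a + 1) b (c + 1) 0 j k = br j * S a b c 0 (j - 1) k" by (rule S0_lower_j_left_0)
  have 3: "q powi (1 + c) * q powi (c + 1 - b) = q powi (2 * c + 2) * q powi (- b)" by (simp add: pws power2_eq_square)
  have alg: "x = - r * (B * X) + (1 - g) * p * A * Y" if "B * X = - e * A * Y" "p * A * Y = x" "r * e = g * p" for x r B X g p A Y e :: 'a
    using that by algebra
  show ?case using alg[OF 1 2 3] by (simp add: mult_ac)
next
  case (step i)
  define E A C B F where "E = 1 - q powi (2 * c + 2)" and "A = q powi a" and "C = q powi c" and "B = q powi b"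
    and "F = 1 - q powi (2 * (c + 1) + 2)"
  define s where "s = S a b (c + 1) i j k"
  have P: "q powi (a + 1) = A * q" "q powi (c + 1) = C * q" "q powi a = A" "q powi c = C" "q powi (- b) = inverse B"
    "q powi (- (b - 1)) = inverse B * q" "q powi (1 + c) = q * C" "q powi (1 + (c + 1)) = q * q * C" "q powi (j - 1) = q powi j * inverse q"
    "q powi (- (i + 1)) = q powi (- i) * inverse q"
    unfolding A_def C_def B_def by (simp_all add: pws eval_nat_numeral)
  have H1: "q powi j * S a (b + 1) c (i + 1) j k = C * S (a - 1) (b + 1) c i j k + E * A * s"
    using S0_up_i[OF step(1), of j a "b + 1" c k] unfolding E_def P s_def by simp
  have H2: "q powi j * S (a + 1) b (c + 1) (i + 1) j k = (C * q) * s + F * (A * q) * S (a + 1) (b - 1) (c + 1 + 1) i j k"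
    using S0_up_i[OF step(1), of j "a + 1" b "c + 1" k] unfolding F_def P s_def by simp
  have H3: "(q powi j * inverse q) * S a b c (i + 1) (j - 1) k = C * S (a - 1) b c i (j - 1) k + E * A * S a (b - 1) (c + 1) i (j - 1) k"
    using S0_up_i[OF step(1), of "j - 1" a b c k] unfolding E_def P .
  have I1: "q powi (- i) * br j * S (a - 1) b c i (j - 1) k = - (q * C) * br (b + 1) * S (a - 1) (b + 1) c i j k + E * inverse B * br a * s"
    using step.IH[of "a - 1" b c] unfolding P s_def E_def by simp
  have I2: "q powi (- i) * br j * S a (b - 1) (c + 1) i (j - 1) k = - (q * q * C) * br b * s + F * (inverse B * q) * br (a + 1) * S (a + 1) (b - 1) (c + 1 + 1) i j k"
    using step.IH[of a "b - 1" "c + 1"] unfolding P s_def F_def by simp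
  have alg: "J * ((Ii * iq) * Bj * L) = J * (- (q * C) * Bb1 * X + E * Bbi * Ba1 * Y)"
    if h: "J * X = C * x1 + E * A * s" "J * Y = (C * q) * s + F * (A * q) * y2" "(J * iq) * L = C * l1 + E * A * l2"
      "Ii * Bj * l1 = - (q * C) * Bb1 * x1 + E * Bbi * Ba * s"
      "Ii * Bj * l2 = - (q * q * C) * Bb * s + F * (Bbi * q) * Ba1 * y2"
      "Bb1 = q * Bb + (q - iq) * Bbi" "Ba1 = iq * Ba + (q - iq) * A" "q * iq = 1"
    for J Ii iq Bj L C Bb1 X E Bbi Ba1 Y x1 A s F y2 l1 l2 Ba Bb :: 'a
  proof -
    have a: "q * Ba1 - Ba = (q * q - 1) * A" using h(7,8) by algebra
    have c: "q * (Bb1 - q * Bb) = (q * q - 1) * Bbi" using h(6,8) by algebra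
    have r: "Bbi * Ba - A * q * q * Bb = q * Bbi * Ba1 - q * A * Bb1" using a c by algebra
    have "J * ((Ii * iq) * Bj * L) = Ii * Bj * ((J * iq) * L)" by algebra
    also have "\<dots> = C * (Ii * Bj * l1) + E * A * (Ii * Bj * l2)" unfolding h(3) by algebra
    also have "\<dots> = - (q * C) * Bb1 * C * x1 + E * C * (Bbi * Ba - A * q * q * Bb) * s + E * Bbi * Ba1 * F * A * q * y2"
      unfolding h(4,5) by algebra
    also have "\<dots> = - (q * C) * Bb1 * (C * x1 + E * A * s) + E * Bbi * Ba1 * ((C * q) * s + F * (A * q) * y2)"
      unfolding r by algebra
    also have "\<dots> = J * (- (q * C) * Bb1 * X + E * Bbi * Ba1 * Y)" unfolding h(1,2)[symmetric] by algebra
    finally show ?thesis .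
  qed
  have "q powi j * ((q powi (- i) * inverse q) * br j * S a b c (i + 1) (j - 1) k) =
     q powi j * (- (q * C) * br (b + 1) * S a (b + 1) c (i + 1) j k + E * inverse B * br (a + 1) * S (a + 1) b (c + 1) (i + 1) j k)"
    by (rule alg[OF H1 H2 H3 I1 I2]) (simp_all add: A_def B_def br_Suc[symmetric] flip: pws(3))
  then show ?case unfolding P by (simp add: E_def)
qed

end

section \<open>One-site relations for bosons and fermions\<close>

context generic_q begin

text \<open>The parameter \<open>q_i\<close> of a site.\<close>
definition site_q :: "nat \<Rightarrow> 'a" where "site_q e = (if e = 0 then q else - inverse q)"

lemma site_q_nz [simp]: "site_q e \<noteq> 0" by (simp add: site_q_def)

text \<open>Allowed occupation numbers: any for a boson, at most one for a fermion.\<close>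
definition occ_ok :: "nat \<Rightarrow> int \<Rightarrow> bool" where "occ_ok e m \<longleftrightarrow> 0 \<le> m \<and> (e = 0 \<or> m \<le> 1)"

lemma occ_ok_fermion: "occ_ok e m \<Longrightarrow> e \<noteq> 0 \<Longrightarrow> m = 0 \<or> m = 1"
  by (auto simp: occ_ok_def)

lemma scrS1_support: "scrS1 q a b c i j k \<noteq> 0 \<Longrightarrow> a \<le> 1 \<and> b \<le> 1 \<and> i \<le> 1 \<and> j \<le> 1 \<and> a + b = i + j"
  unfolding scrS1_def of_bool_def
  by (simp only: split: if_split_asm) auto

lemma S1_out:
  assumes "e \<noteq> 0" "a < 0 \<or> a > 1 \<or> b < 0 \<or> b > 1 \<or> i < 0 \<or> i > 1 \<or> j < 0 \<or> j > 1 \<or> a + b \<noteq> i + j"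
  shows "site_elem e q a b c i j k = 0"
proof (rule ccontr)
  assume nz: "site_elem e q a b c i j k \<noteq> 0"
  then have p: "0 \<le> a \<and> 0 \<le> b \<and> 0 \<le> c \<and> 0 \<le> i \<and> 0 \<le> j \<and> 0 \<le> k"
    by (auto simp: site_elem_def split: if_splits)
  with nz assms(1) have "scrS1 q (nat a) (nat b) (nat c) (nat i) (nat j) (nat k) \<noteq> 0"
    by (simp add: site_elem_def scrS_def)
  from scrS1_support[OF this] p assms(2) show False by linarith
qed

lemma pwd:
  "q powi (d + 1) = q * q powi d" "q powi (1 + d) = q * q powi d" "q powi (d + 2) = q\<^sup>2 * q powi d" "q powi (2 + d) = q\<^sup>2 * q powi d"
  "q powi (2 * d) = (q powi d)\<^sup>2" "q powi (2 * d + 2) = q\<^sup>2 * (q powi d)\<^sup>2" "q powi (2 * (d + 1)) = q\<^sup>2 * (q powi d)\<^sup>2"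
  "q powi (2 + 2 * d) = q\<^sup>2 * (q powi d)\<^sup>2" "q powi (d * 2) = (q powi d)\<^sup>2"
  "q powi (2 + d * 2) = q\<^sup>2 * (q powi d)\<^sup>2" "q powi (d * 2 + 2) = q\<^sup>2 * (q powi d)\<^sup>2"
  "q powi (2 * (d + 2)) = q ^ 4 * (q powi d)\<^sup>2"
  "q * (inverse q * x) = x" "inverse q * (q * x) = x"
  by (simp_all add: pws power2_eq_square eval_nat_numeral)

lemma S1_simps:
  assumes "e \<noteq> 0"
  shows "site_elem e q 0 0 c 0 0 k = of_bool (c = k \<and> 0 \<le> k)" "site_elem e q 1 1 c 1 1 k = of_bool (c = k \<and> 0 \<le> k)"
    "site_elem e q 0 1 c 0 1 k = - (of_bool (c = k \<and> 0 \<le> k) * q powi (k + 1))"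
    "site_elem e q 1 0 c 1 0 k = of_bool (c = k \<and> 0 \<le> k) * q powi k"
    "site_elem e q 0 1 c 1 0 k = of_bool (c + 1 = k \<and> 1 \<le> k) * (1 - q powi (2 * k))"
    "site_elem e q 1 0 c 0 1 k = of_bool (c = k + 1 \<and> 0 \<le> k)"
proof -
  have *: "site_elem e q (int a) (int b) c (int i) (int j) k = (if 0 \<le> c \<and> 0 \<le> k then scrS1 q a b (nat c) i j (nat k) else 0)" for a b i j
    using assms by (simp add: site_elem_def scrS_def)
  have 2: "q powi k = q ^ nat k" "q powi (k + 1) = q ^ (nat k + 1)" "q powi (2 * k) = q ^ (2 * nat k)" if "0 \<le> k"
    using that by (simp_all add: power_int_def nat_add_distrib nat_mult_distrib)
  show "site_elem e q 0 0 c 0 0 k = of_bool (c = k \<and> 0 \<le> k)" using *[of 0 0 0 0] by (auto simp: scrS1_def)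
  show "site_elem e q 1 1 c 1 1 k = of_bool (c = k \<and> 0 \<le> k)" using *[of 1 1 1 1] by (auto simp: scrS1_def)
  show "site_elem e q 0 1 c 0 1 k = - (of_bool (c = k \<and> 0 \<le> k) * q powi (k + 1))" using *[of 0 1 0 1] 2 by (auto simp: scrS1_def)
  show "site_elem e q 1 0 c 1 0 k = of_bool (c = k \<and> 0 \<le> k) * q powi k" using *[of 1 0 1 0] 2 by (auto simp: scrS1_def)
  show "site_elem e q 0 1 c 1 0 k = of_bool (c + 1 = k \<and> 1 \<le> k) * (1 - q powi (2 * k))"
  proof (cases "0 \<le> c \<and> 0 \<le> k")
    case True
    then have "nat c + 1 = nat k \<longleftrightarrow> c + 1 = k \<and> 1 \<le> k" by auto
    then show ?thesis using *[of 0 1 1 0] 2 True by (simp add: scrS1_def)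
  qed (use *[of 0 1 1 0] in auto)
  show "site_elem e q 1 0 c 0 1 k = of_bool (c = k + 1 \<and> 0 \<le> k)"
  proof (cases "0 \<le> c \<and> 0 \<le> k")
    case True
    then have "nat c = nat k + 1 \<longleftrightarrow> c = k + 1 \<and> 0 \<le> k" by auto
    then show ?thesis using *[of 1 0 0 1] True by (simp add: scrS1_def)
  qed (use *[of 1 0 0 1] in auto)
qed

lemma br_1: "br 1 = q - inverse q" "br 2 = (q - inverse q) * (q + inverse q)"
  by (simp_all add: br_def power2_eq_square field_simps power_int_minus)

text \<open>
  All fermionic elements are Kronecker deltas in \<open>c\<close> and \<open>d\<close> that vanish outside \<open>c - d \<in> {0, 1, 2}\<close>,
  so this disjunction makes the fermionic relations a finite check.
\<close>
lemma near_or_far: "c = d \<or> c = d + 1 \<or> c = d + 2 \<or> (c \<noteq> d \<and> c \<noteq> d + 1 \<and> d + 1 \<noteq> c \<and> c + 1 \<noteq> d + 2 \<and> c \<noteq> d + 2 \<and> d + 2 \<noteq> c \<and> d \<noteq> c)" for c d :: int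
  by auto

text \<open>
  The eight relations \<open>X\<close>, \<open>Y\<close> are the common form of the relations for the 3D R and the 3D L: \<open>X\<close> for a
  site that receives a particle under \<open>e\<close> or \<open>f\<close>, and \<open>Y\<close> for a site that gives one away.  The label \<open>c\<close> on
  the far side of the site is fixed, and the label of the link is \<open>d\<close> or \<open>d + 1\<close>.  Where \<open>d = -1\<close> is
  admitted, the terms with \<open>d + 1 = 0\<close> can still contribute.
\<close>
lemma site_X_e1:
  assumes "occ_ok e a" "occ_ok e b" "occ_ok e i" "occ_ok e j" "d \<ge> -1"
  shows "site_q e powi j * site_elem e q a b d (i + 1) j c = q powi d * site_elem e q (a - 1) b d i j c
     + (1 - q powi (2 * d + 2)) * (site_q e powi a * site_elem e q a (b - 1) (d + 1) i j c)"
proof (cases "e = 0")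
  case True
  then show ?thesis using S0_up_i[of i j a b d c] assms by (simp add: site_q_def occ_ok_def mult_ac)
next
  case False
  show ?thesis
    using assms(1-4)[THEN occ_ok_fermion[OF _ False]] assms(5) near_or_far[of c d]
    by (elim disjE; hypsubst?; cases "d = -1"; simp add: S1_simps[OF False] S1_out[OF False] site_q_def False br_1;
      simp add: pwd power2_eq_square algebra_simps)
qed

lemma site_X_e2:
  assumes "occ_ok e a" "occ_ok e b" "occ_ok e i" "occ_ok e j" "d \<ge> -1"
  shows "site_elem e q a b (d + 1) i (j + 1) c = site_elem e q (a - 1) b d i j c - q powi (d + 2) * (site_q e powi a * site_elem e q a (b - 1) (d + 1) i j c)"
proof (cases "e = 0")
  case True
  then show ?thesis using S0_up_j[of i j a b "d + 1" c] assms by (simp add: site_q_def occ_ok_def pws mult_ac power2_eq_square)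
next
  case False
  show ?thesis
    using assms(1-4)[THEN occ_ok_fermion[OF _ False]] assms(5) near_or_far[of c d]
    by (elim disjE; hypsubst?; cases "d = -1"; simp add: S1_simps[OF False] S1_out[OF False] site_q_def False br_1;
      simp add: pwd power2_eq_square algebra_simps)
qed

lemma site_Y_e1:
  assumes "occ_ok e a" "occ_ok e b" "occ_ok e i" "occ_ok e j" "d \<ge> 0"
  shows "br (a + 1) * site_elem e q (a + 1) b c i j d = br j * site_elem e q a b c i (j - 1) (d + 1)
    + q powi d * (site_q e powi (- j) * br i * site_elem e q a b c (i - 1) j d)"
proof (cases "e = 0")
  case True
  then show ?thesis using S0_lower_a_right[of i d a b c j] assms by (simp add: site_q_def occ_ok_def pws mult_ac)
next
  case False
  show ?thesis
    using assms(1-4)[THEN occ_ok_fermion[OF _ False]] assms(5) near_or_far[of c d]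
    by (elim disjE; hypsubst?; cases "d = -1"; simp add: S1_simps[OF False] S1_out[OF False] site_q_def False br_1;
      simp add: pwd power2_eq_square algebra_simps)
qed

lemma site_Y_e2:
  assumes "occ_ok e a" "occ_ok e b" "occ_ok e i" "occ_ok e j" "d \<ge> -1"
  shows "site_q e powi (- a) * br (b + 1) * site_elem e q a (b + 1) c i j (d + 1) = - (q powi (d + 2)) * (br j * site_elem e q a b c i (j - 1) (d + 1))
    + (1 - q powi (2 * d + 2)) * (site_q e powi (- j) * br i * site_elem e q a b c (i - 1) j d)"
proof (cases "e = 0")
  case True
  then show ?thesis using S0_lower_b_right[of i "d + 1" a b c j] assms by (simp add: site_q_def occ_ok_def mult_ac add_ac distrib_left)
next
  case False
  show ?thesis
    using assms(1-4)[THEN occ_ok_fermion[OF _ False]] assms(5) near_or_far[of c d]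
    by (elim disjE; hypsubst?; cases "d = -1"; simp add: S1_simps[OF False] S1_out[OF False] site_q_def False br_1;
      simp add: pwd power2_eq_square algebra_simps)
qed

lemma site_X_f1:
  assumes "occ_ok e a" "occ_ok e b" "occ_ok e i" "occ_ok e j" "d \<ge> 0"
  shows "site_elem e q a (b - 1) c i j d = site_elem e q a b c (i + 1) j (d + 1) - q powi (1 + d) * (site_q e powi i * site_elem e q a b c i (j + 1) d)"
proof (cases "e = 0")
  case True
  then show ?thesis using S0_down_b_left[of i j d a b c] assms by (simp add: site_q_def occ_ok_def pws mult_ac)
next
  case False
  show ?thesis
    using assms(1-4)[THEN occ_ok_fermion[OF _ False]] assms(5) near_or_far[of c d]
    by (elim disjE; hypsubst?; cases "d = -1"; simp add: S1_simps[OF False] S1_out[OF False] site_q_def False br_1;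
      simp add: pwd power2_eq_square algebra_simps)
qed

lemma site_X_f2:
  assumes "occ_ok e a" "occ_ok e b" "occ_ok e i" "occ_ok e j" "d \<ge> -1"
  shows "site_q e powi b * site_elem e q (a - 1) b c i j (d + 1) = q powi (d + 1) * site_elem e q a b c (i + 1) j (d + 1)
    + (1 - q powi (2 * d + 2)) * (site_q e powi i * site_elem e q a b c i (j + 1) d)"
proof (cases "e = 0")
  case True
  then show ?thesis using S0_down_a_left[of i j "d + 1" b a c] assms by (simp add: site_q_def occ_ok_def mult_ac add_ac distrib_left)
next
  case False
  show ?thesis
    using assms(1-4)[THEN occ_ok_fermion[OF _ False]] assms(5) near_or_far[of c d]
    by (elim disjE; hypsubst?; cases "d = -1"; simp add: S1_simps[OF False] S1_out[OF False] site_q_def False br_1;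
      simp add: pwd power2_eq_square algebra_simps)
qed

lemma site_Y_f1:
  assumes "occ_ok e a" "occ_ok e b" "occ_ok e i" "occ_ok e j" "d \<ge> -1"
  shows "br i * site_elem e q a b (d + 1) (i - 1) j c = br (b + 1) * site_elem e q a (b + 1) d i j c
    + q powi (d + 1) * (site_q e powi (- b) * br (a + 1) * site_elem e q (a + 1) b (d + 1) i j c)"
proof (cases "e = 0")
  case True
  then show ?thesis using S0_lower_i_left[of i a b d j c] assms by (simp add: site_q_def occ_ok_def pws mult_ac)
next
  case False
  show ?thesis
    using assms(1-4)[THEN occ_ok_fermion[OF _ False]] assms(5) near_or_far[of c d]
    by (elim disjE; hypsubst?; cases "d = -1"; simp add: S1_simps[OF False] S1_out[OF False] site_q_def False br_1;
      simp add: pwd power2_eq_square algebra_simps)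
qed

lemma site_Y_f2:
  assumes "occ_ok e a" "occ_ok e b" "occ_ok e i" "occ_ok e j" "d \<ge> -1"
  shows "site_q e powi (- i) * br j * site_elem e q a b d i (j - 1) c = - (q powi (1 + d)) * (br (b + 1) * site_elem e q a (b + 1) d i j c)
    + (1 - q powi (2 * d + 2)) * (site_q e powi (- b) * br (a + 1) * site_elem e q (a + 1) b (d + 1) i j c)"
proof (cases "e = 0")
  case True
  then show ?thesis using S0_lower_j_left[of i j a b d c] assms by (simp add: site_q_def occ_ok_def mult_ac)
next
  case False
  show ?thesis
    using assms(1-4)[THEN occ_ok_fermion[OF _ False]] assms(5) near_or_far[of c d]
    by (elim disjE; hypsubst?; cases "d = -1"; simp add: S1_simps[OF False] S1_out[OF False] site_q_def False br_1;
      simp add: pwd power2_eq_square algebra_simps)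
qed

end

section \<open>Chains of sites\<close>

locale site_chain = generic_q q for q :: "'a::field" +
  fixes n :: nat and eps :: "nat \<Rightarrow> nat"
begin

definition site_fac where
  "site_fac a b i j c k = site_elem (eps k) q (a k) (b k) (c (k - 1)) (i k) (j k) (c k)" for a b i j :: "nat \<Rightarrow> int" and c :: "nat \<Rightarrow> int"

text \<open>One term of the sum over auxiliary labels, for the path \<open>c\<close>.\<close>
definition path_prod where
  "path_prod a b i j c = (\<Prod>k=1..n. site_fac a b i j c k)" for a b i j :: "nat \<Rightarrow> int" and c :: "nat \<Rightarrow> int"

definition valid :: "(nat \<Rightarrow> int) \<Rightarrow> bool" where
  "valid m \<longleftrightarrow> (\<forall>k\<in>{1..n}. occ_ok (eps k) (m k))"

lemma validD: "valid m \<Longrightarrow> k \<in> {1..n} \<Longrightarrow> occ_ok (eps k) (m k)"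
  by (simp add: valid_def)

lemma site_elem_not_occ_ok:
  "\<not> occ_ok e a \<or> \<not> occ_ok e b \<or> \<not> occ_ok e i \<or> \<not> occ_ok e j \<Longrightarrow> site_elem e q a b c i j k = 0"
  using S1_out[of e a b i j c k] site_elem_neg[of a b c i j k e q] unfolding occ_ok_def by (cases "e = 0") auto

lemma path_prod_invalid:
  assumes "\<not> valid a \<or> \<not> valid b \<or> \<not> valid i \<or> \<not> valid j"
  shows "path_prod a b i j c = 0"
proof -
  obtain k where "k \<in> {1..n}" "\<not> occ_ok (eps k) (a k) \<or> \<not> occ_ok (eps k) (b k) \<or> \<not> occ_ok (eps k) (i k) \<or> \<not> occ_ok (eps k) (j k)"
    using assms unfolding valid_def by blast
  then have "site_fac a b i j c k = 0" unfolding site_fac_def by (intro site_elem_not_occ_ok)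
  then show ?thesis using \<open>k \<in> {1..n}\<close> unfolding path_prod_def by (meson finite_atLeastAtMost prod_zero)
qed

lemma path_prod_neg:
  assumes "k \<in> {1..n}" "c k < 0 \<or> c (k - 1) < 0"
  shows "path_prod a b i j c = 0"
proof -
  have "site_fac a b i j c k = 0" unfolding site_fac_def by (rule site_elem_neg) (use assms in auto)
  then show ?thesis using assms(1) unfolding path_prod_def by (meson finite_atLeastAtMost prod_zero)
qed

lemma path_prod_split1: "t \<in> {1..n} \<Longrightarrow> path_prod a b i j c = site_fac a b i j c t * (\<Prod>k\<in>{1..n}-{t}. site_fac a b i j c k)"
  unfolding path_prod_def by (rule prod.remove) auto

lemma path_prod_split2: "s \<in> {1..n} \<Longrightarrow> t \<in> {1..n} \<Longrightarrow> s \<noteq> t \<Longrightarrow>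
   path_prod a b i j c = site_fac a b i j c s * site_fac a b i j c t * (\<Prod>k\<in>{1..n}-{s}-{t}. site_fac a b i j c k)"
  unfolding path_prod_split1[of s] by (subst prod.remove[of "{1..n} - {s}" t]) (auto simp: mult.assoc)

text \<open>
  With \<open>X_1, ..., X_4\<close> and \<open>Y_1, ..., Y_4\<close> for the elements at the ends of the link, the one-site
  relations express \<open>X_3, X_4\<close> through \<open>X_1, X_2\<close> and \<open>Y_1, Y_2\<close> through \<open>Y_3, Y_4\<close> by transposed
  matrices, and so \<open>Y_1 X_1 + Y_2 X_2 = Y_3 X_3 + Y_4 X_4\<close>.  All other sites contribute the same
  factor to the four terms.
\<close>
lemma two_site_e:
  assumes st: "s \<in> {1..n}" "t \<in> {1..n}" "s \<noteq> t"
    and v: "valid a" "valid b" "valid i" "valid j"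
    and c: "c s = d" "c (t - 1) = d" "c' s = d + 1" "c' (t - 1) = d + 1"
    and c': "\<And>k. k \<in> {1..n} - {s} \<Longrightarrow> c' k = c k" "\<And>k. k \<in> {1..n} - {t} \<Longrightarrow> c' (k - 1) = c (k - 1)"
  shows "br (a s + 1) * path_prod (a(s := a s + 1, t := a t - 1)) b i j c
     + site_q (eps s) powi (- a s) * site_q (eps t) powi a t * br (b s + 1) * path_prod a (b(s := b s + 1, t := b t - 1)) i j c'
   = br (j s) * path_prod a b i (j(s := j s - 1, t := j t + 1)) c'
     + br (i s) * (site_q (eps s) powi (- j s) * site_q (eps t) powi j t) * path_prod a b (i(s := i s - 1, t := i t + 1)) j c"
proof (cases "d < -1")
  case True
  then show ?thesis using path_prod_neg[OF st(1)] c(1,3) by simp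
next
  case False
  define R where "R = (\<Prod>k\<in>{1..n}-{s}-{t}. site_fac a b i j c k)"
  have st': "t \<noteq> s" using st by simp
  have s: "c' (s - 1) = c (s - 1)" "c' t = c t" using c'(1)[of t] c'(2)[of s] st by auto
  have vs: "occ_ok (eps s) (a s)" "occ_ok (eps s) (b s)" "occ_ok (eps s) (i s)" "occ_ok (eps s) (j s)" using v st by (auto simp: validD)
  have vt: "occ_ok (eps t) (a t)" "occ_ok (eps t) (b t)" "occ_ok (eps t) (i t)" "occ_ok (eps t) (j t)" using v st by (auto simp: validD)
  have d: "d \<ge> -1" using False by simp
  define X1 where "X1 = site_elem (eps t) q (a t - 1) (b t) d (i t) (j t) (c t)"
  define X2 where "X2 = site_q (eps t) powi a t * site_elem (eps t) q (a t) (b t - 1) (d + 1) (i t) (j t) (c t)"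
  define Y3 where "Y3 = br (j s) * site_elem (eps s) q (a s) (b s) (c (s - 1)) (i s) (j s - 1) (d + 1)"
  define Y4 where "Y4 = site_q (eps s) powi (- j s) * br (i s) * site_elem (eps s) q (a s) (b s) (c (s - 1)) (i s - 1) (j s) d"
  have 1: "br (a s + 1) * path_prod (a(s := a s + 1, t := a t - 1)) b i j c = (Y3 + q powi d * Y4) * X1 * R"
  proof (cases "d = -1")
    case True
    then have "X1 = 0" unfolding X1_def by (simp add: site_elem_neg)
    moreover have "path_prod (a(s := a s + 1, t := a t - 1)) b i j c = 0" using path_prod_neg[OF st(1)] c(1) True by simp
    ultimately show ?thesis by simp
  next
    case False
    then have "d \<ge> 0" using d by simp
    have "(\<Prod>k\<in>{1..n}-{s}-{t}. site_fac (a(s := a s + 1, t := a t - 1)) b i j c k) = R"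
      unfolding R_def by (rule prod.cong) (auto simp: site_fac_def)
    then show ?thesis unfolding path_prod_split2[OF st] Y3_def Y4_def X1_def site_Y_e1[OF vs \<open>d \<ge> 0\<close>, symmetric]
      using st' by (simp add: site_fac_def c c[unfolded One_nat_def] mult_ac)
  qed
  have 2: "site_q (eps s) powi (- a s) * site_q (eps t) powi a t * br (b s + 1) * path_prod a (b(s := b s + 1, t := b t - 1)) i j c'
     = (- (q powi (d + 2)) * Y3 + (1 - q powi (2 * d + 2)) * Y4) * X2 * R"
  proof -
    have "(\<Prod>k\<in>{1..n}-{s}-{t}. site_fac a (b(s := b s + 1, t := b t - 1)) i j c' k) = R"
      unfolding R_def by (rule prod.cong) (auto simp: site_fac_def c' c'[unfolded One_nat_def])
    then show ?thesis unfolding path_prod_split2[OF st] Y3_def Y4_def X2_def site_Y_e2[OF vs d, symmetric]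
      using st' by (simp add: site_fac_def c s c[unfolded One_nat_def] s[unfolded One_nat_def] mult_ac)
  qed
  have 3: "br (j s) * path_prod a b i (j(s := j s - 1, t := j t + 1)) c' = Y3 * (X1 - q powi (d + 2) * X2) * R"
  proof -
    have "(\<Prod>k\<in>{1..n}-{s}-{t}. site_fac a b i (j(s := j s - 1, t := j t + 1)) c' k) = R"
      unfolding R_def by (rule prod.cong) (auto simp: site_fac_def c' c'[unfolded One_nat_def])
    then show ?thesis unfolding path_prod_split2[OF st] Y3_def X1_def X2_def site_X_e2[OF vt d, symmetric]
      using st' by (simp add: site_fac_def c s c[unfolded One_nat_def] s[unfolded One_nat_def] mult_ac)
  qed
  have 4: "br (i s) * (site_q (eps s) powi (- j s) * site_q (eps t) powi j t) * path_prod a b (i(s := i s - 1, t := i t + 1)) j c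
     = Y4 * (q powi d * X1 + (1 - q powi (2 * d + 2)) * X2) * R"
  proof -
    have "(\<Prod>k\<in>{1..n}-{s}-{t}. site_fac a b (i(s := i s - 1, t := i t + 1)) j c k) = R"
      unfolding R_def by (rule prod.cong) (auto simp: site_fac_def)
    then show ?thesis unfolding path_prod_split2[OF st] Y4_def X1_def X2_def site_X_e1[OF vt d, symmetric]
      using st' by (simp add: site_fac_def c s c[unfolded One_nat_def] s[unfolded One_nat_def] mult_ac)
  qed
  show ?thesis unfolding 1 2 3 4 by (simp add: algebra_simps)
qed

text \<open>The same argument with the roles of the two sites exchanged.\<close>
lemma two_site_f:
  assumes st: "s \<in> {1..n}" "t \<in> {1..n}" "s \<noteq> t"
    and v: "valid a" "valid b" "valid i" "valid j"
    and c: "c s = d" "c (t - 1) = d" "c' s = d + 1" "c' (t - 1) = d + 1"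
    and c': "\<And>k. k \<in> {1..n} - {s} \<Longrightarrow> c' k = c k" "\<And>k. k \<in> {1..n} - {t} \<Longrightarrow> c' (k - 1) = c (k - 1)"
  shows "br (b t + 1) * path_prod a (b(s := b s - 1, t := b t + 1)) i j c
     + site_q (eps s) powi b s * site_q (eps t) powi (- b t) * br (a t + 1) * path_prod (a(s := a s - 1, t := a t + 1)) b i j c'
   = br (i t) * path_prod a b (i(s := i s + 1, t := i t - 1)) j c'
     + br (j t) * (site_q (eps s) powi i s * site_q (eps t) powi (- i t)) * path_prod a b i (j(s := j s + 1, t := j t - 1)) c"
proof (cases "d < -1")
  case True
  then show ?thesis using path_prod_neg[OF st(1)] c(1,3) by simp
next
  case False
  define R where "R = (\<Prod>k\<in>{1..n}-{s}-{t}. site_fac a b i j c k)"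
  have st': "t \<noteq> s" using st by simp
  have s: "c' (s - 1) = c (s - 1)" "c' t = c t" using c'(1)[of t] c'(2)[of s] st by auto
  have vs: "occ_ok (eps s) (a s)" "occ_ok (eps s) (b s)" "occ_ok (eps s) (i s)" "occ_ok (eps s) (j s)" using v st by (auto simp: validD)
  have vt: "occ_ok (eps t) (a t)" "occ_ok (eps t) (b t)" "occ_ok (eps t) (i t)" "occ_ok (eps t) (j t)" using v st by (auto simp: validD)
  have d: "d \<ge> -1" using False by simp
  define X3 where "X3 = site_elem (eps s) q (a s) (b s) (c (s - 1)) (i s + 1) (j s) (d + 1)"
  define X4 where "X4 = site_q (eps s) powi i s * site_elem (eps s) q (a s) (b s) (c (s - 1)) (i s) (j s + 1) d"
  define Y1 where "Y1 = br (b t + 1) * site_elem (eps t) q (a t) (b t + 1) d (i t) (j t) (c t)"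
  define Y2 where "Y2 = site_q (eps t) powi (- b t) * br (a t + 1) * site_elem (eps t) q (a t + 1) (b t) (d + 1) (i t) (j t) (c t)"
  have 1: "br (b t + 1) * path_prod a (b(s := b s - 1, t := b t + 1)) i j c = (X3 - q powi (1 + d) * X4) * Y1 * R"
  proof (cases "d = -1")
    case True
    then have "Y1 = 0" unfolding Y1_def by (simp add: site_elem_neg)
    moreover have "path_prod a (b(s := b s - 1, t := b t + 1)) i j c = 0" using path_prod_neg[OF st(1)] c(1) True by simp
    ultimately show ?thesis by simp
  next
    case False
    then have "d \<ge> 0" using d by simp
    have "(\<Prod>k\<in>{1..n}-{s}-{t}. site_fac a (b(s := b s - 1, t := b t + 1)) i j c k) = R"
      unfolding R_def by (rule prod.cong) (auto simp: site_fac_def)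
    then show ?thesis unfolding path_prod_split2[OF st] X3_def X4_def Y1_def site_X_f1[OF vs \<open>d \<ge> 0\<close>, symmetric]
      using st' by (simp add: site_fac_def c c[unfolded One_nat_def] mult_ac)
  qed
  have 2: "site_q (eps s) powi b s * site_q (eps t) powi (- b t) * br (a t + 1) * path_prod (a(s := a s - 1, t := a t + 1)) b i j c'
     = (q powi (d + 1) * X3 + (1 - q powi (2 * d + 2)) * X4) * Y2 * R"
  proof -
    have "(\<Prod>k\<in>{1..n}-{s}-{t}. site_fac (a(s := a s - 1, t := a t + 1)) b i j c' k) = R"
      unfolding R_def by (rule prod.cong) (auto simp: site_fac_def c' c'[unfolded One_nat_def])
    then show ?thesis unfolding path_prod_split2[OF st] X3_def X4_def Y2_def site_X_f2[OF vs d, symmetric]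
      using st' by (simp add: site_fac_def c s c[unfolded One_nat_def] s[unfolded One_nat_def] mult_ac)
  qed
  have 3: "br (i t) * path_prod a b (i(s := i s + 1, t := i t - 1)) j c' = X3 * (Y1 + q powi (d + 1) * Y2) * R"
  proof -
    have "(\<Prod>k\<in>{1..n}-{s}-{t}. site_fac a b (i(s := i s + 1, t := i t - 1)) j c' k) = R"
      unfolding R_def by (rule prod.cong) (auto simp: site_fac_def c' c'[unfolded One_nat_def])
    then show ?thesis unfolding path_prod_split2[OF st] X3_def Y1_def Y2_def site_Y_f1[OF vt d, symmetric]
      using st' by (simp add: site_fac_def c s c[unfolded One_nat_def] s[unfolded One_nat_def] mult_ac)
  qed
  have 4: "br (j t) * (site_q (eps s) powi i s * site_q (eps t) powi (- i t)) * path_prod a b i (j(s := j s + 1, t := j t - 1)) c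
     = X4 * (- (q powi (1 + d)) * Y1 + (1 - q powi (2 * d + 2)) * Y2) * R"
  proof -
    have "(\<Prod>k\<in>{1..n}-{s}-{t}. site_fac a b i (j(s := j s + 1, t := j t - 1)) c k) = R"
      unfolding R_def by (rule prod.cong) (auto simp: site_fac_def)
    then show ?thesis unfolding path_prod_split2[OF st] X4_def Y1_def Y2_def site_Y_f2[OF vt d, symmetric]
      using st' by (simp add: site_fac_def c s c[unfolded One_nat_def] s[unfolded One_nat_def] mult_ac)
  qed
  show ?thesis unfolding 1 2 3 4 by (simp add: algebra_simps)
qed

text \<open>
  At the left end of an open chain the weight \<open>w\<close> of \<open>c_0\<close> replaces the missing site.  Its recursion is
  that of \<open>(-q)_c\<close>; the factor \<open>-1/q\<close> is \<open>p^2\<close>.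
\<close>
lemma left_e:
  assumes n: "n \<ge> 1" and v: "valid a" "valid b" "valid i" "valid j"
    and c: "c 0 = d" "c' 0 = d + 1" "\<And>k. k \<ge> 1 \<Longrightarrow> c' k = c k"
    and w: "d \<ge> 0 \<Longrightarrow> w (d + 1) = (1 + q powi (d + 1)) * w d" "w (-1) = 0"
  shows "- inverse q * w d * path_prod (a(1 := a 1 - 1)) b i j c + w (d + 1) * site_q (eps 1) powi a 1 * path_prod a (b(1 := b 1 - 1)) i j c'
    = - inverse q * w (d + 1) * path_prod a b i (j(1 := j 1 + 1)) c' + w d * site_q (eps 1) powi j 1 * path_prod a b (i(1 := i 1 + 1)) j c"
proof (cases "d < -1")
  case True
  then show ?thesis using path_prod_neg[of 1] n c by simp
next
  case False
  have 1: "1 \<in> {1..n}" using n by simp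
  define R where "R = (\<Prod>k\<in>{1..n}-{1}. site_fac a b i j c k)"
  have vt: "occ_ok (eps 1) (a 1)" "occ_ok (eps 1) (b 1)" "occ_ok (eps 1) (i 1)" "occ_ok (eps 1) (j 1)" using v 1 by (auto simp: validD)
  have d: "d \<ge> -1" using False by simp
  have c1: "c' 1 = c 1" using c by simp
  define X1 where "X1 = site_elem (eps 1) q (a 1 - 1) (b 1) d (i 1) (j 1) (c 1)"
  define X2 where "X2 = site_q (eps 1) powi a 1 * site_elem (eps 1) q (a 1) (b 1 - 1) (d + 1) (i 1) (j 1) (c 1)"
  have R1: "(\<Prod>k\<in>{1..n}-{1}. site_fac (a(1 := x)) b i j c k) = R" "(\<Prod>k\<in>{1..n}-{1}. site_fac a b (i(1 := x)) j c k) = R" for x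
    unfolding R_def by (rule prod.cong; auto simp: site_fac_def)+
  have R2: "(\<Prod>k\<in>{1..n}-{1}. site_fac a (b(1 := x)) i j c' k) = R" "(\<Prod>k\<in>{1..n}-{1}. site_fac a b i (j(1 := x)) c' k) = R" for x
    unfolding R_def by (rule prod.cong; auto simp: site_fac_def c)+
  have P1: "path_prod (a(1 := a 1 - 1)) b i j c = X1 * R" unfolding path_prod_split1[OF 1] R1 X1_def by (simp add: site_fac_def c)
  have P2: "site_q (eps 1) powi a 1 * path_prod a (b(1 := b 1 - 1)) i j c' = X2 * R" unfolding path_prod_split1[OF 1] R2 X2_def
    using c1 by (simp add: site_fac_def c mult_ac)
  have P3: "path_prod a b i (j(1 := j 1 + 1)) c' = (X1 - q powi (d + 2) * X2) * R" unfolding path_prod_split1[OF 1] R2 X1_def X2_def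
    unfolding site_X_e2[OF vt d, symmetric] using c1 by (simp add: site_fac_def c mult_ac)
  have P4: "site_q (eps 1) powi j 1 * path_prod a b (i(1 := i 1 + 1)) j c = (q powi d * X1 + (1 - q powi (2 * d + 2)) * X2) * R"
    unfolding path_prod_split1[OF 1] R1 X1_def X2_def
    unfolding site_X_e1[OF vt d, symmetric] using c1 by (simp add: site_fac_def c mult_ac)
  have "- inverse q * w d * (X1 * R) + w (d + 1) * (X2 * R)
    = - inverse q * w (d + 1) * ((X1 - q powi (d + 2) * X2) * R) + w d * ((q powi d * X1 + (1 - q powi (2 * d + 2)) * X2) * R)"
  proof (cases "d = -1")
    case True
    then have "X1 = 0" unfolding X1_def by (simp add: site_elem_neg)
    then show ?thesis using True w(2) by simp
  next
    case False
    then have "w (d + 1) = (1 + q * q powi d) * w d" using w(1) d by (simp add: pws)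
    then show ?thesis by (simp add: pwd power2_eq_square algebra_simps)
  qed
  then show ?thesis unfolding P1 P3 by (simp only: mult.assoc P2 P4)
qed

lemma left_f:
  assumes n: "n \<ge> 1" and v: "valid a" "valid b" "valid i" "valid j"
    and c: "c 0 = d" "c' 0 = d + 1" "\<And>k. k \<ge> 1 \<Longrightarrow> c' k = c k"
    and w: "d \<ge> 0 \<Longrightarrow> w (d + 1) = (1 + q powi (d + 1)) * w d" "w (-1) = 0"
  shows "w d * br (b 1 + 1) * path_prod a (b(1 := b 1 + 1)) i j c + w (d + 1) * site_q (eps 1) powi (- b 1) * br (a 1 + 1) * path_prod (a(1 := a 1 + 1)) b i j c'
    = w (d + 1) * br (i 1) * path_prod a b (i(1 := i 1 - 1)) j c' + w d * site_q (eps 1) powi (- i 1) * br (j 1) * path_prod a b i (j(1 := j 1 - 1)) c"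
proof (cases "d < -1")
  case True
  then show ?thesis using path_prod_neg[of 1] n c by simp
next
  case False
  have 1: "1 \<in> {1..n}" using n by simp
  define R where "R = (\<Prod>k\<in>{1..n}-{1}. site_fac a b i j c k)"
  have vt: "occ_ok (eps 1) (a 1)" "occ_ok (eps 1) (b 1)" "occ_ok (eps 1) (i 1)" "occ_ok (eps 1) (j 1)" using v 1 by (auto simp: validD)
  have d: "d \<ge> -1" using False by simp
  have c1: "c' 1 = c 1" using c by simp
  define Y1 where "Y1 = br (b 1 + 1) * site_elem (eps 1) q (a 1) (b 1 + 1) d (i 1) (j 1) (c 1)"
  define Y2 where "Y2 = site_q (eps 1) powi (- b 1) * br (a 1 + 1) * site_elem (eps 1) q (a 1 + 1) (b 1) (d + 1) (i 1) (j 1) (c 1)"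
  have R1: "(\<Prod>k\<in>{1..n}-{1}. site_fac a (b(1 := x)) i j c k) = R" "(\<Prod>k\<in>{1..n}-{1}. site_fac a b i (j(1 := x)) c k) = R" for x
    unfolding R_def by (rule prod.cong; auto simp: site_fac_def)+
  have R2: "(\<Prod>k\<in>{1..n}-{1}. site_fac (a(1 := x)) b i j c' k) = R" "(\<Prod>k\<in>{1..n}-{1}. site_fac a b (i(1 := x)) j c' k) = R" for x
    unfolding R_def by (rule prod.cong; auto simp: site_fac_def c)+
  have P1: "br (b 1 + 1) * path_prod a (b(1 := b 1 + 1)) i j c = Y1 * R" unfolding path_prod_split1[OF 1] R1 Y1_def by (simp add: site_fac_def c mult_ac)
  have P2: "site_q (eps 1) powi (- b 1) * (br (a 1 + 1) * path_prod (a(1 := a 1 + 1)) b i j c') = Y2 * R" unfolding path_prod_split1[OF 1] R2 Y2_def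
    using c1 by (simp add: site_fac_def c mult_ac)
  have P3: "br (i 1) * path_prod a b (i(1 := i 1 - 1)) j c' = (Y1 + q powi (d + 1) * Y2) * R" unfolding path_prod_split1[OF 1] R2 Y1_def Y2_def
    unfolding site_Y_f1[OF vt d, symmetric] using c1 by (simp add: site_fac_def c mult_ac)
  have P4: "site_q (eps 1) powi (- i 1) * (br (j 1) * path_prod a b i (j(1 := j 1 - 1)) c) = (- (q powi (1 + d)) * Y1 + (1 - q powi (2 * d + 2)) * Y2) * R"
    unfolding path_prod_split1[OF 1] R1 Y1_def Y2_def
    unfolding site_Y_f2[OF vt d, symmetric] using c1 by (simp add: site_fac_def c mult_ac)
  have "w d * (Y1 * R) + w (d + 1) * (Y2 * R)
    = w (d + 1) * ((Y1 + q powi (d + 1) * Y2) * R) + w d * ((- (q powi (1 + d)) * Y1 + (1 - q powi (2 * d + 2)) * Y2) * R)"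
  proof (cases "d = -1")
    case True
    then have "Y1 = 0" unfolding Y1_def by (simp add: site_elem_neg)
    then show ?thesis using True w(2) by simp
  next
    case False
    then have "w (d + 1) = (1 + q * q powi d) * w d" using w(1) d by (simp add: pws)
    then show ?thesis by (simp add: pwd power2_eq_square algebra_simps)
  qed
  then show ?thesis by (simp only: mult.assoc P1 P2 P3 P4)
qed

text \<open>
  At the right end the recursion of \<open>1/(q)_c\<close> plays the role of the missing site.
\<close>
lemma right_e:
  assumes n: "n \<ge> 1" and v: "valid a" "valid b" "valid i" "valid j"
    and c: "c n = d" "c' n = d + 1" "\<And>k. k < n \<Longrightarrow> c' k = c k"
    and w: "w d = (1 - q powi (d + 1)) * w (d + 1)"
  shows "w d * br (a n + 1) * path_prod (a(n := a n + 1)) b i j c - inverse q * w (d + 1) * site_q (eps n) powi (- a n) * br (b n + 1) * path_prod a (b(n := b n + 1)) i j c'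
    = w (d + 1) * br (j n) * path_prod a b i (j(n := j n - 1)) c' - inverse q * w d * site_q (eps n) powi (- j n) * br (i n) * path_prod a b (i(n := i n - 1)) j c"
proof (cases "d < -1")
  case True
  then show ?thesis using path_prod_neg[of n] n c by simp
next
  case False
  have 1: "n \<in> {1..n}" using n by simp
  define R where "R = (\<Prod>k\<in>{1..n}-{n}. site_fac a b i j c k)"
  have vt: "occ_ok (eps n) (a n)" "occ_ok (eps n) (b n)" "occ_ok (eps n) (i n)" "occ_ok (eps n) (j n)" using v 1 by (auto simp: validD)
  have d: "d \<ge> -1" using False by simp
  have c1: "c' (n - 1) = c (n - 1)" "c' (n - Suc 0) = c (n - Suc 0)" using c n by simp_all
  define Y3 where "Y3 = br (j n) * site_elem (eps n) q (a n) (b n) (c (n - 1)) (i n) (j n - 1) (d + 1)"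
  define Y4 where "Y4 = site_q (eps n) powi (- j n) * br (i n) * site_elem (eps n) q (a n) (b n) (c (n - 1)) (i n - 1) (j n) d"
  have R1: "(\<Prod>k\<in>{1..n}-{n}. site_fac (a(n := x)) b i j c k) = R" "(\<Prod>k\<in>{1..n}-{n}. site_fac a b (i(n := x)) j c k) = R" for x
    unfolding R_def by (rule prod.cong; auto simp: site_fac_def)+
  have R2: "(\<Prod>k\<in>{1..n}-{n}. site_fac a (b(n := x)) i j c' k) = R" "(\<Prod>k\<in>{1..n}-{n}. site_fac a b i (j(n := x)) c' k) = R" for x
    unfolding R_def by (rule prod.cong; auto simp: site_fac_def c)+
  have P2: "site_q (eps n) powi (- a n) * (br (b n + 1) * path_prod a (b(n := b n + 1)) i j c') = (- (q powi (d + 2)) * Y3 + (1 - q powi (2 * d + 2)) * Y4) * R"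
    unfolding path_prod_split1[OF 1] R2 Y3_def Y4_def
    unfolding site_Y_e2[OF vt d, symmetric] using c1 by (simp add: site_fac_def c mult_ac)
  have P3: "br (j n) * path_prod a b i (j(n := j n - 1)) c' = Y3 * R" unfolding path_prod_split1[OF 1] R2 Y3_def
    using c1 by (simp add: site_fac_def c mult_ac)
  have P4: "site_q (eps n) powi (- j n) * (br (i n) * path_prod a b (i(n := i n - 1)) j c) = Y4 * R"
    unfolding path_prod_split1[OF 1] R1 Y4_def using c1 by (simp add: site_fac_def c mult_ac)
  have P1: "w d * (br (a n + 1) * path_prod (a(n := a n + 1)) b i j c) = w d * ((Y3 + q powi d * Y4) * R)"
  proof (cases "d = -1")
    case True
    then show ?thesis using w by simp
  next
    case False
    then have d0: "d \<ge> 0" using d by simp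
    show ?thesis unfolding path_prod_split1[OF 1] R1 Y3_def Y4_def
      unfolding site_Y_e1[OF vt d0, symmetric] using c1 by (simp add: site_fac_def c mult_ac)
  qed
  have "w d * ((Y3 + q powi d * Y4) * R) - inverse q * (w (d + 1) * ((- (q powi (d + 2)) * Y3 + (1 - q powi (2 * d + 2)) * Y4) * R))
    = w (d + 1) * (Y3 * R) - inverse q * (w d * (Y4 * R))"
  proof -
    have wd: "w d = (1 - q * q powi d) * w (d + 1)" using w by (simp add: pws)
    show ?thesis unfolding wd by (simp add: pwd power2_eq_square algebra_simps)
  qed
  then show ?thesis by (simp only: mult.assoc P1 P2 P3 P4)
qed

lemma right_f:
  assumes n: "n \<ge> 1" and v: "valid a" "valid b" "valid i" "valid j"
    and c: "c n = d" "c' n = d + 1" "\<And>k. k < n \<Longrightarrow> c' k = c k"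
    and w: "w d = (1 - q powi (d + 1)) * w (d + 1)"
  shows "w d * path_prod a (b(n := b n - 1)) i j c + w (d + 1) * site_q (eps n) powi b n * path_prod (a(n := a n - 1)) b i j c'
    = w (d + 1) * path_prod a b (i(n := i n + 1)) j c' + w d * site_q (eps n) powi i n * path_prod a b i (j(n := j n + 1)) c"
proof (cases "d < -1")
  case True
  then show ?thesis using path_prod_neg[of n] n c by simp
next
  case False
  have 1: "n \<in> {1..n}" using n by simp
  define R where "R = (\<Prod>k\<in>{1..n}-{n}. site_fac a b i j c k)"
  have vt: "occ_ok (eps n) (a n)" "occ_ok (eps n) (b n)" "occ_ok (eps n) (i n)" "occ_ok (eps n) (j n)" using v 1 by (auto simp: validD)
  have d: "d \<ge> -1" using False by simp
  have c1: "c' (n - 1) = c (n - 1)" "c' (n - Suc 0) = c (n - Suc 0)" using c n by simp_all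
  define X3 where "X3 = site_elem (eps n) q (a n) (b n) (c (n - 1)) (i n + 1) (j n) (d + 1)"
  define X4 where "X4 = site_q (eps n) powi i n * site_elem (eps n) q (a n) (b n) (c (n - 1)) (i n) (j n + 1) d"
  have R1: "(\<Prod>k\<in>{1..n}-{n}. site_fac a (b(n := x)) i j c k) = R" "(\<Prod>k\<in>{1..n}-{n}. site_fac a b i (j(n := x)) c k) = R" for x
    unfolding R_def by (rule prod.cong; auto simp: site_fac_def)+
  have R2: "(\<Prod>k\<in>{1..n}-{n}. site_fac (a(n := x)) b i j c' k) = R" "(\<Prod>k\<in>{1..n}-{n}. site_fac a b (i(n := x)) j c' k) = R" for x
    unfolding R_def by (rule prod.cong; auto simp: site_fac_def c)+
  have P2: "site_q (eps n) powi b n * path_prod (a(n := a n - 1)) b i j c' = (q powi (d + 1) * X3 + (1 - q powi (2 * d + 2)) * X4) * R"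
    unfolding path_prod_split1[OF 1] R2 X3_def X4_def
    unfolding site_X_f2[OF vt d, symmetric] using c1 by (simp add: site_fac_def c mult_ac)
  have P3: "path_prod a b (i(n := i n + 1)) j c' = X3 * R" unfolding path_prod_split1[OF 1] R2 X3_def
    using c1 by (simp add: site_fac_def c mult_ac)
  have P4: "site_q (eps n) powi i n * path_prod a b i (j(n := j n + 1)) c = X4 * R"
    unfolding path_prod_split1[OF 1] R1 X4_def using c1 by (simp add: site_fac_def c mult_ac)
  have P1: "w d * path_prod a (b(n := b n - 1)) i j c = w d * ((X3 - q powi (1 + d) * X4) * R)"
  proof (cases "d = -1")
    case True
    then show ?thesis using w by simp
  next
    case False
    then have d0: "d \<ge> 0" using d by simp
    show ?thesis unfolding path_prod_split1[OF 1] R1 X3_def X4_def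
      unfolding site_X_f1[OF vt d0, symmetric] using c1 by (simp add: site_fac_def c mult_ac)
  qed
  have "w d * ((X3 - q powi (1 + d) * X4) * R) + w (d + 1) * ((q powi (d + 1) * X3 + (1 - q powi (2 * d + 2)) * X4) * R)
    = w (d + 1) * (X3 * R) + w d * (X4 * R)"
  proof -
    have wd: "w d = (1 - q * q powi d) * w (d + 1)" using w by (simp add: pws)
    show ?thesis unfolding wd by (simp add: pwd power2_eq_square algebra_simps)
  qed
  then show ?thesis by (simp only: mult.assoc P1 P2 P3 P4)
qed

end

section \<open>Intertwining relations for series in \<open>z\<close>\<close>

definition zpower_series :: "(int \<Rightarrow> 'a::zero) \<Rightarrow> 'a fls" where
  "zpower_series f = fps_to_fls (Abs_fps (\<lambda>m. f (int m)))"

lemma zpower_series_nth: "fls_nth (zpower_series f) k = (if 0 \<le> k then f k else 0)"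
  by (simp add: zpower_series_def)

lemma zpower_series_nth': "(\<And>k. k < 0 \<Longrightarrow> f k = 0) \<Longrightarrow> fls_nth (zpower_series f) k = f k"
  by (simp add: zpower_series_nth)

text \<open>
  The path determined by \<open>c_0\<close> and the conservation law \<open>b_k + c_(k-1) = j_k + c_k\<close>.
\<close>
definition carry :: "(nat \<Rightarrow> int) \<Rightarrow> (nat \<Rightarrow> int) \<Rightarrow> int \<Rightarrow> nat \<Rightarrow> int" where
  "carry b j c0 k = c0 + (\<Sum>t=1..k. b t - j t)"

lemma carry_0 [simp]: "carry b j c0 0 = c0" by (simp add: carry_def)

lemma carry_shift: "carry b j (c0 - e) k = carry b j c0 k - e" by (simp add: carry_def)

lemma sum_single_of_bool: "(\<Sum>x=1..k. of_bool (x = t)) = (of_bool (1 \<le> t \<and> t \<le> k) :: int)" for k t :: nat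
  by (simp add: of_bool_def sum.delta)

locale site_hops = site_chain +
  fixes p :: 'a
begin

text \<open>
  Sites outside \<open>{1..n}\<close> are reservoirs whose occupation is not recorded.  In this way the
  generators \<open>e_0, f_0, e_n, f_n\<close> of \<open>U_B\<close>, which create and annihilate particles, are hops like all
  others.
\<close>
definition ihop :: "nat \<Rightarrow> nat \<Rightarrow> (nat \<Rightarrow> int) \<Rightarrow> nat \<Rightarrow> int" where
  "ihop s t m k = m k + (if k \<in> {1..n} then of_bool (k = t) - of_bool (k = s) else 0)"

lemma ihop_in_in: "s \<in> {1..n} \<Longrightarrow> t \<in> {1..n} \<Longrightarrow> s \<noteq> t \<Longrightarrow> ihop s t m = m(s := m s - 1, t := m t + 1)"
  "s \<in> {1..n} \<Longrightarrow> t \<in> {1..n} \<Longrightarrow> s \<noteq> t \<Longrightarrow> ihop t s m = m(s := m s + 1, t := m t - 1)"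
  by (auto simp: ihop_def fun_eq_iff)

lemma ihop_out_in: "s \<notin> {1..n} \<Longrightarrow> t \<in> {1..n} \<Longrightarrow> ihop s t m = m(t := m t + 1)"
  "s \<notin> {1..n} \<Longrightarrow> t \<in> {1..n} \<Longrightarrow> ihop t s m = m(t := m t - 1)"
  by (auto simp: ihop_def fun_eq_iff)

lemma carry_ihop: "k \<le> n \<Longrightarrow> carry (ihop s t b) j c0 k = carry b j c0 k + of_bool (1 \<le> t \<and> t \<le> k) - of_bool (1 \<le> s \<and> s \<le> k)"
proof -
  assume k: "k \<le> n"
  have "(\<Sum>x=1..k. ihop s t b x - j x) = (\<Sum>x=1..k. (b x - j x) + of_bool (x = t) - of_bool (x = s))"
    by (rule sum.cong) (use k in \<open>auto simp: ihop_def\<close>)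
  then show ?thesis unfolding carry_def by (simp only: sum.distrib sum_subtractf sum_single_of_bool)
qed

lemma carry_move: "carry b (ihop s t j) = carry (ihop t s b) j"
  unfolding carry_def fun_eq_iff by (auto intro!: sum.cong simp: ihop_def)

definition total :: "(nat \<Rightarrow> int) \<Rightarrow> int" where "total m = (\<Sum>k=1..n. m k)"

lemma carry_n: "carry b j c0 n = c0 + total b - total j"
  by (simp add: carry_def total_def sum_subtractf)

lemma total_ihop: "total (ihop s t m) = total m + of_bool (t \<in> {1..n}) - of_bool (s \<in> {1..n})"
  using carry_ihop[of n s t m "\<lambda>_. 0" 0] by (simp add: carry_n total_def)

definition ihop_coeff :: "nat \<Rightarrow> (nat \<Rightarrow> int) \<Rightarrow> 'a" where
  "ihop_coeff s m = (if s \<in> {1..n} then br (m s) / (q - inverse q) else 1)"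

text \<open>
  Eigenvalue of \<open>k_r\<close> for the link from \<open>s\<close> to \<open>t\<close>; a reservoir contributes a power of \<open>p\<close>.
\<close>
definition icartan :: "nat \<Rightarrow> nat \<Rightarrow> (nat \<Rightarrow> int) \<Rightarrow> 'a" where
  "icartan s t m = (if s \<in> {1..n} then site_q (eps s) powi (- m s) else inverse p)
             * (if t \<in> {1..n} then site_q (eps t) powi m t else p)"

lemma path_prod_cong: "(\<And>k. k \<le> n \<Longrightarrow> c k = c' k) \<Longrightarrow> path_prod a b i j c = path_prod a b i j c'"
  unfolding path_prod_def site_fac_def by (rule prod.cong) auto

definition trace_series :: "(nat \<Rightarrow> int) \<Rightarrow> (nat \<Rightarrow> int) \<Rightarrow> (nat \<Rightarrow> int) \<Rightarrow> (nat \<Rightarrow> int) \<Rightarrow> 'a fls" where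
  "trace_series a b i j = zpower_series (\<lambda>d. path_prod a b i j (carry b j d))"

lemma trace_series_nth: "n \<ge> 1 \<Longrightarrow> fls_nth (trace_series a b i j) d = path_prod a b i j (carry b j d)"
  unfolding trace_series_def by (rule zpower_series_nth') (use path_prod_neg[of 1] in auto)

text \<open>
  The ratio \<open>x/y\<close> of the spectral parameters that \<open>e_r\<close> carries in the two factors: \<open>z\<close> for \<open>r = 0\<close>, and 1 otherwise.
\<close>
abbreviation spectral :: "nat \<Rightarrow> 'a fls" where "spectral r \<equiv> (if r = 0 then fls_X else 1)"

lemma spectral_nth: "fls_nth (spectral r * f) k = fls_nth f (k - of_bool (r = 0))"
  by (simp add: fls_X_times_conv_shift)

text \<open>
  A hop along the link \<open>r\<close> raises the path by one on this link only.  On the link 0 the two terms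
  of the coproduct differ by a factor \<open>z\<close>, which shifts \<open>c_0\<close> by one.
\<close>
lemma carry_step:
  assumes "k \<le> n"
  shows "carry (ihop t s b) j c0 k = carry b j (c0 - of_bool (r = 0)) k + of_bool (r = 0) + of_bool (1 \<le> s \<and> s \<le> k) - of_bool (1 \<le> t \<and> t \<le> k)"
  using carry_ihop[OF assms, of t s b j c0] by (simp add: carry_shift)

text \<open>
  Comparison of the coefficients of each power of \<open>z\<close> reduces the claim to \<open>two_site_e\<close>.  The assumption
  on the totals makes the path periodic.
\<close>
lemma trace_series_e:
  assumes n: "n \<ge> 2" and r: "r < n" "s = (if r = 0 then n else r)" "t = r + 1"
    and v: "valid a" "valid b" "valid i" "valid j" and bj: "total b = total j"
  shows "spectral r * (fls_const (ihop_coeff s (ihop t s a)) * trace_series (ihop t s a) b i j) + fls_const (icartan s t a * ihop_coeff s (ihop t s b)) * trace_series a (ihop t s b) i j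
    = fls_const (ihop_coeff s j) * trace_series a b i (ihop s t j) + spectral r * (fls_const (ihop_coeff s i * icartan s t j) * trace_series a b (ihop s t i) j)"
proof (rule fls_eqI)
  fix k
  define c c' where "c = carry b j (k - of_bool (r = 0))" and "c' = carry (ihop t s b) j k"
  have st: "s \<in> {1..n}" "t \<in> {1..n}" "s \<noteq> t" using n r by (auto split: if_splits)
  have c': "c' m = c m + of_bool (r = 0) + of_bool (1 \<le> s \<and> s \<le> m) - of_bool (1 \<le> t \<and> t \<le> m)" if "m \<le> n" for m
    unfolding c'_def c_def by (rule carry_step[OF that])
  have cl: "c n = c 0" unfolding c_def by (simp add: carry_n bj)
  have "br (a s + 1) * path_prod (a(s := a s + 1, t := a t - 1)) b i j c
     + site_q (eps s) powi (- a s) * site_q (eps t) powi a t * br (b s + 1) * path_prod a (b(s := b s + 1, t := b t - 1)) i j c'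
   = br (j s) * path_prod a b i (j(s := j s - 1, t := j t + 1)) c'
     + br (i s) * (site_q (eps s) powi (- j s) * site_q (eps t) powi j t) * path_prod a b (i(s := i s - 1, t := i t + 1)) j c"
  proof (rule two_site_e[OF st v, of c "c s"])
    show "c (t - 1) = c s" using r cl by auto
    show "c' s = c s + 1" using c'[of s] st r by (auto split: if_splits)
    show "c' (t - 1) = c s + 1" using c'[of "t - 1"] st r cl by (auto split: if_splits)
    show "c' m = c m" if "m \<in> {1..n} - {s}" for m using c'[of m] that st r by (auto split: if_splits)
    show "c' (m - 1) = c (m - 1)" if "m \<in> {1..n} - {t}" for m using c'[of "m - 1"] that st r by (auto split: if_splits)
  qed simp
  note E = arg_cong[OF this, of "\<lambda>x. x / (q - inverse q)"]
  have n1: "n \<ge> 1" using n by simp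
  show "fls_nth (spectral r * (fls_const (ihop_coeff s (ihop t s a)) * trace_series (ihop t s a) b i j) + fls_const (icartan s t a * ihop_coeff s (ihop t s b)) * trace_series a (ihop t s b) i j) k
    = fls_nth (fls_const (ihop_coeff s j) * trace_series a b i (ihop s t j) + spectral r * (fls_const (ihop_coeff s i * icartan s t j) * trace_series a b (ihop s t i) j)) k"
    using E st unfolding fls_plus_nth spectral_nth fls_mult_const_nth trace_series_nth[OF n1] carry_move c_def[symmetric] c'_def[symmetric]
    unfolding ihop_in_in[OF st] ihop_coeff_def icartan_def
    by (simp add: add_divide_distrib)
qed

lemma trace_series_f:
  assumes n: "n \<ge> 2" and r: "r < n" "s = (if r = 0 then n else r)" "t = r + 1"
    and v: "valid a" "valid b" "valid i" "valid j" and bj: "total b = total j"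
  shows "spectral r * (fls_const (ihop_coeff t (ihop s t b)) * trace_series a (ihop s t b) i j) + fls_const (ihop_coeff t (ihop s t a) * inverse (icartan s t b)) * trace_series (ihop s t a) b i j
    = fls_const (ihop_coeff t i) * trace_series a b (ihop t s i) j + spectral r * (fls_const (inverse (icartan s t i) * ihop_coeff t j) * trace_series a b i (ihop t s j))"
proof (rule fls_eqI)
  fix k
  define c c' where "c = carry (ihop s t b) j (k - of_bool (r = 0))" and "c' = carry b j k"
  have st: "s \<in> {1..n}" "t \<in> {1..n}" "s \<noteq> t" using n r by (auto split: if_splits)
  have c': "c' m = c m + of_bool (r = 0) + of_bool (1 \<le> s \<and> s \<le> m) - of_bool (1 \<le> t \<and> t \<le> m)" if "m \<le> n" for m
    unfolding c'_def c_def carry_ihop[OF that] by (simp add: carry_shift)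
  have cl: "c n = c 0" unfolding c_def using st by (simp add: carry_n bj total_ihop)
  have "br (b t + 1) * path_prod a (b(s := b s - 1, t := b t + 1)) i j c
     + site_q (eps s) powi b s * site_q (eps t) powi (- b t) * br (a t + 1) * path_prod (a(s := a s - 1, t := a t + 1)) b i j c'
   = br (i t) * path_prod a b (i(s := i s + 1, t := i t - 1)) j c'
     + br (j t) * (site_q (eps s) powi i s * site_q (eps t) powi (- i t)) * path_prod a b i (j(s := j s + 1, t := j t - 1)) c"
  proof (rule two_site_f[OF st v, of c "c s"])
    show "c (t - 1) = c s" using r cl by auto
    show "c' s = c s + 1" using c'[of s] st r by (auto split: if_splits)
    show "c' (t - 1) = c s + 1" using c'[of "t - 1"] st r cl by (auto split: if_splits)
    show "c' m = c m" if "m \<in> {1..n} - {s}" for m using c'[of m] that st r by (auto split: if_splits)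
    show "c' (m - 1) = c (m - 1)" if "m \<in> {1..n} - {t}" for m using c'[of "m - 1"] that st r by (auto split: if_splits)
  qed simp
  note E = arg_cong[OF this, of "\<lambda>x. x / (q - inverse q)"]
  have n1: "n \<ge> 1" using n by simp
  show "fls_nth (spectral r * (fls_const (ihop_coeff t (ihop s t b)) * trace_series a (ihop s t b) i j) + fls_const (ihop_coeff t (ihop s t a) * inverse (icartan s t b)) * trace_series (ihop s t a) b i j) k
    = fls_nth (fls_const (ihop_coeff t i) * trace_series a b (ihop t s i) j + spectral r * (fls_const (inverse (icartan s t i) * ihop_coeff t j) * trace_series a b i (ihop t s j))) k"
    using E st unfolding fls_plus_nth spectral_nth fls_mult_const_nth trace_series_nth[OF n1] carry_move c_def[symmetric] c'_def[symmetric]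
    unfolding ihop_in_in[OF st] ihop_coeff_def icartan_def
    by (simp add: add_divide_distrib power_int_minus mult_ac)
qed

end

text \<open>
  The weights \<open>w0\<close> and \<open>w1\<close> stand for \<open>(-q)_c\<close> and \<open>1/(q)_c\<close>, extended by zero to negative \<open>c\<close>.
\<close>
locale site_hops_B = site_hops +
  fixes w0 w1 :: "int \<Rightarrow> 'a"
  assumes p_sq: "p\<^sup>2 = - inverse q" and n1: "n \<ge> 1"
    and w0_neg: "d < 0 \<Longrightarrow> w0 d = 0"
    and w0_step: "d \<ge> 0 \<Longrightarrow> w0 (d + 1) = (1 + q powi (d + 1)) * w0 d"
    and w1_step: "w1 d = (1 - q powi (d + 1)) * w1 (d + 1)"
begin

lemma p_nz [simp]: "p \<noteq> 0" using p_sq by auto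

lemma p_inv: "inverse p = - (q * p)"
proof -
  have "p * (- (q * p)) = - (q * p\<^sup>2)" by (simp add: power2_eq_square mult_ac)
  also have "\<dots> = 1" unfolding p_sq by simp
  finally have "p * (- (q * p)) = 1" .
  then show ?thesis by (metis inverse_unique)
qed

text \<open>
  The factor \<open>p^(|j| - |a|)\<close> is the effect of the operators \<open>K\<close>: this is the matrix element of
  \<open>R = (K \<otimes> 1) S (1 \<otimes> K^(-1))\<close>.
\<close>
definition boundary_series :: "(nat \<Rightarrow> int) \<Rightarrow> (nat \<Rightarrow> int) \<Rightarrow> (nat \<Rightarrow> int) \<Rightarrow> (nat \<Rightarrow> int) \<Rightarrow> 'a fls" where
  "boundary_series a b i j = fls_const (p powi (total j - total a)) * zpower_series (\<lambda>d. w0 d * w1 (carry b j d n) * path_prod a b i j (carry b j d))"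

lemma boundary_series_nth: "fls_nth (boundary_series a b i j) d = p powi (total j - total a) * (w0 d * w1 (carry b j d n) * path_prod a b i j (carry b j d))"
  unfolding boundary_series_def fls_mult_const_nth by (subst zpower_series_nth') (use w0_neg in auto)

text \<open>
  The link \<open>r\<close> is the left end for \<open>r = 0\<close>, the right end for \<open>r = n\<close>, and a link between two
  sites otherwise.
\<close>
lemma boundary_series_e:
  assumes r: "s = r" "t = r + 1" "r \<le> n" and v: "valid a" "valid b" "valid i" "valid j"
  shows "spectral r * (fls_const (ihop_coeff s (ihop t s a)) * boundary_series (ihop t s a) b i j) + fls_const (icartan s t a * ihop_coeff s (ihop t s b)) * boundary_series a (ihop t s b) i j
    = fls_const (ihop_coeff s j) * boundary_series a b i (ihop s t j) + spectral r * (fls_const (ihop_coeff s i * icartan s t j) * boundary_series a b (ihop s t i) j)"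
proof (rule fls_eqI)
  fix k
  define c c' where "c = carry b j (k - of_bool (r = 0))" and "c' = carry (ihop t s b) j k"
  have c': "c' m = c m + of_bool (r = 0) + of_bool (1 \<le> s \<and> s \<le> m) - of_bool (1 \<le> t \<and> t \<le> m)" if "m \<le> n" for m
    unfolding c'_def c_def by (rule carry_step[OF that])
  have "ihop_coeff s (ihop t s a) * (p powi (total j - total (ihop t s a)) * (w0 (k - of_bool (r = 0)) * w1 (c n) * path_prod (ihop t s a) b i j c))
     + icartan s t a * ihop_coeff s (ihop t s b) * (p powi (total j - total a) * (w0 k * w1 (c' n) * path_prod a (ihop t s b) i j c'))
    = ihop_coeff s j * (p powi (total (ihop s t j) - total a) * (w0 k * w1 (c' n) * path_prod a b i (ihop s t j) c'))
     + ihop_coeff s i * icartan s t j * (p powi (total j - total a) * (w0 (k - of_bool (r = 0)) * w1 (c n) * path_prod a b (ihop s t i) j c))"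
  proof -
    define P where "P = p powi (total j - total a)"
    consider (left) "r = 0" | (right) "r = n" "r > 0" | (inner) "0 < r" "r < n" using r by linarith
    then show ?thesis
    proof cases
      case inner
      have st: "s \<in> {1..n}" "t \<in> {1..n}" "s \<noteq> t" using inner r by auto
      have "br (a s + 1) * path_prod (a(s := a s + 1, t := a t - 1)) b i j c
         + site_q (eps s) powi (- a s) * site_q (eps t) powi a t * br (b s + 1) * path_prod a (b(s := b s + 1, t := b t - 1)) i j c'
       = br (j s) * path_prod a b i (j(s := j s - 1, t := j t + 1)) c'
         + br (i s) * (site_q (eps s) powi (- j s) * site_q (eps t) powi j t) * path_prod a b (i(s := i s - 1, t := i t + 1)) j c"
      proof (rule two_site_e[OF st v, of c "c s"])
        show "c (t - 1) = c s" using r by auto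
        show "c' s = c s + 1" using c'[of s] st r inner by (auto split: if_splits)
        show "c' (t - 1) = c s + 1" using c'[of "t - 1"] st r inner by (auto split: if_splits)
        show "c' m = c m" if "m \<in> {1..n} - {s}" for m using c'[of m] that st r inner by (auto split: if_splits)
        show "c' (m - 1) = c (m - 1)" if "m \<in> {1..n} - {t}" for m using c'[of "m - 1"] that st r inner by (auto split: if_splits)
      qed simp
      note E = arg_cong[OF this, of "\<lambda>x. P * (w0 k * w1 (c n)) * (x / (q - inverse q))"]
      have c'n: "c' n = c n" using c'[of n] inner r by auto
      have ls: "total (ihop t s a) = total a" "total (ihop s t j) = total j" using st by (simp_all add: total_ihop)
      have r0: "k - of_bool (r = 0) = k" using inner by simp
      have alg: "B1 / K * (P * (w * v * X1)) + K1 * (B2 / K) * (P * (w * v * X2)) = B3 / K * (P * (w * v * X3)) + B4 / K * K2 * (P * (w * v * X4))"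
        if "P * (w * v) * ((B1 * X1 + K1 * B2 * X2) / K) = P * (w * v) * ((B3 * X3 + B4 * K2 * X4) / K)" for B1 K P w v X1 K1 B2 X2 B3 X3 B4 K2 X4 :: 'a
        using that by (simp add: add_divide_distrib distrib_left mult_ac)
      show ?thesis unfolding ls c'n r0 P_def[symmetric] unfolding ihop_in_in[OF st]
        using alg[OF E] st by (simp add: ihop_coeff_def icartan_def)
    next
      case left
      have s: "s \<notin> {1..n}" and t: "t \<in> {1..n}" "t = 1" using left r n1 by auto
      have c'1: "c' m = c m" if "1 \<le> m" "m \<le> n" for m using c'[of m] left r that by auto
      define cc where "cc = c(0 := k)"
      have c'_0: "c' 0 = k" by (simp add: c'_def)
      have cc: "path_prod A B I J c' = path_prod A B I J cc" for A B I J
        by (rule path_prod_cong) (simp add: cc_def c'_0 c'1)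
      have L: "- inverse q * w0 (k - 1) * path_prod (a(1 := a 1 - 1)) b i j c + w0 (k - 1 + 1) * site_q (eps 1) powi a 1 * path_prod a (b(1 := b 1 - 1)) i j cc
        = - inverse q * w0 (k - 1 + 1) * path_prod a b i (j(1 := j 1 + 1)) cc + w0 (k - 1) * site_q (eps 1) powi j 1 * path_prod a b (i(1 := i 1 + 1)) j c"
        by (rule left_e[OF n1 v]) (use w0_step[of "k - 1"] w0_neg left in \<open>auto simp: cc_def c_def\<close>)
      note E = arg_cong[OF L, of "\<lambda>x. P * inverse p * w1 (c n) * x"]
      have c'n: "c' n = c n" using c'1 n1 by auto
      have ls: "total (ihop t s a) = total a - 1" "total (ihop s t j) = total j + 1" using s t by (simp_all add: total_ihop)
      have pw: "p powi (total j - (total a - 1)) = P * p" "p powi (total j + 1 - total a) = P * p"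
        unfolding P_def by (simp_all add: power_int_add power_int_diff field_simps)
      have pq: "inverse p * inverse q = - p" using p_inv by simp
      have alg: "P * p * (w * v * X1) + ip * K1 * (P * (w' * v * X2)) = P * p * (w' * v * X3) + ip * K2 * (P * (w * v * X4))"
        if "P * ip * v * (- iq * w * X1 + w' * K1 * X2) = P * ip * v * (- iq * w' * X3 + w * K2 * X4)" "ip * iq = - p"
        for P w v X1 ip K1 w' X2 X3 K2 X4 iq
        using that by algebra
      show ?thesis unfolding ls c'n pw P_def[symmetric] cc unfolding ihop_out_in[OF s t(1)]
        unfolding ihop_coeff_def icartan_def if_not_P[OF s] if_P[OF t(1)] unfolding t(2)
        using alg[OF E pq] left by (simp add: power_int_minus)
    next
      case right
      have s: "s \<in> {1..n}" "s = n" and t: "t \<notin> {1..n}" using right r n1 by auto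
      have c'1: "c' m = c m" if "m < n" for m using c'[of m] right r that by auto
      have c'n: "c' n = c n + 1" using c'[of n] right r by auto
      define cc where "cc = (\<lambda>m. if m < n then c m else c' m)"
      have cc: "path_prod A B I J c' = path_prod A B I J cc" for A B I J
        by (rule path_prod_cong) (simp add: cc_def c'1)
      have L: "w1 (c n) * br (a n + 1) * path_prod (a(n := a n + 1)) b i j c - inverse q * w1 (c n + 1) * site_q (eps n) powi (- a n) * br (b n + 1) * path_prod a (b(n := b n + 1)) i j cc
        = w1 (c n + 1) * br (j n) * path_prod a b i (j(n := j n - 1)) cc - inverse q * w1 (c n) * site_q (eps n) powi (- j n) * br (i n) * path_prod a b (i(n := i n - 1)) j c"
      proof (rule right_e[OF n1 v])
        show "w1 (c n) = (1 - q powi (c n + 1)) * w1 (c n + 1)" by (rule w1_step)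
      qed (simp_all add: cc_def c'n)
      note E = arg_cong[OF L, of "\<lambda>x. P * inverse p * w0 k * (x / (q - inverse q))"]
      have ls: "total (ihop t s a) = total a + 1" "total (ihop s t j) = total j - 1" using s t by (simp_all add: total_ihop)
      have pw: "p powi (total j - (total a + 1)) = P * inverse p" "p powi (total j - 1 - total a) = P * inverse p"
        unfolding P_def by (simp_all add: power_int_add power_int_diff field_simps)
      have pq: "inverse p * inverse q = - p" using p_inv by simp
      have r0: "k - of_bool (r = 0) = k" using right by simp
      have alg: "B1 / K * (P * ip * (w * v * X1)) + K1 * p * (B2 / K) * (P * (w * v' * X2)) = B3 / K * (P * ip * (w * v' * X3)) + B4 / K * (K2 * p) * (P * (w * v * X4))"
        if "P * ip * w * ((v * B1 * X1 - iq * v' * K1 * B2 * X2) / K) = P * ip * w * ((v' * B3 * X3 - iq * v * K2 * B4 * X4) / K)" "ip * iq = - p"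
        for P w v v' X1 ip K1 X2 X3 K2 X4 iq B1 B2 B3 B4 K
      proof -
        have "P * w * (ip * v * B1 * X1 - (ip * iq) * v' * K1 * B2 * X2) * inverse K = P * w * (ip * v' * B3 * X3 - (ip * iq) * v * K2 * B4 * X4) * inverse K"
          using that(1) unfolding divide_inverse by algebra
        then show ?thesis unfolding that(2) divide_inverse by algebra
      qed
      have h: "ihop t s a = a(n := a n + 1)" "ihop t s b = b(n := b n + 1)" "ihop s t j = j(n := j n - 1)" "ihop s t i = i(n := i n - 1)"
        using ihop_out_in[of t s] s t by auto
      show ?thesis unfolding ls c'n pw r0 P_def[symmetric] cc unfolding h
        unfolding ihop_coeff_def icartan_def if_not_P[OF t] if_P[OF s(1)] unfolding s(2)
        using alg[OF E pq] by simp
    qed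
  qed
  then show "fls_nth (spectral r * (fls_const (ihop_coeff s (ihop t s a)) * boundary_series (ihop t s a) b i j) + fls_const (icartan s t a * ihop_coeff s (ihop t s b)) * boundary_series a (ihop t s b) i j) k
    = fls_nth (fls_const (ihop_coeff s j) * boundary_series a b i (ihop s t j) + spectral r * (fls_const (ihop_coeff s i * icartan s t j) * boundary_series a b (ihop s t i) j)) k"
    unfolding fls_plus_nth spectral_nth fls_mult_const_nth boundary_series_nth carry_move c_def[symmetric] c'_def[symmetric] .
qed

lemma boundary_series_f:
  assumes r: "s = r" "t = r + 1" "r \<le> n" and v: "valid a" "valid b" "valid i" "valid j"
  shows "spectral r * (fls_const (ihop_coeff t (ihop s t b)) * boundary_series a (ihop s t b) i j) + fls_const (ihop_coeff t (ihop s t a) * inverse (icartan s t b)) * boundary_series (ihop s t a) b i j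
    = fls_const (ihop_coeff t i) * boundary_series a b (ihop t s i) j + spectral r * (fls_const (inverse (icartan s t i) * ihop_coeff t j) * boundary_series a b i (ihop t s j))"
proof (rule fls_eqI)
  fix k
  define c c' where "c = carry (ihop s t b) j (k - of_bool (r = 0))" and "c' = carry b j k"
  have c': "c' m = c m + of_bool (r = 0) + of_bool (1 \<le> s \<and> s \<le> m) - of_bool (1 \<le> t \<and> t \<le> m)" if "m \<le> n" for m
    unfolding c'_def c_def carry_ihop[OF that] by (simp add: carry_shift)
  have "ihop_coeff t (ihop s t b) * (p powi (total j - total a) * (w0 (k - of_bool (r = 0)) * w1 (c n) * path_prod a (ihop s t b) i j c))
     + ihop_coeff t (ihop s t a) * inverse (icartan s t b) * (p powi (total j - total (ihop s t a)) * (w0 k * w1 (c' n) * path_prod (ihop s t a) b i j c'))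
    = ihop_coeff t i * (p powi (total j - total a) * (w0 k * w1 (c' n) * path_prod a b (ihop t s i) j c'))
     + inverse (icartan s t i) * ihop_coeff t j * (p powi (total (ihop t s j) - total a) * (w0 (k - of_bool (r = 0)) * w1 (c n) * path_prod a b i (ihop t s j) c))"
  proof -
    define P where "P = p powi (total j - total a)"
    consider (left) "r = 0" | (right) "r = n" "r > 0" | (inner) "0 < r" "r < n" using r by linarith
    then show ?thesis
    proof cases
      case inner
      have st: "s \<in> {1..n}" "t \<in> {1..n}" "s \<noteq> t" using inner r by auto
      have "br (b t + 1) * path_prod a (b(s := b s - 1, t := b t + 1)) i j c
         + site_q (eps s) powi b s * site_q (eps t) powi (- b t) * br (a t + 1) * path_prod (a(s := a s - 1, t := a t + 1)) b i j c'
       = br (i t) * path_prod a b (i(s := i s + 1, t := i t - 1)) j c'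
         + br (j t) * (site_q (eps s) powi i s * site_q (eps t) powi (- i t)) * path_prod a b i (j(s := j s + 1, t := j t - 1)) c"
      proof (rule two_site_f[OF st v, of c "c s"])
        show "c (t - 1) = c s" using r by auto
        show "c' s = c s + 1" using c'[of s] st r inner by (auto split: if_splits)
        show "c' (t - 1) = c s + 1" using c'[of "t - 1"] st r inner by (auto split: if_splits)
        show "c' m = c m" if "m \<in> {1..n} - {s}" for m using c'[of m] that st r inner by (auto split: if_splits)
        show "c' (m - 1) = c (m - 1)" if "m \<in> {1..n} - {t}" for m using c'[of "m - 1"] that st r inner by (auto split: if_splits)
      qed simp
      note E = arg_cong[OF this, of "\<lambda>x. P * (w0 k * w1 (c n)) * (x / (q - inverse q))"]
      have c'n: "c' n = c n" using c'[of n] inner r by auto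
      have ls: "total (ihop s t a) = total a" "total (ihop t s j) = total j" using st by (simp_all add: total_ihop)
      have r0: "k - of_bool (r = 0) = k" using inner by simp
      have alg: "B1 / K * (P * (w * v * X1)) + B2 / K * K1 * (P * (w * v * X2)) = B3 / K * (P * (w * v * X3)) + K2 * (B4 / K) * (P * (w * v * X4))"
        if "P * (w * v) * ((B1 * X1 + K1 * B2 * X2) / K) = P * (w * v) * ((B3 * X3 + B4 * K2 * X4) / K)" for B1 K P w v X1 K1 B2 X2 B3 X3 B4 K2 X4 :: 'a
        using that by (simp add: add_divide_distrib distrib_left mult_ac)
      show ?thesis unfolding ls c'n r0 P_def[symmetric] unfolding ihop_in_in[OF st]
        using alg[OF E] st by (simp add: ihop_coeff_def icartan_def power_int_minus)
    next
      case left
      have s: "s \<notin> {1..n}" and t: "t \<in> {1..n}" "t = 1" using left r n1 by auto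
      have c'1: "c' m = c m" if "1 \<le> m" "m \<le> n" for m using c'[of m] left r that by auto
      define cc where "cc = c(0 := k)"
      have c'_0: "c' 0 = k" by (simp add: c'_def)
      have cc: "path_prod A B I J c' = path_prod A B I J cc" for A B I J
        by (rule path_prod_cong) (simp add: cc_def c'_0 c'1)
      have L: "w0 (k - 1) * br (b 1 + 1) * path_prod a (b(1 := b 1 + 1)) i j c + w0 (k - 1 + 1) * site_q (eps 1) powi (- b 1) * br (a 1 + 1) * path_prod (a(1 := a 1 + 1)) b i j cc
        = w0 (k - 1 + 1) * br (i 1) * path_prod a b (i(1 := i 1 - 1)) j cc + w0 (k - 1) * site_q (eps 1) powi (- i 1) * br (j 1) * path_prod a b i (j(1 := j 1 - 1)) c"
        by (rule left_f[OF n1 v]) (use w0_step[of "k - 1"] w0_neg left in \<open>auto simp: cc_def c_def\<close>)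
      note E = arg_cong[OF L, of "\<lambda>x. P * w1 (c n) * (x / (q - inverse q))"]
      have c'n: "c' n = c n" using c'1 n1 by auto
      have ls: "total (ihop s t a) = total a + 1" "total (ihop t s j) = total j - 1" using s t by (simp_all add: total_ihop)
      have pw: "p powi (total j - (total a + 1)) = P * inverse p" "p powi (total j - 1 - total a) = P * inverse p"
        unfolding P_def by (simp_all add: power_int_add power_int_diff field_simps)
      have alg: "B1 / K * (P * (w * v * X1)) + B2 / K * (p * K1) * (P * inverse p * (w' * v * X2)) = B3 / K * (P * (w' * v * X3)) + p * K2 * (B4 / K) * (P * inverse p * (w * v * X4))"
        if "P * v * ((w * B1 * X1 + w' * K1 * B2 * X2) / K) = P * v * ((w' * B3 * X3 + w * K2 * B4 * X4) / K)" for B1 K P w v X1 K1 B2 X2 B3 X3 B4 K2 X4 w'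
        using that by (simp add: add_divide_distrib distrib_left mult_ac)
      show ?thesis unfolding ls c'n pw P_def[symmetric] cc unfolding ihop_out_in[OF s t(1)]
        unfolding ihop_coeff_def icartan_def if_not_P[OF s] if_P[OF t(1)] unfolding t(2)
        using alg[OF E] left by (simp add: power_int_minus)
    next
      case right
      have s: "s \<in> {1..n}" "s = n" and t: "t \<notin> {1..n}" using right r n1 by auto
      have c'1: "c' m = c m" if "m < n" for m using c'[of m] right r that by auto
      have c'n: "c' n = c n + 1" using c'[of n] right r by auto
      define cc where "cc = (\<lambda>m. if m < n then c m else c' m)"
      have cc: "path_prod A B I J c' = path_prod A B I J cc" for A B I J
        by (rule path_prod_cong) (simp add: cc_def c'1)
      have L: "w1 (c n) * path_prod a (b(n := b n - 1)) i j c + w1 (c n + 1) * site_q (eps n) powi b n * path_prod (a(n := a n - 1)) b i j cc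
        = w1 (c n + 1) * path_prod a b (i(n := i n + 1)) j cc + w1 (c n) * site_q (eps n) powi i n * path_prod a b i (j(n := j n + 1)) c"
      proof (rule right_f[OF n1 v])
        show "w1 (c n) = (1 - q powi (c n + 1)) * w1 (c n + 1)" by (rule w1_step)
      qed (simp_all add: cc_def c'n)
      note E = arg_cong[OF L, of "\<lambda>x. P * w0 k * x"]
      have ls: "total (ihop s t a) = total a - 1" "total (ihop t s j) = total j + 1" using s t by (simp_all add: total_ihop)
      have pw: "p powi (total j - (total a - 1)) = P * p" "p powi (total j + 1 - total a) = P * p"
        unfolding P_def by (simp_all add: power_int_add power_int_diff field_simps)
      have r0: "k - of_bool (r = 0) = k" using right by simp
      have alg: "P * (w * v * X1) + K1 * inverse p * (P * p * (w * v' * X2)) = P * (w * v' * X3) + K2 * inverse p * (P * p * (w * v * X4))"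
        if "P * w * (v * X1 + v' * K1 * X2) = P * w * (v' * X3 + v * K2 * X4)" for P w v v' X1 K1 X2 X3 K2 X4
      proof -
        have x: "K * inverse p * (P * p * y) = P * (K * y)" for K y by simp
        show ?thesis unfolding x using that by (simp add: distrib_left mult_ac)
      qed
      have h: "ihop s t a = a(n := a n - 1)" "ihop s t b = b(n := b n - 1)" "ihop t s j = j(n := j n + 1)" "ihop t s i = i(n := i n + 1)"
        using ihop_out_in[of t s] s t by auto
      show ?thesis unfolding ls c'n pw r0 P_def[symmetric] cc unfolding h
        unfolding ihop_coeff_def icartan_def if_not_P[OF t] if_P[OF s(1)] unfolding s(2)
        using alg[OF E] by (simp add: power_int_minus)
    qed
  qed
  then show "fls_nth (spectral r * (fls_const (ihop_coeff t (ihop s t b)) * boundary_series a (ihop s t b) i j) + fls_const (ihop_coeff t (ihop s t a) * inverse (icartan s t b)) * boundary_series (ihop s t a) b i j) k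
    = fls_nth (fls_const (ihop_coeff t i) * boundary_series a b (ihop t s i) j + spectral r * (fls_const (inverse (icartan s t i) * ihop_coeff t j) * boundary_series a b i (ihop t s j))) k"
    unfolding fls_plus_nth spectral_nth fls_mult_const_nth boundary_series_nth carry_move c_def[symmetric] c'_def[symmetric] .
qed

end

section \<open>The substitution \<open>z \<rightarrow> qz\<close> and normalization\<close>

context generic_q begin

text \<open>The substitution \<open>z \<rightarrow> q z\<close>.\<close>
definition shq :: "'a fps \<Rightarrow> 'a fps" where "shq f = Abs_fps (\<lambda>m. q ^ m * fps_nth f m)"

lemma shq_nth [simp]: "fps_nth (shq f) m = q ^ m * fps_nth f m" by (simp add: shq_def)

lemma shq_diff: "shq (f - g) = shq f - shq g" by (simp add: fps_eq_iff algebra_simps)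

lemma shq_mult: "shq (f * g) = shq f * shq g"
proof (rule fps_ext)
  fix m
  have "q ^ m * (\<Sum>i=0..m. fps_nth f i * fps_nth g (m - i)) = (\<Sum>i=0..m. (q ^ i * fps_nth f i) * (q ^ (m - i) * fps_nth g (m - i)))"
    unfolding sum_distrib_left
  proof (rule sum.cong)
    fix i assume "i \<in> {0..m}"
    then have "q ^ m = q ^ i * q ^ (m - i)" by (simp flip: power_add)
    then show "q ^ m * (fps_nth f i * fps_nth g (m - i)) = q ^ i * fps_nth f i * (q ^ (m - i) * fps_nth g (m - i))" by simp
  qed simp
  then show "fps_nth (shq (f * g)) m = fps_nth (shq f * shq g) m" by (simp add: fps_mult_nth)
qed

lemma shq_const [simp]: "shq (fps_const c) = fps_const c" by (auto simp: fps_eq_iff)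
lemma shq_1 [simp]: "shq 1 = 1" by (auto simp: fps_eq_iff)
lemma shq_X [simp]: "shq fps_X = fps_const q * fps_X" by (auto simp: fps_eq_iff fps_X_def)

text \<open>
  The factors \<open>1 - c z\<close> and \<open>z - c\<close> of the normalization for \<open>S^tr\<close>.
\<close>
definition lin_factor :: "'a \<Rightarrow> 'a fps" where "lin_factor c = 1 - fps_const c * fps_X"
definition rev_factor :: "'a \<Rightarrow> 'a fps" where "rev_factor c = fps_X - fps_const c"

lemma lin_factor_nth: "fps_nth (lin_factor c * f) m = fps_nth f m - (if m = 0 then 0 else c * fps_nth f (m - 1))"
  by (simp add: lin_factor_def left_diff_distrib mult.assoc)

lemma rev_factor_nz: "rev_factor c \<noteq> 0"
proof
  assume "rev_factor c = 0"
  then have "fps_nth (rev_factor c) 1 = 0" by simp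
  then show False by (simp add: rev_factor_def fps_X_def)
qed

lemma shq_lin_factor: "shq (lin_factor c) = lin_factor (c * q)"
  by (simp add: lin_factor_def shq_diff shq_mult mult.assoc[symmetric])

lemma shq_rev_factor: "shq (rev_factor c) = fps_const q * rev_factor (c / q)"
  by (simp add: rev_factor_def shq_diff right_diff_distrib)

definition DP :: "'a \<Rightarrow> nat \<Rightarrow> 'a fps" where "DP A m = (\<Prod>t=1..m. lin_factor (A * q ^ (2 * t)))"
definition NP :: "'a \<Rightarrow> nat \<Rightarrow> 'a fps" where "NP A m = (\<Prod>t=1..m. rev_factor (A * q ^ (2 * t)))"

lemma DP_0 [simp]: "DP A 0 = 1" and NP_0 [simp]: "NP A 0 = 1" by (simp_all add: DP_def NP_def)
lemma DP_Suc: "DP A (Suc m) = DP A m * lin_factor (A * q ^ (2 * Suc m))"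
  and NP_Suc: "NP A (Suc m) = NP A m * rev_factor (A * q ^ (2 * Suc m))" by (simp_all add: DP_def NP_def)

lemma NP_nz: "NP A m \<noteq> 0" by (simp add: NP_def rev_factor_nz)

lemma NP_shift: "NP A (Suc m) = rev_factor (A * q\<^sup>2) * NP (A * q\<^sup>2) m"
proof (induction m)
  case 0
  show ?case by (simp add: NP_Suc power2_eq_square)
next
  case (Suc m)
  have "A * q\<^sup>2 * q ^ (2 * Suc m) = A * q ^ (2 * Suc (Suc m))" by (simp add: power2_eq_square mult_ac)
  then show ?case unfolding NP_Suc[of A "Suc m"] Suc.IH NP_Suc[of "A * q\<^sup>2"] by (simp only: mult.assoc)
qed

lemma DP_shift: "DP A (Suc m) = lin_factor (A * q\<^sup>2) * DP (A * q\<^sup>2) m"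
proof (induction m)
  case 0
  show ?case by (simp add: DP_Suc power2_eq_square)
next
  case (Suc m)
  have "A * q\<^sup>2 * q ^ (2 * Suc m) = A * q ^ (2 * Suc (Suc m))" by (simp add: power2_eq_square mult_ac)
  then show ?case unfolding DP_Suc[of A "Suc m"] Suc.IH DP_Suc[of "A * q\<^sup>2"] by (simp only: mult.assoc)
qed

lemma shq_DP: "shq (DP A m) = DP (A * q) m"
  by (induction m) (simp_all add: DP_Suc shq_mult shq_lin_factor mult_ac)

lemma shq_NP: "shq (NP A m) = fps_const (q ^ m) * NP (A / q) m"
proof (induction m)
  case (Suc m)
  have "fps_const (q ^ Suc m) = fps_const q * fps_const (q ^ m)" by (simp del: fps_const_power add: fps_const_mult)
  then show ?case by (simp only: NP_Suc shq_mult shq_rev_factor Suc.IH) (simp add: mult_ac)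
qed simp

definition diag_series :: "nat \<Rightarrow> nat \<Rightarrow> 'a fps" where
  "diag_series l m = Abs_fps (\<lambda>c. S (int l) (int m) (int c) (int l) (int m) (int c))"

text \<open>
  The recursions \<open>S0_up_i\<close> and \<open>S0_up_j\<close> in the diagonal case; a power \<open>q^c\<close> in a coefficient becomes the
  substitution \<open>z \<rightarrow> q z\<close>.
\<close>
lemma diag_series_rec: "diag_series (Suc l) (Suc m) = fps_X * (diag_series l m + fps_const (q ^ Suc l) * shq (diag_series l (Suc m))) - fps_const (q ^ (l + 2)) * shq (diag_series (Suc l) m)"
proof (rule fps_ext)
  fix c
  have up: "S (int (Suc l)) (int (Suc m)) (int c) (int (Suc l)) (int (Suc m)) (int c)
     = S (int l) (int (Suc m)) (int c - 1) (int (Suc l)) (int m) (int c) - q powi (1 + int (Suc l) + int c) * S (int (Suc l)) (int m) (int c) (int (Suc l)) (int m) (int c)"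
    using S0_up_j[of "int (Suc l)" "int m" "int (Suc l)" "int (Suc m)" "int c" "int c"] by (simp add: add.commute)
  have "1 + int (Suc l) + int c = int (l + 2 + c)" by simp
  then have p1: "q powi (1 + int (Suc l) + int c) = q ^ (l + 2) * q ^ c"
    by (simp only: power_int_of_nat power_add)
  show "fps_nth (diag_series (Suc l) (Suc m)) c = fps_nth (fps_X * (diag_series l m + fps_const (q ^ Suc l) * shq (diag_series l (Suc m))) - fps_const (q ^ (l + 2)) * shq (diag_series (Suc l) m)) c"
  proof (cases c)
    case 0
    then show ?thesis using up p1 by (simp add: diag_series_def site_elem_neg)
  next
    case (Suc d)
    have down: "S (int l) (int m) (int d) (int l) (int m) (int d) = S (int l) (int (Suc m)) (int d) (int (Suc l)) (int m) (int c)
        - q powi (1 + int d + int l) * S (int l) (int (Suc m)) (int d) (int l) (int (Suc m)) (int d)"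
      using S0_down_b_left[of "int l" "int m" "int d" "int l" "int (Suc m)" "int d"] Suc by (simp add: add.commute)
    have "1 + int d + int l = int (Suc l + d)" by simp
    then have p2: "q powi (1 + int d + int l) = q ^ Suc l * q ^ d"
      by (simp only: power_int_of_nat power_add)
    have cd: "int c - 1 = int d" "c - 1 = d" "c \<noteq> 0" using Suc by auto
    show ?thesis unfolding fps_sub_nth fps_X_mult_nth fps_add_nth fps_mult_left_const_nth shq_nth if_not_P[OF cd(3)] cd(2)
      unfolding diag_series_def fps_nth_Abs_fps up unfolding cd(1) p1 using down p2 by (simp add: algebra_simps)
  qed
qed

lemma geometric_fps: "lin_factor r * Abs_fps (\<lambda>c. r ^ c) = 1"
proof (rule fps_ext)
  fix m show "fps_nth (lin_factor r * Abs_fps (\<lambda>c. r ^ c)) m = fps_nth 1 m" unfolding lin_factor_nth by (cases m) simp_all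
qed

lemma diag_series_l0: "fps_nth (diag_series l 0) c = q ^ (l * c)"
proof (induction l)
  case 0 then show ?case by (simp add: diag_series_def S_0_0)
next
  case (Suc l)
  have "S (int (Suc l)) 0 (int c) (int (Suc l)) 0 (int c) = q ^ c * S (int l) 0 (int c) (int l) 0 (int c)"
    using S0_up_i[of "int l" 0 "int (Suc l)" 0 "int c" "int c"] by (simp add: site_elem_neg add.commute)
  then show ?case using Suc.IH by (simp add: diag_series_def power_add)
qed

lemma diag_series_0m: "diag_series 0 (Suc m) = - (fps_const q * shq (diag_series 0 m))"
proof (rule fps_ext)
  fix c
  have "S 0 (int (Suc m)) (int c) 0 (int (Suc m)) (int c) = - (q powi (1 + int c)) * S 0 (int m) (int c) 0 (int m) (int c)"
    using S0_up_j[of 0 "int m" 0 "int (Suc m)" "int c" "int c"] by (simp add: site_elem_neg add.commute)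
  moreover have "q powi (1 + int c) = q * q ^ c" by (simp add: pws)
  ultimately show "fps_nth (diag_series 0 (Suc m)) c = fps_nth (- (fps_const q * shq (diag_series 0 m))) c" by (simp add: diag_series_def)
qed

text \<open>
  The claimed product formula satisfies the recursion \<open>diag_series_rec\<close>, because a shift \<open>z \<rightarrow> q z\<close> moves the
  products by one factor.  Both sides agree for \<open>l = 0\<close> and for \<open>m = 0\<close>.
\<close>
lemma diag_series_formula:
  "diag_series l m * (lin_factor (q powi (int l - int m)) * DP (q powi (int l - int m)) m) = NP (q powi (int l - int m)) m"
proof (induction l arbitrary: m)
  case 0
  show ?case
  proof (induction m)
    case 0
    have "diag_series 0 0 = Abs_fps (\<lambda>c. 1 ^ c)" by (rule fps_ext) (simp add: diag_series_l0)
    then show ?case using geometric_fps[of 1] by (simp add: mult.commute)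
  next
    case (Suc m)
    define A where "A = q powi (int 0 - int (Suc m))"
    have Aq: "q powi (int 0 - int m) = A * q" unfolding A_def by (simp add: pws)
    have A2: "A * q ^ (2 * Suc m) = q ^ Suc m"
    proof -
      have "A * q ^ (2 * Suc m) = q powi (int 0 - int (Suc m)) * q powi int (2 * Suc m)" unfolding A_def by (simp only: power_int_of_nat)
      also have "\<dots> = q powi int (Suc m)" unfolding power_int_add[OF disjI1[OF q_nz], symmetric] by (rule arg_cong[of _ _ "power_int q"]) simp
      finally show ?thesis by (simp only: power_int_of_nat)
    qed
    have IH: "shq (diag_series 0 m) * (lin_factor (A * q\<^sup>2) * DP (A * q\<^sup>2) m) = fps_const (q ^ m) * NP A m"
      using arg_cong[OF Suc.IH, of shq] unfolding Aq shq_mult shq_lin_factor shq_DP shq_NP by (simp add: power2_eq_square mult.assoc)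
    have "diag_series 0 (Suc m) * (lin_factor A * DP A (Suc m)) = - (fps_const q * (shq (diag_series 0 m) * (lin_factor (A * q\<^sup>2) * DP (A * q\<^sup>2) m)) * lin_factor A)"
      unfolding diag_series_0m DP_shift by (simp add: mult_ac)
    also have "\<dots> = NP A m * (- (fps_const (q ^ Suc m) * lin_factor A))"
      unfolding IH by (simp add: mult_ac fps_const_mult[symmetric] del: fps_const_mult fps_const_power)
    also have "- (fps_const (q ^ Suc m) * lin_factor A) = rev_factor (A * q ^ (2 * Suc m))"
    proof -
      have "q ^ Suc m * A = 1"
        unfolding A_def by (simp add: power_int_diff power_int_add)
      then have "fps_const (q ^ Suc m) * fps_const A = 1" by (simp del: power_Suc)
      then have "fps_const (q ^ Suc m) * (fps_const A * fps_X) = fps_X" by (simp only: mult.assoc[symmetric] mult_1_left)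
      then show ?thesis unfolding A2 lin_factor_def rev_factor_def by (simp only: right_diff_distrib mult_1_right) simp
    qed
    finally show ?case unfolding NP_Suc A_def .
  qed
next
  case (Suc l)
  note IHl = Suc.IH
  show ?case
  proof (induction m)
    case 0
    have "diag_series (Suc l) 0 = Abs_fps (\<lambda>c. (q ^ Suc l) ^ c)" by (rule fps_ext) (simp only: diag_series_l0 power_mult fps_nth_Abs_fps)
    moreover have "q powi (int (Suc l) - int 0) = q ^ Suc l" by (simp only: of_nat_0 diff_0_right power_int_of_nat)
    ultimately show ?case using geometric_fps[of "q ^ Suc l"] by (simp add: mult.commute del: power_Suc)
  next
    case (Suc m)
    define A where "A = q powi (int l - int m)"
    define P Nn where "P = DP A m" and "Nn = NP A m"
    have e: "q powi (int (Suc l) - int (Suc m)) = A" unfolding A_def by simp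
    have A1: "q powi (int l - int (Suc m)) = A / q" "q powi (int (Suc l) - int m) = A * q"
      unfolding A_def by (simp_all add: pws power_int_diff divide_inverse)
    define B where "B = A * q ^ (2 * Suc m)"
    have Bq: "q ^ (l + 2) * q ^ m = B"
    proof -
      have "B = q powi (int l - int m) * q powi int (2 * Suc m)" unfolding B_def A_def by (simp only: power_int_of_nat)
      also have "\<dots> = q powi int (l + 2 + m)" unfolding power_int_add[OF disjI1[OF q_nz], symmetric] by (rule arg_cong[of _ _ "power_int q"]) simp
      finally show ?thesis by (simp only: power_int_of_nat power_add)
    qed
    have I1: "diag_series l m * (lin_factor A * P) = Nn" unfolding A_def P_def Nn_def by (rule IHl)
    have I2: "shq (diag_series l (Suc m)) * (lin_factor A * (P * lin_factor B)) = fps_const (q ^ Suc m) * (rev_factor A * Nn)"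
    proof -
      have "shq (diag_series l (Suc m)) * (lin_factor (A / q * q) * DP (A / q * q) (Suc m)) = fps_const (q ^ Suc m) * NP (A / q / q) (Suc m)"
        using arg_cong[OF IHl[of "Suc m"], of shq]
        unfolding A1 shq_mult shq_lin_factor shq_DP shq_NP .
      moreover have "A / q * q = A" "A / q / q * q\<^sup>2 = A" by (simp_all add: power2_eq_square)
      ultimately show ?thesis unfolding NP_shift P_def Nn_def B_def by (simp only: DP_Suc)
    qed
    have I3: "shq (diag_series (Suc l) m) * (P * lin_factor B) = fps_const (q ^ m) * Nn"
    proof -
      have "shq (diag_series (Suc l) m) * (lin_factor (A * q * q) * DP (A * q * q) m) = fps_const (q ^ m) * NP (A * q / q) m"
        using arg_cong[OF Suc.IH, of shq] unfolding A1 shq_mult shq_lin_factor shq_DP shq_NP .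
      moreover have "A * q * q = A * q\<^sup>2" "A * q / q = A" by (simp_all add: power2_eq_square mult.assoc)
      moreover have "lin_factor (A * q\<^sup>2) * DP (A * q\<^sup>2) m = P * lin_factor B" unfolding P_def B_def DP_shift[symmetric] DP_Suc ..
      ultimately show ?thesis unfolding Nn_def by simp
    qed
    have c1: "fps_const (q ^ Suc l) * fps_const (q ^ Suc m) = fps_const B" "fps_const (q ^ (l + 2)) * fps_const (q ^ m) = fps_const B"
      using Bq by (simp_all add: mult_ac)
    have alg: "(X * (f1 + a * f2) - b * f3) * (u * (p * w)) = nn * r"
      if "f1 * (u * p) = nn" "f2 * (u * (p * w)) = c * (s * nn)" "f3 * (p * w) = d * nn" "a * c = bb" "b * d = bb"
        "u = 1 - aa * X" "w = 1 - bb * X" "s = X - aa" "r = X - bb"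
      for X f1 a f2 b f3 u p w nn r c s d bb aa :: "'a fps"
    proof -
      have "(X * (f1 + a * f2) - b * f3) * (u * (p * w)) = X * ((f1 * (u * p)) * w + a * (f2 * (u * (p * w)))) - b * (f3 * (p * w)) * u"
        by algebra
      also have "\<dots> = X * (nn * w + (a * c) * (s * nn)) - (b * d) * nn * u" unfolding that(1-3) by algebra
      also have "\<dots> = nn * r" unfolding that(4-9) by algebra
      finally show ?thesis .
    qed
    show ?case unfolding e diag_series_rec DP_Suc NP_Suc B_def[symmetric] P_def[symmetric] Nn_def[symmetric]
      by (rule alg[OF I1 I2 I3 c1 lin_factor_def lin_factor_def rev_factor_def rev_factor_def])
  qed
qed

section \<open>q-binomial theorem\<close>

text \<open>
  Coefficients of \<open>(\<alpha> z; q)_\<infinity>\<close> by Euler's identity, and of the finite product \<open>(\<alpha> z; q)_m\<close>.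
\<close>
definition euler_coeff :: "'a \<Rightarrow> nat \<Rightarrow> 'a" where
  "euler_coeff \<alpha> d = (\<Prod>t<d. - \<alpha> * q ^ t / (1 - q ^ Suc t))"

definition fin_euler_coeff :: "'a \<Rightarrow> nat \<Rightarrow> nat \<Rightarrow> 'a" where
  "fin_euler_coeff \<alpha> m d = (\<Prod>t<d. \<alpha> * (q ^ m - q ^ t) / (1 - q ^ Suc t))"

lemma q1: "1 - q ^ Suc t \<noteq> 0" using q_no_root[of "Suc t"] by (simp del: power_Suc)

definition qprod :: "'a \<Rightarrow> nat \<Rightarrow> 'a fps" where "qprod \<alpha> m = (\<Prod>k<m. lin_factor (\<alpha> * q ^ k))"

lemma qprod_Suc: "qprod \<alpha> (Suc m) = qprod \<alpha> m * lin_factor (\<alpha> * q ^ m)" by (simp add: qprod_def)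

lemma qprod_shq: "qprod \<alpha> (Suc m) = lin_factor \<alpha> * shq (qprod \<alpha> m)"
proof (induction m)
  case 0
  show ?case by (simp add: qprod_def)
next
  case (Suc m)
  have "\<alpha> * q ^ m * q = \<alpha> * q ^ Suc m" by simp
  then have "shq (qprod \<alpha> (Suc m)) = shq (qprod \<alpha> m) * lin_factor (\<alpha> * q ^ Suc m)"
    unfolding qprod_Suc[of \<alpha> m] shq_mult shq_lin_factor by (simp only: mult.assoc)
  moreover have "qprod \<alpha> (Suc (Suc m)) = lin_factor \<alpha> * shq (qprod \<alpha> m) * lin_factor (\<alpha> * q ^ Suc m)"
    unfolding qprod_Suc[of \<alpha> "Suc m"] Suc.IH ..
  ultimately show ?case by (simp only: mult.assoc)
qed

lemma qprod_nth: "fps_nth (qprod \<alpha> m) d = fin_euler_coeff \<alpha> m d"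
proof (induction d)
  case 0
  have "fps_nth (qprod \<alpha> m) 0 = 1" unfolding qprod_def by (induction m) (simp_all add: fps_mult_nth lin_factor_def)
  then show ?case by (simp add: fin_euler_coeff_def)
next
  case (Suc d)
  have "lin_factor (\<alpha> * q ^ m) * qprod \<alpha> m = lin_factor \<alpha> * shq (qprod \<alpha> m)"
    unfolding qprod_shq[symmetric] by (simp add: qprod_def mult.commute)
  from arg_cong[OF this, of "\<lambda>f. fps_nth f (Suc d)"]
  have "fps_nth (qprod \<alpha> m) (Suc d) * (1 - q ^ Suc d) = \<alpha> * (q ^ m - q ^ d) * fps_nth (qprod \<alpha> m) d"
    unfolding lin_factor_nth by (simp add: algebra_simps)
  then have "fps_nth (qprod \<alpha> m) (Suc d) = \<alpha> * (q ^ m - q ^ d) * fps_nth (qprod \<alpha> m) d / (1 - q ^ Suc d)"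
    using q1[of d] by (simp add: field_simps del: power_Suc)
  then show ?case unfolding Suc.IH by (simp add: fin_euler_coeff_def)
qed

text \<open>
  Comparison of coefficients gives a recursion, in which \<open>1 - q^m\<close> is invertible.
\<close>
lemma q_functional_unique:
  assumes "f = lin_factor \<alpha> * shq f" "g = lin_factor \<alpha> * shq g" "fps_nth f 0 = fps_nth g 0"
  shows "f = g"
proof (rule fps_ext)
  have rec: "fps_nth f (Suc d) = - \<alpha> * q ^ d / (1 - q ^ Suc d) * fps_nth f d" if "f = lin_factor \<alpha> * shq f" for f d
  proof -
    have "fps_nth f (Suc d) = q ^ Suc d * fps_nth f (Suc d) - \<alpha> * (q ^ d * fps_nth f d)"
      using arg_cong[OF that, of "\<lambda>f. fps_nth f (Suc d)"] unfolding lin_factor_nth by simp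
    then have "fps_nth f (Suc d) * (1 - q ^ Suc d) = - \<alpha> * q ^ d * fps_nth f d" by (simp add: algebra_simps)
    then show ?thesis using q1[of d] by (simp add: field_simps del: power_Suc)
  qed
  fix d show "fps_nth f d = fps_nth g d"
    by (induction d) (simp_all only: assms(3) rec[OF assms(1)] rec[OF assms(2)])
qed

lemma euler_coeff_functional: "Abs_fps (euler_coeff \<alpha>) = lin_factor \<alpha> * shq (Abs_fps (euler_coeff \<alpha>))"
proof (rule fps_ext)
  fix d show "fps_nth (Abs_fps (euler_coeff \<alpha>)) d = fps_nth (lin_factor \<alpha> * shq (Abs_fps (euler_coeff \<alpha>))) d"
  proof (cases d)
    case 0 then show ?thesis unfolding lin_factor_nth by simp
  next
    case (Suc t)
    have "euler_coeff \<alpha> (Suc t) * (1 - q ^ Suc t) = - \<alpha> * q ^ t * euler_coeff \<alpha> t"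
      using q1[of t] by (simp add: euler_coeff_def del: power_Suc)
    then have "euler_coeff \<alpha> (Suc t) = q ^ Suc t * euler_coeff \<alpha> (Suc t) - \<alpha> * (q ^ t * euler_coeff \<alpha> t)" by (simp add: algebra_simps)
    then show ?thesis unfolding lin_factor_nth Suc by simp
  qed
qed

text \<open>
  The assumptions say \<open>h_c = (-q)_c/(q)_c\<close>.  By the functional equations of the factors, the product
  satisfies that of \<open>(-q z; q)_\<infinity>\<close>; no infinite product is needed.
\<close>
lemma q_binomial:
  assumes h: "\<And>c. h (Suc c) * (1 - q ^ Suc c) = (1 + q ^ Suc c) * h c" "h 0 = 1"
  shows "Abs_fps (euler_coeff 1) * Abs_fps h = Abs_fps (euler_coeff (- q))"
proof -
  define F where "F = Abs_fps h"
  have F: "lin_factor 1 * F = lin_factor (- q) * shq F"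
  proof (rule fps_ext)
    fix m show "fps_nth (lin_factor 1 * F) m = fps_nth (lin_factor (- q) * shq F) m"
    proof (cases m)
      case 0 then show ?thesis unfolding lin_factor_nth by simp
    next
      case (Suc c)
      have "h (Suc c) - h c = q ^ Suc c * h (Suc c) + q * (q ^ c * h c)" using h(1)[of c] by (simp add: algebra_simps)
      then show ?thesis unfolding lin_factor_nth Suc F_def by simp
    qed
  qed
  define f where "f = Abs_fps (euler_coeff 1)"
  have f: "f = lin_factor 1 * shq f" unfolding f_def by (rule euler_coeff_functional)
  have "f * F = lin_factor (- q) * shq (f * F)"
  proof -
    have "f * F = shq f * (lin_factor 1 * F)" by (subst f) (simp add: mult_ac)
    also have "\<dots> = lin_factor (- q) * shq (f * F)" unfolding F shq_mult by (simp add: mult_ac)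
    finally show ?thesis .
  qed
  then show ?thesis unfolding f_def[symmetric] F_def[symmetric]
    by (rule q_functional_unique[OF _ euler_coeff_functional]) (simp add: f_def F_def fps_mult_nth euler_coeff_def h)
qed

end

section \<open>Entries generated by leading terms\<close>

text \<open>
  The value \<open>v 0\<close> is left unspecified, so that \<open>v\<close> can be integer valued; every rule has the
  corresponding side condition.
\<close>
locale val_field =
  fixes v :: "'f::field \<Rightarrow> int"
  assumes v_mult: "a \<noteq> 0 \<Longrightarrow> b \<noteq> 0 \<Longrightarrow> v (a * b) = v a + v b"
    and v_add: "a \<noteq> 0 \<Longrightarrow> b \<noteq> 0 \<Longrightarrow> a + b \<noteq> 0 \<Longrightarrow> min (v a) (v b) \<le> v (a + b)"
begin

lemma v_1 [simp]: "v 1 = 0"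
  using v_mult[of 1 1] by simp

lemma v_minus: "v (- a) = v a"
proof (cases "a = 0")
  case False
  have "v ((-1) * (-1)) = v (-1) + v (-1)" by (rule v_mult) auto
  then have "v (-1) = 0" by simp
  then show ?thesis using v_mult[of "-1" a] False by simp
qed simp

lemma v_inverse: "a \<noteq> 0 \<Longrightarrow> v (inverse a) = - v a"
  using v_mult[of a "inverse a"] by simp

lemma v_divide: "a \<noteq> 0 \<Longrightarrow> b \<noteq> 0 \<Longrightarrow> v (a / b) = v a - v b"
  by (simp add: divide_inverse v_mult v_inverse)

lemma v_power: "a \<noteq> 0 \<Longrightarrow> v (a ^ m) = int m * v a"
  by (induction m) (simp_all add: v_mult algebra_simps)

lemma v_powi: "a \<noteq> 0 \<Longrightarrow> v (a powi m) = m * v a"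
  by (simp add: power_int_def v_power v_inverse)

lemma v_sum: "finite I \<Longrightarrow> sum f I \<noteq> 0 \<Longrightarrow> \<exists>t\<in>I. f t \<noteq> 0 \<and> v (f t) \<le> v (sum f I)"
proof (induction I rule: finite_induct)
  case (insert x I)
  show ?case
  proof (cases "f x = 0 \<or> sum f I = 0")
    case True
    then show ?thesis using insert by auto
  next
    case False
    then obtain t where "t \<in> I" "f t \<noteq> 0" "v (f t) \<le> v (sum f I)" using insert by auto
    moreover have "min (v (f x)) (v (sum f I)) \<le> v (sum f (insert x I))"
      using v_add[of "f x" "sum f I"] False insert by simp
    ultimately show ?thesis using False by (auto simp: min_def split: if_splits intro: order.trans)
  qed
qed simp

text \<open>
  A sum with a unique term of minimal valuation is nonzero and has the valuation of this term.
\<close>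
lemma v_dominant:
  assumes "finite I" "s \<in> I" "f s \<noteq> 0" "\<And>t. t \<in> I \<Longrightarrow> t \<noteq> s \<Longrightarrow> f t \<noteq> 0 \<Longrightarrow> v (f s) < v (f t)"
  shows "sum f I \<noteq> 0 \<and> v (sum f I) = v (f s)"
proof -
  define R where "R = sum f (I - {s})"
  have S: "sum f I = f s + R" unfolding R_def using assms by (simp add: sum.remove)
  show ?thesis
  proof (cases "R = 0")
    case True
    then show ?thesis using S assms by simp
  next
    case False
    then obtain t where "t \<in> I - {s}" "f t \<noteq> 0" "v (f t) \<le> v R"
      unfolding R_def using v_sum[of "I - {s}" f] assms(1) by auto
    then have R: "v (f s) < v R" using assms(4)[of t] by auto
    have nz: "f s + R \<noteq> 0"
    proof
      assume "f s + R = 0"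
      then have "R = - f s" by (simp add: add_eq_0_iff)
      then show False using R v_minus by simp
    qed
    have "v (f s) \<le> v (f s + R)" using v_add[OF assms(3) False nz] R by simp
    moreover have "v (f s + R) \<le> v (f s)"
      using v_add[of "f s + R" "- R"] nz False assms(3) R by (simp add: v_minus)
    ultimately show ?thesis using nz S by simp
  qed
qed

end

text \<open>
  A subfield \<open>k\<close> and a subspace \<open>K'\<close> over it.  The cases in use are \<open>k = K'\<close>, which transfers membership
  in a subfield, and \<open>K' = {0}\<close>, which gives uniqueness.
\<close>
locale subfield_module =
  fixes k K' :: "'f::field set"
  assumes k_sub: "0 \<in> k" "1 \<in> k" "\<And>a b. a \<in> k \<Longrightarrow> b \<in> k \<Longrightarrow> a + b \<in> k" "\<And>a b. a \<in> k \<Longrightarrow> b \<in> k \<Longrightarrow> a - b \<in> k"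
    "\<And>a b. a \<in> k \<Longrightarrow> b \<in> k \<Longrightarrow> a * b \<in> k" "\<And>a. a \<in> k \<Longrightarrow> inverse a \<in> k"
    and K'_sub: "0 \<in> K'" "\<And>a b. a \<in> K' \<Longrightarrow> b \<in> K' \<Longrightarrow> a + b \<in> K'" "\<And>a b. a \<in> k \<Longrightarrow> b \<in> K' \<Longrightarrow> a * b \<in> K'"
begin

lemma k_sum: "(\<And>x. x \<in> I \<Longrightarrow> f x \<in> k) \<Longrightarrow> sum f I \<in> k"
  by (induction I rule: infinite_finite_induct) (auto intro: k_sub)

lemma K'_sum: "(\<And>x. x \<in> I \<Longrightarrow> f x \<in> K') \<Longrightarrow> sum f I \<in> K'"
  by (induction I rule: infinite_finite_induct) (auto intro: K'_sub)

lemma K'_diff: "a \<in> K' \<Longrightarrow> b \<in> K' \<Longrightarrow> a - b \<in> K'"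
  using K'_sub(2)[of a "(0 - 1) * b"] K'_sub(3)[OF k_sub(4)[OF k_sub(1,2)], of b] by simp

text \<open>
  Gaussian elimination over \<open>k\<close>: if the vectors in \<open>U\<close> separate points, a functional whose values on \<open>U\<close> lie in
  \<open>K'\<close> has its components in \<open>K'\<close>.
\<close>
lemma linear_system_solution:
  assumes "finite T" "\<And>u t. u \<in> U \<Longrightarrow> t \<in> T \<Longrightarrow> u t \<in> k"
    "\<And>u. u \<in> U \<Longrightarrow> (\<Sum>t\<in>T. \<phi> t * u t) \<in> K'"
    "\<And>\<psi>. (\<And>u. u \<in> U \<Longrightarrow> (\<Sum>t\<in>T. \<psi> t * u t) = 0) \<Longrightarrow> (\<forall>t\<in>T. \<psi> t = 0)"
  shows "\<forall>t\<in>T. \<phi> t \<in> K'"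
  using assms
proof (induction T arbitrary: U rule: finite_induct)
  case (insert t0 T)
  note fin = insert.hyps
  have "\<exists>u0\<in>U. u0 t0 \<noteq> 0"
  proof (rule ccontr)
    assume "\<not> ?thesis"
    then have z: "\<And>u. u \<in> U \<Longrightarrow> u t0 = 0" by auto
    have "\<forall>t\<in>insert t0 T. (\<lambda>t. if t = t0 then 1 else 0 :: 'f) t = 0"
    proof (rule insert.prems(3))
      fix u assume "u \<in> U"
      then show "(\<Sum>t\<in>insert t0 T. (if t = t0 then 1 else 0) * u t) = 0"
        by (intro sum.neutral) (auto simp: z)
    qed
    then show False by simp
  qed
  then obtain u0 where u0: "u0 \<in> U" "u0 t0 \<noteq> 0" by auto
  \<comment> \<open>the coordinate \<open>t0\<close> is eliminated by means of the pivot \<open>u0\<close>\<close>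
  define red where "red u = (\<lambda>t. u t - u t0 * inverse (u0 t0) * u0 t)" for u
  have redsum: "(\<Sum>t\<in>T. \<psi> t * red u t) = (\<Sum>t\<in>insert t0 T. \<psi> t * u t) - u t0 * inverse (u0 t0) * (\<Sum>t\<in>insert t0 T. \<psi> t * u0 t)" for \<psi> u
    using fin u0(2) by (simp add: red_def right_diff_distrib sum_subtractf sum_distrib_left algebra_simps)
  have T: "\<forall>t\<in>T. \<phi> t \<in> K'"
  proof (rule insert.IH)
    fix u t assume "u \<in> red ` U" "t \<in> T"
    then show "u t \<in> k" unfolding red_def using insert.prems(1) u0 by (auto intro!: k_sub)
  next
    fix u assume "u \<in> red ` U"
    then obtain u' where u': "u' \<in> U" "u = red u'" by auto
    have "u' t0 * inverse (u0 t0) \<in> k" using insert.prems(1) u0 u' by (auto intro!: k_sub)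
    then show "(\<Sum>t\<in>T. \<phi> t * u t) \<in> K'"
      unfolding u' redsum using insert.prems(2) u0 u' by (intro K'_diff K'_sub(3)) auto
  next
    fix \<psi> assume h: "\<And>u. u \<in> red ` U \<Longrightarrow> (\<Sum>t\<in>T. \<psi> t * u t) = 0"
    \<comment> \<open>the extension of \<open>\<psi>\<close> to \<open>t0\<close> that annihilates \<open>u0\<close>\<close>
    define \<psi>' where "\<psi>' = \<psi>(t0 := - (\<Sum>t\<in>T. \<psi> t * u0 t) / u0 t0)"
    have \<psi>'T: "(\<Sum>t\<in>T. \<psi>' t * u t) = (\<Sum>t\<in>T. \<psi> t * u t)" for u
      using fin by (intro sum.cong) (auto simp: \<psi>'_def)
    have 0: "(\<Sum>t\<in>insert t0 T. \<psi>' t * u0 t) = 0"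
      using fin u0 by (simp add: \<psi>'T) (simp add: \<psi>'_def)
    have "\<forall>t\<in>insert t0 T. \<psi>' t = 0"
    proof (rule insert.prems(3))
      fix u assume "u \<in> U"
      then have "(\<Sum>t\<in>T. \<psi>' t * red u t) = 0" using h \<psi>'T by auto
      then show "(\<Sum>t\<in>insert t0 T. \<psi>' t * u t) = 0" unfolding redsum 0 by simp
    qed
    moreover have "\<psi>' t = \<psi> t" if "t \<in> T" for t using fin that by (auto simp: \<psi>'_def)
    ultimately show "\<forall>t\<in>T. \<psi> t = 0" by auto
  qed
  have "\<phi> t0 = inverse (u0 t0) * ((\<Sum>t\<in>insert t0 T. \<phi> t * u0 t) - (\<Sum>t\<in>T. u0 t * \<phi> t))"
    using fin u0 by (simp add: mult.commute)
  also have "\<dots> \<in> K'"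
  proof (rule K'_sub(3)[OF _ K'_diff])
    show "inverse (u0 t0) \<in> k" using insert.prems(1) u0 by (auto intro!: k_sub)
    show "(\<Sum>t\<in>insert t0 T. \<phi> t * u0 t) \<in> K'" using insert.prems(2) u0 by blast
    show "(\<Sum>t\<in>T. u0 t * \<phi> t) \<in> K'"
      by (rule K'_sum, rule K'_sub(3)) (use insert.prems(1) u0 T in auto)
  qed
  finally show ?case using T by auto
qed simp

end

text \<open>
  The matrices \<open>D g\<close> act on vectors indexed by \<open>X\<close>.  They shift the weight \<open>wt\<close> by \<open>dl g\<close>, and this makes all
  sums finite.  In the gauge \<open>\<gamma>\<close>, with valuations scaled by \<open>L\<close>, the entries of \<open>D g\<close> have valuation at
  least \<open>\<tau> g\<close>.
\<close>
locale generation = val_field v for v :: "'f::field \<Rightarrow> int" +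
  fixes X :: "'s set" and D :: "'g \<Rightarrow> 's \<Rightarrow> 's \<Rightarrow> 'f" and gens :: "'g set"
    and wt :: "'s \<Rightarrow> int" and dl :: "'g \<Rightarrow> int" and \<gamma> :: "'s \<Rightarrow> int" and L :: int and \<tau> :: "'g \<Rightarrow> int" and s0 :: 's
  assumes L: "L > 0" and fin: "\<And>w. finite {s \<in> X. wt s = w}" and s0: "s0 \<in> X"
    and D_wt: "\<And>g s s'. g \<in> gens \<Longrightarrow> s \<in> X \<Longrightarrow> s' \<in> X \<Longrightarrow> D g s' s \<noteq> 0 \<Longrightarrow> wt s' = wt s + dl g"
    and D_val: "\<And>g s s'. g \<in> gens \<Longrightarrow> s \<in> X \<Longrightarrow> s' \<in> X \<Longrightarrow> D g s' s \<noteq> 0 \<Longrightarrow> \<tau> g \<le> L * v (D g s' s) + \<gamma> s' - \<gamma> s"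
begin

text \<open>The entries of \<open>D g\<close> of minimal valuation.\<close>
definition lead :: "'g \<Rightarrow> 's \<Rightarrow> 's \<Rightarrow> bool" where
  "lead g s s' \<longleftrightarrow> s \<in> X \<and> s' \<in> X \<and> D g s' s \<noteq> 0 \<and> L * v (D g s' s) + \<gamma> s' - \<gamma> s = \<tau> g"

abbreviation Fw :: "int \<Rightarrow> 's set" where "Fw w \<equiv> {s \<in> X. wt s = w}"

definition N :: "('s \<Rightarrow> 'f) \<Rightarrow> 's \<Rightarrow> int" where "N u s = L * v (u s) + \<gamma> s"

text \<open>The term of \<open>u\<close> at \<open>s\<close> strictly dominates all others.\<close>
definition good :: "('s \<Rightarrow> 'f) \<Rightarrow> 's \<Rightarrow> bool" where
  "good u s \<longleftrightarrow> s \<in> X \<and> u s \<noteq> 0 \<and> (\<forall>t. u t \<noteq> 0 \<longrightarrow> t \<in> X \<and> wt t = wt s \<and> (t \<noteq> s \<longrightarrow> N u s < N u t))"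

definition Dact :: "'g \<Rightarrow> ('s \<Rightarrow> 'f) \<Rightarrow> 's \<Rightarrow> 'f" where
  "Dact g u s' = (if s' \<in> X then \<Sum>x\<in>Fw (wt s' - dl g). D g s' x * u x else 0)"

text \<open>
  If the leading part of \<open>D g\<close> is a partial injection near \<open>s\<close>, the dominant term of \<open>u\<close> is moved to
  the dominant term of \<open>D g u\<close>, and no other term can catch up with it.
\<close>
lemma good_step:
  assumes u: "good u s" and g: "g \<in> gens" and ld: "lead g s s'"
    and inj: "\<And>x. lead g x s' \<Longrightarrow> x = s" and func: "\<And>x. lead g s x \<Longrightarrow> x = s'"
  shows "good (Dact g u) s'"
proof -
  have X: "s \<in> X" "s' \<in> X" "D g s' s \<noteq> 0" "L * v (D g s' s) + \<gamma> s' - \<gamma> s = \<tau> g" using ld by (auto simp: lead_def)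
  have w: "wt s' = wt s + dl g" using D_wt[OF g] X by auto
  have us: "u s \<noteq> 0" using u by (simp add: good_def)
  have tm: "\<tau> g + N u s \<le> L * v (D g t x * u x) + \<gamma> t \<and> (L * v (D g t x * u x) + \<gamma> t = \<tau> g + N u s \<longrightarrow> x = s \<and> t = s')"
    if "t \<in> X" "x \<in> X" "D g t x * u x \<noteq> 0" for t x
  proof -
    have nz: "D g t x \<noteq> 0" "u x \<noteq> 0" using that by auto
    have 1: "\<tau> g \<le> L * v (D g t x) + \<gamma> t - \<gamma> x" using D_val[OF g that(2,1)] nz by simp
    have 2: "N u s \<le> N u x" "x \<noteq> s \<Longrightarrow> N u s < N u x" using u nz by (auto simp: good_def less_imp_le)
    have 3: "L * v (D g t x * u x) + \<gamma> t = (L * v (D g t x) + \<gamma> t - \<gamma> x) + N u x"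
      using nz by (simp add: v_mult N_def algebra_simps)
    have "x = s \<and> t = s'" if e: "L * v (D g t x * u x) + \<gamma> t = \<tau> g + N u s"
    proof -
      have "x = s" using e 1 2 3 by linarith
      moreover have "L * v (D g t x) + \<gamma> t - \<gamma> x = \<tau> g" using e 1 2 3 by linarith
      ultimately have "lead g s t" using \<open>t \<in> X\<close> X nz by (simp add: lead_def)
      then show ?thesis using \<open>x = s\<close> func by simp
    qed
    then show ?thesis using 1 2(1) 3 by linarith
  qed
  have s': "Dact g u s' = (\<Sum>x\<in>Fw (wt s). D g s' x * u x)" using X w by (simp add: Dact_def)
  have dom: "Dact g u s' \<noteq> 0 \<and> v (Dact g u s') = v (D g s' s * u s)"
    unfolding s'
  proof (rule v_dominant)
    fix t assume t: "t \<in> Fw (wt s)" "t \<noteq> s" "D g s' t * u t \<noteq> 0"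
    have "L * v (D g s' s * u s) + \<gamma> s' = \<tau> g + N u s"
      using X us by (simp add: v_mult N_def algebra_simps)
    moreover have "\<tau> g + N u s < L * v (D g s' t * u t) + \<gamma> s'" using tm[of s' t] t X by force
    ultimately have "L * v (D g s' s * u s) < L * v (D g s' t * u t)" by simp
    then show "v (D g s' s * u s) < v (D g s' t * u t)" using L by simp
  qed (use fin X us in auto)
  have Ns': "N (Dact g u) s' = \<tau> g + N u s"
    using dom X us by (simp add: N_def v_mult algebra_simps)
  show ?thesis unfolding good_def
  proof (intro conjI allI impI)
    fix t assume nz: "Dact g u t \<noteq> 0"
    then show tX: "t \<in> X" by (auto simp: Dact_def split: if_splits)
    have "\<exists>x\<in>Fw (wt t - dl g). D g t x * u x \<noteq> 0 \<and> v (D g t x * u x) \<le> v (Dact g u t)"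
      using v_sum[OF fin, of "\<lambda>x. D g t x * u x" "wt t - dl g"] nz tX by (simp add: Dact_def)
    then obtain x where x: "x \<in> Fw (wt t - dl g)" "D g t x * u x \<noteq> 0" "v (D g t x * u x) \<le> v (Dact g u t)" by (elim bexE conjE)
    have "u x \<noteq> 0" using x(2) by simp
    then have "wt x = wt s" using u unfolding good_def by blast
    then show "wt t = wt s'" using x w by simp
    assume ne: "t \<noteq> s'"
    have "\<tau> g + N u s < L * v (D g t x * u x) + \<gamma> t" using tm[of t x] tX x ne by force
    also have "L * v (D g t x * u x) \<le> L * v (Dact g u t)" using x L by simp
    finally show "N (Dact g u) s' < N (Dact g u) t" unfolding Ns' by (simp add: N_def)
  qed (use dom X in auto)
qed

definition step :: "('s \<times> 's) set" where
  "step = {(s, s'). \<exists>g\<in>gens. lead g s s' \<and> (\<forall>x. lead g x s' \<longrightarrow> x = s) \<and> (\<forall>x. lead g s x \<longrightarrow> x = s')}"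

text \<open>
  The row \<open>\<Phi> x\<close> is applied to good vectors, which are built along the steps from \<open>s0\<close>.  Its values on
  them lie in \<open>K'\<close>: this holds at the start, and the relation \<open>cl\<close> carries it along a step.  Good vectors
  with different dominant terms are linearly independent, and so the components of \<open>\<Phi> x\<close> lie in \<open>K'\<close> as well.
\<close>
theorem generated_entries:
  fixes \<Phi> :: "'o \<Rightarrow> 's \<Rightarrow> 'f"
  assumes reach: "\<And>s. s \<in> X \<Longrightarrow> (s0, s) \<in> step\<^sup>*"
    and sub: "subfield_module k K'"
    and Dk: "\<And>g s s'. g \<in> gens \<Longrightarrow> s \<in> X \<Longrightarrow> s' \<in> X \<Longrightarrow> D g s' s \<in> k"
    and cl: "\<And>g x. g \<in> gens \<Longrightarrow> x \<in> Out \<Longrightarrow> \<exists>A J. J \<subseteq> Out \<and> (\<forall>y\<in>J. A y \<in> k) \<and>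
          (\<forall>s\<in>X. (\<Sum>s'\<in>Fw (wt s + dl g). \<Phi> x s' * D g s' s) = (\<Sum>y\<in>J. A y * \<Phi> y s))"
    and init: "\<And>x. x \<in> Out \<Longrightarrow> \<Phi> x s0 \<in> K'"
    and x: "x \<in> Out" and s: "s \<in> X"
  shows "\<Phi> x s \<in> K'"
proof -
  interpret subfield_module k K' by (rule sub)
  have gen: "\<exists>u. good u s \<and> (\<forall>t. u t \<in> k) \<and> (\<forall>x\<in>Out. (\<Sum>t\<in>Fw (wt s). \<Phi> x t * u t) \<in> K')" if "s \<in> X" for s
    using reach[OF that]
  proof (induction rule: rtrancl_induct)
    case base
    define u where "u = (\<lambda>t. if t = s0 then 1 else 0 :: 'f)"
    have S: "(\<Sum>t\<in>Fw (wt s0). \<Phi> x t * u t) = \<Phi> x s0" for x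
      using sum.remove[OF fin, of s0 "wt s0" "\<lambda>t. \<Phi> x t * u t"] s0 by (simp add: u_def)
    have 1: "good u s0" using s0 by (simp add: good_def u_def)
    have 2: "\<forall>t. u t \<in> k" unfolding u_def using k_sub(1,2) by simp
    have 3: "\<forall>x\<in>Out. (\<Sum>t\<in>Fw (wt s0). \<Phi> x t * u t) \<in> K'" unfolding S using init by blast
    show ?case by (rule exI[of _ u], rule conjI[OF 1 conjI[OF 2 3]])
  next
    case (step s s')
    have "\<exists>g\<in>gens. lead g s s' \<and> (\<forall>x. lead g x s' \<longrightarrow> x = s) \<and> (\<forall>x. lead g s x \<longrightarrow> x = s')"
      using step.hyps(2) unfolding step_def mem_Collect_eq prod.case .
    then obtain g where g: "g \<in> gens" "lead g s s'" "\<forall>x. lead g x s' \<longrightarrow> x = s" "\<forall>x. lead g s x \<longrightarrow> x = s'"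
      by (elim bexE conjE)
    obtain u where u: "good u s" "\<And>t. u t \<in> k" "\<And>x. x \<in> Out \<Longrightarrow> (\<Sum>t\<in>Fw (wt s). \<Phi> x t * u t) \<in> K'"
    proof (rule exE[OF step.IH])
      fix u assume "good u s \<and> (\<forall>t. u t \<in> k) \<and> (\<forall>x\<in>Out. (\<Sum>t\<in>Fw (wt s). \<Phi> x t * u t) \<in> K')"
      then show thesis using that[of u] by blast
    qed
    have X: "s \<in> X" "s' \<in> X" "D g s' s \<noteq> 0" using g(2) by (auto simp: lead_def)
    have w: "wt s' = wt s + dl g" using D_wt[OF g(1)] X by auto
    have "Dact g u t \<in> k" for t
      unfolding Dact_def using Dk g(1) u(2) by (auto intro!: k_sum k_sub)
    moreover have "(\<Sum>t\<in>Fw (wt s'). \<Phi> x t * Dact g u t) \<in> K'" if x: "x \<in> Out" for x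
    proof -
      obtain A J where AJ: "J \<subseteq> Out" "\<forall>y\<in>J. A y \<in> k"
        "\<forall>s\<in>X. (\<Sum>s'\<in>Fw (wt s + dl g). \<Phi> x s' * D g s' s) = (\<Sum>y\<in>J. A y * \<Phi> y s)"
        using cl[OF g(1) x] by (elim exE conjE)
      have "(\<Sum>t\<in>Fw (wt s'). \<Phi> x t * Dact g u t) = (\<Sum>t\<in>Fw (wt s'). \<Sum>y\<in>Fw (wt s). \<Phi> x t * (D g t y * u y))"
        by (rule sum.cong) (auto simp: Dact_def w sum_distrib_left)
      also have "\<dots> = (\<Sum>y\<in>Fw (wt s). \<Sum>t\<in>Fw (wt s'). \<Phi> x t * (D g t y * u y))"
        by (rule sum.swap)
      also have "\<dots> = (\<Sum>y\<in>Fw (wt s). (\<Sum>z\<in>J. A z * \<Phi> z y) * u y)"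
      proof (rule sum.cong)
        fix y assume y: "y \<in> Fw (wt s)"
        have "(\<Sum>t\<in>Fw (wt s'). \<Phi> x t * (D g t y * u y)) = (\<Sum>t\<in>Fw (wt y + dl g). \<Phi> x t * D g t y) * u y"
          using y w by (simp add: sum_distrib_right mult.assoc)
        then show "(\<Sum>t\<in>Fw (wt s'). \<Phi> x t * (D g t y * u y)) = (\<Sum>z\<in>J. A z * \<Phi> z y) * u y"
          using AJ(3)[rule_format, of y] y by simp
      qed simp
      also have "\<dots> = (\<Sum>y\<in>Fw (wt s). \<Sum>z\<in>J. A z * (\<Phi> z y * u y))" by (simp add: sum_distrib_right mult.assoc)
      also have "\<dots> = (\<Sum>z\<in>J. \<Sum>y\<in>Fw (wt s). A z * (\<Phi> z y * u y))" by (rule sum.swap)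
      also have "\<dots> = (\<Sum>z\<in>J. A z * (\<Sum>y\<in>Fw (wt s). \<Phi> z y * u y))" by (simp add: sum_distrib_left)
      also have "\<dots> \<in> K'"
        by (rule K'_sum, rule K'_sub(3)) (use AJ(1,2) u(3) in auto)
      finally show ?thesis .
    qed
    ultimately have "good (Dact g u) s' \<and> (\<forall>t. Dact g u t \<in> k) \<and> (\<forall>x\<in>Out. (\<Sum>t\<in>Fw (wt s'). \<Phi> x t * Dact g u t) \<in> K')"
      using good_step[OF u(1) g(1,2) g(3)[rule_format] g(4)[rule_format]] by simp
    then show ?case by (rule exI[of _ "Dact g u"])
  qed
  \<comment> \<open>one vector with dominant term at each state; these vectors form a triangular system\<close>
  define uu where "uu s = (SOME u. good u s \<and> (\<forall>t. u t \<in> k) \<and> (\<forall>x\<in>Out. (\<Sum>t\<in>Fw (wt s). \<Phi> x t * u t) \<in> K'))" for s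
  have uu: "good (uu s) s" "uu s t \<in> k" "x \<in> Out \<Longrightarrow> (\<Sum>t\<in>Fw (wt s). \<Phi> x t * uu s t) \<in> K'" if "s \<in> X" for s t x
    using someI_ex[OF gen[OF that]] unfolding uu_def by auto
  have "\<forall>t\<in>Fw (wt s). \<Phi> x t \<in> K'"
  proof (rule linear_system_solution[where U = "uu ` Fw (wt s)"])
    show "finite (Fw (wt s))" by (rule fin)
    show "u t \<in> k" if "u \<in> uu ` Fw (wt s)" "t \<in> Fw (wt s)" for u t using that uu(2) by auto
    show "(\<Sum>t\<in>Fw (wt s). \<Phi> x t * u t) \<in> K'" if "u \<in> uu ` Fw (wt s)" for u using that uu(3)[OF _ x] by fastforce
    fix \<psi> assume h: "\<And>u. u \<in> uu ` Fw (wt s) \<Longrightarrow> (\<Sum>t\<in>Fw (wt s). \<psi> t * u t) = 0"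
    show "\<forall>t\<in>Fw (wt s). \<psi> t = 0"
    proof (rule ccontr)
      assume "\<not> ?thesis"
      then have ne: "{t \<in> Fw (wt s). \<psi> t \<noteq> 0} \<noteq> {}" by auto
      have fn: "finite {t \<in> Fw (wt s). \<psi> t \<noteq> 0}" by (rule finite_subset[OF _ fin[of "wt s"]]) auto
      obtain y where y: "y \<in> {t \<in> Fw (wt s). \<psi> t \<noteq> 0}" "\<And>t. t \<in> {t \<in> Fw (wt s). \<psi> t \<noteq> 0} \<Longrightarrow> L * v (\<psi> y) - \<gamma> y \<le> L * v (\<psi> t) - \<gamma> t"
      proof -
        let ?S = "{t \<in> Fw (wt s). \<psi> t \<noteq> 0}" and ?f = "\<lambda>t. L * v (\<psi> t) - \<gamma> t"
        have "Min (?f ` ?S) \<in> ?f ` ?S" using fn ne by (intro Min_in) auto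
        then obtain y where y: "y \<in> ?S" "Min (?f ` ?S) = ?f y" by (elim imageE)
        have "?f y \<le> ?f t" if "t \<in> ?S" for t
          unfolding y(2)[symmetric] using fn that by (intro Min_le finite_imageI imageI)
        then show thesis using that y(1) by blast
      qed
      have yX: "y \<in> X" "y \<in> Fw (wt s)" and y0: "\<psi> y \<noteq> 0" using y(1) by simp_all
      have gy: "good (uu y) y" by (rule uu(1)[OF yX(1)])
      have uy: "uu y y \<noteq> 0" using gy by (simp add: good_def)
      have "(\<Sum>t\<in>Fw (wt s). \<psi> t * uu y t) \<noteq> 0 \<and> v (\<Sum>t\<in>Fw (wt s). \<psi> t * uu y t) = v (\<psi> y * uu y y)"
      proof (rule v_dominant)
        fix t assume t: "t \<in> Fw (wt s)" "t \<noteq> y" "\<psi> t * uu y t \<noteq> 0"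
        have nz: "\<psi> t \<noteq> 0" "uu y t \<noteq> 0" using t(3) by simp_all
        have "L * v (\<psi> y) - \<gamma> y \<le> L * v (\<psi> t) - \<gamma> t" by (rule y(2)) (use t(1) nz(1) in simp)
        moreover have "N (uu y) y < N (uu y) t" using gy t(2) nz(2) by (simp add: good_def)
        moreover have "v (\<psi> y * uu y y) = v (\<psi> y) + v (uu y y)" "v (\<psi> t * uu y t) = v (\<psi> t) + v (uu y t)"
          by (rule v_mult; fact)+
        ultimately have "L * v (\<psi> y * uu y y) < L * v (\<psi> t * uu y t)"
          by (simp add: N_def algebra_simps)
        then show "v (\<psi> y * uu y y) < v (\<psi> t * uu y t)" using L by simp
      qed (use fin[of "wt s"] yX(2) y0 uy in simp_all)
      moreover have "(\<Sum>t\<in>Fw (wt s). \<psi> t * uu y t) = 0" by (rule h) (use yX(2) in blast)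
      ultimately show False by simp
    qed
  qed
  then show ?thesis using s by auto
qed

end

section \<open>Evaluation homomorphisms\<close>

definition ev :: "('a::comm_ring_1 \<Rightarrow> 'b::comm_ring_1) \<Rightarrow> 'b \<Rightarrow> 'a poly \<Rightarrow> 'b" where
  "ev f s p = poly (map_poly f p) s"

lemma eval2_ev: "eval2 emb s t P = ev (ev emb s) t P"
  by (simp add: eval2_def ev_def[abs_def])

locale ringhom =
  fixes f :: "'a::comm_ring_1 \<Rightarrow> 'b::comm_ring_1"
  assumes hom_0 [simp]: "f 0 = 0" and hom_1 [simp]: "f 1 = 1"
    and hom_add [simp]: "f (a + b) = f a + f b" and hom_mult [simp]: "f (a * b) = f a * f b"
begin

lemma ev_pCons [simp]: "ev f s (pCons a p) = f a + s * ev f s p"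
  by (simp add: ev_def map_poly_pCons)

lemma ev_0 [simp]: "ev f s 0 = 0" by (simp add: ev_def)

lemma ev_add [simp]: "ev f s (p + q) = ev f s p + ev f s q"
  by (induction p q rule: poly_induct2) (simp_all add: algebra_simps)

lemma ev_smult [simp]: "ev f s (smult a p) = f a * ev f s p"
  by (induction p) (simp_all add: algebra_simps)

lemma ev_mult [simp]: "ev f s (p * q) = ev f s p * ev f s q"
  by (induction p) (simp_all add: algebra_simps)

lemma ev_1 [simp]: "ev f s 1 = 1"
  by (simp add: one_pCons)

lemma ringhom_ev: "ringhom (ev f s)"
  by unfold_locales simp_all

lemma ev_sum: "ev f s p = (\<Sum>i\<le>degree p. f (coeff p i) * s ^ i)"
proof -
  have "degree (map_poly f p) \<le> degree p" by (rule degree_le) (simp add: coeff_map_poly coeff_eq_0)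
  then have "ev f s p = (\<Sum>i\<le>degree p. coeff (map_poly f p) i * s ^ i)"
    unfolding ev_def poly_altdef by (intro sum.mono_neutral_left) (auto simp: coeff_eq_0)
  then show ?thesis by (simp add: coeff_map_poly)
qed

end

section \<open>Valued fields containing \<open>C(q^(1/2))\<close> as constants\<close>

text \<open>
  A valuation that is trivial on \<open>C(s)\<close>, where \<open>s\<close> plays the role of \<open>q^(1/2)\<close>.
\<close>
locale scalar_val = val_field v + emb: ringhom emb for v :: "'f::field \<Rightarrow> int" and emb :: "complex \<Rightarrow> 'f" +
  fixes s :: 'f
  assumes inner: "c \<noteq> 0 \<Longrightarrow> ev emb s c \<noteq> 0 \<and> v (ev emb s c) = 0"
begin

abbreviation "q \<equiv> s\<^sup>2"

lemma s_val: "s \<noteq> 0" "v s = 0"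
  using inner[of "[:0, 1:]"] by auto

lemma q_val: "q \<noteq> 0" "v q = 0"
  using s_val by (auto simp: v_power)

lemma q_power_minus_1: assumes "m > 0" shows "q ^ m - 1 \<noteq> 0" "v (q ^ m - 1) = 0"
proof -
  interpret I: ringhom "ev emb s" by (rule emb.ringhom_ev)
  define P :: "complex poly" where "P = [:0,1:] ^ (2 * m) + (-1)"
  have pw: "ev emb s (c ^ k) = ev emb s c ^ k" for c k by (induction k) simp_all
  have "emb (-1) = -1" using emb.hom_add[of "-1" 1] by (simp add: add_eq_0_iff2 del: emb.hom_add)
  then have "ev emb s (-1) = -1" by (simp add: ev_def one_pCons map_poly_pCons)
  then have e: "ev emb s P = q ^ m - 1" unfolding P_def emb.ev_add pw by (simp add: power_mult)
  have "poly P 0 = -1" using assms by (simp add: P_def poly_power)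
  then have "P \<noteq> 0" by auto
  then show "q ^ m - 1 \<noteq> 0" "v (q ^ m - 1) = 0" using inner[of P] e by auto
qed

lemma q_no_root: "m > 0 \<Longrightarrow> q ^ m \<noteq> 1"
  using q_power_minus_1[of m] by auto

definition qn :: "int \<Rightarrow> 'f" where "qn m = (q powi m - q powi (- m)) / (q - inverse q)"

lemma qn_val: assumes "m > 0" shows "qn m \<noteq> 0" "v (qn m) = 0"
proof -
  obtain k where k: "m = int k" "k > 0" using assms by (metis pos_int_cases)
  have 1: "q powi m - q powi (- m) = inverse (q ^ k) * (q ^ (2 * k) - 1)"
    using q_val by (simp add: k power_int_minus field_simps power_mult[symmetric] power_add[symmetric] flip: mult_2)
  have 2: "q - inverse q = inverse q * (q ^ 2 - 1)"
    using q_val by (simp add: field_simps power2_eq_square)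
  have "q ^ (2 * k) - 1 \<noteq> 0" "v (q ^ (2 * k) - 1) = 0" "q ^ 2 - 1 \<noteq> 0" "v (q ^ 2 - 1) = 0"
    using q_power_minus_1[of "2 * k"] q_power_minus_1[of 2] k by auto
  then show "qn m \<noteq> 0" "v (qn m) = 0" unfolding qn_def 1 2 using q_val
    by (simp_all add: v_divide v_mult v_inverse v_power del: power_mult)
qed

text \<open>
  As \<open>t\<close> has positive valuation and the coefficients have valuation zero, the term of lowest degree
  dominates.
\<close>
lemma eval2_nz:
  assumes "v t > 0" "t \<noteq> 0" "P \<noteq> 0"
  shows "eval2 emb s t P \<noteq> 0"
proof -
  interpret I: ringhom "ev emb s" by (rule emb.ringhom_ev)
  \<comment> \<open>the lowest term of \<open>P\<close>, which dominates\<close>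
  define j where "j = (LEAST j. coeff P j \<noteq> 0)"
  have j: "coeff P j \<noteq> 0" unfolding j_def
    using assms(3) by (metis (mono_tags, lifting) LeastI_ex leading_coeff_0_iff)
  have jmin: "coeff P i = 0" if "i < j" for i using that not_less_Least unfolding j_def by blast
  have vt: "ev emb s (coeff P i) * t ^ i \<noteq> 0" "v (ev emb s (coeff P i) * t ^ i) = int i * v t" if "coeff P i \<noteq> 0" for i
    using inner[OF that] assms by (simp_all add: v_mult v_power)
  have "(\<Sum>i\<le>degree P. ev emb s (coeff P i) * t ^ i) \<noteq> 0 \<and> v (\<Sum>i\<le>degree P. ev emb s (coeff P i) * t ^ i) = v (ev emb s (coeff P j) * t ^ j)"
  proof (rule v_dominant)
    show "j \<in> {..degree P}" using j le_degree by auto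
    fix i assume "i \<noteq> j" "ev emb s (coeff P i) * t ^ i \<noteq> 0"
    then have c: "coeff P i \<noteq> 0" by auto
    then have "i > j" using jmin \<open>i \<noteq> j\<close> by (meson linorder_neqE_nat)
    then show "v (ev emb s (coeff P j) * t ^ j) < v (ev emb s (coeff P i) * t ^ i)"
      unfolding vt[OF j] vt[OF c] using assms by simp
  qed (use vt[OF j] in auto)
  then show ?thesis unfolding eval2_ev I.ev_sum by simp
qed

end

section \<open>The two fields\<close>

definition embL :: "complex \<Rightarrow> lser" where "embL c = fls_const (fls_const c)"
definition sL :: lser where "sL = fls_const qhs"

lemma evalL_eq: "evalL = eval2 embL sL zL"
  by (simp add: evalL_def embL_def[abs_def] sL_def)

interpretation embL: ringhom embL
  by unfold_locales (simp_all add: embL_def fls_plus_const)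

lemma innerL: "ev embL sL c = fls_const (fps_to_fls (fps_of_poly c))"
proof (induction c)
  case (pCons a p)
  have "fps_to_fls (fps_of_poly (pCons a p)) = fls_const a + qhs * fps_to_fls (fps_of_poly p)"
    by (simp add: fps_of_poly_pCons qhs_def fls_times_fps_to_fls)
  then show ?case unfolding embL.ev_pCons pCons.IH by (simp add: embL_def sL_def fls_plus_const)
qed simp

interpretation L: scalar_val "fls_subdegree :: lser \<Rightarrow> int" embL sL
proof unfold_locales
  fix a b :: lser assume "a \<noteq> 0" "b \<noteq> 0"
  then show "fls_subdegree (a * b) = fls_subdegree a + fls_subdegree b" by simp
  assume "a + b \<noteq> 0"
  then show "min (fls_subdegree a) (fls_subdegree b) \<le> fls_subdegree (a + b)" by (rule fls_plus_subdegree)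
next
  fix c :: "complex poly" assume "c \<noteq> 0"
  then show "ev embL sL c \<noteq> 0 \<and> fls_subdegree (ev embL sL c) = 0" by (simp add: innerL)
qed

text \<open>Minus the degree in \<open>y\<close>, the outermost variable of the polynomials.\<close>
definition vK :: "gfield \<Rightarrow> int" where
  "vK r = (SOME d. \<exists>a b. a \<noteq> 0 \<and> b \<noteq> 0 \<and> r = Fract a b \<and> d = int (degree b) - int (degree a))"

lemma vK_Fract: assumes "a \<noteq> 0" "b \<noteq> 0" shows "vK (Fract a b) = int (degree b) - int (degree a)"
proof -
  have "\<exists>d. \<exists>a' b'. a' \<noteq> 0 \<and> b' \<noteq> 0 \<and> Fract a b = Fract a' b' \<and> d = int (degree b') - int (degree a')" using assms by blast
  from someI_ex[OF this] obtain a' b' where h: "a' \<noteq> 0" "b' \<noteq> 0" "Fract a b = Fract a' b'" "vK (Fract a b) = int (degree b') - int (degree a')"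
    unfolding vK_def by blast
  then have "a * b' = a' * b" using assms by (simp add: eq_fract)
  then have "degree a + degree b' = degree a' + degree b" using assms h by (metis degree_mult_eq)
  then show ?thesis using h(4) by linarith
qed

interpretation embK: ringhom cK
proof
  have "[:[:[:1 :: complex:]:]:] = 1" by (simp add: one_pCons)
  then show "cK 1 = 1" by (simp add: cK_def)
  show "cK (a + b) = cK a + cK b" "cK (a * b) = cK a * cK b" for a b
    by (simp_all add: cK_def mult.commute flip: to_fract_add to_fract_mult)
qed (simp add: cK_def)

lemma innerK: "ev cK qhK c = to_fract [:[:c:]:]"
proof (induction c)
  case (pCons a p)
  then show ?case unfolding embK.ev_pCons pCons.IH by (simp add: cK_def qhK_def flip: to_fract_add to_fract_mult)
qed simp

interpretation K: scalar_val vK cK qhK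
proof unfold_locales
  fix a b :: gfield assume nz: "a \<noteq> 0" "b \<noteq> 0"
  obtain n d where a: "a = Fract n d" "d \<noteq> 0" by (cases a) auto
  obtain n' d' where b: "b = Fract n' d'" "d' \<noteq> 0" by (cases b) auto
  have nn: "n \<noteq> 0" "n' \<noteq> 0" using nz a b by (auto simp: Zero_fract_def eq_fract)
  show "vK (a * b) = vK a + vK b" using a b nn by (simp add: vK_Fract degree_mult_eq)
  assume s: "a + b \<noteq> 0"
  have ab: "a + b = Fract (n * d' + n' * d) (d * d')" using a b by simp
  have nz': "n * d' + n' * d \<noteq> 0" using s ab by (auto simp: Zero_fract_def eq_fract)
  have "degree (n * d' + n' * d) \<le> max (degree (n * d')) (degree (n' * d))" by (rule degree_add_le_max)
  then show "min (vK a) (vK b) \<le> vK (a + b)"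
    using a b nn nz' by (simp add: ab vK_Fract degree_mult_eq)
next
  fix c :: "complex poly" assume "c \<noteq> 0"
  then show "ev cK qhK c \<noteq> 0 \<and> vK (ev cK qhK c) = 0" by (simp add: innerK vK_Fract to_fract_def Zero_fract_def eq_fract)
qed

lemma vK_xyz: "xK \<noteq> 0" "yK \<noteq> 0" "zK \<noteq> 0" "vK xK = 0" "vK yK = -1" "vK zK = 1"
proof -
  show 1: "xK \<noteq> 0" "yK \<noteq> 0" by (simp_all add: xK_def yK_def)
  then show "zK \<noteq> 0" by (simp add: zK_def)
  show 2: "vK xK = 0" "vK yK = -1" by (simp_all add: xK_def yK_def to_fract_def vK_Fract)
  then show "vK zK = 1" using 1 by (simp add: zK_def K.v_divide)
qed

lemma evalL_nz: "P \<noteq> 0 \<Longrightarrow> evalL P \<noteq> 0"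
  unfolding evalL_eq by (rule L.eval2_nz) (simp_all add: zL_def)

lemma evalK_nz: "P \<noteq> 0 \<Longrightarrow> evalK P \<noteq> 0"
  unfolding evalK_def by (rule K.eval2_nz) (simp_all add: vK_xyz)

interpretation evalL: ringhom evalL
proof -
  interpret I: ringhom "ev embL sL" by (rule embL.ringhom_ev)
  show "ringhom evalL" using I.ringhom_ev[of zL] unfolding evalL_eq eval2_ev[abs_def] .
qed

interpretation evalK: ringhom evalK
proof -
  interpret I: ringhom "ev cK qhK" by (rule embK.ringhom_ev)
  show "ringhom evalK" using I.ringhom_ev[of zK] unfolding evalK_def eval2_ev[abs_def] .
qed

section \<open>Rational values\<close>

text \<open>
  The evaluations in both fields are injective, so both sides of \<open>P/Q = P'/Q'\<close> come from one identity
  between polynomials.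
\<close>
lemma expansion_unique:
  assumes "expansion_of f r" "expansion_of f r'"
  shows "r = r'"
proof -
  obtain P Q where 1: "Q \<noteq> 0" "evalL Q * f = evalL P" "r = evalK P / evalK Q" using assms(1) unfolding expansion_of_def by blast
  obtain P' Q' where 2: "Q' \<noteq> 0" "evalL Q' * f = evalL P'" "r' = evalK P' / evalK Q'" using assms(2) unfolding expansion_of_def by blast
  have "evalL (Q' * P) = evalL (Q * P')"
    unfolding evalL.hom_mult 1(2)[symmetric] 2(2)[symmetric] by (simp add: mult_ac)
  then have "evalL (Q' * P + (- 1) * (Q * P')) = 0"
  proof -
    assume e: "evalL (Q' * P) = evalL (Q * P')"
    have "evalL (-1) + evalL 1 = 0" unfolding evalL.hom_add[symmetric] by simp
    then have "evalL (-1) = -1" by (simp add: add_eq_0_iff2)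
    then show ?thesis unfolding evalL.hom_add evalL.hom_mult[of "-1"] e by simp
  qed
  then have "Q' * P + (- 1) * (Q * P') = 0" using evalL_nz by blast
  then have "Q' * P = Q * P'" by simp
  then have "evalK Q' * evalK P = evalK Q * evalK P'" by (metis evalK.hom_mult)
  then show ?thesis unfolding 1(3) 2(3) using evalK_nz[OF 1(1)] evalK_nz[OF 2(1)] by (simp add: field_simps)
qed

lemma rat_valueI: "expansion_of f r \<Longrightarrow> rat_value f = r"
  unfolding rat_value_def using expansion_unique by blast

lemma rat_value_expansion: "rational_series f \<Longrightarrow> expansion_of f (rat_value f)"
  unfolding rational_series_def using rat_valueI by metis

lemma expansion_eval: "expansion_of (evalL P) (evalK P)"
  unfolding expansion_of_def by (rule exI[of _ P], rule exI[of _ 1]) simp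

lemma expansion_add:
  assumes "expansion_of f r" "expansion_of g r'" shows "expansion_of (f + g) (r + r')"
proof -
  obtain P Q where 1: "Q \<noteq> 0" "evalL Q * f = evalL P" "r = evalK P / evalK Q" using assms(1) unfolding expansion_of_def by blast
  obtain P' Q' where 2: "Q' \<noteq> 0" "evalL Q' * g = evalL P'" "r' = evalK P' / evalK Q'" using assms(2) unfolding expansion_of_def by blast
  have "evalL (Q * Q') * (f + g) = evalL Q' * (evalL Q * f) + evalL Q * (evalL Q' * g)" by (simp add: algebra_simps)
  also have "\<dots> = evalL (Q' * P + Q * P')" unfolding 1(2) 2(2) by simp
  finally show ?thesis unfolding expansion_of_def 1(3) 2(3) using 1(1) 2(1) evalK_nz[OF 1(1)] evalK_nz[OF 2(1)]
    by (intro exI[of _ "Q' * P + Q * P'"] exI[of _ "Q * Q'"]) (simp add: field_simps)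
qed

lemma expansion_mult:
  assumes "expansion_of f r" "expansion_of g r'" shows "expansion_of (f * g) (r * r')"
proof -
  obtain P Q where 1: "Q \<noteq> 0" "evalL Q * f = evalL P" "r = evalK P / evalK Q" using assms(1) unfolding expansion_of_def by blast
  obtain P' Q' where 2: "Q' \<noteq> 0" "evalL Q' * g = evalL P'" "r' = evalK P' / evalK Q'" using assms(2) unfolding expansion_of_def by blast
  have "evalL (Q * Q') * (f * g) = (evalL Q * f) * (evalL Q' * g)" by (simp add: algebra_simps)
  also have "\<dots> = evalL (P * P')" unfolding 1(2) 2(2) by simp
  finally show ?thesis unfolding expansion_of_def 1(3) 2(3) using 1(1) 2(1)
    by (intro exI[of _ "P * P'"] exI[of _ "Q * Q'"]) simp
qed

lemma expansion_inverse:
  assumes "expansion_of f r" shows "expansion_of (inverse f) (inverse r)"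
proof (cases "f = 0")
  case True
  have "expansion_of 0 0" using expansion_eval[of 0] by simp
  then show ?thesis using True expansion_unique[OF assms] by simp
next
  case False
  obtain P Q where 1: "Q \<noteq> 0" "evalL Q * f = evalL P" "r = evalK P / evalK Q" using assms(1) unfolding expansion_of_def by blast
  have "P \<noteq> 0" using 1 False evalL_nz[OF 1(1)] by auto
  moreover have "evalL P * inverse f = evalL Q" unfolding 1(2)[symmetric] using False by simp
  ultimately show ?thesis unfolding expansion_of_def 1(3) by (intro exI[of _ Q] exI[of _ P]) simp
qed

lemma rat_add: "rational_series f \<Longrightarrow> rational_series g \<Longrightarrow> rational_series (f + g) \<and> rat_value (f + g) = rat_value f + rat_value g"
  using expansion_add[OF rat_value_expansion rat_value_expansion] rat_valueI unfolding rational_series_def by blast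

lemma rat_mult: "rational_series f \<Longrightarrow> rational_series g \<Longrightarrow> rational_series (f * g) \<and> rat_value (f * g) = rat_value f * rat_value g"
  using expansion_mult[OF rat_value_expansion rat_value_expansion] rat_valueI unfolding rational_series_def by blast

lemma rat_inverse: "rational_series f \<Longrightarrow> rational_series (inverse f) \<and> rat_value (inverse f) = inverse (rat_value f)"
  using expansion_inverse[OF rat_value_expansion] rat_valueI unfolding rational_series_def by blast

lemma rat_eval: "rational_series (evalL P) \<and> rat_value (evalL P) = evalK P"
  using expansion_eval rat_valueI unfolding rational_series_def by blast

lemma rat_0 [simp]: "rational_series 0" "rat_value 0 = 0" using rat_eval[of 0] by auto
lemma rat_1 [simp]: "rational_series 1" "rat_value 1 = 1" using rat_eval[of 1] by auto

lemma rat_minus: "rational_series f \<Longrightarrow> rational_series (- f) \<and> rat_value (- f) = - rat_value f"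
proof -
  assume f: "rational_series f"
  have "evalL (-1) + evalL 1 = 0" "evalK (-1) + evalK 1 = 0"
    unfolding evalL.hom_add[symmetric] evalK.hom_add[symmetric] by simp_all
  then have "evalL (-1) = -1" "evalK (-1) = -1" by (simp_all add: add_eq_0_iff2)
  then show ?thesis using rat_mult[OF conjunct1[OF rat_eval[of "-1"]] f] rat_eval[of "-1"] by simp
qed

lemma rat_diff: "rational_series f \<Longrightarrow> rational_series g \<Longrightarrow> rational_series (f - g) \<and> rat_value (f - g) = rat_value f - rat_value g"
  using rat_add[of f "- g"] rat_minus[of g] by simp

lemma rat_divide: "rational_series f \<Longrightarrow> rational_series g \<Longrightarrow> rational_series (f / g) \<and> rat_value (f / g) = rat_value f / rat_value g"
  using rat_mult[of f "inverse g"] rat_inverse[of g] by (simp add: divide_inverse)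

lemma rat_power: "rational_series f \<Longrightarrow> rational_series (f ^ m) \<and> rat_value (f ^ m) = rat_value f ^ m"
  by (induction m) (use rat_mult[of f] in auto)

lemma rat_powi: "rational_series f \<Longrightarrow> rational_series (f powi m) \<and> rat_value (f powi m) = rat_value f powi m"
  unfolding power_int_def using rat_power[of f] rat_power[of "inverse f"] rat_inverse[of f] by (auto simp: power_inverse)

lemma rat_z: "rational_series zL" "rat_value zL = zK"
  using rat_eval[of "[:0, 1:]"] by (auto simp: evalL_def evalK_def eval2_def map_poly_pCons)

lemma rat_s: "rational_series sL" "rat_value sL = qhK"
  using rat_eval[of "[:[:0, 1:]:]"] by (auto simp: evalL_def evalK_def eval2_def map_poly_pCons sL_def)

lemma rat_emb: "rational_series (embL c)" "rat_value (embL c) = cK c"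
  using rat_eval[of "[:[:c:]:]"] by (auto simp: evalL_def evalK_def eval2_def map_poly_pCons embL_def)

lemma rational_subfield: "subfield_module {f. rational_series f} {f. rational_series f}"
  by unfold_locales (auto simp: rat_add rat_diff rat_mult rat_inverse)

section \<open>Matrix elements as series\<close>

text \<open>In the sums over paths at most one path contributes.\<close>
lemma sum'_at_most_one:
  assumes "\<And>x. x \<in> A \<Longrightarrow> g x \<noteq> 0 \<Longrightarrow> x = x0"
  shows "sum' g A = (if x0 \<in> A then g x0 else 0)"
proof (cases "x0 \<in> A \<and> g x0 \<noteq> 0")
  case True
  then have "{x \<in> A. g x \<noteq> 0} = {x0}" using assms by auto
  then show ?thesis using True by (simp add: sum.G_def)
next
  case False
  then have e: "{x \<in> A. g x \<noteq> 0} = {}" using assms by auto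
  show ?thesis unfolding sum.G_def e using False by auto
qed

lemma qs_pow: "qs ^ m = fps_to_fls (fps_X ^ (2 * m))"
  by (simp add: qs_def qhs_def fps_to_fls_power power_mult[symmetric])

interpretation Q: generic_q qs
proof
  show "qs \<noteq> 0" by (simp add: qs_def qhs_def)
  fix m :: nat assume "m > 0"
  then have "fls_subdegree (qs ^ m) \<noteq> fls_subdegree (1 :: complex fls)"
    by (simp add: qs_def qhs_def fls_subdegree_pow)
  then show "qs ^ m \<noteq> 1" by metis
qed

text \<open>
  The value of \<open>p\<close> in the field of Laurent series in \<open>q^(1/2)\<close>.
\<close>
definition ps :: "complex fls" where "ps = fls_const \<i> * inverse qhs"

lemma ps_sq: "ps\<^sup>2 = - inverse qs"
proof -
  have "ps\<^sup>2 = (fls_const \<i>)\<^sup>2 * (inverse qhs)\<^sup>2" by (simp add: ps_def power_mult_distrib)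
  also have "(fls_const \<i>)\<^sup>2 = (-1 :: complex fls)" by (simp add: power2_eq_square)
  finally show ?thesis by (simp add: qs_def power_inverse)
qed

definition int_label :: "label \<Rightarrow> nat \<Rightarrow> int" where "int_label m = (\<lambda>k. int (m k))"

locale qmodel =
  fixes n :: nat and eps :: "nat \<Rightarrow> nat"
  assumes eps01: "k \<in> {1..n} \<Longrightarrow> eps k \<le> 1" and n_pos: "n \<ge> 1"
begin

sublocale site_hops qs n eps ps by unfold_locales

lemma scrS_prod_path_prod: "scrS_prod n eps a b i j c = path_prod (int_label a) (int_label b) (int_label i) (int_label j) (\<lambda>k. int (c k))"
  unfolding scrS_prod_def path_prod_def site_fac_def int_label_def site_elem_def by (rule prod.cong) simp_all

lemma total_int_label: "total (int_label m) = int (lsum n m)"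
  by (simp add: total_def int_label_def lsum_def)

lemma site_fac_nz: "path_prod a b i j c \<noteq> 0 \<Longrightarrow> k \<in> {1..n} \<Longrightarrow> a k + b k = i k + j k \<and> b k + c (k - 1) = j k + c k"
proof -
  assume nz: "path_prod a b i j c \<noteq> 0" and k: "k \<in> {1..n}"
  then have "site_fac a b i j c k \<noteq> 0" unfolding path_prod_def by (auto simp: prod_zero_iff)
  then show ?thesis unfolding site_fac_def using site_elem_weight eps01[OF k] by blast
qed

lemma path_determined:
  assumes "path_prod a b i j c \<noteq> 0" "k \<le> n"
  shows "c k = carry b j (c 0) k"
  using assms(2)
proof (induction k)
  case (Suc k)
  then have "b (Suc k) + c k = j (Suc k) + c (Suc k)" using site_fac_nz[OF assms(1), of "Suc k"] by simp
  then show ?case using Suc by (simp add: carry_def)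
qed simp

text \<open>
  Only the path determined by \<open>c_0\<close> can contribute.  If it takes negative values it is not in the range of summation,
  but then the product on the right vanishes, too.
\<close>
lemma path_sum:
  assumes g: "\<And>c. g c \<noteq> 0 \<Longrightarrow> scrS_prod n eps a b i j c \<noteq> 0"
    and P: "\<And>c. (\<And>k. k \<le> n \<Longrightarrow> int (c k) = carry (int_label b) (int_label j) (int c0) k) \<Longrightarrow> c 0 = c0 \<Longrightarrow> P c"
    and v: "\<And>c. (\<And>k. k \<le> n \<Longrightarrow> int (c k) = carry (int_label b) (int_label j) (int c0) k) \<Longrightarrow> g c = w * path_prod (int_label a) (int_label b) (int_label i) (int_label j) (carry (int_label b) (int_label j) (int c0))"
  shows "sum' g {c. c 0 = c0 \<and> P c \<and> (\<forall>k>n. c k = 0)} = w * path_prod (int_label a) (int_label b) (int_label i) (int_label j) (carry (int_label b) (int_label j) (int c0))"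
proof -
  \<comment> \<open>the only possible path\<close>
  define C where "C = carry (int_label b) (int_label j) (int c0)"
  define c' where "c' = (\<lambda>k. if k \<le> n then nat (C k) else 0)"
  have C0: "C 0 = int c0" by (simp add: C_def)
  have uni: "c = c'" if c: "c \<in> {c. c 0 = c0 \<and> P c \<and> (\<forall>k>n. c k = 0)}" "g c \<noteq> 0" for c
  proof
    fix k
    have "int (c k) = C k" if "k \<le> n"
      using path_determined[OF g[OF c(2), unfolded scrS_prod_path_prod] that] c(1) by (simp add: C_def)
    then show "c k = c' k" using c(1) by (cases "k \<le> n") (auto simp: c'_def)
  qed
  have S: "sum' g {c. c 0 = c0 \<and> P c \<and> (\<forall>k>n. c k = 0)} = (if c' \<in> {c. c 0 = c0 \<and> P c \<and> (\<forall>k>n. c k = 0)} then g c' else 0)"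
    by (rule sum'_at_most_one) (rule uni)
  show ?thesis
  proof (cases "\<forall>k\<le>n. C k \<ge> 0")
    case True
    then have c': "int (c' k) = C k" if "k \<le> n" for k using that by (simp add: c'_def)
    have "c' \<in> {c. c 0 = c0 \<and> P c \<and> (\<forall>k>n. c k = 0)}"
      using P[of c'] c' C0 by (auto simp: C_def c'_def)
    then show ?thesis unfolding S using v[of c'] c' by (simp add: C_def)
  next
    case False
    then obtain k where k: "k \<le> n" "C k < 0" by auto
    then have "k \<noteq> 0" using C0 by (cases "k = 0") auto
    then have z: "path_prod (int_label a) (int_label b) (int_label i) (int_label j) C = 0" using path_prod_neg[of k C] k by auto
    have "g c' = 0 \<or> c' \<notin> {c. c 0 = c0 \<and> P c \<and> (\<forall>k>n. c k = 0)}"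
    proof (rule ccontr)
      assume "\<not> ?thesis"
      then have "scrS_prod n eps a b i j c' \<noteq> 0" "c' 0 = c0" using g by auto
      then have "int (c' k) = C k" using path_determined[of "int_label a" "int_label b" "int_label i" "int_label j" "\<lambda>k. int (c' k)" k] k by (simp add: scrS_prod_path_prod C_def)
      then show False using k by simp
    qed
    then show ?thesis unfolding S C_def[symmetric] z by auto
  qed
qed

lemma Str_coeff_path_prod:
  assumes "lsum n b = lsum n j"
  shows "Str_coeff n eps a b i j c0 = path_prod (int_label a) (int_label b) (int_label i) (int_label j) (carry (int_label b) (int_label j) (int c0))"
proof -
  have "sum' (scrS_prod n eps a b i j) {c. c 0 = c0 \<and> c n = c0 \<and> (\<forall>k>n. c k = 0)} = 1 * path_prod (int_label a) (int_label b) (int_label i) (int_label j) (carry (int_label b) (int_label j) (int c0))"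
  proof (rule path_sum)
    fix c :: "nat \<Rightarrow> nat" assume c: "\<And>k. k \<le> n \<Longrightarrow> int (c k) = carry (int_label b) (int_label j) (int c0) k"
    have "int (c n) = int c0" using c[of n] assms by (simp add: carry_n total_int_label)
    then show "c n = c0" by simp
    show "scrS_prod n eps a b i j c = 1 * path_prod (int_label a) (int_label b) (int_label i) (int_label j) (carry (int_label b) (int_label j) (int c0))"
      unfolding scrS_prod_path_prod mult_1_left by (rule path_prod_cong) (rule c)
  qed
  then show ?thesis by (simp add: Str_coeff_def)
qed

text \<open>\<open>(q^2)_c/(q)_c = (-q)_c\<close>\<close>
definition w0 :: "int \<Rightarrow> complex fls" where "w0 d = (if d < 0 then 0 else qpoch (qs\<^sup>2) (qs\<^sup>2) (nat d) / qpoch qs qs (nat d))"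
definition w1 :: "int \<Rightarrow> complex fls" where "w1 d = (if d < 0 then 0 else 1 / qpoch qs qs (nat d))"

lemma S11_coeff_path_prod:
  "S11_coeff n eps a b i j c0 = w0 (int c0) * w1 (carry (int_label b) (int_label j) (int c0) n) * path_prod (int_label a) (int_label b) (int_label i) (int_label j) (carry (int_label b) (int_label j) (int c0))"
proof -
  let ?g = "\<lambda>c. qpoch (qs^2) (qs^2) c0 / (qpoch qs qs c0 * qpoch qs qs (c n)) * scrS_prod n eps a b i j c"
  have "sum' ?g {c. c 0 = c0 \<and> True \<and> (\<forall>k>n. c k = 0)} = w0 (int c0) * w1 (carry (int_label b) (int_label j) (int c0) n) * path_prod (int_label a) (int_label b) (int_label i) (int_label j) (carry (int_label b) (int_label j) (int c0))"
  proof (rule path_sum)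
    fix c :: "nat \<Rightarrow> nat" assume c: "\<And>k. k \<le> n \<Longrightarrow> int (c k) = carry (int_label b) (int_label j) (int c0) k"
    have "path_prod (int_label a) (int_label b) (int_label i) (int_label j) (\<lambda>k. int (c k)) = path_prod (int_label a) (int_label b) (int_label i) (int_label j) (carry (int_label b) (int_label j) (int c0))"
      by (rule path_prod_cong) (rule c)
    then show "?g c = w0 (int c0) * w1 (carry (int_label b) (int_label j) (int c0) n) * path_prod (int_label a) (int_label b) (int_label i) (int_label j) (carry (int_label b) (int_label j) (int c0))"
      unfolding scrS_prod_path_prod c[OF order.refl, symmetric] by (simp add: w0_def w1_def)
  qed auto
  then show ?thesis by (simp add: S11_coeff_def)
qed

lemma qpoch_qs: "qpoch qs qs (Suc m) = qpoch qs qs m * (1 - qs ^ Suc m)" "qpoch qs qs m \<noteq> 0"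
proof -
  show s: "qpoch qs qs (Suc m) = qpoch qs qs m * (1 - qs ^ Suc m)" for m by (simp add: qpoch_Suc)
  show "qpoch qs qs m \<noteq> 0" by (induction m) (use Q.q1 in \<open>auto simp: s simp del: power_Suc\<close>)
qed

sublocale B: site_hops_B qs n eps ps w0 w1
proof
  show "ps\<^sup>2 = - inverse qs" by (rule ps_sq)
  show "1 \<le> n" by (rule n_pos)
  show "w0 d = 0" if "d < 0" for d using that by (simp add: w0_def)
  show "w0 (d + 1) = (1 + qs powi (d + 1)) * w0 d" if d: "0 \<le> d" for d
  proof -
    obtain m where m: "d = int m" using d by (metis nonneg_eq_int)
    have p: "qs powi (int m + 1) = qs ^ Suc m" by (metis of_nat_Suc power_int_of_nat add.commute)
    have e: "1 - qs ^ (2 * Suc m) = (1 - qs ^ Suc m) * (1 + qs ^ Suc m)"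
      unfolding mult.commute[of 2] power_mult by (simp add: power2_eq_square algebra_simps)
    have "w0 (d + 1) = qpoch (qs\<^sup>2) (qs\<^sup>2) m * ((1 - qs ^ Suc m) * (1 + qs ^ Suc m)) / (qpoch qs qs m * (1 - qs ^ Suc m))"
      using m by (simp add: w0_def nat_add_distrib Q.po_Suc qpoch_qs e del: power_Suc mult_Suc_right)
    also have "\<dots> = (1 + qs ^ Suc m) * w0 d"
      using Q.q1[of m] m by (simp add: w0_def del: power_Suc)
    finally show ?thesis unfolding m p .
  qed
  show "w1 d = (1 - qs powi (d + 1)) * w1 (d + 1)" for d
  proof -
    consider "d < -1" | "d = -1" | "d \<ge> 0" by linarith
    then show ?thesis
    proof cases
      case 3
      obtain m where m: "d = int m" using 3 by (metis nonneg_eq_int)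
      have p: "qs powi (int m + 1) = qs ^ Suc m" by (metis of_nat_Suc power_int_of_nat add.commute)
      show ?thesis unfolding m p using Q.q1[of m] by (simp add: w1_def nat_add_distrib qpoch_qs del: power_Suc)
    qed (simp_all add: w1_def)
  qed
qed

lemma Str_series: "lsum n b = lsum n j \<Longrightarrow> zseries (Str_coeff n eps a b i j) = trace_series (int_label a) (int_label b) (int_label i) (int_label j)"
  unfolding zseries_def trace_series_def zpower_series_def by (simp add: Str_coeff_path_prod fps_eq_iff)

lemma S11_series: "fls_const (ps powi (total (int_label j) - total (int_label a))) * zseries (S11_coeff n eps a b i j) = B.boundary_series (int_label a) (int_label b) (int_label i) (int_label j)"
  unfolding zseries_def B.boundary_series_def zpower_series_def by (simp add: S11_coeff_path_prod fps_eq_iff)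

lemma Str_weight:
  assumes "lsum n b = lsum n j" "k \<in> {1..n}" "a k + b k \<noteq> i k + j k"
  shows "zseries (Str_coeff n eps a b i j) = 0"
proof -
  have "Str_coeff n eps a b i j c0 = 0" for c0
    using site_fac_nz[of "int_label a" "int_label b" "int_label i" "int_label j" "carry (int_label b) (int_label j) (int c0)", OF _ assms(2)] assms(3)
    unfolding Str_coeff_path_prod[OF assms(1)] int_label_def by (metis of_nat_add of_nat_eq_iff)
  then show ?thesis by (simp add: zseries_def fps_eq_iff)
qed

lemma S11_weight:
  assumes "k \<in> {1..n}" "a k + b k \<noteq> i k + j k"
  shows "zseries (S11_coeff n eps a b i j) = 0"
proof -
  have "S11_coeff n eps a b i j c0 = 0" for c0
    using site_fac_nz[of "int_label a" "int_label b" "int_label i" "int_label j" "carry (int_label b) (int_label j) (int c0)", OF _ assms(1)] assms(2)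
    unfolding S11_coeff_path_prod int_label_def by (metis mult_zero_right of_nat_add of_nat_eq_iff)
  then show ?thesis by (simp add: zseries_def fps_eq_iff)
qed

lemma site_vacuum: "e \<le> 1 \<Longrightarrow> c \<ge> 0 \<Longrightarrow> site_elem e qs 0 0 c 0 0 c = 1"
  using Q.S_0_0[of 0 0 c c] Q.S1_simps(1)[of e c c] by (cases "e = 0") auto

text \<open>
  All sites other than \<open>i0\<close> are empty and contribute 1, so the trace is the diagonal series of one
  boson, which \<open>Q.diag_series_formula\<close> evaluates.
\<close>
lemma norm_boson:
  assumes i0: "i0 \<in> {1..n}" "eps i0 = 0"
  defines "r \<equiv> \<lambda>l. (\<lambda>k. if k = i0 then l else 0) :: label"
  shows "Str_elem n eps l m (r l) (r m) (r l) (r m) = 1"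
proof -
  have c: "Str_coeff n eps (r l) (r m) (r l) (r m) c = fps_nth (Q.diag_series l m) c" for c
  proof -
    have "Str_coeff n eps (r l) (r m) (r l) (r m) c = path_prod (int_label (r l)) (int_label (r m)) (int_label (r l)) (int_label (r m)) (\<lambda>_. int c)"
      unfolding Str_coeff_path_prod[OF HOL.refl] by (rule path_prod_cong) (simp add: carry_def)
    also have "\<dots> = site_fac (int_label (r l)) (int_label (r m)) (int_label (r l)) (int_label (r m)) (\<lambda>_. int c) i0"
      unfolding path_prod_split1[OF i0(1)] using eps01
      by (subst prod.neutral) (auto simp: site_fac_def r_def int_label_def site_vacuum)
    also have "\<dots> = fps_nth (Q.diag_series l m) c" using i0 by (simp add: site_fac_def r_def int_label_def Q.diag_series_def)
    finally show ?thesis .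
  qed
  define A where "A = qs powi (int l - int m)"
  have T: "zseries (Str_coeff n eps (r l) (r m) (r l) (r m)) = fps_to_fls (Q.diag_series l m)"
    unfolding zseries_def c by (simp add: fps_nth_inverse)
  have lin: "1 - fls_const a * zL = fps_to_fls (Q.lin_factor a)" for a
    by (simp add: Q.lin_factor_def zL_def fls_times_fps_to_fls)
  have qLp: "qL powi x = fls_const (qs powi x)" "qL ^ k = fls_const (qs ^ k)" for x k
  proof -
    show 1: "qL ^ k = fls_const (qs ^ k)" for k by (simp add: qL_def fls_const_power)
    show "qL powi x = fls_const (qs powi x)" by (simp add: power_int_def 1 fls_inverse_const flip: fls_const_power) (simp add: qL_def fls_inverse_const fls_const_power)
  qed
  have D: "qpoch (qL powi (int l - int m) * zL) (qL^2) (m + 1) = fps_to_fls (Q.lin_factor A * Q.DP A m)"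
  proof -
    have "qpoch (fls_const A * zL) (qL^2) (Suc k) = fps_to_fls (Q.lin_factor A * Q.DP A k)" for k
    proof (induction k)
      case 0
      show ?case by (simp add: qpoch_Suc lin)
    next
      case (Suc k)
      have f: "fls_const A * zL * (qL^2) ^ Suc k = fls_const (A * qs ^ (2 * Suc k)) * zL"
      proof -
        have 1: "(qL^2) ^ Suc k = fls_const (qs ^ (2 * Suc k))" unfolding power_mult[symmetric] by (rule qLp(2))
        show ?thesis unfolding 1 by (simp only: fls_const_mult_const[symmetric] mult_ac)
      qed
      show ?case unfolding qpoch_Suc[of _ _ "Suc k"] Suc.IH f lin Q.DP_Suc by (simp add: fls_times_fps_to_fls mult.assoc)
    qed
    then show ?thesis by (simp add: qLp A_def)
  qed
  have zz: "zL \<noteq> 0" by (simp add: zL_def)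
  have N: "zL ^ m * qpoch (qL powi (int l - int m + 2) * inverse zL) (qL^2) m = fps_to_fls (Q.NP A m)"
  proof -
    have a2: "qL powi (int l - int m + 2) = fls_const (A * qs\<^sup>2)" unfolding qLp A_def by (simp add: power_int_add)
    have "zL ^ k * qpoch (fls_const (A * qs\<^sup>2) * inverse zL) (qL^2) k = fps_to_fls (Q.NP A k)" for k
    proof (induction k)
      case 0
      show ?case by simp
    next
      case (Suc k)
      have f: "fls_const (A * qs\<^sup>2) * inverse zL * (qL^2) ^ k = fls_const (A * qs ^ (2 * Suc k)) * inverse zL"
      proof -
        have 1: "(qL^2) ^ k = fls_const (qs ^ (2 * k))" unfolding power_mult[symmetric] by (rule qLp(2))
        have 2: "A * qs ^ (2 * Suc k) = A * qs\<^sup>2 * qs ^ (2 * k)" by (simp add: power2_eq_square)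
        show ?thesis unfolding 1 2 by (simp only: fls_const_mult_const[symmetric] mult_ac)
      qed
      have "zL * (1 - fls_const (A * qs ^ (2 * Suc k)) * inverse zL) = fps_to_fls (Q.rev_factor (A * qs ^ (2 * Suc k)))"
        using zz by (simp add: Q.rev_factor_def zL_def right_diff_distrib mult.left_commute del: power_Suc mult_Suc_right)
      then have "zL ^ Suc k * qpoch (fls_const (A * qs\<^sup>2) * inverse zL) (qL^2) (Suc k)
         = (zL ^ k * qpoch (fls_const (A * qs\<^sup>2) * inverse zL) (qL^2) k) * fps_to_fls (Q.rev_factor (A * qs ^ (2 * Suc k)))"
        unfolding qpoch_Suc f by (simp add: mult_ac)
      then show ?case unfolding Suc.IH Q.NP_Suc fls_times_fps_to_fls .
    qed
    then show ?thesis by (simp add: a2)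
  qed
  have nf: "\<not> (\<forall>k\<in>{1..n}. eps k = 1)" using i0 by force
  have Nnz: "fps_to_fls (Q.NP A m) \<noteq> 0" using Q.NP_nz by simp
  have F: "fps_to_fls (Q.diag_series l m) * fps_to_fls (Q.lin_factor A * Q.DP A m) = fps_to_fls (Q.NP A m)"
    unfolding fls_times_fps_to_fls[symmetric] A_def Q.diag_series_formula ..
  have "rho_tr n eps l m = fps_to_fls (Q.lin_factor A * Q.DP A m) / fps_to_fls (Q.NP A m)"
    unfolding rho_tr_def if_not_P[OF nf] D N[symmetric] using zz by (simp add: power_int_minus field_simps)
  then show ?thesis unfolding Str_elem_def T using F Nnz by (simp add: mult.commute)
qed

text \<open>
  A site contributes 1 if it is occupied in both factors or in none, and otherwise \<open>q^c\<close> or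
  \<open>-q^(c+1)\<close>.  There are \<open>|l - m|\<close> sites of the latter kind, all of the same sign type, and the sum over
  \<open>c\<close> is a geometric series.
\<close>
lemma norm_fermion:
  assumes e: "\<forall>k\<in>{1..n}. eps k = 1" and lm: "l \<le> n" "m \<le> n"
  defines "r \<equiv> \<lambda>l. (\<lambda>k. of_bool (n - l < k \<and> k \<le> n)) :: label"
  shows "Str_elem n eps l m (r l) (r m) (r l) (r m) = 1"
proof -
  define x where "x c = (if m \<le> l then qs ^ c else - (qs ^ Suc c))" for c
  define d where "d = (if m \<le> l then l - m else m - l)"
  \<comment> \<open>the sites that are occupied in exactly one of the two factors\<close>
  define J where "J = (if m \<le> l then {n - l<..n - m} else {n - m<..n - l})"
  have c: "Str_coeff n eps (r l) (r m) (r l) (r m) c = x c ^ d" for c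
  proof -
    have "Str_coeff n eps (r l) (r m) (r l) (r m) c = path_prod (int_label (r l)) (int_label (r m)) (int_label (r l)) (int_label (r m)) (\<lambda>_. int c)"
      unfolding Str_coeff_path_prod[OF HOL.refl] by (rule path_prod_cong) (simp add: carry_def)
    also have "\<dots> = (\<Prod>k\<in>{1..n}. if k \<in> J then x c else 1)"
      unfolding path_prod_def
    proof (rule prod.cong)
      fix k assume k: "k \<in> {1..n}"
      then have ek: "eps k \<noteq> 0" using e by simp
      have p: "qs powi int c = qs ^ c" "qs powi (int c + 1) = qs ^ Suc c"
        by (simp_all add: Q.pws)
      show "site_fac (int_label (r l)) (int_label (r m)) (int_label (r l)) (int_label (r m)) (\<lambda>_. int c) k = (if k \<in> J then x c else 1)"
        using k lm Q.S1_simps[OF ek, of "int c" "int c"] p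
        by (cases "n - l < k"; cases "n - m < k") (auto simp: site_fac_def int_label_def r_def J_def x_def)
    qed simp
    also have "\<dots> = (\<Prod>k\<in>J. x c)"
      by (rule prod.mono_neutral_cong_right) (auto simp: J_def)
    also have "\<dots> = x c ^ d" using lm by (auto simp: J_def d_def)
    finally show ?thesis .
  qed
  \<comment> \<open>the product of the site elements at \<open>c = 0\<close>\<close>
  define K where "K = (if m \<le> l then 1 else (- qs) ^ d)"
  have xd: "x c ^ d = K * (qs ^ d) ^ c" for c
  proof (cases "m \<le> l")
    case True
    then show ?thesis by (simp add: x_def K_def power_mult[symmetric] mult.commute)
  next
    case False
    have "- (qs ^ Suc c) = (- qs) * qs ^ c" by simp
    then have "x c ^ d = (- qs) ^ d * (qs ^ c) ^ d" using False by (simp only: x_def if_False power_mult_distrib)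
    then show ?thesis using False by (simp add: K_def power_mult[symmetric] mult.commute)
  qed
  have T: "zseries (Str_coeff n eps (r l) (r m) (r l) (r m)) = fls_const K * fps_to_fls (Abs_fps (\<lambda>c. (qs ^ d) ^ c))"
  proof -
    have "Abs_fps (Str_coeff n eps (r l) (r m) (r l) (r m)) = fps_const K * Abs_fps (\<lambda>c. (qs ^ d) ^ c)"
      by (simp add: fps_eq_iff c xd)
    then show ?thesis unfolding zseries_def by (simp add: fls_times_fps_to_fls)
  qed
  have L: "1 - qL powi \<bar>int l - int m\<bar> * zL = fps_to_fls (Q.lin_factor (qs ^ d))"
  proof -
    have "\<bar>int l - int m\<bar> = int d" by (auto simp: d_def)
    then have "qL powi \<bar>int l - int m\<bar> = fls_const (qs ^ d)" by (simp add: qL_def fls_const_power)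
    then show ?thesis by (simp add: Q.lin_factor_def zL_def fls_times_fps_to_fls)
  qed
  have K: "(- qL) powi (- max (int m - int l) 0) * fls_const K = 1"
  proof (cases "m \<le> l")
    case True
    then show ?thesis by (simp add: K_def)
  next
    case False
    then have "- max (int m - int l) 0 = - int d" by (simp add: d_def)
    moreover have "fls_const K = (- qL) ^ d" using False by (simp add: K_def qL_def fls_const_power flip: fls_const_uminus)
    moreover have "- qL \<noteq> 0" by (simp add: qL_def)
    ultimately show ?thesis by (simp add: power_int_minus)
  qed
  have G: "fps_to_fls (Q.lin_factor (qs ^ d)) * fps_to_fls (Abs_fps (\<lambda>c. (qs ^ d) ^ c)) = 1"
    unfolding fls_times_fps_to_fls[symmetric] Q.geometric_fps by simp
  show ?thesis unfolding Str_elem_def T rho_tr_def if_P[OF e] L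
  proof -
    have "a * g * (k * f) = (a * k) * (g * f)" for a g k f :: lser by (simp add: mult_ac)
    then show "(- qL) powi (- max (int m - int l) 0) * fps_to_fls (Q.lin_factor (qs ^ d)) * (fls_const K * fps_to_fls (Abs_fps (\<lambda>c. (qs ^ d) ^ c))) = 1"
      by (simp only: K G mult_1_left)
  qed
qed

end

section \<open>The infinite products\<close>

text \<open>
  Divisibility by \<open>q^(m/2)\<close> in the ring of power series in \<open>q^(1/2)\<close>.
\<close>
definition small :: "nat \<Rightarrow> complex fls \<Rightarrow> bool" where
  "small m x \<longleftrightarrow> (\<exists>y. x = fps_to_fls (fps_X ^ m * y))"

lemma small_add: "small m x \<Longrightarrow> small m y \<Longrightarrow> small m (x + y)"
  unfolding small_def by (auto simp: distrib_left[symmetric] simp flip: fps_to_fls_plus)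

lemma small_mult: "small m x \<Longrightarrow> small 0 y \<Longrightarrow> small m (x * y)"
  unfolding small_def by (auto simp: mult.assoc simp flip: fls_times_fps_to_fls)

lemma small_minus: "small m x \<Longrightarrow> small m (- x)"
proof -
  assume "small m x"
  then obtain y where "x = fps_to_fls (fps_X ^ m * y)" by (auto simp: small_def)
  then have "- x = fps_to_fls (fps_X ^ m * (- y))" by simp
  then show ?thesis unfolding small_def by blast
qed

lemma small_fps: "small 0 (fps_to_fls y)" unfolding small_def by auto

lemma small_qs: "small m (qs ^ m)"
proof -
  have "qs ^ m = fps_to_fls (fps_X ^ m * fps_X ^ m)" by (simp add: qs_pow mult_2 power_add)
  then show ?thesis unfolding small_def by blast
qed

lemma small_qs0: "small 0 (qs ^ m)" unfolding qs_pow by (rule small_fps)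

lemma small_inv: "small 0 (1 / (1 - qs ^ Suc t))"
proof -
  define y :: "complex fps" where "y = 1 - fps_X ^ (2 * Suc t)"
  have "fps_nth y 0 = 1" by (simp add: y_def)
  then have "inverse y * y = 1" by (intro inverse_mult_eq_1) simp
  then have "fps_to_fls (inverse y) * fps_to_fls y = 1" unfolding fls_times_fps_to_fls[symmetric] by simp
  moreover have "fps_to_fls y = 1 - qs ^ Suc t" unfolding y_def qs_pow by simp
  ultimately have "1 / (1 - qs ^ Suc t) = fps_to_fls (inverse y)" using Q.q1[of t] by (simp add: field_simps del: power_Suc)
  then show ?thesis using small_fps by simp
qed

lemma small_dist: assumes "small m (x - y)" shows "dist x y \<le> (1 / 2) ^ m"
proof (cases "x = y")
  case False
  obtain z where z: "x - y = fps_to_fls (fps_X ^ m * z)" using assms by (auto simp: small_def)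
  then have "z \<noteq> 0" using False by auto
  then have "subdegree (fps_X ^ m * z) = m + subdegree z" by simp
  then have "fls_subdegree (x - y) \<ge> int m" unfolding z fls_subdegree_fls_to_fps by simp
  then have "dist x y = inverse (2 ^ nat (fls_subdegree (x - y)))" "nat (fls_subdegree (x - y)) \<ge> m"
    using False by (auto simp: dist_fls_def)
  then have "dist x y = inverse (2 ^ nat (fls_subdegree (x - y)))" "(2 :: real) ^ m \<le> 2 ^ nat (fls_subdegree (x - y))"
    by (simp_all add: power_increasing)
  then have "dist x y \<le> inverse (2 ^ m)" by (simp add: le_imp_inverse_le)
  then show ?thesis by (simp add: power_one_over inverse_eq_divide)
qed simp

text \<open>
  As \<open>q^m\<close> tends to zero, the coefficients of the finite products converge to those of Euler's series.
\<close>
lemma fin_euler_coeff_limit: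
  assumes a: "small 0 \<alpha>"
  shows "(\<lambda>m. Q.fin_euler_coeff \<alpha> m d) \<longlonglongrightarrow> Q.euler_coeff \<alpha> d"
proof -
  have e0: "small 0 (Q.euler_coeff \<alpha> d) \<and> small 0 (Q.fin_euler_coeff \<alpha> m d) \<and> small m (Q.fin_euler_coeff \<alpha> m d - Q.euler_coeff \<alpha> d)" for m
  proof (induction d)
    case 0
    have "small 0 (1 :: complex fls)" using small_fps[of 1] by simp
    moreover have "small m (0 :: complex fls)" unfolding small_def by (rule exI[of _ 0]) simp
    ultimately show ?case by (simp add: Q.euler_coeff_def Q.fin_euler_coeff_def)
  next
    case (Suc d)
    define I where "I = 1 / (1 - qs ^ Suc d)"
    have I: "small 0 I" unfolding I_def by (rule small_inv)
    have 1: "Q.euler_coeff \<alpha> (Suc d) = - (Q.euler_coeff \<alpha> d * \<alpha> * qs ^ d * I)"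
      "Q.fin_euler_coeff \<alpha> m (Suc d) = (qs ^ m + - (qs ^ d)) * \<alpha> * I * Q.fin_euler_coeff \<alpha> m d"
      by (simp_all add: Q.euler_coeff_def Q.fin_euler_coeff_def I_def mult_ac del: power_Suc)
    have 2: "Q.fin_euler_coeff \<alpha> m (Suc d) - Q.euler_coeff \<alpha> (Suc d) = qs ^ m * \<alpha> * I * Q.fin_euler_coeff \<alpha> m d + - ((Q.fin_euler_coeff \<alpha> m d - Q.euler_coeff \<alpha> d) * \<alpha> * qs ^ d * I)"
      unfolding 1 by (simp add: algebra_simps)
    show ?case unfolding 2 unfolding 1 using Suc.IH
      by (intro conjI small_minus small_add small_mult small_qs small_qs0 a I) auto
  qed
  have "(\<lambda>m. dist (Q.fin_euler_coeff \<alpha> m d) (Q.euler_coeff \<alpha> d)) \<longlonglongrightarrow> 0"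
  proof (rule tendsto_sandwich[OF _ _ tendsto_const])
    show "\<forall>\<^sub>F m in sequentially. 0 \<le> dist (Q.fin_euler_coeff \<alpha> m d) (Q.euler_coeff \<alpha> d)" by simp
    show "\<forall>\<^sub>F m in sequentially. dist (Q.fin_euler_coeff \<alpha> m d) (Q.euler_coeff \<alpha> d) \<le> (1 / 2) ^ m"
      using small_dist e0 by auto
    show "(\<lambda>m. (1 / 2 :: real) ^ m) \<longlonglongrightarrow> 0" by (rule LIMSEQ_realpow_zero) auto
  qed
  then show ?thesis by (subst tendsto_dist_iff)
qed

lemma qpoch_inf_euler_coeff:
  assumes "small 0 \<alpha>"
  shows "qpoch_inf (fls_const \<alpha> * zL) qL = fps_to_fls (Abs_fps (Q.euler_coeff \<alpha>))"
proof -
  have lin: "1 - fls_const a * zL = fps_to_fls (Q.lin_factor a)" for a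
    by (simp add: Q.lin_factor_def zL_def fls_times_fps_to_fls)
  have P: "qpoch (fls_const \<alpha> * zL) qL m = fps_to_fls (Q.qprod \<alpha> m)" for m
  proof (induction m)
    case 0
    show ?case by (simp add: Q.qprod_def)
  next
    case (Suc m)
    have "fls_const \<alpha> * zL * qL ^ m = fls_const (\<alpha> * qs ^ m) * zL" by (simp add: qL_def fls_const_power fls_const_mult_const[symmetric] mult_ac del: fls_const_mult_const)
    then show ?case unfolding qpoch_Suc Suc.IH Q.qprod_Suc fls_times_fps_to_fls by (simp only: lin)
  qed
  have "lim (\<lambda>m. fls_nth (qpoch (fls_const \<alpha> * zL) qL m) d) = (if d < 0 then 0 else Q.euler_coeff \<alpha> (nat d))" for d
    unfolding P fps_to_fls_nth Q.qprod_nth using fin_euler_coeff_limit[OF assms, of "nat d"] by (auto intro: limI)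
  then show ?thesis unfolding qpoch_inf_def fps_to_fls_Abs_fps by simp
qed

text \<open>The normalizing factor is the reciprocal of the \<open>q\<close>-binomial series.\<close>
lemma rho_11_norm:
  assumes h: "\<And>c. h (Suc c) * (1 - qs ^ Suc c) = (1 + qs ^ Suc c) * h c" "h 0 = 1"
  shows "rho_11 * zseries h = 1"
proof -
  have 1: "qpoch_inf zL qL = fps_to_fls (Abs_fps (Q.euler_coeff 1))"
    using qpoch_inf_euler_coeff[of 1] small_fps[of 1] by simp
  have "small 0 (- qs)" using small_minus[OF small_qs0[of 1]] by simp
  then have 2: "qpoch_inf (- qL * zL) qL = fps_to_fls (Abs_fps (Q.euler_coeff (- qs)))"
    using qpoch_inf_euler_coeff[of "- qs"] by (simp add: qL_def)
  have nz: "fps_to_fls (Abs_fps (Q.euler_coeff (- qs))) \<noteq> 0"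
  proof
    assume "fps_to_fls (Abs_fps (Q.euler_coeff (- qs))) = 0"
    then have "fps_nth (Abs_fps (Q.euler_coeff (- qs))) 0 = 0" by simp
    then show False by (simp add: Q.euler_coeff_def)
  qed
  have "fps_to_fls (Abs_fps (Q.euler_coeff 1)) * zseries h = fps_to_fls (Abs_fps (Q.euler_coeff (- qs)))"
    unfolding zseries_def fls_times_fps_to_fls[symmetric] Q.q_binomial[OF h] ..
  then show ?thesis unfolding rho_11_def 1 2 using nz by simp
qed

context qmodel begin

lemma norm_B: "S11_elem n eps (\<lambda>_. 0) (\<lambda>_. 0) (\<lambda>_. 0) (\<lambda>_. 0) = 1"
  unfolding S11_elem_def
proof (rule rho_11_norm)
  let ?h = "S11_coeff n eps (\<lambda>_. 0) (\<lambda>_. 0) (\<lambda>_. 0) (\<lambda>_. 0)"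
  have h: "?h c = w0 (int c) * w1 (int c)" for c
  proof -
    have "path_prod (int_label (\<lambda>_. 0)) (int_label (\<lambda>_. 0)) (int_label (\<lambda>_. 0)) (int_label (\<lambda>_. 0)) (carry (int_label (\<lambda>_. 0)) (int_label (\<lambda>_. 0)) (int c)) = 1"
      unfolding path_prod_def site_fac_def using eps01 by (intro prod.neutral) (auto simp: int_label_def carry_def site_vacuum)
    then show ?thesis unfolding S11_coeff_path_prod by (simp add: carry_def int_label_def)
  qed
  show "?h (Suc c) * (1 - qs ^ Suc c) = (1 + qs ^ Suc c) * ?h c" for c
  proof -
    have p: "qs powi (int c + 1) = qs ^ Suc c" by (simp add: Q.pws)
    have s: "w0 (int (Suc c)) = (1 + qs ^ Suc c) * w0 (int c)" "w1 (int c) = (1 - qs ^ Suc c) * w1 (int (Suc c))"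
      using B.w0_step[of "int c"] B.w1_step[of "int c"] unfolding p by (simp_all add: add.commute)
    show ?thesis unfolding h s by (simp only: mult_ac)
  qed
  show "?h 0 = 1" unfolding h by (simp add: w0_def w1_def)
qed

end

section \<open>Linear maps and expressions in the generators\<close>

lemma lookup_smul [simp]: "Poly_Mapping.lookup (smul c v) x = c * Poly_Mapping.lookup v x"
  unfolding smul_def by (simp add: Poly_Mapping.map.rep_eq when_def)

lemma lookup_ket: "Poly_Mapping.lookup (ket b) x = of_bool (b = x)"
  by (simp add: ket_def lookup_single when_def)

text \<open>
  With this formula all properties of tensor products reduce to products of coefficients.
\<close>
lemma lookup_tens [simp]: "Poly_Mapping.lookup (tens v w) (a, b) = Poly_Mapping.lookup v a * Poly_Mapping.lookup w b"
proof -
  let ?v = "Poly_Mapping.lookup v" and ?w = "Poly_Mapping.lookup w"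
  have 1: "(\<Sum>b'\<in>Poly_Mapping.keys w. Poly_Mapping.lookup (Poly_Mapping.single (a', b') (?v a' * ?w b')) (a, b))
      = (if a' = a then ?v a * ?w b else 0)" for a'
  proof -
    have "(\<Sum>b'\<in>Poly_Mapping.keys w. Poly_Mapping.lookup (Poly_Mapping.single (a', b') (?v a' * ?w b')) (a, b))
      = (\<Sum>b'\<in>Poly_Mapping.keys w. if b' = b then (if a' = a then ?v a * ?w b else 0) else 0)"
      by (rule sum.cong) (auto simp: lookup_single when_def)
    also have "\<dots> = (if a' = a then ?v a * ?w b else 0)"
      by (simp add: sum.delta' in_keys_iff)
    finally show ?thesis .
  qed
  show ?thesis unfolding tens_def lookup_sum 1 by (simp add: in_keys_iff)
qed

lemma smul_simps [simp]: "smul 0 v = 0" "smul c 0 = 0" "smul 1 v = v" "smul c (smul d v) = smul (c * d) v"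
  by (rule poly_mapping_eqI; simp)+

lemma smul_add: "smul c (v + w) = smul c v + smul c w" "smul (c + d) v = smul c v + smul d v"
  by (rule poly_mapping_eqI; simp add: lookup_add algebra_simps)+

lemma smul_sum: "smul c (sum f I) = (\<Sum>i\<in>I. smul c (f i))"
  by (induction I rule: infinite_finite_induct) (simp_all add: smul_add)

definition lin :: "(('b \<Rightarrow>\<^sub>0 gfield) \<Rightarrow> ('c \<Rightarrow>\<^sub>0 gfield)) \<Rightarrow> bool" where
  "lin f \<longleftrightarrow> (\<forall>v w. f (v + w) = f v + f w) \<and> (\<forall>c v. f (smul c v) = smul c (f v))"

lemma linD: assumes "lin f" shows "f (v + w) = f v + f w" "f (smul c v) = smul c (f v)" "f 0 = 0"
proof -
  show s: "f (v + w) = f v + f w" "f (smul c v) = smul c (f v)" for v w c using assms by (simp_all add: lin_def)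
  show "f 0 = 0" using s(2)[of 0 0] by simp
qed

lemma lin_sum: "lin f \<Longrightarrow> f (sum g I) = (\<Sum>i\<in>I. f (g i))"
  by (induction I rule: infinite_finite_induct) (simp_all add: linD)

lemma lin_ext_sum:
  assumes "finite S" "Poly_Mapping.keys v \<subseteq> S"
  shows "lin_ext f v = (\<Sum>b\<in>S. smul (Poly_Mapping.lookup v b) (f b))"
  unfolding lin_ext_def by (rule sum.mono_neutral_left) (use assms in \<open>auto simp: in_keys_iff\<close>)

lemma lin_lin_ext: "lin (lin_ext f)"
  unfolding lin_def
proof (intro conjI allI)
  fix v w :: "'a \<Rightarrow>\<^sub>0 gfield" and c :: gfield
  let ?S = "Poly_Mapping.keys v \<union> Poly_Mapping.keys w"
  have f: "finite ?S" by simp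
  have k: "Poly_Mapping.keys (v + w) \<subseteq> ?S" "Poly_Mapping.keys v \<subseteq> ?S" "Poly_Mapping.keys w \<subseteq> ?S"
    using keys_add[of v w] by blast+
  show "lin_ext f (v + w) = lin_ext f v + lin_ext f w"
    unfolding lin_ext_sum[OF f k(1)] lin_ext_sum[OF f k(2)] lin_ext_sum[OF f k(3)]
    by (simp add: lookup_add smul_add sum.distrib)
  have c: "Poly_Mapping.keys (smul c v) \<subseteq> Poly_Mapping.keys v" by (auto simp: in_keys_iff)
  show "lin_ext f (smul c v) = smul c (lin_ext f v)"
    unfolding lin_ext_sum[OF finite_keys c] unfolding lin_ext_def by (simp add: smul_sum)
qed

lemma keys_ket [simp]: "Poly_Mapping.keys (ket b) = {b}"
  by (simp add: ket_def)

lemma lin_ext_ket [simp]: "lin_ext f (ket b) = f b"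
  by (simp add: lin_ext_def lookup_ket)

lemma ket_expansion: "v = (\<Sum>b\<in>Poly_Mapping.keys v. smul (Poly_Mapping.lookup v b) (ket b))"
proof (rule poly_mapping_eqI)
  fix x
  show "Poly_Mapping.lookup v x = Poly_Mapping.lookup (\<Sum>b\<in>Poly_Mapping.keys v. smul (Poly_Mapping.lookup v b) (ket b)) x"
    unfolding lookup_sum lookup_smul lookup_ket by (simp add: in_keys_iff of_bool_def if_distrib[of "\<lambda>x. _ * x"] cong: if_cong)
qed

lemma lin_eq_lin_ext: assumes "lin f" shows "f v = lin_ext (\<lambda>b. f (ket b)) v"
  by (subst ket_expansion[of v]) (simp add: lin_ext_def lin_sum[OF assms] linD[OF assms])

lemma lin_comp: "lin f \<Longrightarrow> lin g \<Longrightarrow> lin (\<lambda>v. f (g v))"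
  by (simp add: lin_def)

lemma lin_smul: "lin (smul c)"
  by (simp add: lin_def smul_add mult.commute)

lemma lin_plus: "lin f \<Longrightarrow> lin g \<Longrightarrow> lin (\<lambda>v. f v + g v)"
  by (simp add: lin_def smul_add algebra_simps)

lemma lin_eq_on:
  assumes "lin f" "lin g" "\<And>b. b \<in> B \<Longrightarrow> f (ket b) = g (ket b)" "v \<in> space_on B"
  shows "f v = g v"
  unfolding lin_eq_lin_ext[OF assms(1), of v] lin_eq_lin_ext[OF assms(2), of v] unfolding lin_ext_def
  by (rule sum.cong) (use assms(3,4) in \<open>auto simp: space_on_def\<close>)

lemma lin_eq: "lin f \<Longrightarrow> lin g \<Longrightarrow> (\<And>b. f (ket b) = g (ket b)) \<Longrightarrow> f v = g v"
  using lin_eq_on[of f g UNIV] by (simp add: space_on_def)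

lemma space_on_0 [simp]: "0 \<in> space_on B" by (simp add: space_on_def)
lemma space_on_ket: "b \<in> B \<Longrightarrow> ket b \<in> space_on B" by (simp add: space_on_def)
lemma space_on_smul: "v \<in> space_on B \<Longrightarrow> smul c v \<in> space_on B"
  by (auto simp: space_on_def in_keys_iff subset_iff)
lemma space_on_add: "v \<in> space_on B \<Longrightarrow> w \<in> space_on B \<Longrightarrow> v + w \<in> space_on B"
  unfolding space_on_def using keys_add[of v w] by blast
lemma space_on_sum: "(\<And>i. i \<in> I \<Longrightarrow> f i \<in> space_on B) \<Longrightarrow> sum f I \<in> space_on B"
  by (induction I rule: infinite_finite_induct) (simp_all add: space_on_add)

lemma lin_ext_space: "(\<And>b. b \<in> B \<Longrightarrow> f b \<in> space_on B') \<Longrightarrow> v \<in> space_on B \<Longrightarrow> lin_ext f v \<in> space_on B'"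
  unfolding lin_ext_def by (intro space_on_sum space_on_smul) (auto simp: space_on_def)

lemma lin_space:
  assumes "lin f" "\<And>b. b \<in> B \<Longrightarrow> f (ket b) \<in> space_on B'" "v \<in> space_on B"
  shows "f v \<in> space_on B'"
  unfolding lin_eq_lin_ext[OF assms(1), of v] using assms(2,3) by (rule lin_ext_space)

lemma lin_tens_op: "lin (tens_op A B)"
  unfolding tens_op_def by (rule lin_lin_ext)

lemma tens_simps [simp]: "tens (smul c v) w = smul c (tens v w)" "tens v (smul c w) = smul c (tens v w)"
    "tens 0 w = 0" "tens v 0 = 0" "tens (ket a) (ket b) = ket (a, b)"
  by (rule poly_mapping_eqI; clarsimp simp: lookup_ket)+

lemma tens_add: "tens (v + v') w = tens v w + tens v' w" "tens v (w + w') = tens v w + tens v w'"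
  by (rule poly_mapping_eqI; clarsimp simp: lookup_add algebra_simps)+

lemma tens_op_ket [simp]: "tens_op A B (ket (a, b)) = tens (A (ket a)) (B (ket b))"
  by (simp add: tens_op_def)

lemma tens_op_tens:
  assumes "lin A" "lin B"
  shows "tens_op A B (tens v w) = tens (A v) (B w)"
proof -
  have k: "tens_op A B (tens v (ket b)) = tens (A v) (B (ket b))" for b
  proof (rule lin_eq[of "\<lambda>v. tens_op A B (tens v (ket b))" "\<lambda>v. tens (A v) (B (ket b))"])
    show "lin (\<lambda>v. tens_op A B (tens v (ket b)))"
      by (rule lin_comp[OF lin_tens_op]) (simp add: lin_def tens_add)
    show "lin (\<lambda>v. tens (A v) (B (ket b)))" using assms by (simp add: lin_def tens_add)
  qed simp
  show ?thesis
  proof (rule lin_eq[of "\<lambda>w. tens_op A B (tens v w)" "\<lambda>w. tens (A v) (B w)"])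
    show "lin (\<lambda>w. tens_op A B (tens v w))"
      by (rule lin_comp[OF lin_tens_op]) (simp add: lin_def tens_add)
    show "lin (\<lambda>w. tens (A v) (B w))" using assms by (simp add: lin_def tens_add)
  qed (rule k)
qed

lemma tens_op_comp:
  assumes "lin A" "lin B" "lin A'" "lin B'"
  shows "tens_op (\<lambda>v. A (A' v)) (\<lambda>v. B (B' v)) v = tens_op A B (tens_op A' B' v)"
  by (rule lin_eq[OF lin_tens_op lin_comp[OF lin_tens_op lin_tens_op]])
     (clarsimp simp: tens_op_tens[OF assms(1,2)])

lemma lin_uact: "(\<And>g. lin (\<pi> g)) \<Longrightarrow> lin (uact \<pi> t)"
  by (induction t) (simp_all add: lin_smul lin_plus lin_comp)

lemma lin_sum_list: "(\<And>x. x \<in> set X \<Longrightarrow> lin (F x)) \<Longrightarrow> lin (\<lambda>v. \<Sum>x\<leftarrow>X. F x v)"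
proof (induction X)
  case Nil
  show ?case by (simp add: lin_def)
next
  case (Cons x X)
  then show ?case by (simp add: lin_plus)
qed

lemma lin_tens_act: "lin (tens_act \<pi>1 \<pi>2 X)"
  unfolding tens_act_def[abs_def] by (rule lin_sum_list) (auto simp: lin_tens_op)

lemma tens_act_append: "tens_act \<pi>1 \<pi>2 (X @ Y) v = tens_act \<pi>1 \<pi>2 X v + tens_act \<pi>1 \<pi>2 Y v"
  by (simp add: tens_act_def)

definition mul_tensors :: "(uexp \<times> uexp) list \<Rightarrow> (uexp \<times> uexp) list \<Rightarrow> (uexp \<times> uexp) list" where
  "mul_tensors X Y = [(Mul a c, Mul b d). (a, b) \<leftarrow> X, (c, d) \<leftarrow> Y]"

lemma tens_act_mul:
  assumes "\<And>g. lin (\<pi>1 g)" "\<And>g. lin (\<pi>2 g)"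
  shows "tens_act \<pi>1 \<pi>2 (mul_tensors X Y) v = tens_act \<pi>1 \<pi>2 X (tens_act \<pi>1 \<pi>2 Y v)"
proof (induction X)
  case Nil
  show ?case by (simp add: mul_tensors_def tens_act_def)
next
  case (Cons x X)
  obtain a b where x: "x = (a, b)" by force
  have "mul_tensors (x # X) Y = map (\<lambda>(c, d). (Mul a c, Mul b d)) Y @ mul_tensors X Y"
    by (simp add: mul_tensors_def x)
  moreover have "tens_act \<pi>1 \<pi>2 (map (\<lambda>(c, d). (Mul a c, Mul b d)) Y) v = tens_op (uact \<pi>1 a) (uact \<pi>2 b) (tens_act \<pi>1 \<pi>2 Y v)"
  proof (induction Y)
    case Nil
    show ?case by (simp add: tens_act_def linD[OF lin_tens_op])
  next
    case (Cons y Y)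
    obtain c d where y: "y = (c, d)" by force
    have u: "uact \<pi> (Mul a c) = (\<lambda>v. uact \<pi> a (uact \<pi> c v))" for \<pi> :: "gen \<Rightarrow> ('a \<Rightarrow>\<^sub>0 gfield) \<Rightarrow> ('a \<Rightarrow>\<^sub>0 gfield)" and a c by simp
    have "tens_op (uact \<pi>1 (Mul a c)) (uact \<pi>2 (Mul b d)) v = tens_op (uact \<pi>1 a) (uact \<pi>2 b) (tens_op (uact \<pi>1 c) (uact \<pi>2 d) v)"
      unfolding u by (rule tens_op_comp) (rule lin_uact, rule assms)+
    then show ?case using Cons.IH unfolding tens_act_def y by (simp add: linD[OF lin_tens_op])
  qed
  ultimately show ?case using Cons.IH by (simp add: tens_act_append) (simp add: tens_act_def x)
qed

lemma coprod_Mul: "coprod (Mul s t) = mul_tensors (coprod s) (coprod t)"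
  by (simp add: mul_tensors_def)

lemma coprod_op_simps: "coprod_op (Add s t) = coprod_op s @ coprod_op t"
    "coprod_op (Mul s t) = mul_tensors (coprod_op s) (coprod_op t)"
  by (simp_all add: coprod_op_def mul_tensors_def map_concat comp_def split_def)

lemma tens_act_swap_scalar: "tens_act \<pi>1 \<pi>2 (coprod (Sc c)) v = smul c v" "tens_act \<pi>1 \<pi>2 (coprod_op (Sc c)) v = smul c v"
  unfolding tens_act_def coprod_op_def
  by (simp; rule lin_eq[OF lin_tens_op lin_smul]; clarsimp)+

text \<open>
  Invariance of the subspace is proved along with the relation, since the relation for a product of
  expressions needs it for the intermediate vector.
\<close>
lemma intertwines_from_generators:
  assumes lin: "\<And>g. lin (\<pi>1 g)" "\<And>g. lin (\<pi>2 g)"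
    and R: "\<And>v w. v \<in> space_on B \<Longrightarrow> w \<in> space_on B \<Longrightarrow> R (v + w) = R v + R w"
      "\<And>c v. v \<in> space_on B \<Longrightarrow> R (smul c v) = smul c (R v)"
      "\<And>v. v \<in> space_on B \<Longrightarrow> R v \<in> space_on B"
    and inv: "\<And>g b. gen_index g \<in> I \<Longrightarrow> b \<in> B \<Longrightarrow> tens_act \<pi>1 \<pi>2 (coprod_gen g) (ket b) \<in> space_on B"
    and gen: "\<And>g v. gen_index g \<in> I \<Longrightarrow> v \<in> space_on B \<Longrightarrow>
        tens_act \<pi>1 \<pi>2 (coprod_op (Gen g)) (R v) = R (tens_act \<pi>1 \<pi>2 (coprod_gen g) v)"
    and t: "uindices t \<subseteq> I" and v: "v \<in> space_on B"
  shows "tens_act \<pi>1 \<pi>2 (coprod t) v \<in> space_on B \<and>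
    tens_act \<pi>1 \<pi>2 (coprod_op t) (R v) = R (tens_act \<pi>1 \<pi>2 (coprod t) v)"
  using t v
proof (induction t arbitrary: v)
  case (Gen g)
  have g: "gen_index g \<in> I" using Gen.prems(1) by simp
  show ?case using lin_space[OF lin_tens_act inv[OF g] Gen.prems(2)] gen[OF g Gen.prems(2)] by simp
next
  case (Sc c)
  show ?case unfolding tens_act_swap_scalar using Sc.prems(2) R(2)[of v c] by (simp add: space_on_smul)
next
  case (Add s t)
  have s: "uindices s \<subseteq> I" and t: "uindices t \<subseteq> I" using Add.prems(1) by simp_all
  show ?case using Add.IH(1)[OF s Add.prems(2)] Add.IH(2)[OF t Add.prems(2)]
    by (simp add: coprod_op_simps tens_act_append space_on_add R(1))
next
  case (Mul s t)
  have s: "uindices s \<subseteq> I" and t: "uindices t \<subseteq> I" using Mul.prems(1) by simp_all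
  note T = Mul.IH(2)[OF t Mul.prems(2)]
  show ?case unfolding coprod_Mul coprod_op_simps tens_act_mul[OF lin]
    using T Mul.IH(1)[OF s, of "tens_act \<pi>1 \<pi>2 (coprod t) v"] by simp
qed

lemma ualg_elem:
  assumes "g \<in> ualg N D r" "t \<in> g" shows "uindices t \<subseteq> {..N}"
  using assms unfolding ualg_def quotient_def by blast

lemma ualg_gen:
  assumes "gen_index g \<le> N" shows "\<exists>c\<in>ualg N D r. Gen g \<in> c"
proof -
  let ?r = "{(s, t). uindices s \<subseteq> {..N} \<and> uindices t \<subseteq> {..N} \<and> ueq N D r s t}"
  have m: "Gen g \<in> {t. uindices t \<subseteq> {..N}}" using assms by simp
  have "(Gen g, Gen g) \<in> ?r" using assms ueq.refl[of N D r "Gen g"] by simp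
  then have "Gen g \<in> ?r `` {Gen g}" by (rule ImageI) (rule singletonI)
  then show ?thesis unfolding ualg_def by (rule bexI[OF _ quotientI[OF m]])
qed

section \<open>Hops between states\<close>

text \<open>
  The flag \<open>aff\<close> selects \<open>U_A\<close> (on states of total \<open>l\<close>) or \<open>U_B\<close> (on all states).  The generator with index
  \<open>r \<le> rmax\<close> belongs to the link from \<open>src r\<close> to \<open>r + 1\<close>.  For \<open>U_B\<close> the ends 0 and \<open>n + 1\<close> of the
  chain are reservoirs.
\<close>
locale hop_graph =
  fixes n :: nat and eps :: "nat \<Rightarrow> nat" and aff :: bool and l :: nat
  assumes eps01: "k \<in> {1..n} \<Longrightarrow> eps k \<le> 1" and n_pos: "1 \<le> n" and n_aff: "aff \<Longrightarrow> 2 \<le> n"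
begin

definition rmax :: nat where "rmax = (if aff then n - 1 else n)"
definition src :: "nat \<Rightarrow> nat" where "src r = (if aff \<and> r = 0 then n else r)"

definition nhop :: "nat \<Rightarrow> nat \<Rightarrow> label \<Rightarrow> label" where
  "nhop s t m = (\<lambda>k. if k \<in> {1..n} then m k + of_bool (k = t) - of_bool (k = s) else 0)"

definition can_hop :: "nat \<Rightarrow> nat \<Rightarrow> label \<Rightarrow> bool" where
  "can_hop s t m \<longleftrightarrow> (s \<in> {1..n} \<longrightarrow> 1 \<le> m s) \<and> (t \<in> {1..n} \<longrightarrow> eps t = 1 \<longrightarrow> m t = 0)"

definition St :: "label set" where "St = {m \<in> states n eps. aff \<longrightarrow> lsum n m = l}"

lemma src_tgt: "r \<le> rmax \<Longrightarrow> src r \<noteq> Suc r" "r \<le> rmax \<Longrightarrow> aff \<Longrightarrow> src r \<in> {1..n} \<and> Suc r \<in> {1..n}"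
  unfolding rmax_def src_def using n_pos n_aff by (auto split: if_splits)

lemma StD: "m \<in> St \<Longrightarrow> m \<in> states n eps" by (simp add: St_def)

lemma states_out: "m \<in> states n eps \<Longrightarrow> k \<notin> {1..n} \<Longrightarrow> m k = 0" by (simp add: states_def)

lemma states_fermion: "m \<in> states n eps \<Longrightarrow> k \<in> {1..n} \<Longrightarrow> eps k = 1 \<Longrightarrow> m k \<le> 1" by (simp add: states_def)

lemma nhop_states: "m \<in> states n eps \<Longrightarrow> can_hop s t m \<Longrightarrow> nhop s t m \<in> states n eps"
  unfolding states_def nhop_def can_hop_def by auto

lemma lsum_nhop:
  assumes "can_hop s t m"
  shows "lsum n (nhop s t m) + of_bool (s \<in> {1..n}) = lsum n m + of_bool (t \<in> {1..n})"
proof (cases "s = t")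
  case True
  have "lsum n (nhop s t m) = lsum n m"
    unfolding lsum_def by (rule sum.cong) (simp_all add: nhop_def True)
  then show ?thesis using True by simp
next
  case False
  have "lsum n (nhop s t m) + (\<Sum>k=1..n. of_bool (k = s)) = (\<Sum>k=1..n. nhop s t m k + of_bool (k = s))"
    by (simp add: lsum_def sum.distrib)
  also have "\<dots> = (\<Sum>k=1..n. m k + of_bool (k = t))"
    by (rule sum.cong) (use assms False in \<open>auto simp: nhop_def can_hop_def\<close>)
  also have "\<dots> = lsum n m + (\<Sum>k=1..n. of_bool (k = t))"
    by (simp add: lsum_def sum.distrib)
  finally show ?thesis by (simp add: of_bool_def)
qed

lemma nhop_St: "m \<in> St \<Longrightarrow> can_hop s t m \<Longrightarrow> (aff \<Longrightarrow> s \<in> {1..n} \<and> t \<in> {1..n}) \<Longrightarrow> nhop s t m \<in> St"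
  using lsum_nhop[of s t m] nhop_states[of m s t] by (auto simp: St_def)

lemma nhop_nhop:
  assumes m: "m \<in> states n eps" and c: "can_hop s t m" and st: "s \<noteq> t"
  shows "nhop t s (nhop s t m) = m"
proof
  fix k show "nhop t s (nhop s t m) k = m k"
    using states_out[OF m, of k] c st by (auto simp: nhop_def can_hop_def)
qed

lemma can_hop_back:
  assumes m: "m \<in> states n eps" and c: "can_hop s t m" and st: "s \<noteq> t"
  shows "can_hop t s (nhop s t m)"
  using states_fermion[OF m, of s] c st by (auto simp: nhop_def can_hop_def)

lemma nhop_eq_iff:
  assumes "s \<noteq> t" "m \<in> states n eps" "m' \<in> states n eps"
  shows "can_hop s t m \<and> m' = nhop s t m \<longleftrightarrow> can_hop t s m' \<and> m = nhop t s m'"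
  using nhop_nhop[of m s t] nhop_nhop[of m' t s] can_hop_back[of m s t] can_hop_back[of m' t s] assms by metis

definition hop_steps :: "(label \<times> label) set" where
  "hop_steps = {(m, m'). m \<in> St \<and> (\<exists>r\<le>rmax. can_hop (src r) (Suc r) m \<and> m' = nhop (src r) (Suc r) m)}"

text \<open>
  A particle can be carried from \<open>s\<close> to \<open>t\<close> by hops along links, whatever the occupation of the sites between them.
\<close>
definition transfers :: "nat \<Rightarrow> nat \<Rightarrow> bool" where
  "transfers s t \<longleftrightarrow> (\<forall>m\<in>St. can_hop s t m \<longrightarrow> (m, nhop s t m) \<in> hop_steps\<^sup>*)"

lemma transfers_edge: "r \<le> rmax \<Longrightarrow> transfers (src r) (Suc r)"
  unfolding transfers_def hop_steps_def by (auto intro!: r_into_rtrancl)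

text \<open>
  If \<open>u\<close> accepts the particle, it goes to \<open>u\<close> first and on to \<open>t\<close>.  Otherwise \<open>u\<close> is an occupied fermionic
  site; then its particle goes to \<open>t\<close>, and the one from \<open>s\<close> takes its place.
\<close>
lemma transfers_comp:
  assumes sp: "transfers s u" and pt: "transfers u t" and d: "s \<noteq> u" "u \<noteq> t" "s \<noteq> t" and u: "u \<in> {1..n}"
    and af: "aff \<Longrightarrow> s \<in> {1..n} \<and> t \<in> {1..n}"
  shows "transfers s t"
  unfolding transfers_def
proof (intro ballI impI)
  fix m assume m: "m \<in> St" and c: "can_hop s t m"
  show "(m, nhop s t m) \<in> hop_steps\<^sup>*"
  proof (cases "eps u = 1 \<and> m u \<noteq> 0")
    case False
    have c1: "can_hop s u m" using c False by (auto simp: can_hop_def)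
    have c2: "can_hop u t (nhop s u m)" using c d u by (auto simp: can_hop_def nhop_def)
    have e: "nhop u t (nhop s u m) = nhop s t m"
      using c d u by (auto simp: nhop_def can_hop_def fun_eq_iff)
    have m1: "nhop s u m \<in> St" by (rule nhop_St[OF m c1]) (use af u in auto)
    show ?thesis using sp pt m m1 c1 c2 unfolding transfers_def e[symmetric] by (meson rtrancl_trans)
  next
    case True
    have mu: "m u = 1" using True states_fermion[OF StD[OF m] u] by auto
    have c1: "can_hop u t m" using c mu by (auto simp: can_hop_def)
    have c2: "can_hop s u (nhop u t m)" using c d u mu by (auto simp: can_hop_def nhop_def)
    have e: "nhop s u (nhop u t m) = nhop s t m"
      using c d u mu by (auto simp: nhop_def can_hop_def fun_eq_iff)
    have m1: "nhop u t m \<in> St" by (rule nhop_St[OF m c1]) (use af u in auto)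
    show ?thesis using sp pt m m1 c1 c2 unfolding transfers_def e[symmetric] by (meson rtrancl_trans)
  qed
qed

lemma transfers_up: "s < t \<Longrightarrow> t \<le> (if aff then n else Suc n) \<Longrightarrow> (aff \<Longrightarrow> 1 \<le> s) \<Longrightarrow> transfers s t"
proof (induction t rule: less_induct)
  case (less t)
  then obtain u where t: "t = Suc u" by (cases t) auto
  have uN: "u \<le> rmax" using less.prems(2) t by (auto simp: rmax_def split: if_splits)
  have su: "src u = u" using less.prems t by (auto simp: src_def)
  have E: "transfers u t" using transfers_edge[OF uN] su t by simp
  show ?case
  proof (cases "s = u")
    case False
    have "transfers s u" by (rule less.IH) (use less.prems False t in auto)
    then show ?thesis by (rule transfers_comp[OF _ E]) (use less.prems False t in \<open>auto split: if_splits\<close>)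
  qed (use E in simp)
qed

lemma transfers_down:
  assumes "aff" "s \<in> {1..n}" "t \<in> {1..n}" "t < s"
  shows "transfers s t"
proof -
  have n1: "transfers n 1" using transfers_edge[of 0, unfolded src_def] assms(1) by simp
  have s1: "transfers s 1"
  proof (cases "s = n")
    case False
    have "transfers s n" by (rule transfers_up) (use assms False in auto)
    then show ?thesis by (rule transfers_comp[OF _ n1]) (use assms False in auto)
  qed (use n1 in simp)
  show ?thesis
  proof (cases "t = 1")
    case False
    have "transfers 1 t" by (rule transfers_up) (use assms False in auto)
    then show ?thesis by (rule transfers_comp[OF s1]) (use assms False in auto)
  qed (use s1 in simp)
qed

lemma hop_steps_St: "(m, m') \<in> hop_steps \<Longrightarrow> m' \<in> St"
  unfolding hop_steps_def using nhop_St src_tgt(2) by blast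

definition gap :: "label \<Rightarrow> label \<Rightarrow> nat" where
  "gap a b = (\<Sum>k=1..n. (a k - b k) + (b k - a k))"

lemma gap_less:
  assumes "s \<noteq> t" "s \<in> {1..n} \<or> t \<in> {1..n}" "s \<in> {1..n} \<Longrightarrow> a s > b s" "t \<in> {1..n} \<Longrightarrow> a t < b t"
  shows "gap (nhop s t a) b < gap a b"
  unfolding gap_def
proof (rule sum_strict_mono_ex1)
  show "\<forall>x\<in>{1..n}. nhop s t a x - b x + (b x - nhop s t a x) \<le> a x - b x + (b x - a x)"
    using assms by (auto simp: nhop_def)
  show "\<exists>x\<in>{1..n}. nhop s t a x - b x + (b x - nhop s t a x) < a x - b x + (b x - a x)"
  proof (cases "s \<in> {1..n}")
    case True
    then show ?thesis using assms by (intro bexI[of _ s]) (auto simp: nhop_def)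
  next
    case False
    then show ?thesis using assms by (intro bexI[of _ t]) (auto simp: nhop_def)
  qed
qed simp

text \<open>
  For \<open>U_A\<close> the totals agree, so there are both a site with too many and one with too few particles.
  For \<open>U_B\<close> a reservoir takes a surplus particle or supplies a missing one.
\<close>
lemma move_closer:
  assumes a: "a \<in> St" and b: "b \<in> St" and ne: "a \<noteq> b"
  shows "\<exists>s t. transfers s t \<and> can_hop s t a \<and> gap (nhop s t a) b < gap a b \<and> (aff \<longrightarrow> s \<in> {1..n} \<and> t \<in> {1..n})"
proof -
  have ab: "a \<in> states n eps" "b \<in> states n eps" using a b StD by auto
  obtain k where "a k \<noteq> b k" using ne by blast
  then have k: "k \<in> {1..n}" "a k \<noteq> b k" using ab states_out by metis+
  have can_hop: "can_hop s t a" if "s \<in> {1..n} \<Longrightarrow> a s > b s" "t \<in> {1..n} \<Longrightarrow> a t < b t" for s t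
    using that states_fermion[OF ab(2), of t] unfolding can_hop_def by fastforce
  show ?thesis
  proof (cases aff)
    case True
    have eq: "lsum n a = lsum n b" using a b True unfolding St_def by simp
    have "\<exists>s\<in>{1..n}. b s < a s"
    proof (rule ccontr)
      assume h: "\<not> ?thesis"
      have "lsum n a < lsum n b" unfolding lsum_def
      proof (rule sum_strict_mono_ex1)
        show "\<forall>x\<in>{1..n}. a x \<le> b x" using h by (simp add: not_less)
        moreover have "a k \<noteq> b k" using k by simp
        ultimately show "\<exists>x\<in>{1..n}. a x < b x" using k(1) by (intro bexI[of _ k]) (auto simp: less_le)
      qed simp
      then show False using eq by simp
    qed
    moreover have "\<exists>s\<in>{1..n}. a s < b s"
    proof (rule ccontr)
      assume h: "\<not> ?thesis"
      have "lsum n b < lsum n a" unfolding lsum_def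
      proof (rule sum_strict_mono_ex1)
        show "\<forall>x\<in>{1..n}. b x \<le> a x" using h by (simp add: not_less)
        moreover have "b k \<noteq> a k" using k by simp
        ultimately show "\<exists>x\<in>{1..n}. b x < a x" using k(1) by (intro bexI[of _ k]) (auto simp: less_le)
      qed simp
      then show False using eq by simp
    qed
    ultimately obtain s t where st: "s \<in> {1..n}" "b s < a s" "t \<in> {1..n}" "a t < b t" by blast
    then have d: "s \<noteq> t" by auto
    have "transfers s t" using transfers_up[of s t] transfers_down[OF True st(1,3)] st d True by (cases "s < t") auto
    moreover have "gap (nhop s t a) b < gap a b" by (rule gap_less) (use st d in auto)
    ultimately show ?thesis using can_hop[of s t] st by blast
  next
    case False
    show ?thesis
    proof (cases "b k < a k")
      case True
      have "transfers k (Suc n)" by (rule transfers_up) (use k False in auto)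
      moreover have "gap (nhop k (Suc n) a) b < gap a b" by (rule gap_less) (use k True in auto)
      moreover have "can_hop k (Suc n) a" by (rule can_hop) (use True in auto)
      ultimately show ?thesis using False by blast
    next
      case F: False
      have "transfers 0 k" by (rule transfers_up) (use k False in auto)
      moreover have "gap (nhop 0 k a) b < gap a b" by (rule gap_less) (use k F in auto)
      moreover have "can_hop 0 k a" by (rule can_hop) (use F k in auto)
      ultimately show ?thesis using False by blast
    qed
  qed
qed

theorem hop_steps_connected: "a \<in> St \<Longrightarrow> b \<in> St \<Longrightarrow> (a, b) \<in> hop_steps\<^sup>*"
proof (induction "gap a b" arbitrary: a rule: less_induct)
  case less
  show ?case
  proof (cases "a = b")
    case False
    obtain s t where st: "transfers s t" "can_hop s t a" "gap (nhop s t a) b < gap a b"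
      "aff \<longrightarrow> s \<in> {1..n} \<and> t \<in> {1..n}"
      using move_closer[OF less.prems False] by blast
    have m: "nhop s t a \<in> St" by (rule nhop_St[OF less.prems(1) st(2)]) (use st(4) in blast)
    have "(a, nhop s t a) \<in> hop_steps\<^sup>*" using st(1,2) less.prems(1) unfolding transfers_def by blast
    also have "(nhop s t a, b) \<in> hop_steps\<^sup>*" by (rule less.hyps[OF st(3) m less.prems(2)])
    finally show ?thesis .
  qed simp
qed

lemma finite_states_lsum: "finite {m \<in> states n eps. lsum n m = w}"
proof (rule finite_subset)
  show "{m \<in> states n eps. lsum n m = w} \<subseteq> {f. (\<forall>k. k \<notin> {1..n} \<longrightarrow> f k = 0) \<and> (\<forall>k. f k \<le> w)}"
  proof (rule subsetI, clarsimp, intro conjI allI impI)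
    fix m k assume m: "m \<in> states n eps" "w = lsum n m"
    { fix k assume "Suc 0 \<le> k \<longrightarrow> \<not> k \<le> n" then show "m k = 0" using states_out[OF m(1)] by auto }
    show "m k \<le> lsum n m"
    proof (cases "k \<in> {1..n}")
      case True
      then show ?thesis unfolding lsum_def by (intro member_le_sum) auto
    qed (use states_out[OF m(1)] in simp)
  qed
  have "{f. (\<forall>k. k \<notin> {1..n} \<longrightarrow> f k = 0) \<and> (\<forall>k. f k \<le> w)} \<subseteq> {f. (\<forall>k. (k \<in> {1..n} \<longrightarrow> f k \<in> {..w}) \<and> (k \<notin> {1..n} \<longrightarrow> f k = 0))}"
    by auto
  then show "finite {f :: label. (\<forall>k. k \<notin> {1..n} \<longrightarrow> f k = 0) \<and> (\<forall>k. f k \<le> w)}"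
    by (rule finite_subset) (rule finite_set_of_finite_funs, auto)
qed

end

section \<open>Matrices that satisfy the intertwining relation\<close>

locale hop_field = hop_graph n eps aff l + B: hop_graph n eps aff m
  for n :: nat and eps :: "nat \<Rightarrow> nat" and aff :: bool and l m :: nat +
  fixes q p :: "'f::field"
begin

definition hop_coeff :: "nat \<Rightarrow> label \<Rightarrow> 'f" where
  "hop_coeff s a = (if s \<in> {1..n} then (q powi int (a s) - q powi (- int (a s))) / (q - inverse q) else 1)"

definition Qs :: "nat \<Rightarrow> 'f" where "Qs e = (if e = 0 then q else - inverse q)"

definition cartan :: "nat \<Rightarrow> nat \<Rightarrow> label \<Rightarrow> 'f" where
  "cartan s t a = (if s \<in> {1..n} then Qs (eps s) powi (- int (a s)) else inverse p)
            * (if t \<in> {1..n} then Qs (eps t) powi int (a t) else p)"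

definition X :: "(label \<times> label) set" where "X = St \<times> B.St"

text \<open>
  Row of \<open>\<Delta>'(e) M\<close> and column of \<open>M \<Delta>(e)\<close> for the link from \<open>s\<close> to \<open>t\<close>, with \<open>c\<close> and \<open>d\<close> for the spectral
  parameters of the two factors.  The generator \<open>f\<close> is covered by exchange of \<open>s\<close> with \<open>t\<close> and of the two tensor
  factors, as \<open>\<Delta>(f)\<close> is the mirror image of \<open>\<Delta>(e)\<close>.
\<close>
definition lhs_e :: "nat \<Rightarrow> nat \<Rightarrow> 'f \<Rightarrow> 'f \<Rightarrow> (label \<times> label \<Rightarrow> 'f) \<Rightarrow> label \<times> label \<Rightarrow> 'f" where
  "lhs_e s t c d \<Psi> A =
     (if can_hop t s (fst A) then c * hop_coeff s (nhop t s (fst A)) * \<Psi> (nhop t s (fst A), snd A) else 0)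
   + (if can_hop t s (snd A) then d * hop_coeff s (nhop t s (snd A)) * cartan s t (fst A) * \<Psi> (fst A, nhop t s (snd A)) else 0)"

definition rhs_e :: "nat \<Rightarrow> nat \<Rightarrow> 'f \<Rightarrow> 'f \<Rightarrow> (label \<times> label \<Rightarrow> 'f) \<Rightarrow> label \<times> label \<Rightarrow> 'f" where
  "rhs_e s t c d \<Psi> S =
     (if can_hop s t (snd S) then d * hop_coeff s (snd S) * \<Psi> (fst S, nhop s t (snd S)) else 0)
   + (if can_hop s t (fst S) then c * hop_coeff s (fst S) * cartan s t (snd S) * \<Psi> (nhop s t (fst S), snd S) else 0)"

definition u :: "nat \<Rightarrow> 'f \<Rightarrow> 'f" where "u r c = (if r = 0 then c else 1)"

definition hop_rel :: "'f \<Rightarrow> 'f \<Rightarrow> (label \<times> label \<Rightarrow> label \<times> label \<Rightarrow> 'f) \<Rightarrow> bool" where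
  "hop_rel x y M \<longleftrightarrow> (\<forall>r\<le>rmax. \<forall>A\<in>X. \<forall>S\<in>X.
     lhs_e (src r) (Suc r) (u r x) (u r y) (\<lambda>A. M A S) A = rhs_e (src r) (Suc r) (u r x) (u r y) (M A) S \<and>
     lhs_e (Suc r) (src r) (inverse (u r y)) (inverse (u r x)) (\<lambda>A. M (prod.swap A) S) (prod.swap A)
       = rhs_e (Suc r) (src r) (inverse (u r y)) (inverse (u r x)) (\<lambda>S. M A (prod.swap S)) (prod.swap S))"

text \<open>
  The matrix of \<open>\<Delta>(e)\<close>; that of \<open>\<Delta>(f)\<close> arises by exchange of \<open>s\<close> with \<open>t\<close> and of the two factors.
\<close>
definition coproduct_e :: "nat \<Rightarrow> nat \<Rightarrow> 'f \<Rightarrow> 'f \<Rightarrow> label \<times> label \<Rightarrow> label \<times> label \<Rightarrow> 'f" where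
  "coproduct_e s t c d S' S =
     (if S' = (fst S, nhop s t (snd S)) then (if can_hop s t (snd S) then d * hop_coeff s (snd S) else 0) else 0)
   + (if S' = (nhop s t (fst S), snd S) then (if can_hop s t (fst S) then c * hop_coeff s (fst S) * cartan s t (snd S) else 0) else 0)"

definition gen_matrix :: "'f \<Rightarrow> 'f \<Rightarrow> bool \<times> nat \<Rightarrow> label \<times> label \<Rightarrow> label \<times> label \<Rightarrow> 'f" where
  "gen_matrix x y g S' S = (let r = snd g in
     if fst g then coproduct_e (Suc r) (src r) (inverse (u r y)) (inverse (u r x)) (prod.swap S') (prod.swap S)
     else coproduct_e (src r) (Suc r) (u r x) (u r y) S' S)"

definition real_site :: "nat \<Rightarrow> int" where "real_site k = of_bool (k \<in> {1..n})"

definition wt :: "label \<times> label \<Rightarrow> int" where "wt S = int (lsum n (fst S)) + int (lsum n (snd S))"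

lemma lsum_nhop': "can_hop s t a \<Longrightarrow> int (lsum n (nhop s t a)) = int (lsum n a) + real_site t - real_site s"
proof -
  assume "can_hop s t a"
  from arg_cong[OF lsum_nhop[OF this], of int]
  show ?thesis unfolding of_nat_add of_nat_of_bool real_site_def by linarith
qed

lemma sum_coproduct_e:
  assumes "finite F" "can_hop s t (snd S) \<Longrightarrow> (fst S, nhop s t (snd S)) \<in> F" "can_hop s t (fst S) \<Longrightarrow> (nhop s t (fst S), snd S) \<in> F"
  shows "(\<Sum>S'\<in>F. \<Psi> S' * coproduct_e s t c d S' S) = rhs_e s t c d \<Psi> S"
proof -
  have d: "(\<Sum>S'\<in>F. \<Psi> S' * (if S' = Z then w else 0)) = (if Z \<in> F then \<Psi> Z * w else 0)" for Z w
    using assms(1) by (simp add: if_distrib[of "\<lambda>z. _ * z"] cong: if_cong)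
  show ?thesis unfolding coproduct_e_def distrib_left sum.distrib d rhs_e_def using assms(2,3) by (auto simp: mult_ac)
qed

lemma swap_swap: "prod.swap (prod.swap z) = z" by (cases z) simp

lemma sum_De_swap:
  assumes "finite F" "can_hop s t (snd S) \<Longrightarrow> (nhop s t (snd S), fst S) \<in> F" "can_hop s t (fst S) \<Longrightarrow> (snd S, nhop s t (fst S)) \<in> F"
  shows "(\<Sum>S'\<in>F. \<Psi> S' * coproduct_e s t c d (prod.swap S') S) = rhs_e s t c d (\<lambda>S. \<Psi> (prod.swap S)) S"
proof -
  have "(\<Sum>S'\<in>F. \<Psi> S' * coproduct_e s t c d (prod.swap S') S) = (\<Sum>S'\<in>prod.swap ` F. \<Psi> (prod.swap S') * coproduct_e s t c d S' S)"
    by (subst sum.reindex) (simp_all add: swap_swap)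
  also have "\<dots> = rhs_e s t c d (\<lambda>S. \<Psi> (prod.swap S)) S"
    by (rule sum_coproduct_e) (use assms in \<open>force+\<close>)
  finally show ?thesis .
qed

lemma nhop_neq:
  assumes "can_hop s t a" "s \<noteq> t" "s \<in> {1..n} \<or> t \<in> {1..n}"
  shows "nhop s t a \<noteq> a"
proof
  assume "nhop s t a = a"
  then have "nhop s t a s = a s" "nhop s t a t = a t" by simp_all
  then show False using assms by (auto simp: nhop_def can_hop_def split: if_splits)
qed

lemma edge: "r \<le> rmax \<Longrightarrow> src r \<noteq> Suc r \<and> (src r \<in> {1..n} \<or> Suc r \<in> {1..n})"
  using src_tgt[of r] n_pos by (auto simp: rmax_def src_def split: if_splits)

lemma coproduct_e_cases:
  assumes "coproduct_e s t c d S' S \<noteq> 0" "s \<noteq> t" "s \<in> {1..n} \<or> t \<in> {1..n}"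
  obtains "can_hop s t (snd S)" "S' = (fst S, nhop s t (snd S))" "coproduct_e s t c d S' S = d * hop_coeff s (snd S)"
    | "can_hop s t (fst S)" "S' = (nhop s t (fst S), snd S)" "coproduct_e s t c d S' S = c * hop_coeff s (fst S) * cartan s t (snd S)"
proof (cases "S' = (fst S, nhop s t (snd S)) \<and> can_hop s t (snd S)")
  case True
  then have ne: "S' \<noteq> (nhop s t (fst S), snd S)" using nhop_neq[OF _ assms(2,3), of "snd S"] by auto
  have "coproduct_e s t c d S' S = d * hop_coeff s (snd S)"
    unfolding coproduct_e_def if_P[OF conjunct1[OF True]] if_P[OF conjunct2[OF True]] if_not_P[OF ne] by simp
  then show thesis using True that(1) by blast
next
  case False
  then have e: "coproduct_e s t c d S' S = (if S' = (nhop s t (fst S), snd S) then (if can_hop s t (fst S) then c * hop_coeff s (fst S) * cartan s t (snd S) else 0) else 0)"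
    by (auto simp: coproduct_e_def)
  then show thesis using assms(1) that(2) by (auto split: if_splits)
qed

end

locale hop_generation = hop_field n eps aff l m q p + val_field v
  for n eps aff l m and q p :: "'f::field" and v :: "'f \<Rightarrow> int" +
  fixes x y :: 'f
  assumes nz: "x \<noteq> 0" "y \<noteq> 0" "q \<noteq> 0" "p \<noteq> 0" and vals: "v q = 0" "v p = 0" "v y < v x"
    and br_val: "\<And>k. k > 0 \<Longrightarrow> (q powi k - q powi (- k)) / (q - inverse q) \<noteq> 0 \<and> v ((q powi k - q powi (- k)) / (q - inverse q)) = 0"
begin

text \<open>
  Heights of the sites: each link raises the height by one, except that one passage through the link 0 is
  compensated by \<open>height_period\<close>.
\<close>
definition site_height :: "nat \<Rightarrow> int" where "site_height k = (if k \<in> {1..n} then (if aff then int k else int k - int n - 1) else 0)"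
definition height_period :: int where "height_period = (if aff then int n else int n + 1)"
definition pos :: "label \<Rightarrow> int" where "pos a = (\<Sum>k=1..n. site_height k * int (a k))"

lemma pos_nhop:
  assumes c: "can_hop s t a" and st: "s \<noteq> t"
  shows "pos (nhop s t a) = pos a + site_height t - site_height s"
proof -
  have w: "(\<Sum>k=1..n. site_height k * of_bool (k = z)) = site_height z" for z
    by (simp add: of_bool_def if_distrib[of "\<lambda>z. _ * z"] site_height_def cong: if_cong)
  have "pos (nhop s t a) = (\<Sum>k=1..n. site_height k * int (a k) + site_height k * of_bool (k = t) - site_height k * of_bool (k = s))"
    unfolding pos_def by (rule sum.cong) (use c st in \<open>auto simp: nhop_def can_hop_def algebra_simps\<close>)
  also have "\<dots> = pos a + site_height t - site_height s" by (simp only: sum.distrib sum_subtractf w pos_def)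
  finally show ?thesis .
qed

text \<open>
  This is what makes the spectral parameter of the link 0 and the heights add up to the same gauge on every link.
\<close>
lemma edge_level: "r \<le> rmax \<Longrightarrow> height_period * of_bool (r = 0) + site_height (Suc r) - site_height (src r) = 1"
  using n_pos n_aff by (auto simp: height_period_def site_height_def src_def rmax_def split: if_splits)

lemma hop_coeff_val: "can_hop s t a \<Longrightarrow> hop_coeff s a \<noteq> 0 \<and> v (hop_coeff s a) = 0"
  using br_val[of "int (a s)"] by (auto simp: hop_coeff_def can_hop_def)

lemma cartan_val: "cartan s t a \<noteq> 0 \<and> v (cartan s t a) = 0"
proof -
  have "Qs e \<noteq> 0 \<and> v (Qs e) = 0" for e using nz vals by (simp add: Qs_def v_minus v_inverse)
  then show ?thesis unfolding cartan_def using nz vals by (auto simp: v_mult v_powi v_power v_inverse)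
qed

lemma coproduct_e_weight:
  assumes "coproduct_e s t c d S' S \<noteq> 0" "s \<noteq> t" "s \<in> {1..n} \<or> t \<in> {1..n}"
  shows "wt S' = wt S + real_site t - real_site s"
  using coproduct_e_cases[OF assms] by cases (simp_all add: wt_def lsum_nhop')

text \<open>
  The two nonzero kinds of entries are the hops of the second and of the first factor, and only the
  former attain the minimal valuation \<open>\<tau>\<close>.
\<close>
lemma coproduct_e_value:
  assumes D: "coproduct_e s t c d S' S \<noteq> 0" and st: "s \<noteq> t" "s \<in> {1..n} \<or> t \<in> {1..n}" and cd: "c \<noteq> 0" "d \<noteq> 0"
    and \<tau>: "height_period * v d + \<beta> * (site_height t - site_height s) = \<tau>" "height_period * v c + \<alpha> * (site_height t - site_height s) > \<tau>"
  defines "E \<equiv> height_period * v (coproduct_e s t c d S' S) + (\<alpha> * pos (fst S') + \<beta> * pos (snd S')) - (\<alpha> * pos (fst S) + \<beta> * pos (snd S))"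
  shows "\<tau> \<le> E" "E = \<tau> \<longleftrightarrow> can_hop s t (snd S) \<and> S' = (fst S, nhop s t (snd S))"
proof -
  have "\<tau> \<le> E \<and> (E = \<tau> \<longleftrightarrow> can_hop s t (snd S) \<and> S' = (fst S, nhop s t (snd S)))"
    using D st(1,2)
  proof (cases rule: coproduct_e_cases)
    case 1
    have v: "v (coproduct_e s t c d S' S) = v d" unfolding 1(3) using hop_coeff_val[OF 1(1)] cd by (simp add: v_mult)
    have p: "pos (snd S') = pos (snd S) + site_height t - site_height s" "fst S' = fst S" using 1(2) pos_nhop[OF 1(1) st(1)] by simp_all
    have "E = \<tau>" unfolding E_def v p using \<tau>(1) by (simp add: algebra_simps)
    then show ?thesis using 1 by simp
  next
    case 2
    have v: "v (coproduct_e s t c d S' S) = v c" unfolding 2(3) using hop_coeff_val[OF 2(1)] cartan_val cd by (simp add: v_mult)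
    have p: "pos (fst S') = pos (fst S) + site_height t - site_height s" "snd S' = snd S" using 2(2) pos_nhop[OF 2(1) st(1)] by simp_all
    have "E > \<tau>" unfolding E_def v p using \<tau>(2) by (simp add: algebra_simps)
    moreover have "\<not> (can_hop s t (snd S) \<and> S' = (fst S, nhop s t (snd S)))"
      using 2(2) nhop_neq[OF 2(1) st] by auto
    ultimately show ?thesis by simp
  qed
  then show "\<tau> \<le> E" "E = \<tau> \<longleftrightarrow> can_hop s t (snd S) \<and> S' = (fst S, nhop s t (snd S))" by blast+
qed

definition gens :: "(bool \<times> nat) set" where "gens = {g. snd g \<le> rmax}"
definition dl :: "bool \<times> nat \<Rightarrow> int" where
  "dl g = (if fst g then real_site (src (snd g)) - real_site (Suc (snd g)) else real_site (Suc (snd g)) - real_site (src (snd g)))"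
definition gauge :: "label \<times> label \<Rightarrow> int" where "gauge S = v x * pos (fst S) + v y * pos (snd S)"
definition tau :: "bool \<times> nat \<Rightarrow> int" where "tau g = (if fst g then - v x else v y)"

lemma u_val: "u r c = 0 \<longleftrightarrow> r = 0 \<and> c = 0" "v (u r c) = of_bool (r = 0) * v c"
  by (simp_all add: u_def)

lemma edge_vals:
  assumes "r \<le> rmax"
  shows "height_period * v (u r c) + v c * (site_height (Suc r) - site_height (src r)) = v c"
    "c \<noteq> 0 \<Longrightarrow> height_period * v (inverse (u r c)) + v c * (site_height (src r) - site_height (Suc r)) = - v c"
proof -
  have d: "site_height (Suc r) - site_height (src r) = 1 - height_period * of_bool (r = 0)" using edge_level[OF assms] by simp
  show "height_period * v (u r c) + v c * (site_height (Suc r) - site_height (src r)) = v c"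
    unfolding d u_val by (simp add: algebra_simps)
  assume c: "c \<noteq> 0"
  have i: "v (inverse (u r c)) = - v (u r c)" using c by (intro v_inverse) (simp add: u_val)
  have d': "site_height (src r) - site_height (Suc r) = - (1 - height_period * of_bool (r = 0))" using d by simp
  show "height_period * v (inverse (u r c)) + v c * (site_height (src r) - site_height (Suc r)) = - v c"
    unfolding d' i u_val by (simp add: algebra_simps)
qed

lemma gen_matrix_weight: assumes g: "g \<in> gens" and D: "gen_matrix x y g S' S \<noteq> 0" shows "wt S' = wt S + dl g"
proof -
  obtain b r where gr: "g = (b, r)" by force
  have r: "r \<le> rmax" using g by (simp add: gens_def gr)
  note e = edge[OF r]
  show ?thesis
  proof (cases b)
    case True
    have "wt (prod.swap S') = wt (prod.swap S) + real_site (src r) - real_site (Suc r)"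
      by (rule coproduct_e_weight) (use D e in \<open>auto simp: gr True gen_matrix_def\<close>)
    then show ?thesis by (simp add: wt_def dl_def gr True)
  next
    case False
    have "wt S' = wt S + real_site (Suc r) - real_site (src r)"
      by (rule coproduct_e_weight) (use D e in \<open>auto simp: gr False gen_matrix_def\<close>)
    then show ?thesis by (simp add: dl_def gr False)
  qed
qed

definition mover :: "bool \<times> nat \<Rightarrow> label \<times> label \<Rightarrow> label \<times> label \<Rightarrow> bool" where
  "mover g S S' \<longleftrightarrow> (if fst g then can_hop (Suc (snd g)) (src (snd g)) (fst S) \<and> S' = (nhop (Suc (snd g)) (src (snd g)) (fst S), snd S)
     else can_hop (src (snd g)) (Suc (snd g)) (snd S) \<and> S' = (fst S, nhop (src (snd g)) (Suc (snd g)) (snd S)))"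

lemma gen_matrix_value:
  assumes g: "g \<in> gens" and D: "gen_matrix x y g S' S \<noteq> 0"
  shows "tau g \<le> height_period * v (gen_matrix x y g S' S) + gauge S' - gauge S"
    "height_period * v (gen_matrix x y g S' S) + gauge S' - gauge S = tau g \<longleftrightarrow> mover g S S'"
proof -
  obtain b r where gr: "g = (b, r)" by force
  have r: "r \<le> rmax" using g by (simp add: gens_def gr)
  note e = edge[OF r] edge_vals[OF r]
  have "tau g \<le> height_period * v (gen_matrix x y g S' S) + gauge S' - gauge S \<and> (height_period * v (gen_matrix x y g S' S) + gauge S' - gauge S = tau g \<longleftrightarrow> mover g S S')"
  proof (cases b)
    case True
    have D': "coproduct_e (Suc r) (src r) (inverse (u r y)) (inverse (u r x)) (prod.swap S') (prod.swap S) \<noteq> 0"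
      using D by (simp add: gr True gen_matrix_def)
    have V: "height_period * v (inverse (u r x)) + v x * (site_height (src r) - site_height (Suc r)) = - v x"
      "height_period * v (inverse (u r y)) + v y * (site_height (src r) - site_height (Suc r)) > - v x"
      "Suc r \<noteq> src r" "Suc r \<in> {1..n} \<or> src r \<in> {1..n}" "inverse (u r x) \<noteq> 0" "inverse (u r y) \<noteq> 0"
      using e nz vals by (auto simp: u_def)
    note V = coproduct_e_value[OF D' V(3,4,6,5,1,2)]
    have m: "mover g S S' \<longleftrightarrow> can_hop (Suc r) (src r) (snd (prod.swap S)) \<and> prod.swap S' = (fst (prod.swap S), nhop (Suc r) (src r) (snd (prod.swap S)))"
      using True by (cases S') (auto simp: mover_def gr)
    have "tau g \<le> height_period * v (coproduct_e (Suc r) (src r) (inverse (u r y)) (inverse (u r x)) (prod.swap S') (prod.swap S))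
         + (v y * pos (fst (prod.swap S')) + v x * pos (snd (prod.swap S'))) - (v y * pos (fst (prod.swap S)) + v x * pos (snd (prod.swap S)))"
      "height_period * v (coproduct_e (Suc r) (src r) (inverse (u r y)) (inverse (u r x)) (prod.swap S') (prod.swap S))
         + (v y * pos (fst (prod.swap S')) + v x * pos (snd (prod.swap S'))) - (v y * pos (fst (prod.swap S)) + v x * pos (snd (prod.swap S))) = tau g
       \<longleftrightarrow> mover g S S'"
      unfolding m using V by (simp_all add: tau_def gr True)
    then show ?thesis by (simp add: gauge_def gen_matrix_def gr True algebra_simps)
  next
    case False
    have D': "coproduct_e (src r) (Suc r) (u r x) (u r y) S' S \<noteq> 0"
      using D by (simp add: gr False gen_matrix_def)
    have V: "height_period * v (u r y) + v y * (site_height (Suc r) - site_height (src r)) = v y"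
      "height_period * v (u r x) + v x * (site_height (Suc r) - site_height (src r)) > v y"
      "src r \<noteq> Suc r" "src r \<in> {1..n} \<or> Suc r \<in> {1..n}" "u r x \<noteq> 0" "u r y \<noteq> 0"
      using e nz vals by (auto simp: u_def)
    note V = coproduct_e_value[OF D' V(3,4,5,6,1,2)]
    have m: "mover g S S' \<longleftrightarrow> can_hop (src r) (Suc r) (snd S) \<and> S' = (fst S, nhop (src r) (Suc r) (snd S))"
      by (simp add: mover_def gr False)
    have "tau g \<le> height_period * v (coproduct_e (src r) (Suc r) (u r x) (u r y) S' S) + (v x * pos (fst S') + v y * pos (snd S')) - (v x * pos (fst S) + v y * pos (snd S))"
      "height_period * v (coproduct_e (src r) (Suc r) (u r x) (u r y) S' S) + (v x * pos (fst S') + v y * pos (snd S')) - (v x * pos (fst S) + v y * pos (snd S)) = tau g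
        \<longleftrightarrow> mover g S S'"
      unfolding m using V by (simp_all add: tau_def gr False)
    then show ?thesis by (simp add: gauge_def gen_matrix_def gr False algebra_simps)
  qed
  then show "tau g \<le> height_period * v (gen_matrix x y g S' S) + gauge S' - gauge S"
    "height_period * v (gen_matrix x y g S' S) + gauge S' - gauge S = tau g \<longleftrightarrow> mover g S S'" by blast+
qed

lemma gen_matrix_mover:
  assumes g: "g \<in> gens" and m: "mover g S S'"
  shows "gen_matrix x y g S' S \<noteq> 0"
proof -
  obtain b r where gr: "g = (b, r)" by force
  have r: "r \<le> rmax" using g by (simp add: gens_def gr)
  have *: "coproduct_e s t c d (fst S, nhop s t (snd S)) S \<noteq> 0" if "can_hop s t (snd S)" "s \<noteq> t" "s \<in> {1..n} \<or> t \<in> {1..n}" "d \<noteq> 0" for s t c d S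
  proof -
    have ne: "(fst S, nhop s t (snd S)) \<noteq> (nhop s t (fst S), snd S)" using nhop_neq[OF that(1-3)] by auto
    show ?thesis unfolding coproduct_e_def if_P[OF HOL.refl] if_P[OF that(1)] if_not_P[OF ne]
      using that(4) hop_coeff_val[OF that(1)] by simp
  qed
  show ?thesis
  proof (cases b)
    case True
    have "coproduct_e (Suc r) (src r) (inverse (u r y)) (inverse (u r x)) (fst (prod.swap S), nhop (Suc r) (src r) (snd (prod.swap S))) (prod.swap S) \<noteq> 0"
      by (rule *) (use m edge[OF r] nz in \<open>auto simp: mover_def gr True u_val\<close>)
    then show ?thesis using m by (simp add: gen_matrix_def mover_def gr True)
  next
    case False
    have "coproduct_e (src r) (Suc r) (u r x) (u r y) (fst S, nhop (src r) (Suc r) (snd S)) S \<noteq> 0"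
      by (rule *) (use m edge[OF r] nz in \<open>auto simp: mover_def gr False u_val\<close>)
    then show ?thesis using m by (simp add: gen_matrix_def mover_def gr False)
  qed
qed

lemma X_D: "S \<in> X \<Longrightarrow> fst S \<in> states n eps \<and> snd S \<in> states n eps"
  using StD B.StD by (auto simp: X_def)

lemma fin_X: "finite {S \<in> X. wt S = w}"
proof (rule finite_subset)
  show "{S \<in> X. wt S = w} \<subseteq> (\<Union>k\<le>nat w. {a \<in> states n eps. lsum n a = k}) \<times> (\<Union>k\<le>nat w. {a \<in> states n eps. lsum n a = k})"
    using X_D by (fastforce simp: wt_def)
  show "finite ((\<Union>k\<le>nat w. {a \<in> states n eps. lsum n a = k}) \<times> (\<Union>k\<le>nat w. {a \<in> states n eps. lsum n a = k}))"
    using finite_states_lsum by blast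
qed

lemma generation_X: "s0 \<in> X \<Longrightarrow> generation v X (gen_matrix x y) gens wt dl gauge height_period tau s0"
  by unfold_locales (use fin_X gen_matrix_weight gen_matrix_value(1) n_pos in \<open>auto simp: height_period_def\<close>)

lemma mover_X:
  assumes "g \<in> gens" "S \<in> X" "mover g S S'" shows "S' \<in> X"
proof -
  obtain b r where gr: "g = (b, r)" by force
  have r: "r \<le> rmax" using assms(1) by (simp add: gens_def gr)
  show ?thesis using assms(2,3) src_tgt(2)[OF r] nhop_St[of "fst S" "Suc r" "src r"] B.nhop_St[of "snd S" "src r" "Suc r"]
    unfolding X_def mover_def gr by (auto split: if_splits)
qed

lemma mover_inj:
  assumes g: "g \<in> gens" and S: "S1 \<in> X" "S2 \<in> X" and m: "mover g S1 S'" "mover g S2 S'"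
  shows "S1 = S2"
proof -
  obtain b r where gr: "g = (b, r)" by force
  have r: "r \<le> rmax" using g by (simp add: gens_def gr)
  have ne: "src r \<noteq> Suc r" "Suc r \<noteq> src r" using edge[OF r] by auto
  have inj: "a1 = a2" if "a1 \<in> states n eps" "a2 \<in> states n eps" "can_hop s t a1" "can_hop s t a2" "nhop s t a1 = nhop s t a2" "s \<noteq> t" for s t a1 a2
    using nhop_nhop[OF that(1,3,6)] nhop_nhop[OF that(2,4,6)] that(5) by metis
  show ?thesis using m X_D[OF S(1)] X_D[OF S(2)] inj[OF _ _ _ _ _ ne(1)] inj[OF _ _ _ _ _ ne(2)]
    unfolding mover_def gr by (cases S1; cases S2) (auto split: if_splits)
qed

lemma mover_step:
  assumes s0: "s0 \<in> X" and g: "g \<in> gens" and S: "S \<in> X" and m: "mover g S S'"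
  shows "(S, S') \<in> generation.step v X (gen_matrix x y) gens gauge height_period tau"
proof -
  interpret generation v X "gen_matrix x y" gens wt dl gauge height_period tau s0 by (rule generation_X[OF s0])
  have lead: "lead g Z Z' \<longleftrightarrow> Z \<in> X \<and> Z' \<in> X \<and> mover g Z Z'" for Z Z'
    unfolding lead_def using gen_matrix_value(2)[OF g] gen_matrix_mover[OF g] by blast
  have func: "Z1 = Z2" if "mover g Z Z1" "mover g Z Z2" for Z Z1 Z2
    using that unfolding mover_def by (auto split: if_splits)
  have "lead g S S' \<and> (\<forall>Z. lead g Z S' \<longrightarrow> Z = S) \<and> (\<forall>Z. lead g S Z \<longrightarrow> Z = S')"
    unfolding lead using S m mover_X[OF g S m] mover_inj[OF g] func by blast
  then show ?thesis unfolding step_def using g by blast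
qed

text \<open>
  The second factor is moved by \<open>e\<close> generators.  The first is moved by \<open>f\<close> generators, which run along the
  links backwards; as any two states are connected in one direction, they are in the other.
\<close>
lemma reach:
  assumes s0: "s0 \<in> X" and S: "S \<in> X"
  shows "(s0, S) \<in> (generation.step v X (gen_matrix x y) gens gauge height_period tau)\<^sup>*"
proof -
  let ?step = "generation.step v X (gen_matrix x y) gens gauge height_period tau"
  obtain a0 b0 a b where e: "s0 = (a0, b0)" "S = (a, b)" by force
  have ab: "a0 \<in> St" "a \<in> St" "b0 \<in> B.St" "b \<in> B.St" using s0 S by (simp_all add: X_def e)
  have "(b0, b) \<in> B.hop_steps\<^sup>*" by (rule B.hop_steps_connected[OF ab(3,4)])
  then have "b \<in> B.St \<and> ((a0, b0), (a0, b)) \<in> ?step\<^sup>*"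
  proof (induction rule: rtrancl_induct)
    case (step c c')
    then obtain r where r: "r \<le> rmax" "can_hop (src r) (Suc r) c" "c' = nhop (src r) (Suc r) c" by (auto simp: B.hop_steps_def)
    have "((a0, c), (a0, c')) \<in> ?step"
      by (rule mover_step[OF s0, of "(False, r)"]) (use r ab step in \<open>auto simp: gens_def X_def mover_def\<close>)
    then show ?case using step B.hop_steps_St by (blast intro: rtrancl_into_rtrancl)
  qed (use ab in simp)
  moreover have "((a0, b), (a, b)) \<in> ?step\<^sup>*"
  proof -
    have "(a, a0) \<in> hop_steps\<^sup>*" by (rule hop_steps_connected[OF ab(2,1)])
    then have "a0 \<in> St \<and> ((a0, b), (a, b)) \<in> ?step\<^sup>*"
    proof (induction rule: rtrancl_induct)
      case (step c c')
      then obtain r where r: "r \<le> rmax" "can_hop (src r) (Suc r) c" "c' = nhop (src r) (Suc r) c" by (auto simp: hop_steps_def)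
      have c: "c \<in> St" "c' \<in> St" using step hop_steps_St by blast+
      note ne = edge[OF r(1)]
      have k: "can_hop (Suc r) (src r) c' \<and> c = nhop (Suc r) (src r) c'"
        using nhop_nhop[OF StD[OF c(1)] r(2)] can_hop_back[OF StD[OF c(1)] r(2)] ne r(3) by simp
      have "((c', b), (c, b)) \<in> ?step"
        by (rule mover_step[OF s0, of "(True, r)"]) (use r(1) k c ab in \<open>auto simp: gens_def X_def mover_def\<close>)
      then show ?case using step c(2) by (blast intro: converse_rtrancl_into_rtrancl)
    qed (use ab in simp)
    then show ?thesis ..
  qed
  ultimately show ?thesis unfolding e by (meson rtrancl_trans)
qed

context
  fixes k K' :: "'f set" and M :: "label \<times> label \<Rightarrow> label \<times> label \<Rightarrow> 'f"
  assumes sub: "subfield_module k K'" and coeffs: "q \<in> k" "p \<in> k" "x \<in> k" "y \<in> k"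
    and rel: "hop_rel x y M"
begin

interpretation subfield_module k K' by (rule sub)

lemma k_power: "c \<in> k \<Longrightarrow> c ^ j \<in> k"
  by (induction j) (auto intro: k_sub)

lemma k_powi: "c \<in> k \<Longrightarrow> c powi i \<in> k"
  unfolding power_int_def using k_power k_sub(6) by auto

lemma k_hop_coeff: "hop_coeff s a \<in> k" "cartan s t a \<in> k"
proof -
  have i: "inverse c \<in> k" "- c \<in> k" if "c \<in> k" for c using k_sub(6)[OF that] k_sub(4)[OF k_sub(1) that] by simp_all
  show "hop_coeff s a \<in> k" unfolding hop_coeff_def divide_inverse using coeffs by (auto intro!: k_sub k_powi k_power)
  have "Qs e \<in> k" for e unfolding Qs_def using coeffs i by auto
  then show "cartan s t a \<in> k" unfolding cartan_def using coeffs by (auto intro!: k_sub k_powi k_power)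
qed

lemma k_u: "u r x \<in> k" "u r y \<in> k" "inverse (u r x) \<in> k" "inverse (u r y) \<in> k"
  using coeffs k_sub(2,6) by (simp_all add: u_def)

lemma k_coproduct_e: "c \<in> k \<Longrightarrow> d \<in> k \<Longrightarrow> coproduct_e s t c d S' S \<in> k"
  unfolding coproduct_e_def by (auto intro!: k_sub k_hop_coeff)

lemma lhs_e_combination:
  assumes cd: "c \<in> k" "d \<in> k"
    and T: "can_hop t s (fst A) \<Longrightarrow> f (nhop t s (fst A), snd A) \<in> X" "can_hop t s (snd A) \<Longrightarrow> f (fst A, nhop t s (snd A)) \<in> X"
    and f: "\<And>Z. f (f Z) = Z"
  shows "\<exists>C J. J \<subseteq> X \<and> (\<forall>Z\<in>J. C Z \<in> k) \<and> (\<forall>S\<in>X. lhs_e s t c d (\<lambda>A. M (f A) S) A = (\<Sum>Z\<in>J. C Z * M Z S))"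
proof -
  let ?z1 = "f (nhop t s (fst A), snd A)" and ?z2 = "f (fst A, nhop t s (snd A))"
  define c1 where "c1 = (if can_hop t s (fst A) then c * hop_coeff s (nhop t s (fst A)) else 0)"
  define c2 where "c2 = (if can_hop t s (snd A) then d * hop_coeff s (nhop t s (snd A)) * cartan s t (fst A) else 0)"
  define C where "C Z = (if Z = ?z1 then c1 else 0) + (if Z = ?z2 then c2 else 0)" for Z
  define J where "J = {?z1, ?z2} \<inter> X"
  have ck: "c1 \<in> k" "c2 \<in> k" unfolding c1_def c2_def using cd by (auto intro!: k_sub k_hop_coeff)
  have "C Z \<in> k" for Z unfolding C_def using ck k_sub(1,3) by auto
  moreover have "lhs_e s t c d (\<lambda>A. M (f A) S) A = (\<Sum>Z\<in>J. C Z * M Z S)" for S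
  proof -
    have fin: "finite J" by (simp add: J_def)
    have del: "(\<Sum>Z\<in>J. (if Z = z then w else 0) * M Z S) = (if z \<in> J then w * M z S else 0)" for z w
    proof -
      have "(\<Sum>Z\<in>J. (if Z = z then w else 0) * M Z S) = (\<Sum>Z\<in>J. if Z = z then w * M z S else 0)"
        by (rule sum.cong) auto
      then show ?thesis using fin by simp
    qed
    show ?thesis unfolding C_def distrib_right sum.distrib del unfolding lhs_e_def J_def c1_def c2_def using T by auto
  qed
  ultimately show ?thesis by (intro exI[of _ C] exI[of _ J]) (auto simp: J_def)
qed

text \<open>
  A row of a matrix with \<open>hop_rel\<close> is closed under the action of \<open>\<Delta>(g)\<close> from the right, because \<open>\<Delta>'(g)\<close> on the left
  only mixes rows.
\<close>
theorem hop_generated: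
  assumes s0: "s0 \<in> X" and init: "\<And>A. A \<in> X \<Longrightarrow> M A s0 \<in> K'" and A: "A \<in> X" and S: "S \<in> X"
  shows "M A S \<in> K'"
proof -
  interpret generation v X "gen_matrix x y" gens wt dl gauge height_period tau s0 by (rule generation_X[OF s0])
  show ?thesis
  proof (rule generated_entries[where \<Phi> = M and Out = X and k = k])
    fix g S S' assume "g \<in> gens" then show "gen_matrix x y g S' S \<in> k"
      unfolding gen_matrix_def Let_def by (auto intro!: k_coproduct_e k_u)
  next
    fix g A assume g: "g \<in> gens" and A: "A \<in> X"
    obtain b r where gr: "g = (b, r)" by force
    have r: "r \<le> rmax" using g by (simp add: gens_def gr)
    have Ap: "fst A \<in> St" "snd A \<in> B.St" using A by (auto simp: X_def)
    have in_F: "S' \<in> {S' \<in> X. wt S' = wt S + dl g}" if "S \<in> X" "S' \<in> X" "wt S' = wt S + dl g" for S S'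
      using that by simp
    note af = src_tgt(2)[OF r]
    have tgt: "can_hop (src r) (Suc r) (snd S) \<Longrightarrow> (fst S, nhop (src r) (Suc r) (snd S)) \<in> X"
       "can_hop (src r) (Suc r) (fst S) \<Longrightarrow> (nhop (src r) (Suc r) (fst S), snd S) \<in> X"
       "can_hop (Suc r) (src r) (snd S) \<Longrightarrow> (fst S, nhop (Suc r) (src r) (snd S)) \<in> X"
       "can_hop (Suc r) (src r) (fst S) \<Longrightarrow> (nhop (Suc r) (src r) (fst S), snd S) \<in> X" if "S \<in> X" for S
      using that nhop_St[of "fst S"] B.nhop_St[of "snd S"] af unfolding X_def by auto
    show "\<exists>C J. J \<subseteq> X \<and> (\<forall>Z\<in>J. C Z \<in> k) \<and>
       (\<forall>S\<in>X. (\<Sum>S'\<in>{S' \<in> X. wt S' = wt S + dl g}. M A S' * gen_matrix x y g S' S) = (\<Sum>Z\<in>J. C Z * M Z S))"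
    proof (cases b)
      case True
      have R: "(\<Sum>S'\<in>{S' \<in> X. wt S' = wt S + dl g}. M A S' * gen_matrix x y g S' S)
          = lhs_e (Suc r) (src r) (inverse (u r y)) (inverse (u r x)) (\<lambda>A. M (prod.swap A) S) (prod.swap A)" if S: "S \<in> X" for S
      proof -
        have "(\<Sum>S'\<in>{S' \<in> X. wt S' = wt S + dl g}. M A S' * gen_matrix x y g S' S)
          = rhs_e (Suc r) (src r) (inverse (u r y)) (inverse (u r x)) (\<lambda>S. M A (prod.swap S)) (prod.swap S)"
          unfolding gen_matrix_def gr Let_def using True
          by (simp, intro sum_De_swap) (use fin tgt[OF S] in \<open>auto simp: wt_def dl_def lsum_nhop'\<close>)
        then show ?thesis using rel r A S unfolding hop_rel_def by simp
      qed
      have "\<exists>C J. J \<subseteq> X \<and> (\<forall>Z\<in>J. C Z \<in> k) \<and> (\<forall>S\<in>X. lhs_e (Suc r) (src r) (inverse (u r y)) (inverse (u r x)) (\<lambda>A. M (prod.swap A) S) (prod.swap A) = (\<Sum>Z\<in>J. C Z * M Z S))"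
        by (rule lhs_e_combination) (use tgt[OF A] in \<open>auto simp: swap_swap intro!: k_u\<close>)
      then show ?thesis using R by simp
    next
      case False
      have R: "(\<Sum>S'\<in>{S' \<in> X. wt S' = wt S + dl g}. M A S' * gen_matrix x y g S' S)
          = lhs_e (src r) (Suc r) (u r x) (u r y) (\<lambda>A. M A S) A" if S: "S \<in> X" for S
      proof -
        have "(\<Sum>S'\<in>{S' \<in> X. wt S' = wt S + dl g}. M A S' * gen_matrix x y g S' S)
          = rhs_e (src r) (Suc r) (u r x) (u r y) (M A) S"
          unfolding gen_matrix_def gr Let_def using False
          by (simp, intro sum_coproduct_e) (use fin tgt[OF S] in \<open>auto simp: wt_def dl_def lsum_nhop'\<close>)
        then show ?thesis using rel r A S unfolding hop_rel_def by simp
      qed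
      have "\<exists>C J. J \<subseteq> X \<and> (\<forall>Z\<in>J. C Z \<in> k) \<and> (\<forall>S\<in>X. lhs_e (src r) (Suc r) (u r x) (u r y) (\<lambda>A. M (id A) S) A = (\<Sum>Z\<in>J. C Z * M Z S))"
        by (rule lhs_e_combination) (use tgt[OF A] in \<open>auto intro!: k_u\<close>)
      then show ?thesis using R by simp
    qed
  qed (use reach[OF s0] sub init A S in auto)
qed

end

end

section \<open>The intertwining series\<close>

context hop_field begin

lemma lhs_e_scale: "lhs_e s t c d (\<lambda>A. w * \<Psi> A) A = w * lhs_e s t c d \<Psi> A" "lhs_e s t (w * c) (w * d) \<Psi> A = w * lhs_e s t c d \<Psi> A"
  by (simp_all add: lhs_e_def algebra_simps)

lemma rhs_e_scale: "rhs_e s t c d (\<lambda>A. w * \<Psi> A) A = w * rhs_e s t c d \<Psi> A" "rhs_e s t (w * c) (w * d) \<Psi> A = w * rhs_e s t c d \<Psi> A"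
  by (simp_all add: rhs_e_def algebra_simps)

lemma hop_rel_scale: "hop_rel x y M \<Longrightarrow> hop_rel x y (\<lambda>A S. w * M A S)"
  unfolding hop_rel_def lhs_e_scale rhs_e_scale by simp

lemma u_mult: "u r (c * d) = u r c * u r d"
  by (simp add: u_def)

text \<open>Only the ratio of the spectral parameters matters.\<close>
lemma hop_rel_homogeneous: "hop_rel x y M \<Longrightarrow> hop_rel (w * x) (w * y) M"
  unfolding hop_rel_def u_mult inverse_mult_distrib lhs_e_scale rhs_e_scale by simp

lemma lhs_e_alt: "lhs_e s t c d \<Psi> (a, b) = c * (if can_hop t s a then hop_coeff s (nhop t s a) * \<Psi> (nhop t s a, b) else 0)
    + d * (cartan s t a * (if can_hop t s b then hop_coeff s (nhop t s b) * \<Psi> (a, nhop t s b) else 0))"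
  by (simp add: lhs_e_def)

lemma rhs_e_alt: "rhs_e s t c d \<Psi> (i, j) = d * (hop_coeff s j * (if can_hop s t j then \<Psi> (i, nhop s t j) else 0))
    + c * (hop_coeff s i * (cartan s t j * (if can_hop s t i then \<Psi> (nhop s t i, j) else 0)))"
  "rhs_e s t c d \<Psi> (i, j) = d * (hop_coeff s j * (if can_hop s t j then \<Psi> (i, nhop s t j) else 0))
    + c * (cartan s t j * (hop_coeff s i * (if can_hop s t i then \<Psi> (nhop s t i, j) else 0)))"
  by (simp_all add: rhs_e_def)

lemma cartan_swap: "cartan t s a = inverse (cartan s t a)"
  by (simp add: cartan_def power_int_minus)

end

text \<open>The value of \<open>p\<close> in the field of Laurent series in \<open>z\<close>.\<close>
definition pL :: lser where "pL = fls_const ps"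

lemma qL_powi: "qL powi i = fls_const (qs powi i)"
  unfolding qL_def power_int_def by (auto simp: fls_const_power fls_inverse_const)

locale series_model = T: qmodel n eps + hop_field n eps aff l m qL pL for n eps aff l m
begin

lemma valid_states: "a \<in> states n eps \<Longrightarrow> T.valid (int_label a)"
  using eps01 unfolding T.valid_def T.occ_ok_def int_label_def states_def by (force simp: le_Suc_eq)

lemma ihop_can_hop: "a \<in> states n eps \<Longrightarrow> can_hop s t a \<Longrightarrow> s \<noteq> t \<Longrightarrow> T.ihop s t (int_label a) = int_label (nhop s t a)"
  unfolding T.ihop_def int_label_def nhop_def can_hop_def states_def by (auto simp: fun_eq_iff)

lemma ihop_cannot: "a \<in> states n eps \<Longrightarrow> \<not> can_hop s t a \<Longrightarrow> s \<noteq> t \<Longrightarrow> \<not> T.valid (T.ihop s t (int_label a))"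
proof -
  assume a: "a \<in> states n eps" and c: "\<not> can_hop s t a" and st: "s \<noteq> t"
  have "s \<in> {1..n} \<and> a s = 0 \<or> t \<in> {1..n} \<and> eps t = 1 \<and> a t \<noteq> 0" using c by (auto simp: can_hop_def)
  then show ?thesis
  proof (elim disjE conjE)
    assume "s \<in> {1..n}" "a s = 0"
    then show ?thesis using st by (auto simp: T.valid_def T.occ_ok_def T.ihop_def int_label_def intro!: bexI[of _ s])
  next
    assume "t \<in> {1..n}" "eps t = 1" "a t \<noteq> 0"
    then show ?thesis using st by (auto simp: T.valid_def T.occ_ok_def T.ihop_def int_label_def intro!: bexI[of _ t])
  qed
qed

lemma ihop_coeff_hop_coeff: "fls_const (T.ihop_coeff s (int_label a)) = hop_coeff s a"
  unfolding T.ihop_coeff_def hop_coeff_def int_label_def Q.br_def qL_powi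
  by (simp add: qL_def fls_inverse_const divide_inverse fls_minus_const)

lemma icartan_cartan: "fls_const (T.icartan s t (int_label a)) = cartan s t a"
proof -
  have Q: "fls_const (Q.site_q e powi i) = Qs e powi i" for e i
  proof -
    have "Qs e = fls_const (Q.site_q e)" unfolding Qs_def Q.site_q_def unfolding qL_def by (simp add: fls_inverse_const fls_const_uminus)
    then show ?thesis by (auto simp: power_int_def fls_const_power fls_inverse_const)
  qed
  have p: "inverse pL = fls_const (inverse ps)" by (simp add: pL_def fls_inverse_const)
  show ?thesis unfolding T.icartan_def cartan_def int_label_def p Q[symmetric] unfolding pL_def by simp
qed

definition base :: "label \<times> label \<Rightarrow> label \<times> label \<Rightarrow> lser" where
  "base A S = (if aff then T.trace_series else T.B.boundary_series) (int_label (fst A)) (int_label (snd A)) (int_label (fst S)) (int_label (snd S))"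

abbreviation Tm where "Tm \<equiv> (if aff then T.trace_series else T.B.boundary_series)"

lemma Tm_invalid: "\<not> T.valid a \<or> \<not> T.valid b \<or> \<not> T.valid i \<or> \<not> T.valid j \<Longrightarrow> Tm a b i j = 0"
proof -
  assume "\<not> T.valid a \<or> \<not> T.valid b \<or> \<not> T.valid i \<or> \<not> T.valid j"
  then have z: "T.path_prod a b i j c = 0" for c by (rule T.path_prod_invalid)
  have 0: "zpower_series (\<lambda>d. 0 :: complex fls) = 0" by (simp add: zpower_series_def fps_zero_def[symmetric])
  show ?thesis by (simp add: T.trace_series_def T.B.boundary_series_def z 0)
qed

text \<open>A hop that is not possible leads to a label out of range, where the series vanishes.\<close>
lemma hop_terms:
  assumes st: "s \<noteq> t" and S: "a \<in> states n eps" "b \<in> states n eps" "i \<in> states n eps" "j \<in> states n eps"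
  shows "fls_const (T.ihop_coeff s (T.ihop t s (int_label a))) * Tm (T.ihop t s (int_label a)) (int_label b) (int_label i) (int_label j)
      = (if can_hop t s a then hop_coeff s (nhop t s a) * base (nhop t s a, b) (i, j) else 0)"
    "fls_const (T.ihop_coeff s (T.ihop t s (int_label b))) * Tm (int_label a) (T.ihop t s (int_label b)) (int_label i) (int_label j)
      = (if can_hop t s b then hop_coeff s (nhop t s b) * base (a, nhop t s b) (i, j) else 0)"
    "Tm (int_label a) (int_label b) (T.ihop s t (int_label i)) (int_label j) = (if can_hop s t i then base (a, b) (nhop s t i, j) else 0)"
    "Tm (int_label a) (int_label b) (int_label i) (T.ihop s t (int_label j)) = (if can_hop s t j then base (a, b) (i, nhop s t j) else 0)"
  using ihop_can_hop[OF S(1), of t s] ihop_can_hop[OF S(2), of t s] ihop_can_hop[OF S(3), of s t] ihop_can_hop[OF S(4), of s t]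
    ihop_cannot[OF S(1), of t s] ihop_cannot[OF S(2), of t s] ihop_cannot[OF S(3), of s t] ihop_cannot[OF S(4), of s t] st
  by (simp_all add: Tm_invalid base_def ihop_coeff_hop_coeff)

lemma Tm_e:
  assumes r: "r \<le> rmax" and v: "T.valid a" "T.valid b" "T.valid i" "T.valid j" and bj: "aff \<Longrightarrow> T.total b = T.total j"
  defines "s \<equiv> src r" and "t \<equiv> Suc r"
  shows "T.spectral r * (fls_const (T.ihop_coeff s (T.ihop t s a)) * Tm (T.ihop t s a) b i j) + fls_const (T.icartan s t a * T.ihop_coeff s (T.ihop t s b)) * Tm a (T.ihop t s b) i j
    = fls_const (T.ihop_coeff s j) * Tm a b i (T.ihop s t j) + T.spectral r * (fls_const (T.ihop_coeff s i * T.icartan s t j) * Tm a b (T.ihop s t i) j)"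
proof (cases aff)
  case True
  have "r < n" using r True n_aff unfolding rmax_def by simp
  have sr: "src r = (if r = 0 then n else r)" using True unfolding src_def by simp
  show ?thesis unfolding if_P[OF True] s_def t_def
    by (rule T.trace_series_e[OF n_aff[OF True] \<open>r < n\<close> sr _ v bj[OF True]]) simp
next
  case False
  have sr: "src r = r" using False unfolding src_def by simp
  show ?thesis unfolding if_not_P[OF False] s_def t_def
    by (rule T.B.boundary_series_e[OF sr _ _ v]) (use r[unfolded rmax_def if_not_P[OF False]] in simp_all)
qed

lemma Tm_f:
  assumes r: "r \<le> rmax" and v: "T.valid a" "T.valid b" "T.valid i" "T.valid j" and bj: "aff \<Longrightarrow> T.total b = T.total j"
  defines "s \<equiv> src r" and "t \<equiv> Suc r"
  shows "T.spectral r * (fls_const (T.ihop_coeff t (T.ihop s t b)) * Tm a (T.ihop s t b) i j) + fls_const (inverse (T.icartan s t b) * T.ihop_coeff t (T.ihop s t a)) * Tm (T.ihop s t a) b i j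
    = fls_const (T.ihop_coeff t i) * Tm a b (T.ihop t s i) j + T.spectral r * (fls_const (inverse (T.icartan s t i) * T.ihop_coeff t j) * Tm a b i (T.ihop t s j))"
proof (cases aff)
  case True
  have "r < n" using r True n_aff unfolding rmax_def by simp
  have sr: "src r = (if r = 0 then n else r)" using True unfolding src_def by simp
  show ?thesis unfolding if_P[OF True] s_def t_def mult.commute[of "inverse (T.icartan _ _ b)"]
    by (rule T.trace_series_f[OF n_aff[OF True] \<open>r < n\<close> sr _ v bj[OF True]]) simp
next
  case False
  have sr: "src r = r" using False unfolding src_def by simp
  show ?thesis unfolding if_not_P[OF False] s_def t_def mult.commute[of "inverse (T.icartan _ _ b)"]
    by (rule T.B.boundary_series_f[OF sr _ _ v]) (use r[unfolded rmax_def if_not_P[OF False]] in simp_all)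
qed

lemma X_states: "A \<in> X \<Longrightarrow> fst A \<in> states n eps \<and> snd A \<in> states n eps"
  using StD B.StD by (auto simp: X_def)

lemma clear_denominator:
  fixes z P Q U W :: lser
  assumes "z \<noteq> 0" "z * P + Q = U + z * W"
  shows "P + inverse z * Q = inverse z * U + W"
proof -
  have "z * (P + inverse z * Q) = z * (inverse z * U + W)"
    using assms by (simp add: distrib_left mult.assoc[symmetric])
  then show ?thesis using assms(1) by simp
qed

text \<open>The spectral parameters are \<open>(x, y) = (z, 1)\<close>.\<close>
theorem base_rel: "hop_rel zL 1 base"
  unfolding hop_rel_def
proof (intro allI ballI impI conjI)
  fix r A S assume r: "r \<le> rmax" and A: "A \<in> X" and S: "S \<in> X"
  obtain a b i j where ab: "A = (a, b)" "S = (i, j)" by force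
  have st: "a \<in> states n eps" "b \<in> states n eps" "i \<in> states n eps" "j \<in> states n eps"
    using X_states[OF A] X_states[OF S] by (auto simp: ab)
  have bj: "aff \<Longrightarrow> T.total (int_label b) = T.total (int_label j)"
    using A S unfolding T.total_int_label X_def B.St_def ab by simp
  define s t where "s = src r" and "t = Suc r"
  have ne: "s \<noteq> t" "t \<noteq> s" using edge[OF r] by (auto simp: s_def t_def)
  have z: "u r zL = T.spectral r" "u r 1 = 1" by (simp_all add: u_def zL_def)
  have znz: "T.spectral r \<noteq> 0" by simp
  have v: "T.valid (int_label a)" "T.valid (int_label b)" "T.valid (int_label i)" "T.valid (int_label j)" using valid_states st by auto
  note E = Tm_e[OF r v bj, folded s_def t_def, unfolded fls_const_mult_const[symmetric] mult.assoc,
      unfolded hop_terms[OF ne(1) st] icartan_cartan ihop_coeff_hop_coeff]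
  show "lhs_e (src r) (Suc r) (u r zL) (u r 1) (\<lambda>A. base A S) A = rhs_e (src r) (Suc r) (u r zL) (u r 1) (base A) S"
    unfolding s_def[symmetric] t_def[symmetric] ab lhs_e_alt rhs_e_alt(1) z mult_1_left by (rule E)
  have inv: "fls_const (inverse (T.icartan s t (int_label a))) = cartan t s a" for a
    unfolding cartan_swap[of t s] unfolding icartan_cartan[symmetric] by (simp add: fls_inverse_const)
  note F = Tm_f[OF r v bj, folded s_def t_def, unfolded fls_const_mult_const[symmetric] mult.assoc,
      unfolded hop_terms[OF ne(2) st] inv ihop_coeff_hop_coeff]
  show "lhs_e (Suc r) (src r) (inverse (u r 1)) (inverse (u r zL)) (\<lambda>A. base (prod.swap A) S) (prod.swap A)
      = rhs_e (Suc r) (src r) (inverse (u r 1)) (inverse (u r zL)) (\<lambda>S. base A (prod.swap S)) (prod.swap S)"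
    unfolding s_def[symmetric] t_def[symmetric] ab swap_simp lhs_e_alt rhs_e_alt(2) z mult_1_left inverse_1
    by (rule clear_denominator[OF znz F])
qed

end

context hop_field begin

lemma target_X:
  assumes "r \<le> rmax" "S \<in> X"
  shows "can_hop (src r) (Suc r) (snd S) \<Longrightarrow> (fst S, nhop (src r) (Suc r) (snd S)) \<in> X"
    "can_hop (src r) (Suc r) (fst S) \<Longrightarrow> (nhop (src r) (Suc r) (fst S), snd S) \<in> X"
    "can_hop (Suc r) (src r) (snd S) \<Longrightarrow> (fst S, nhop (Suc r) (src r) (snd S)) \<in> X"
    "can_hop (Suc r) (src r) (fst S) \<Longrightarrow> (nhop (Suc r) (src r) (fst S), snd S) \<in> X"
  using assms(2) src_tgt(2)[OF assms(1)] nhop_St[of "fst S"] B.nhop_St[of "snd S"] unfolding X_def by auto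

lemma hop_rel_cong:
  assumes eq: "\<And>A S. A \<in> X \<Longrightarrow> S \<in> X \<Longrightarrow> M A S = M' A S" and rel: "hop_rel x y M"
  shows "hop_rel x y M'"
  unfolding hop_rel_def
proof (intro allI ballI impI)
  fix r A S assume r: "r \<le> rmax" and A: "A \<in> X" and S: "S \<in> X"
  note tA = target_X[OF r A] and tS = target_X[OF r S]
  have L: "lhs_e (src r) (Suc r) c d (\<lambda>A. M' A S) A = lhs_e (src r) (Suc r) c d (\<lambda>A. M A S) A"
      "lhs_e (Suc r) (src r) c d (\<lambda>A. M' (prod.swap A) S) (prod.swap A) = lhs_e (Suc r) (src r) c d (\<lambda>A. M (prod.swap A) S) (prod.swap A)" for c d
    using tA eq S by (simp_all add: lhs_e_def)
  have R: "rhs_e (src r) (Suc r) c d (M' A) S = rhs_e (src r) (Suc r) c d (M A) S"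
      "rhs_e (Suc r) (src r) c d (\<lambda>S. M' A (prod.swap S)) (prod.swap S) = rhs_e (Suc r) (src r) c d (\<lambda>S. M A (prod.swap S)) (prod.swap S)" for c d
    using tS eq A by (simp_all add: rhs_e_def)
  show "lhs_e (src r) (Suc r) (u r x) (u r y) (\<lambda>A. M' A S) A = rhs_e (src r) (Suc r) (u r x) (u r y) (M' A) S \<and>
     lhs_e (Suc r) (src r) (inverse (u r y)) (inverse (u r x)) (\<lambda>A. M' (prod.swap A) S) (prod.swap A)
       = rhs_e (Suc r) (src r) (inverse (u r y)) (inverse (u r x)) (\<lambda>S. M' A (prod.swap S)) (prod.swap S)"
    unfolding L R using rel r A S unfolding hop_rel_def by blast
qed

definition ref_pair :: "nat \<Rightarrow> label \<times> label" where
  "ref_pair i0 = (if aff then (ref_state n eps i0 l, ref_state n eps i0 m) else (\<lambda>_. 0, \<lambda>_. 0))"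

definition ref_ok :: "nat \<Rightarrow> bool" where
  "ref_ok i0 \<longleftrightarrow> (aff \<longrightarrow> (if \<forall>k\<in>{1..n}. eps k = 1 then l \<le> n \<and> m \<le> n else i0 \<in> {1..n} \<and> eps i0 = 0))"

lemma ref_state_lsum:
  assumes "if \<forall>k\<in>{1..n}. eps k = 1 then w \<le> n else i0 \<in> {1..n} \<and> eps i0 = 0"
  shows "ref_state n eps i0 w \<in> states n eps" "lsum n (ref_state n eps i0 w) = w"
proof -
  have "ref_state n eps i0 w \<in> states n eps \<and> lsum n (ref_state n eps i0 w) = w"
  proof (cases "\<forall>k\<in>{1..n}. eps k = 1")
    case True
    have w: "w \<le> n" using assms True by simp
    have "(\<Sum>k=1..n. of_bool (n - w < k \<and> k \<le> n) :: nat) = card ({1..n} \<inter> {k. n - w < k \<and> k \<le> n})"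
      by (subst sum_of_bool_eq) simp_all
    also have "{1..n} \<inter> {k. n - w < k \<and> k \<le> n} = {n - w<..n}" using w by auto
    also have "card \<dots> = w" using w by simp
    finally show ?thesis unfolding ref_state_def if_P[OF True] lsum_def states_def using w by auto
  next
    case False
    have "i0 \<in> {1..n}" "eps i0 = 0" using assms False by (simp_all only: if_False) 
    then show ?thesis unfolding ref_state_def if_not_P[OF False] lsum_def states_def by auto
  qed
  then show "ref_state n eps i0 w \<in> states n eps" "lsum n (ref_state n eps i0 w) = w" by simp_all
qed

lemma ref_pair_X: "ref_ok i0 \<Longrightarrow> ref_pair i0 \<in> X"
proof (cases aff)
  case True
  assume "ref_ok i0"
  then have h: "if \<forall>k\<in>{1..n}. eps k = 1 then l \<le> n else i0 \<in> {1..n} \<and> eps i0 = 0"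
    "if \<forall>k\<in>{1..n}. eps k = 1 then m \<le> n else i0 \<in> {1..n} \<and> eps i0 = 0"
    using True unfolding ref_ok_def by (simp_all split: if_splits)
  show ?thesis unfolding ref_pair_def if_P[OF True] X_def St_def B.St_def
    using ref_state_lsum[OF h(1)] ref_state_lsum[OF h(2)] by simp
next
  case False
  then show ?thesis unfolding ref_pair_def X_def St_def B.St_def by (simp add: states_def)
qed

lemma states_le_eq:
  assumes "a \<in> states n eps" "b \<in> states n eps" "\<And>k. k \<in> {1..n} \<Longrightarrow> a k \<le> b k" "lsum n a = lsum n b"
  shows "a = b"
proof
  fix k
  show "a k = b k"
  proof (cases "k \<in> {1..n}")
    case True
    then show ?thesis using assms(3,4) unfolding lsum_def by (intro sum_mono_inv[of a "{1..n}" b]) auto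
  qed (use states_out[OF assms(1)] states_out[OF assms(2)] in simp)
qed

text \<open>
  By conservation of the sum of the two labels at each site, the column of the reference vector can have no
  other nonzero entry.
\<close>
lemma ref_pair_unique:
  assumes ok: "ref_ok i0" and A: "A \<in> X" and w: "\<And>k. k \<in> {1..n} \<Longrightarrow> fst A k + snd A k = fst (ref_pair i0) k + snd (ref_pair i0) k"
  shows "A = ref_pair i0"
proof -
  note rX = ref_pair_X[OF ok]
  obtain a b a' b' where e: "A = (a, b)" "ref_pair i0 = (a', b')" by force
  have st: "a \<in> states n eps" "b \<in> states n eps" "a' \<in> states n eps" "b' \<in> states n eps"
    using A rX StD B.StD unfolding e X_def by auto
  have w': "a k + b k = a' k + b' k" if "k \<in> {1..n}" for k using w[OF that] by (simp add: e)
  have other: "a = a' \<longleftrightarrow> b = b'"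
  proof
    assume "a = a'"
    then show "b = b'" using w' st by (intro states_le_eq) (auto simp: lsum_def)
  next
    assume "b = b'"
    then show "a = a'" using w' st by (intro states_le_eq) (auto simp: lsum_def)
  qed
  have "a = a'"
  proof (cases aff)
    case False
    have "fst (ref_pair i0) = (\<lambda>_. 0)" "snd (ref_pair i0) = (\<lambda>_. 0)" unfolding ref_pair_def if_not_P[OF False] by simp_all
    then have "a' = (\<lambda>_. 0)" "b' = (\<lambda>_. 0)" using e(2) by simp_all
    then have "a k = 0" if "k \<in> {1..n}" for k using w'[OF that] by simp
    then show ?thesis using \<open>a' = (\<lambda>_. 0)\<close> states_out[OF st(1)] by fastforce
  next
    case True
    have sums: "lsum n a = l" "lsum n a' = l" "lsum n b = m" "lsum n b' = m"
      using A rX True unfolding e X_def St_def B.St_def by simp_all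
    have rs: "a' = ref_state n eps i0 l" "b' = ref_state n eps i0 m" using e(2) True unfolding ref_pair_def by simp_all
    show ?thesis
    proof (cases "\<forall>k\<in>{1..n}. eps k = 1")
      case F: True
      have r: "a' k = of_bool (n - l < k \<and> k \<le> n)" "b' k = of_bool (n - m < k \<and> k \<le> n)" for k
        unfolding rs ref_state_def if_P[OF F] by simp_all
      have le1: "a k \<le> 1" "b k \<le> 1" if "k \<in> {1..n}" for k using states_fermion[OF st(1) that] states_fermion[OF st(2) that] F that by auto
      show ?thesis
      proof (cases "l \<le> m")
        case True
        have "a' k \<le> a k" if k: "k \<in> {1..n}" for k
          using w'[OF k] le1[OF k] True unfolding r by (auto simp: of_bool_def split: if_splits)
        then show ?thesis using states_le_eq[OF st(3,1)] sums by simp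
      next
        case False
        have "b' k \<le> b k" if k: "k \<in> {1..n}" for k
          using w'[OF k] le1[OF k] False unfolding r by (auto simp: of_bool_def split: if_splits)
        then have "b' = b" using states_le_eq[OF st(4,2)] sums by simp
        then show ?thesis using other by simp
      qed
    next
      case F: False
      have r: "a' k = (if k = i0 then l else 0)" "b' k = (if k = i0 then m else 0)" for k
        unfolding rs ref_state_def if_not_P[OF F] by simp_all
      have "a k \<le> a' k" if k: "k \<in> {1..n}" for k
      proof (cases "k = i0")
        case True
        have "a k \<le> lsum n a" unfolding lsum_def by (rule member_le_sum) (use k in auto)
        then show ?thesis unfolding r using sums True by simp
      qed (use w'[OF k] r in simp)
      then show ?thesis using states_le_eq[OF st(1,3)] sums by simp
    qed
  qed
  then show ?thesis using other e by simp
qed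

end

context series_model begin

text \<open>
  The normalized series; for \<open>U_B\<close> it is twisted by the operators \<open>K\<close>, so that it intertwines.
\<close>
definition R_series :: "label \<times> label \<Rightarrow> label \<times> label \<Rightarrow> lser" where
  "R_series A S = (if aff then Str_elem n eps l m (fst A) (snd A) (fst S) (snd S)
     else fls_const (ps powi (int (lsum n (snd S)) - int (lsum n (fst A)))) * S11_elem n eps (fst A) (snd A) (fst S) (snd S))"

lemma R_series_base:
  assumes "A \<in> X" "S \<in> X"
  shows "R_series A S = (if aff then rho_tr n eps l m else rho_11) * base A S"
proof (cases aff)
  case True
  have "lsum n (snd A) = lsum n (snd S)" using assms True unfolding X_def B.St_def by auto
  from T.Str_series[OF this, of "fst A" "fst S"] show ?thesis using True unfolding R_series_def base_def Str_elem_def by simp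
next
  case False
  show ?thesis using False T.S11_series[of "snd S" "fst A" "snd A" "fst S"]
    unfolding R_series_def base_def S11_elem_def by (simp add: T.total_int_label mult_ac)
qed

lemma R_series_rel: "hop_rel zL 1 R_series"
  by (rule hop_rel_cong[OF _ hop_rel_scale[OF base_rel]]) (rule HOL.sym, rule R_series_base)

lemma R_series_weight:
  assumes A: "A \<in> X" "S \<in> X" and k: "k \<in> {1..n}" "fst A k + snd A k \<noteq> fst S k + snd S k"
  shows "R_series A S = 0"
proof (cases aff)
  case True
  have "lsum n (snd A) = lsum n (snd S)" using A True unfolding X_def B.St_def by auto
  from T.Str_weight[of "snd A" "snd S" k "fst A" "fst S", OF this k] show ?thesis using True unfolding R_series_def Str_elem_def by simp
next
  case False
  show ?thesis using False T.S11_weight[of k "fst A" "snd A" "fst S" "snd S", OF k] unfolding R_series_def S11_elem_def by simp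
qed

lemma R_series_init:
  assumes ok: "ref_ok i0" and A: "A \<in> X"
  shows "R_series A (ref_pair i0) = of_bool (A = ref_pair i0)"
proof (cases "A = ref_pair i0")
  case True
  have "R_series (ref_pair i0) (ref_pair i0) = 1"
  proof (cases aff)
    case aff: True
    show ?thesis
    proof (cases "\<forall>k\<in>{1..n}. eps k = 1")
      case F: True
      have "l \<le> n" "m \<le> n" using ok aff F unfolding ref_ok_def by simp_all
      from T.norm_fermion[OF F this] show ?thesis
        unfolding R_series_def ref_pair_def if_P[OF aff] ref_state_def if_P[OF F] by simp
    next
      case F: False
      have "i0 \<in> {1..n}" "eps i0 = 0" using ok aff F unfolding ref_ok_def by (simp_all only: if_False simp_thms)
      from T.norm_boson[OF this, of l m] show ?thesis
        unfolding R_series_def ref_pair_def if_P[OF aff] ref_state_def if_not_P[OF F] by simp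
    qed
  next
    case False
    show ?thesis unfolding R_series_def ref_pair_def if_not_P[OF False] using T.norm_B by (simp add: lsum_def)
  qed
  then show ?thesis using True by simp
next
  case False
  have "\<exists>k\<in>{1..n}. fst A k + snd A k \<noteq> fst (ref_pair i0) k + snd (ref_pair i0) k"
    using ref_pair_unique[OF ok A] False by blast
  then show ?thesis using R_series_weight[OF A ref_pair_X[OF ok]] False by auto
qed

lemma ps_val: "pL = embL \<i> * inverse sL"
  unfolding pL_def ps_def embL_def sL_def by (simp add: fls_inverse_const)

lemma qL_sL: "qL = sL\<^sup>2"
  unfolding qL_def qs_def sL_def by (simp add: fls_const_power)

lemma generation_L: "hop_generation n eps aff qL pL fls_subdegree zL 1"
proof (unfold_locales)
  show "zL \<noteq> 0" "qL \<noteq> 0" "pL \<noteq> 0" "(1 :: lser) \<noteq> 0"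
    unfolding qL_def by (simp_all add: zL_def pL_def ps_def qhs_def qs_def)
  have i: "embL \<i> \<noteq> 0 \<and> fls_subdegree (embL \<i>) = 0" by (simp add: embL_def)
  show "fls_subdegree qL = 0" "fls_subdegree pL = 0" "fls_subdegree (1::lser) < fls_subdegree zL"
    unfolding qL_def pL_def zL_def by simp_all
  fix k :: int assume "0 < k"
  then show "(qL powi k - qL powi - k) / (qL - inverse qL) \<noteq> 0 \<and> fls_subdegree ((qL powi k - qL powi - k) / (qL - inverse qL)) = 0"
    unfolding qL_sL using L.qn_val[of k] unfolding L.qn_def by blast
qed

lemma rat_qp: "rational_series qL" "rational_series pL" "rat_value qL = qK" "rat_value pL = pK"
  unfolding qL_sL ps_val qK_def pK_def
  using rat_power[OF rat_s(1), of 2] rat_mult[OF rat_emb(1) rat_inverse[OF rat_s(1), THEN conjunct1]] rat_inverse[OF rat_s(1)] rat_emb(2) rat_s(2) by simp_all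

text \<open>
  In the column of the reference vector the entries are 0 and 1.  All others follow from \<open>G.hop_generated\<close>, applied to
  the field of rational series.
\<close>
theorem R_series_rational:
  assumes ok: "ref_ok i0" and A: "A \<in> X" and S: "S \<in> X"
  shows "rational_series (R_series A S)"
proof -
  interpret G: hop_generation n eps aff l m qL pL fls_subdegree zL 1 by (rule generation_L)
  have "R_series A S \<in> {f. rational_series f}"
    by (rule G.hop_generated[OF rational_subfield _ _ _ _ R_series_rel ref_pair_X[OF ok] _ A S])
       (use rat_qp rat_z R_series_init[OF ok] in \<open>auto simp: of_bool_def\<close>)
  then show ?thesis by simp
qed

end

section \<open>The action of the generators\<close>

text \<open>
  The homomorphism from rational series to \<open>C(q^(1/2), x, y)\<close>, as a relation.
\<close>
definition has_value :: "lser \<Rightarrow> gfield \<Rightarrow> bool" where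
  "has_value f g \<longleftrightarrow> rational_series f \<and> rat_value f = g"

lemma has_value_simps: "has_value 0 0" "has_value 1 1" "has_value f g \<Longrightarrow> has_value f' g' \<Longrightarrow> has_value (f + f') (g + g')" "has_value f g \<Longrightarrow> has_value f' g' \<Longrightarrow> has_value (f - f') (g - g')"
    "has_value f g \<Longrightarrow> has_value f' g' \<Longrightarrow> has_value (f * f') (g * g')" "has_value f g \<Longrightarrow> has_value (inverse f) (inverse g)"
    "has_value f g \<Longrightarrow> has_value f' g' \<Longrightarrow> has_value (f / f') (g / g')" "has_value f g \<Longrightarrow> has_value (- f) (- g)" "has_value f g \<Longrightarrow> has_value (f powi i) (g powi i)"
  unfolding has_value_def by (simp_all add: rat_add rat_diff rat_mult rat_inverse rat_divide rat_minus rat_powi)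

context series_model begin

sublocale K: hop_field n eps aff l m qK pK by unfold_locales

lemma has_value_qp: "has_value qL qK" "has_value pL pK" "has_value zL zK"
  unfolding has_value_def using rat_qp rat_z by simp_all

lemma has_value_coeffs: "has_value (hop_coeff s a) (K.hop_coeff s a)" "has_value (cartan s t a) (K.cartan s t a)"
proof -
  show "has_value (hop_coeff s a) (K.hop_coeff s a)" unfolding hop_coeff_def K.hop_coeff_def by (auto intro!: has_value_simps(2-7,9) has_value_qp simp del: power_int_of_nat)
  have "has_value (Qs e) (K.Qs e)" for e unfolding Qs_def K.Qs_def by (auto intro!: has_value_simps has_value_qp)
  then show "has_value (cartan s t a) (K.cartan s t a)" unfolding cartan_def K.cartan_def by (auto intro!: has_value_simps(2-7,9) has_value_qp simp del: power_int_of_nat)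
qed

lemma has_value_u: "has_value c c' \<Longrightarrow> has_value (u r c) (K.u r c')"
  by (simp add: u_def K.u_def has_value_simps)

lemma has_value_lhs_e:
  assumes "has_value c c'" "has_value d d'" "can_hop t s (fst A) \<Longrightarrow> has_value (\<Psi> (nhop t s (fst A), snd A)) (\<Psi>' (nhop t s (fst A), snd A))"
    "can_hop t s (snd A) \<Longrightarrow> has_value (\<Psi> (fst A, nhop t s (snd A))) (\<Psi>' (fst A, nhop t s (snd A)))"
  shows "has_value (lhs_e s t c d \<Psi> A) (K.lhs_e s t c' d' \<Psi>' A)"
  unfolding lhs_e_def K.lhs_e_def using assms by (auto intro!: has_value_simps has_value_coeffs)

lemma has_value_rhs_e:
  assumes "has_value c c'" "has_value d d'" "can_hop s t (fst S) \<Longrightarrow> has_value (\<Psi> (nhop s t (fst S), snd S)) (\<Psi>' (nhop s t (fst S), snd S))"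
    "can_hop s t (snd S) \<Longrightarrow> has_value (\<Psi> (fst S, nhop s t (snd S))) (\<Psi>' (fst S, nhop s t (snd S)))"
  shows "has_value (rhs_e s t c d \<Psi> S) (K.rhs_e s t c' d' \<Psi>' S)"
  unfolding rhs_e_def K.rhs_e_def using assms by (auto intro!: has_value_simps has_value_coeffs)

definition R_value :: "label \<times> label \<Rightarrow> label \<times> label \<Rightarrow> gfield" where
  "R_value A S = rat_value (R_series A S)"

lemma has_value_R_value: "ref_ok i0 \<Longrightarrow> A \<in> X \<Longrightarrow> S \<in> X \<Longrightarrow> has_value (R_series A S) (R_value A S)"
  unfolding has_value_def R_value_def using R_series_rational by blast

lemma R_value_weight:
  "A \<in> X \<Longrightarrow> S \<in> X \<Longrightarrow> k \<in> {1..n} \<Longrightarrow> fst A k + snd A k \<noteq> fst S k + snd S k \<Longrightarrow> R_value A S = 0"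
  unfolding R_value_def by (subst R_series_weight) simp_all

lemma R_value_init: "ref_ok i0 \<Longrightarrow> A \<in> X \<Longrightarrow> R_value A (ref_pair i0) = of_bool (A = ref_pair i0)"
  unfolding R_value_def by (subst R_series_init) auto

text \<open>
  The relation of the series is transported term by term and rescaled from \<open>(z, 1)\<close> to \<open>(x, y)\<close>.
\<close>
theorem R_value_rel:
  assumes ok: "ref_ok i0"
  shows "K.hop_rel xK yK R_value"
proof -
  have "K.hop_rel zK 1 R_value"
    unfolding K.hop_rel_def
  proof (intro allI ballI impI conjI)
    fix r A S assume r: "r \<le> rmax" and A: "A \<in> X" and S: "S \<in> X"
    note tA = target_X[OF r A] and tS = target_X[OF r S] and v = has_value_R_value[OF ok]
    note uu = has_value_u[OF has_value_qp(3)] has_value_u[OF has_value_simps(2)] has_value_simps(6)[OF has_value_u[OF has_value_qp(3)]] has_value_simps(6)[OF has_value_u[OF has_value_simps(2)]]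
    have 1: "has_value (lhs_e (src r) (Suc r) (u r zL) (u r 1) (\<lambda>A. R_series A S) A) (K.lhs_e (src r) (Suc r) (K.u r zK) (K.u r 1) (\<lambda>A. R_value A S) A)"
      by (rule has_value_lhs_e) (use uu tA v S in auto)
    have 2: "has_value (rhs_e (src r) (Suc r) (u r zL) (u r 1) (R_series A) S) (K.rhs_e (src r) (Suc r) (K.u r zK) (K.u r 1) (R_value A) S)"
      by (rule has_value_rhs_e) (use uu tS v A in auto)
    show "K.lhs_e (src r) (Suc r) (K.u r zK) (K.u r 1) (\<lambda>A. R_value A S) A = K.rhs_e (src r) (Suc r) (K.u r zK) (K.u r 1) (R_value A) S"
      using 1 2 R_series_rel r A S unfolding has_value_def hop_rel_def by metis
    have 3: "has_value (lhs_e (Suc r) (src r) (inverse (u r 1)) (inverse (u r zL)) (\<lambda>A. R_series (prod.swap A) S) (prod.swap A))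
       (K.lhs_e (Suc r) (src r) (inverse (K.u r 1)) (inverse (K.u r zK)) (\<lambda>A. R_value (prod.swap A) S) (prod.swap A))"
      by (rule has_value_lhs_e) (use uu tA v S in auto)
    have 4: "has_value (rhs_e (Suc r) (src r) (inverse (u r 1)) (inverse (u r zL)) (\<lambda>S. R_series A (prod.swap S)) (prod.swap S))
       (K.rhs_e (Suc r) (src r) (inverse (K.u r 1)) (inverse (K.u r zK)) (\<lambda>S. R_value A (prod.swap S)) (prod.swap S))"
      by (rule has_value_rhs_e) (use uu tS v A in auto)
    show "K.lhs_e (Suc r) (src r) (inverse (K.u r 1)) (inverse (K.u r zK)) (\<lambda>A. R_value (prod.swap A) S) (prod.swap A)
      = K.rhs_e (Suc r) (src r) (inverse (K.u r 1)) (inverse (K.u r zK)) (\<lambda>S. R_value A (prod.swap S)) (prod.swap S)"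
      using 3 4 R_series_rel r A S unfolding has_value_def hop_rel_def by metis
  qed
  from K.hop_rel_homogeneous[OF this, of yK] show ?thesis
    using vK_xyz by (simp add: zK_def)
qed

end

locale op_model = hop_field n eps aff l m qK pK for n eps aff l m
begin

lemma qK_qhK: "qK = qhK\<^sup>2" by (simp add: qK_def)

sublocale G: hop_generation n eps aff l m qK pK vK xK yK
proof (unfold_locales)
  have "cK \<i> \<noteq> 0 \<and> vK (cK \<i>) = 0" using K.inner[of "[:\<i>:]"] by simp
  then show "pK \<noteq> 0" "vK pK = 0" unfolding pK_def using K.s_val by (simp_all add: K.v_mult K.v_inverse)
  show "qK \<noteq> 0" "vK qK = 0" unfolding qK_qhK using K.q_val by simp_all
  show "xK \<noteq> 0" "yK \<noteq> 0" "vK yK < vK xK" using vK_xyz by simp_all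
  fix k :: int assume "0 < k"
  then show "(qK powi k - qK powi - k) / (qK - inverse qK) \<noteq> 0 \<and> vK ((qK powi k - qK powi - k) / (qK - inverse qK)) = 0"
    unfolding qK_qhK using K.qn_val[of k] unfolding K.qn_def by blast
qed

definition rep :: "gfield \<Rightarrow> gen \<Rightarrow> (label \<Rightarrow>\<^sub>0 gfield) \<Rightarrow> (label \<Rightarrow>\<^sub>0 gfield)" where
  "rep x = (if aff then pi_A n eps x else pi_B n eps x)"

definition alg :: "uexp set set" where
  "alg = (if aff then U_A n eps else U_B n eps)"

lemma alg_ualg: "\<exists>D r. alg = ualg rmax D r"
  unfolding alg_def rmax_def U_A_def U_B_def by auto

lemma lin_rep: "lin (rep x g)"
  unfolding rep_def pi_A_def pi_B_def hop_def pi_B0_def pi_Bn_def by (simp add: Let_def lin_lin_ext)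

text \<open>The ket of a label out of range is zero, exactly when the hop is not possible.\<close>
lemma iket_hop:
  assumes m: "a \<in> states n eps" and st: "s \<noteq> t"
    and f: "\<And>k. f k = int (a k) + (if k \<in> {1..n} then of_bool (k = t) - of_bool (k = s) else 0)"
  shows "iket n eps f = (if can_hop s t a then ket (nhop s t a) else 0)"
proof (cases "can_hop s t a")
  case True
  have "f k = int (nhop s t a k)" for k
    unfolding f using True st states_out[OF m, of k] by (auto simp: can_hop_def nhop_def)
  then have "f = (\<lambda>k. int (nhop s t a k))" by blast
  then show ?thesis using True nhop_states[OF m True] by (simp add: iket_def)
next
  case False
  have "s \<in> {1..n} \<and> a s = 0 \<or> t \<in> {1..n} \<and> eps t = 1 \<and> a t \<noteq> 0" using False by (auto simp: can_hop_def)
  then have no: "\<not> ((\<forall>k. 0 \<le> f k) \<and> (\<lambda>k. nat (f k)) \<in> states n eps)"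
  proof (elim disjE conjE)
    assume "s \<in> {1..n}" "a s = 0"
    then have "f s < 0" using st by (simp add: f)
    then show ?thesis by (meson not_less)
  next
    assume t: "t \<in> {1..n}" "eps t = 1" "a t \<noteq> 0"
    then have "nat (f t) > 1" using st by (simp add: f)
    then show ?thesis using t unfolding states_def by fastforce
  qed
  show ?thesis unfolding iket_def if_not_P[OF no] if_not_P[OF False] ..
qed

lemma qint_hop_coeff: "s \<in> {1..n} \<Longrightarrow> qint (a s) = hop_coeff s a" "s \<notin> {1..n} \<Longrightarrow> hop_coeff s a = 1"
  unfolding qint_def hop_coeff_def by (simp_all only: if_True if_False)

lemma cartan_real: "s \<in> {1..n} \<Longrightarrow> t \<in> {1..n} \<Longrightarrow> q_i eps s powi (- int (a s)) * q_i eps t powi int (a t) = cartan s t a"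
  unfolding cartan_def Qs_def q_i_def by (simp only: if_True)

lemma hop_ket:
  assumes a: "a \<in> states n eps" and st: "s \<noteq> t" "s \<in> {1..n}" "t \<in> {1..n}"
  shows "hop n eps c s t (GE r) (ket a) = (if can_hop s t a then smul (c * hop_coeff s a) (ket (nhop s t a)) else 0)"
    "hop n eps c s t (GF r) (ket a) = (if can_hop t s a then smul (inverse c * hop_coeff t a) (ket (nhop t s a)) else 0)"
    "hop n eps c s t (GK r) (ket a) = smul (cartan s t a) (ket a)"
    "hop n eps c s t (GKinv r) (ket a) = smul (inverse (cartan s t a)) (ket a)"
proof -
  have 1: "iket n eps (\<lambda>k. int (a k) - of_bool (k = s) + of_bool (k = t)) = (if can_hop s t a then ket (nhop s t a) else 0)"
    by (rule iket_hop[OF a st(1)]) (use st in auto)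
  have 2: "iket n eps (\<lambda>k. int (a k) + of_bool (k = s) - of_bool (k = t)) = (if can_hop t s a then ket (nhop t s a) else 0)"
    by (rule iket_hop[OF a]) (use st in auto)
  show "hop n eps c s t (GE r) (ket a) = (if can_hop s t a then smul (c * hop_coeff s a) (ket (nhop s t a)) else 0)"
    unfolding hop_def lin_ext_ket gen.case 1 qint_hop_coeff(1)[OF st(2)] by simp
  show "hop n eps c s t (GF r) (ket a) = (if can_hop t s a then smul (inverse c * hop_coeff t a) (ket (nhop t s a)) else 0)"
    unfolding hop_def lin_ext_ket gen.case 2 qint_hop_coeff(1)[OF st(3)] by simp
  show "hop n eps c s t (GK r) (ket a) = smul (cartan s t a) (ket a)"
    "hop n eps c s t (GKinv r) (ket a) = smul (inverse (cartan s t a)) (ket a)"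
    unfolding hop_def lin_ext_ket gen.case cartan_real[OF st(2,3)] by simp_all
qed

lemma rep_ket:
  assumes a: "a \<in> states n eps" and r: "r \<le> rmax"
  shows "rep x (GE r) (ket a) = (if can_hop (src r) (Suc r) a then smul (u r x * hop_coeff (src r) a) (ket (nhop (src r) (Suc r) a)) else 0)"
    "rep x (GF r) (ket a) = (if can_hop (Suc r) (src r) a then smul (inverse (u r x) * hop_coeff (Suc r) a) (ket (nhop (Suc r) (src r) a)) else 0)"
    "rep x (GK r) (ket a) = smul (cartan (src r) (Suc r) a) (ket a)"
    "rep x (GKinv r) (ket a) = smul (inverse (cartan (src r) (Suc r) a)) (ket a)"
proof -
  have "rep x (GE r) (ket a) = (if can_hop (src r) (Suc r) a then smul (u r x * hop_coeff (src r) a) (ket (nhop (src r) (Suc r) a)) else 0)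
   \<and> rep x (GF r) (ket a) = (if can_hop (Suc r) (src r) a then smul (inverse (u r x) * hop_coeff (Suc r) a) (ket (nhop (Suc r) (src r) a)) else 0)
   \<and> rep x (GK r) (ket a) = smul (cartan (src r) (Suc r) a) (ket a)
   \<and> rep x (GKinv r) (ket a) = smul (inverse (cartan (src r) (Suc r) a)) (ket a)"
  proof (cases aff)
    case True
    have c: "cyc n r = src r" using True unfolding cyc_def src_def by simp
    have st: "src r \<noteq> Suc r" "src r \<in> {1..n}" "Suc r \<in> {1..n}" using src_tgt[OF r] True by auto
    show ?thesis unfolding rep_def if_P[OF True] pi_A_def gen_index.simps Let_def c Suc_eq_plus1[symmetric]
      unfolding hop_ket[OF a st] u_def by simp
  next
    case False
    have rn: "r \<le> n" using r[unfolded rmax_def if_not_P[OF False]] .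
    have sr: "src r = r" using False unfolding src_def by simp
    have R: "rep x g = (if gen_index g = 0 then pi_B0 n eps x g else if gen_index g = n then pi_Bn n eps g else hop n eps 1 (gen_index g) (gen_index g + 1) g)" for g
      unfolding rep_def if_not_P[OF False] pi_B_def Let_def by (rule HOL.refl)
    have n1: "1 \<in> {1..n}" "0 \<notin> {1..n}" "n \<in> {1..n}" "Suc n \<notin> {1..n}" using n_pos by auto
    consider "r = 0" | "r \<noteq> 0" "r = n" | "r \<noteq> 0" "r \<noteq> n" by blast
    then show ?thesis
    proof cases
      case 1
      have i1: "iket n eps (\<lambda>k. int (a k) + of_bool (k = 1)) = (if can_hop 0 (Suc 0) a then ket (nhop 0 (Suc 0) a) else 0)"
        by (rule iket_hop[OF a]) (use n1 in auto)
      have i2: "iket n eps (\<lambda>k. int (a k) - of_bool (k = 1)) = (if can_hop (Suc 0) 0 a then ket (nhop (Suc 0) 0 a) else 0)"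
        by (rule iket_hop[OF a]) (use n1 in auto)
      have k: "inverse pK * q_i eps 1 powi int (a 1) = cartan 0 (Suc 0) a"
        unfolding cartan_def Qs_def q_i_def using n1 by simp
      show ?thesis unfolding R sr gen_index.simps if_P[OF 1] pi_B0_def lin_ext_ket gen.case unfolding 1 i1 i2 k
        unfolding qint_hop_coeff(1)[OF n1(1)] qint_hop_coeff(2)[OF n1(2)] u_def by simp
    next
      case 2
      have i1: "iket n eps (\<lambda>k. int (a k) - of_bool (k = n)) = (if can_hop n (Suc n) a then ket (nhop n (Suc n) a) else 0)"
        by (rule iket_hop[OF a]) (use n1 in auto)
      have i2: "iket n eps (\<lambda>k. int (a k) + of_bool (k = n)) = (if can_hop (Suc n) n a then ket (nhop (Suc n) n a) else 0)"
        by (rule iket_hop[OF a]) (use n1 in auto)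
      have k: "pK * q_i eps n powi - int (a n) = cartan n (Suc n) a"
        unfolding cartan_def Qs_def q_i_def using n1 by (simp add: mult.commute)
      have n0: "n \<noteq> 0" using 2 by simp
      show ?thesis unfolding R sr gen_index.simps if_not_P[OF 2(1)] if_P[OF 2(2)] pi_Bn_def lin_ext_ket gen.case unfolding 2(2) i1 i2 k
        unfolding qint_hop_coeff(1)[OF n1(3)] qint_hop_coeff(2)[OF n1(4)] u_def using n0 by simp
    next
      case 3
      have st: "r \<noteq> Suc r" "r \<in> {1..n}" "Suc r \<in> {1..n}" using 3 rn by auto
      show ?thesis unfolding R sr gen_index.simps if_not_P[OF 3(1)] if_not_P[OF 3(2)] Suc_eq_plus1[symmetric]
        unfolding hop_ket[OF a st] u_def using 3 by simp
    qed
  qed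
  then show "rep x (GE r) (ket a) = (if can_hop (src r) (Suc r) a then smul (u r x * hop_coeff (src r) a) (ket (nhop (src r) (Suc r) a)) else 0)"
    "rep x (GF r) (ket a) = (if can_hop (Suc r) (src r) a then smul (inverse (u r x) * hop_coeff (Suc r) a) (ket (nhop (Suc r) (src r) a)) else 0)"
    "rep x (GK r) (ket a) = smul (cartan (src r) (Suc r) a) (ket a)"
    "rep x (GKinv r) (ket a) = smul (inverse (cartan (src r) (Suc r) a)) (ket a)" by blast+
qed

text \<open>
  The images of a basis vector under \<open>\<Delta>(e)\<close> and \<open>\<Delta>'(e)\<close>.
\<close>
definition actE :: "nat \<Rightarrow> nat \<Rightarrow> gfield \<Rightarrow> gfield \<Rightarrow> label \<times> label \<Rightarrow> (label \<times> label \<Rightarrow>\<^sub>0 gfield)" where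
  "actE s t c d S =
     (if can_hop s t (snd S) then smul (d * hop_coeff s (snd S)) (ket (fst S, nhop s t (snd S))) else 0)
   + (if can_hop s t (fst S) then smul (c * hop_coeff s (fst S) * cartan s t (snd S)) (ket (nhop s t (fst S), snd S)) else 0)"

definition actE' :: "nat \<Rightarrow> nat \<Rightarrow> gfield \<Rightarrow> gfield \<Rightarrow> label \<times> label \<Rightarrow> (label \<times> label \<Rightarrow>\<^sub>0 gfield)" where
  "actE' s t c d S =
     (if can_hop s t (fst S) then smul (c * hop_coeff s (fst S)) (ket (nhop s t (fst S), snd S)) else 0)
   + (if can_hop s t (snd S) then smul (d * hop_coeff s (snd S) * cartan s t (fst S)) (ket (fst S, nhop s t (snd S))) else 0)"

lemma generator_action:
  assumes S: "S \<in> X" and r: "r \<le> rmax"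
  shows "tens_act (rep x) (rep y) (coprod_gen (GE r)) (ket S) = actE (src r) (Suc r) (u r x) (u r y) S"
    "tens_act (rep x) (rep y) (coprod_op (Gen (GE r))) (ket S) = actE' (src r) (Suc r) (u r x) (u r y) S"
    "tens_act (rep x) (rep y) (coprod_gen (GF r)) (ket S) = actE' (Suc r) (src r) (inverse (u r x)) (inverse (u r y)) S"
    "tens_act (rep x) (rep y) (coprod_op (Gen (GF r))) (ket S) = actE (Suc r) (src r) (inverse (u r x)) (inverse (u r y)) S"
    "tens_act (rep x) (rep y) (coprod_gen (GK r)) (ket S) = smul (cartan (src r) (Suc r) (fst S) * cartan (src r) (Suc r) (snd S)) (ket S)"
    "tens_act (rep x) (rep y) (coprod_op (Gen (GK r))) (ket S) = smul (cartan (src r) (Suc r) (fst S) * cartan (src r) (Suc r) (snd S)) (ket S)"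
    "tens_act (rep x) (rep y) (coprod_gen (GKinv r)) (ket S) = smul (inverse (cartan (src r) (Suc r) (fst S) * cartan (src r) (Suc r) (snd S))) (ket S)"
    "tens_act (rep x) (rep y) (coprod_op (Gen (GKinv r))) (ket S) = smul (inverse (cartan (src r) (Suc r) (fst S) * cartan (src r) (Suc r) (snd S))) (ket S)"
proof -
  obtain i j where e: "S = (i, j)" by force
  have i: "i \<in> states n eps" and j: "j \<in> states n eps" using G.X_D[OF S] by (simp_all add: e)
  note k = rep_ket[OF i r] rep_ket[OF j r]
  note d = tens_act_def coprod_op_def
  show "tens_act (rep x) (rep y) (coprod_gen (GE r)) (ket S) = actE (src r) (Suc r) (u r x) (u r y) S"
    "tens_act (rep x) (rep y) (coprod_op (Gen (GE r))) (ket S) = actE' (src r) (Suc r) (u r x) (u r y) S"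
    unfolding d e actE_def actE'_def by (simp_all add: k mult_ac)
  show "tens_act (rep x) (rep y) (coprod_gen (GF r)) (ket S) = actE' (Suc r) (src r) (inverse (u r x)) (inverse (u r y)) S"
    "tens_act (rep x) (rep y) (coprod_op (Gen (GF r))) (ket S) = actE (Suc r) (src r) (inverse (u r x)) (inverse (u r y)) S"
    unfolding d e actE_def actE'_def cartan_swap[of "Suc r"] by (simp_all add: k mult_ac)
  show "tens_act (rep x) (rep y) (coprod_gen (GK r)) (ket S) = smul (cartan (src r) (Suc r) (fst S) * cartan (src r) (Suc r) (snd S)) (ket S)"
    "tens_act (rep x) (rep y) (coprod_op (Gen (GK r))) (ket S) = smul (cartan (src r) (Suc r) (fst S) * cartan (src r) (Suc r) (snd S)) (ket S)"
    "tens_act (rep x) (rep y) (coprod_gen (GKinv r)) (ket S) = smul (inverse (cartan (src r) (Suc r) (fst S) * cartan (src r) (Suc r) (snd S))) (ket S)"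
    "tens_act (rep x) (rep y) (coprod_op (Gen (GKinv r))) (ket S) = smul (inverse (cartan (src r) (Suc r) (fst S) * cartan (src r) (Suc r) (snd S))) (ket S)"
    unfolding d e by (simp_all add: k mult_ac)
qed

end

section \<open>Intertwining operators and their matrices\<close>

lemma lookup_outside: "v \<in> space_on B \<Longrightarrow> b \<notin> B \<Longrightarrow> Poly_Mapping.lookup v b = 0"
  by (auto simp: space_on_def in_keys_iff)

lemma space_on_eqI:
  assumes "v \<in> space_on B" "w \<in> space_on B" "\<And>b. b \<in> B \<Longrightarrow> Poly_Mapping.lookup v b = Poly_Mapping.lookup w b"
  shows "v = w"
proof (rule poly_mapping_eqI)
  fix b show "Poly_Mapping.lookup v b = Poly_Mapping.lookup w b"
    using assms(3) lookup_outside[OF assms(1)] lookup_outside[OF assms(2)] by (cases "b \<in> B") simp_all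
qed

lemma lookup_lin_ext: "Poly_Mapping.lookup (lin_ext f v) x = (\<Sum>b\<in>Poly_Mapping.keys v. Poly_Mapping.lookup v b * Poly_Mapping.lookup (f b) x)"
  by (simp add: lin_ext_def lookup_sum)

lemma lookup_diagonal: "Poly_Mapping.lookup (lin_ext (\<lambda>b. smul (g b) (ket b)) v) x = g x * Poly_Mapping.lookup v x"
proof -
  have "Poly_Mapping.lookup (lin_ext (\<lambda>b. smul (g b) (ket b)) v) x = (\<Sum>b\<in>Poly_Mapping.keys v. if b = x then g x * Poly_Mapping.lookup v x else 0)"
    unfolding lookup_lin_ext by (rule sum.cong) (auto simp: lookup_ket)
  then show ?thesis by (simp add: in_keys_iff)
qed

text \<open>
  Elements of \<open>End\<close> are undefined outside the subspace; this replaces them by globally linear maps.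
\<close>
lemma End_lin_ext:
  assumes R: "R \<in> End (space_on B)" and v: "v \<in> space_on B"
  shows "R v = lin_ext (\<lambda>b. R (ket b)) v"
proof -
  have add: "R (v + w) = R v + R w" if "v \<in> space_on B" "w \<in> space_on B" for v w
    using R that by (simp add: End_def)
  have sm: "R (smul c v) = smul c (R v)" if "v \<in> space_on B" for c v
    using R that by (simp add: End_def)
  have 0: "R 0 = 0" using sm[OF space_on_0, of 0] by simp
  have "R (\<Sum>b\<in>F. smul (Poly_Mapping.lookup v b) (ket b)) = (\<Sum>b\<in>F. smul (Poly_Mapping.lookup v b) (R (ket b)))"
    if "finite F" "F \<subseteq> B" for F
    using that
  proof (induction F rule: finite_induct)
    case (insert b F)
    have b: "ket b \<in> space_on B" using insert.prems by (intro space_on_ket) simp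
    have F: "(\<Sum>b\<in>F. smul (Poly_Mapping.lookup v b) (ket b)) \<in> space_on B"
      using insert.prems by (intro space_on_sum space_on_smul space_on_ket) auto
    show ?case using insert by (simp add: add[OF space_on_smul[OF b] F] sm[OF b])
  qed (simp add: 0)
  from this[of "Poly_Mapping.keys v"] show ?thesis
    using v by (subst ket_expansion) (simp add: lin_ext_def space_on_def)
qed

lemma restrict_End:
  assumes "lin f" "\<And>b. b \<in> B \<Longrightarrow> f (ket b) \<in> space_on B"
  shows "restrict f (space_on B) \<in> End (space_on B)"
  unfolding End_def using lin_space[OF assms] linD[OF assms(1)] space_on_add space_on_smul by fastforce

lemma lookup_sum':
  assumes "finite {A \<in> X. h A \<noteq> 0}"
  shows "Poly_Mapping.lookup (sum' (\<lambda>A. smul (h A) (ket A)) X) Z = (if Z \<in> X then h Z else 0)"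
proof -
  have nz: "smul (h A) (ket A) \<noteq> 0 \<longleftrightarrow> h A \<noteq> 0" for A
  proof
    assume "h A \<noteq> 0"
    then have "Poly_Mapping.lookup (smul (h A) (ket A)) A \<noteq> Poly_Mapping.lookup 0 A" by (simp add: lookup_ket)
    then show "smul (h A) (ket A) \<noteq> 0" by metis
  qed auto
  have "Poly_Mapping.lookup (sum' (\<lambda>A. smul (h A) (ket A)) X) Z = (\<Sum>A\<in>{A \<in> X. h A \<noteq> 0}. h A * of_bool (A = Z))"
    unfolding sum.G_def nz if_P[OF assms] lookup_sum lookup_smul lookup_ket ..
  also have "\<dots> = (\<Sum>A\<in>{A \<in> X. h A \<noteq> 0}. if A = Z then h Z else 0)" by (rule sum.cong) auto
  also have "\<dots> = (if Z \<in> X then h Z else 0)" using assms by (simp add: sum.delta')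
  finally show ?thesis .
qed

context op_model begin

definition space :: "(label \<times> label \<Rightarrow>\<^sub>0 gfield) set" where "space = space_on X"

lemma act_space:
  assumes "r \<le> rmax" "S \<in> X"
  shows "actE (src r) (Suc r) c d S \<in> space" "actE' (src r) (Suc r) c d S \<in> space"
    "actE (Suc r) (src r) c d S \<in> space" "actE' (Suc r) (src r) c d S \<in> space"
  using target_X[OF assms] unfolding actE_def actE'_def space_def
  by (auto intro!: space_on_add space_on_smul space_on_ket)

lemma lookup_lin_actE:
  assumes R: "lin R"
  shows "Poly_Mapping.lookup (R (actE s t c d S)) A = rhs_e s t c d (\<lambda>S. Poly_Mapping.lookup (R (ket S)) A) S"
    "Poly_Mapping.lookup (R (actE' s t c d S)) A = rhs_e s t d c (\<lambda>S. Poly_Mapping.lookup (R (ket (prod.swap S))) A) (prod.swap S)"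
  unfolding actE_def actE'_def rhs_e_def linD(1)[OF R] lookup_add
  by (auto simp: linD[OF R])

lemma sum_hop:
  assumes w: "w \<in> space" and A: "A \<in> X" and st: "s \<noteq> t"
  shows "(\<Sum>S\<in>Poly_Mapping.keys w. Poly_Mapping.lookup w S * Poly_Mapping.lookup (if can_hop s t (fst S) then smul (g S) (ket (nhop s t (fst S), snd S)) else 0) A)
      = (if can_hop t s (fst A) then g (nhop t s (fst A), snd A) * Poly_Mapping.lookup w (nhop t s (fst A), snd A) else 0)"
    "(\<Sum>S\<in>Poly_Mapping.keys w. Poly_Mapping.lookup w S * Poly_Mapping.lookup (if can_hop s t (snd S) then smul (g S) (ket (fst S, nhop s t (snd S))) else 0) A)
      = (if can_hop t s (snd A) then g (fst A, nhop t s (snd A)) * Poly_Mapping.lookup w (fst A, nhop t s (snd A)) else 0)"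
proof -
  have sX: "S \<in> X" if "S \<in> Poly_Mapping.keys w" for S using w that unfolding space_def space_on_def by auto
  have Ast: "fst A \<in> states n eps" "snd A \<in> states n eps" using G.X_D[OF A] by auto
  let ?Z = "(nhop t s (fst A), snd A)"
  have "(\<Sum>S\<in>Poly_Mapping.keys w. Poly_Mapping.lookup w S * Poly_Mapping.lookup (if can_hop s t (fst S) then smul (g S) (ket (nhop s t (fst S), snd S)) else 0) A)
     = (\<Sum>S\<in>Poly_Mapping.keys w. if S = ?Z then (if can_hop t s (fst A) then g ?Z * Poly_Mapping.lookup w ?Z else 0) else 0)"
  proof (rule sum.cong)
    fix S assume "S \<in> Poly_Mapping.keys w"
    then have "fst S \<in> states n eps" using G.X_D[OF sX] by blast
    from nhop_eq_iff[OF st this Ast(1)]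
    have "can_hop s t (fst S) \<and> (nhop s t (fst S), snd S) = A \<longleftrightarrow> can_hop t s (fst A) \<and> S = ?Z"
      by (cases A; cases S) auto
    moreover have "Poly_Mapping.lookup (if can_hop s t (fst S) then smul (g S) (ket (nhop s t (fst S), snd S)) else 0) A
       = (if can_hop s t (fst S) \<and> (nhop s t (fst S), snd S) = A then g S else 0)" by (simp add: lookup_ket)
    ultimately show "Poly_Mapping.lookup w S * Poly_Mapping.lookup (if can_hop s t (fst S) then smul (g S) (ket (nhop s t (fst S), snd S)) else 0) A
       = (if S = ?Z then (if can_hop t s (fst A) then g ?Z * Poly_Mapping.lookup w ?Z else 0) else 0)"
      by (simp only:) simp
  qed simp
  then show "(\<Sum>S\<in>Poly_Mapping.keys w. Poly_Mapping.lookup w S * Poly_Mapping.lookup (if can_hop s t (fst S) then smul (g S) (ket (nhop s t (fst S), snd S)) else 0) A)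
      = (if can_hop t s (fst A) then g ?Z * Poly_Mapping.lookup w ?Z else 0)"
    by (simp add: sum.delta' in_keys_iff)
  let ?Y = "(fst A, nhop t s (snd A))"
  have "(\<Sum>S\<in>Poly_Mapping.keys w. Poly_Mapping.lookup w S * Poly_Mapping.lookup (if can_hop s t (snd S) then smul (g S) (ket (fst S, nhop s t (snd S))) else 0) A)
     = (\<Sum>S\<in>Poly_Mapping.keys w. if S = ?Y then (if can_hop t s (snd A) then g ?Y * Poly_Mapping.lookup w ?Y else 0) else 0)"
  proof (rule sum.cong)
    fix S assume "S \<in> Poly_Mapping.keys w"
    then have "snd S \<in> states n eps" using G.X_D[OF sX] by blast
    from nhop_eq_iff[OF st this Ast(2)]
    have "can_hop s t (snd S) \<and> (fst S, nhop s t (snd S)) = A \<longleftrightarrow> can_hop t s (snd A) \<and> S = ?Y"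
      by (cases A; cases S) auto
    moreover have "Poly_Mapping.lookup (if can_hop s t (snd S) then smul (g S) (ket (fst S, nhop s t (snd S))) else 0) A
       = (if can_hop s t (snd S) \<and> (fst S, nhop s t (snd S)) = A then g S else 0)" by (simp add: lookup_ket)
    ultimately show "Poly_Mapping.lookup w S * Poly_Mapping.lookup (if can_hop s t (snd S) then smul (g S) (ket (fst S, nhop s t (snd S))) else 0) A
       = (if S = ?Y then (if can_hop t s (snd A) then g ?Y * Poly_Mapping.lookup w ?Y else 0) else 0)"
      by (simp only:) simp
  qed simp
  then show "(\<Sum>S\<in>Poly_Mapping.keys w. Poly_Mapping.lookup w S * Poly_Mapping.lookup (if can_hop s t (snd S) then smul (g S) (ket (fst S, nhop s t (snd S))) else 0) A)
      = (if can_hop t s (snd A) then g ?Y * Poly_Mapping.lookup w ?Y else 0)"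
    by (simp add: sum.delta' in_keys_iff)
qed

lemma lookup_actE_ext:
  assumes w: "w \<in> space" and A: "A \<in> X" and st: "s \<noteq> t"
  shows "Poly_Mapping.lookup (lin_ext (actE' s t c d) w) A = lhs_e s t c d (Poly_Mapping.lookup w) A"
    "Poly_Mapping.lookup (lin_ext (actE s t c d) w) A = lhs_e s t d c (\<lambda>A. Poly_Mapping.lookup w (prod.swap A)) (prod.swap A)"
  unfolding lookup_lin_ext actE_def actE'_def lookup_add distrib_left sum.distrib sum_hop[OF assms] lhs_e_def
  by simp_all

lemma tens_act_ext:
  assumes "\<And>S. S \<in> X \<Longrightarrow> tens_act \<pi>1 \<pi>2 Y (ket S) = f S" "w \<in> space"
  shows "tens_act \<pi>1 \<pi>2 Y w = lin_ext f w"
  by (rule lin_eq_on[OF lin_tens_act lin_lin_ext]) (use assms in \<open>auto simp: space_def\<close>)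

lemma generator_space:
  assumes g: "gen_index g \<in> {..rmax}" and S: "S \<in> X"
  shows "tens_act (rep x) (rep y) (coprod_gen g) (ket S) \<in> space \<and> tens_act (rep x) (rep y) (coprod_op (Gen g)) (ket S) \<in> space"
proof -
  have "ket S \<in> space" using S by (simp add: space_def space_on_ket)
  then have d: "smul c (ket S) \<in> space" for c unfolding space_def by (rule space_on_smul)
  show ?thesis using g
    by (cases g) (simp_all only: gen_index.simps atMost_iff generator_action[OF S] act_space[OF _ S] d simp_thms)
qed

lemma intertwines_imp_hop_rel:
  assumes R: "lin R" "\<And>S. S \<in> X \<Longrightarrow> R (ket S) \<in> space"
    and I: "\<And>g S. gen_index g \<le> rmax \<Longrightarrow> S \<in> X \<Longrightarrow>
      tens_act (rep xK) (rep yK) (coprod_op (Gen g)) (R (ket S)) = R (tens_act (rep xK) (rep yK) (coprod_gen g) (ket S))"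
  shows "hop_rel xK yK (\<lambda>A S. Poly_Mapping.lookup (R (ket S)) A)"
  unfolding hop_rel_def
proof (intro allI ballI impI conjI)
  fix r A S assume r: "r \<le> rmax" and A: "A \<in> X" and S: "S \<in> X"
  note ne = edge[OF r]
  note gen = I[OF _ S]
  have "tens_act (rep xK) (rep yK) (coprod_op (Gen (GE r))) (R (ket S)) = lin_ext (actE' (src r) (Suc r) (u r xK) (u r yK)) (R (ket S))"
    by (rule tens_act_ext[OF _ R(2)[OF S]]) (rule generator_action(2)[OF _ r])
  with gen[of "GE r"] r have "lin_ext (actE' (src r) (Suc r) (u r xK) (u r yK)) (R (ket S)) = R (actE (src r) (Suc r) (u r xK) (u r yK) S)"
    using generator_action(1)[OF S r, of xK yK] by simp
  from arg_cong[OF this, of "\<lambda>v. Poly_Mapping.lookup v A"]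
  show "lhs_e (src r) (Suc r) (u r xK) (u r yK) (\<lambda>A. Poly_Mapping.lookup (R (ket S)) A) A
      = rhs_e (src r) (Suc r) (u r xK) (u r yK) (\<lambda>S. Poly_Mapping.lookup (R (ket S)) A) S"
    unfolding lookup_actE_ext(1)[OF R(2)[OF S] A conjunct1[OF ne]] lookup_lin_actE[OF R(1)] .
  have "tens_act (rep xK) (rep yK) (coprod_op (Gen (GF r))) (R (ket S)) = lin_ext (actE (Suc r) (src r) (inverse (u r xK)) (inverse (u r yK))) (R (ket S))"
    by (rule tens_act_ext[OF _ R(2)[OF S]]) (rule generator_action(4)[OF _ r])
  with gen[of "GF r"] r have F: "lin_ext (actE (Suc r) (src r) (inverse (u r xK)) (inverse (u r yK))) (R (ket S)) = R (actE' (Suc r) (src r) (inverse (u r xK)) (inverse (u r yK)) S)"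
    using generator_action(3)[OF S r, of xK yK] by simp
  have ne': "Suc r \<noteq> src r" using ne by auto
  from arg_cong[OF F, of "\<lambda>v. Poly_Mapping.lookup v A"]
  show "lhs_e (Suc r) (src r) (inverse (u r yK)) (inverse (u r xK)) (\<lambda>A. Poly_Mapping.lookup (R (ket S)) (prod.swap A)) (prod.swap A)
      = rhs_e (Suc r) (src r) (inverse (u r yK)) (inverse (u r xK)) (\<lambda>S. Poly_Mapping.lookup (R (ket (prod.swap S))) A) (prod.swap S)"
    unfolding lookup_actE_ext(2)[OF R(2)[OF S] A ne'] lookup_lin_actE[OF R(1)] .
qed

text \<open>
  The eigenvalue of \<open>\<Delta>(k_r)\<close> depends only on the sums of the two labels at each site.
\<close>
lemma cartan_weight:
  assumes r: "r \<le> rmax" and w: "\<And>k. k \<in> {1..n} \<Longrightarrow> fst A k + snd A k = fst S k + snd S k"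
  shows "cartan (src r) (Suc r) (fst A) * cartan (src r) (Suc r) (snd A) = cartan (src r) (Suc r) (fst S) * cartan (src r) (Suc r) (snd S)"
proof -
  have Qnz: "Qs e \<noteq> 0" for e using G.nz by (simp add: Qs_def)
  have 1: "Qs e powi - int (fst A k) * Qs e powi - int (snd A k) = Qs e powi - int (fst S k) * Qs e powi - int (snd S k)"
    "Qs e powi int (fst A k) * Qs e powi int (snd A k) = Qs e powi int (fst S k) * Qs e powi int (snd S k)" if "k \<in> {1..n}" for e k
  proof -
    have "int (fst A k) + int (snd A k) = int (fst S k) + int (snd S k)" using w[OF that] by linarith
    then have "- int (fst A k) + - int (snd A k) = - int (fst S k) + - int (snd S k)"
      "int (fst A k) + int (snd A k) = int (fst S k) + int (snd S k)" by linarith+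
    then show "Qs e powi - int (fst A k) * Qs e powi - int (snd A k) = Qs e powi - int (fst S k) * Qs e powi - int (snd S k)"
      "Qs e powi int (fst A k) * Qs e powi int (snd A k) = Qs e powi int (fst S k) * Qs e powi int (snd S k)"
      using power_int_add[OF disjI1[OF Qnz[of e]]] by metis+
  qed
  define f where "f z = (if src r \<in> {1..n} then Qs (eps (src r)) powi - int (z (src r)) else inverse pK)" for z :: label
  define g where "g z = (if Suc r \<in> {1..n} then Qs (eps (Suc r)) powi int (z (Suc r)) else pK)" for z :: label
  have fg: "cartan (src r) (Suc r) z = f z * g z" for z unfolding cartan_def f_def g_def ..
  have "f (fst A) * f (snd A) = f (fst S) * f (snd S)"
  proof (cases "src r \<in> {1..n}")
    case True
    show ?thesis unfolding f_def if_P[OF True] by (rule 1(1)[OF True])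
  next
    case False
    show ?thesis unfolding f_def if_not_P[OF False] ..
  qed
  moreover have "g (fst A) * g (snd A) = g (fst S) * g (snd S)"
  proof (cases "Suc r \<in> {1..n}")
    case True
    show ?thesis unfolding g_def if_P[OF True] by (rule 1(2)[OF True])
  next
    case False
    show ?thesis unfolding g_def if_not_P[OF False] ..
  qed
  ultimately have "(f (fst A) * f (snd A)) * (g (fst A) * g (snd A)) = (f (fst S) * f (snd S)) * (g (fst S) * g (snd S))" by simp
  then show ?thesis unfolding fg by (simp only: mult_ac)
qed

lemma hop_rel_imp_intertwines:
  assumes R: "lin R" "\<And>S. S \<in> X \<Longrightarrow> R (ket S) \<in> space"
    and rel: "hop_rel xK yK (\<lambda>A S. Poly_Mapping.lookup (R (ket S)) A)"
    and w: "\<And>A S k. A \<in> X \<Longrightarrow> S \<in> X \<Longrightarrow> k \<in> {1..n} \<Longrightarrow> fst A k + snd A k \<noteq> fst S k + snd S k \<Longrightarrow> Poly_Mapping.lookup (R (ket S)) A = 0"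
  shows "intertwines alg (rep xK) (rep yK) space (restrict R space)"
proof -
  let ?T = "tens_act (rep xK) (rep yK)"
  obtain D r' where al: "alg = ualg rmax D r'" using alg_ualg by blast
  have Rsp: "v \<in> space \<Longrightarrow> R v \<in> space" for v unfolding space_def by (rule lin_space[OF R(1)]) (use R(2) in \<open>auto simp: space_def\<close>)
  note inv = generator_space
  have gk: "?T (coprod_op (Gen g)) (R (ket S)) = R (?T (coprod_gen g) (ket S))" if g: "gen_index g \<in> {..rmax}" and S: "S \<in> X" for g S
  proof -
    define r where "r = gen_index g"
    have r: "r \<le> rmax" using g by (simp add: r_def)
    note ne = edge[OF r]
    have ne': "Suc r \<noteq> src r" using ne by auto
    have RS: "R (ket S) \<in> space" by (rule R(2)[OF S])
    have op: "v \<in> space \<Longrightarrow> ?T (coprod_op (Gen g)) v \<in> space" for v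
      unfolding space_def by (rule lin_space[OF lin_tens_act]) (use inv[OF g] in \<open>auto simp: space_def\<close>)
    have diag: "Poly_Mapping.lookup (lin_ext (\<lambda>S. smul (h (cartan (src r) (Suc r) (fst S) * cartan (src r) (Suc r) (snd S))) (ket S)) (R (ket S))) A
       = Poly_Mapping.lookup (R (smul (h (cartan (src r) (Suc r) (fst S) * cartan (src r) (Suc r) (snd S))) (ket S))) A" if A: "A \<in> X" for A and h :: "gfield \<Rightarrow> gfield"
    proof (cases "\<forall>k\<in>{1..n}. fst A k + snd A k = fst S k + snd S k")
      case True
      show ?thesis unfolding lookup_diagonal linD[OF R(1)] lookup_smul
        by (subst cartan_weight[OF r, of A S]) (use True in simp_all)
    next
      case False
      then have "Poly_Mapping.lookup (R (ket S)) A = 0" using w[OF A S] by blast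
      then show ?thesis unfolding lookup_diagonal linD[OF R(1)] lookup_smul by simp
    qed
    show ?thesis
    proof (rule space_on_eqI[of _ X])
      show "?T (coprod_op (Gen g)) (R (ket S)) \<in> space_on X" using op[OF RS] by (simp only: space_def)
      show "R (?T (coprod_gen g) (ket S)) \<in> space_on X" using Rsp inv[OF g S] by (simp only: space_def simp_thms)
      fix A assume A: "A \<in> X"
      show "Poly_Mapping.lookup (?T (coprod_op (Gen g)) (R (ket S))) A = Poly_Mapping.lookup (R (?T (coprod_gen g) (ket S))) A"
      proof (cases g)
        case (GE i)
        then have g: "g = GE r" by (simp add: r_def)
        have e: "?T (coprod_op (Gen (GE r))) (R (ket S)) = lin_ext (actE' (src r) (Suc r) (u r xK) (u r yK)) (R (ket S))"
          by (rule tens_act_ext[OF _ RS]) (rule generator_action(2)[OF _ r])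
        show ?thesis unfolding g e generator_action(1)[OF S r]
            lookup_actE_ext(1)[OF RS A conjunct1[OF ne]] lookup_lin_actE[OF R(1)]
          using rel r A S unfolding hop_rel_def by blast
      next
        case (GF i)
        then have g: "g = GF r" by (simp add: r_def)
        have e: "?T (coprod_op (Gen (GF r))) (R (ket S)) = lin_ext (actE (Suc r) (src r) (inverse (u r xK)) (inverse (u r yK))) (R (ket S))"
          by (rule tens_act_ext[OF _ RS]) (rule generator_action(4)[OF _ r])
        show ?thesis unfolding g e generator_action(3)[OF S r]
            lookup_actE_ext(2)[OF RS A ne'] lookup_lin_actE[OF R(1)]
          using rel r A S unfolding hop_rel_def by blast
      next
        case (GK i)
        then have g: "g = GK r" by (simp add: r_def)
        have e: "?T (coprod_op (Gen (GK r))) (R (ket S)) = lin_ext (\<lambda>S. smul (cartan (src r) (Suc r) (fst S) * cartan (src r) (Suc r) (snd S)) (ket S)) (R (ket S))"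
          by (rule tens_act_ext[OF _ RS]) (rule generator_action(6)[OF _ r])
        show ?thesis unfolding g e generator_action(5)[OF S r]
          by (rule diag[OF A, of "\<lambda>z. z"])
      next
        case (GKinv i)
        then have g: "g = GKinv r" by (simp add: r_def)
        have e: "?T (coprod_op (Gen (GKinv r))) (R (ket S)) = lin_ext (\<lambda>S. smul (inverse (cartan (src r) (Suc r) (fst S) * cartan (src r) (Suc r) (snd S))) (ket S)) (R (ket S))"
          by (rule tens_act_ext[OF _ RS]) (rule generator_action(8)[OF _ r])
        show ?thesis unfolding g e generator_action(7)[OF S r]
          by (rule diag[OF A, of inverse])
      qed
    qed
  qed
  have gen: "?T (coprod_op (Gen g)) (R v) = R (?T (coprod_gen g) v)" if "gen_index g \<in> {..rmax}" "v \<in> space_on X" for g v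
    by (rule lin_eq_on[OF lin_comp[OF lin_tens_act R(1)] lin_comp[OF R(1) lin_tens_act] _ that(2)]) (rule gk[OF that(1)])
  show ?thesis unfolding intertwines_def
  proof (intro ballI)
    fix g t v assume g: "g \<in> alg" "t \<in> g" and v: "v \<in> space"
    have t: "uindices t \<subseteq> {..rmax}" by (rule ualg_elem[OF g(1)[unfolded al] g(2)])
    have "?T (coprod t) v \<in> space_on X \<and> ?T (coprod_op t) (R v) = R (?T (coprod t) v)"
    proof (rule intertwines_from_generators[OF lin_rep lin_rep _ _ _ _ gen t])
      show "R (v + w) = R v + R w" "R (smul c v) = smul c (R v)" for v w c by (rule linD[OF R(1)])+
      show "v \<in> space_on X \<Longrightarrow> R v \<in> space_on X" for v using Rsp[of v] by (simp only: space_def)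
      show "gen_index g \<in> {..rmax} \<Longrightarrow> b \<in> X \<Longrightarrow> ?T (coprod_gen g) (ket b) \<in> space_on X" for g b
        using inv[of g b] by (simp only: space_def simp_thms)
      show "v \<in> space_on X" using v by (simp only: space_def)
    qed
    then show "?T (coprod_op t) (restrict R space v) = restrict R space (?T (coprod t) v)"
      using v by (simp add: space_def)
  qed
qed

end

section \<open>Existence and uniqueness of the R matrix\<close>

context hop_field begin

lemma hop_rel_diff:
  assumes "hop_rel x y M" "hop_rel x y M'"
  shows "hop_rel x y (\<lambda>A S. M A S - M' A S)"
proof -
  have L: "lhs_e s t c d (\<lambda>A. \<Psi> A - \<Psi>' A) A = lhs_e s t c d \<Psi> A - lhs_e s t c d \<Psi>' A" for s t c d \<Psi> \<Psi>' A
    by (simp add: lhs_e_def algebra_simps)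
  have R: "rhs_e s t c d (\<lambda>A. \<Psi> A - \<Psi>' A) A = rhs_e s t c d \<Psi> A - rhs_e s t c d \<Psi>' A" for s t c d \<Psi> \<Psi>' A
    by (simp add: rhs_e_def algebra_simps)
  show ?thesis using assms unfolding hop_rel_def L R by simp
qed

end

context op_model begin

definition is_R :: "nat \<Rightarrow> ((label \<times> label \<Rightarrow>\<^sub>0 gfield) \<Rightarrow> (label \<times> label \<Rightarrow>\<^sub>0 gfield)) \<Rightarrow> bool" where
  "is_R i0 R \<longleftrightarrow> R \<in> End space \<and> intertwines alg (rep xK) (rep yK) space R \<and> R (ket (ref_pair i0)) = ket (ref_pair i0)"

text \<open>
  The difference of the two matrices satisfies the intertwining relation and vanishes on the reference vector.
\<close>
theorem is_R_unique:
  assumes ok: "ref_ok i0" and R: "is_R i0 R" and R': "is_R i0 R'"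
  shows "R = R'"
proof -
  obtain D r' where al: "alg = ualg rmax D r'" using alg_ualg by blast
  have matrix: "hop_rel xK yK (\<lambda>A S. Poly_Mapping.lookup (R (ket S)) A)" if R: "is_R i0 R" for R
  proof -
    have E: "R \<in> End space" using R by (simp add: is_R_def)
    have I: "intertwines alg (rep xK) (rep yK) space R" using R by (simp add: is_R_def)
    define R0 where "R0 = lin_ext (\<lambda>S. R (ket S))"
    have R0: "v \<in> space \<Longrightarrow> R v = R0 v" for v
      unfolding R0_def space_def by (rule End_lin_ext) (use E in \<open>simp add: space_def\<close>)
    have k: "S \<in> X \<Longrightarrow> ket S \<in> space" for S by (simp add: space_def space_on_ket)
    have "hop_rel xK yK (\<lambda>A S. Poly_Mapping.lookup (R0 (ket S)) A)"
    proof (rule intertwines_imp_hop_rel)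
      show "lin R0" unfolding R0_def by (rule lin_lin_ext)
      fix S assume S: "S \<in> X"
      show "R0 (ket S) \<in> space" using E k[OF S] unfolding R0_def lin_ext_ket End_def by auto
      fix g assume g: "gen_index g \<le> rmax"
      obtain c where c: "c \<in> alg" "Gen g \<in> c" using ualg_gen[OF g, of D r'] unfolding al by blast
      have "tens_act (rep xK) (rep yK) (coprod_op (Gen g)) (R (ket S)) = R (tens_act (rep xK) (rep yK) (coprod (Gen g)) (ket S))"
        using I c k[OF S] unfolding intertwines_def by blast
      then show "tens_act (rep xK) (rep yK) (coprod_op (Gen g)) (R0 (ket S)) = R0 (tens_act (rep xK) (rep yK) (coprod_gen g) (ket S))"
        using R0[OF k[OF S]] R0[OF conjunct1[OF generator_space[OF _ S, of g xK yK]]] g by simp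
    qed
    then show ?thesis unfolding R0_def lin_ext_ket .
  qed
  note rel = hop_rel_diff[OF matrix[OF R] matrix[OF R']]
  have sub: "subfield_module UNIV {0 :: gfield}" by unfold_locales auto
  have eq: "Poly_Mapping.lookup (R (ket S)) A - Poly_Mapping.lookup (R' (ket S)) A \<in> {0}" if "A \<in> X" "S \<in> X" for A S
    by (rule G.hop_generated[OF sub _ _ _ _ rel ref_pair_X[OF ok] _ that]) (use R R' in \<open>simp_all add: is_R_def\<close>)
  have E: "R \<in> End space" "R' \<in> End space" using R R' by (simp_all add: is_R_def)
  have kets: "R (ket S) = R' (ket S)" if S: "S \<in> X" for S
  proof (rule space_on_eqI[of _ X])
    have "ket S \<in> space" using S by (simp add: space_def space_on_ket)
    then show "R (ket S) \<in> space_on X" "R' (ket S) \<in> space_on X" using E unfolding End_def space_def by auto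
    fix A assume "A \<in> X"
    then show "Poly_Mapping.lookup (R (ket S)) A = Poly_Mapping.lookup (R' (ket S)) A" using eq[OF _ S] by simp
  qed
  have P: "R \<in> space \<rightarrow>\<^sub>E space" "R' \<in> space \<rightarrow>\<^sub>E space" using E unfolding End_def by blast+
  show ?thesis
  proof (rule PiE_ext[OF P])
    fix v assume v: "v \<in> space"
    show "R v = R' v"
      unfolding End_lin_ext[OF E(1)[unfolded space_def] v[unfolded space_def]] End_lin_ext[OF E(2)[unfolded space_def] v[unfolded space_def]]
      by (rule lin_eq_on[OF lin_lin_ext lin_lin_ext _ v[unfolded space_def]]) (simp add: kets)
  qed
qed

definition op_of :: "(label \<times> label \<Rightarrow> label \<times> label \<Rightarrow> gfield) \<Rightarrow> (label \<times> label \<Rightarrow>\<^sub>0 gfield) \<Rightarrow> (label \<times> label \<Rightarrow>\<^sub>0 gfield)" where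
  "op_of M = lin_ext (\<lambda>S. \<Sum>A\<in>{A \<in> X. wt A = wt S}. smul (M A S) (ket A))"

lemma lin_op_of: "lin (op_of M)"
  unfolding op_of_def by (rule lin_lin_ext)

definition preserves_weight :: "(label \<times> label \<Rightarrow> label \<times> label \<Rightarrow> gfield) \<Rightarrow> bool" where
  "preserves_weight M \<longleftrightarrow> (\<forall>A\<in>X. \<forall>S\<in>X. M A S \<noteq> 0 \<longrightarrow> (\<forall>k\<in>{1..n}. fst A k + snd A k = fst S k + snd S k))"

context
  fixes M :: "label \<times> label \<Rightarrow> label \<times> label \<Rightarrow> gfield"
  assumes weight: "preserves_weight M"
begin

lemma weight_wt: "A \<in> X \<Longrightarrow> S \<in> X \<Longrightarrow> M A S \<noteq> 0 \<Longrightarrow> wt A = wt S"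
proof -
  assume A: "A \<in> X" "S \<in> X" "M A S \<noteq> 0"
  then have "(\<Sum>k=1..n. fst A k + snd A k) = (\<Sum>k=1..n. fst S k + snd S k)"
    using weight unfolding preserves_weight_def by (intro sum.cong) auto
  then show ?thesis unfolding wt_def lsum_def sum.distrib by linarith
qed

lemma finite_column: "S \<in> X \<Longrightarrow> finite {A \<in> X. M A S \<noteq> 0}"
  by (rule finite_subset[OF _ G.fin_X[of "wt S"]]) (use weight_wt[OF _ _] in blast)

lemma lookup_op_of:
  assumes S: "S \<in> X"
  shows "Poly_Mapping.lookup (op_of M (ket S)) Z = (if Z \<in> X then M Z S else 0)"
proof -
  have "Poly_Mapping.lookup (op_of M (ket S)) Z = (\<Sum>A\<in>{A \<in> X. wt A = wt S}. if A = Z then M Z S else 0)"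
    unfolding op_of_def lin_ext_ket lookup_sum by (rule sum.cong) (auto simp: lookup_ket)
  also have "\<dots> = (if Z \<in> X \<and> wt Z = wt S then M Z S else 0)" using G.fin_X[of "wt S"] by (simp add: sum.delta')
  also have "\<dots> = (if Z \<in> X then M Z S else 0)" using weight_wt[OF _ S, of Z] by (cases "M Z S = 0") simp_all
  finally show ?thesis .
qed

lemma op_of_space: "S \<in> X \<Longrightarrow> op_of M (ket S) \<in> space"
  unfolding op_of_def lin_ext_ket space_def by (intro space_on_sum space_on_smul space_on_ket) simp

theorem op_of_is_R:
  assumes ok: "ref_ok i0" and rel: "hop_rel xK yK M" and init: "\<And>A. A \<in> X \<Longrightarrow> M A (ref_pair i0) = of_bool (A = ref_pair i0)"
  shows "is_R i0 (restrict (op_of M) space)"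
proof -
  note rX = ref_pair_X[OF ok]
  have r: "ket (ref_pair i0) \<in> space" using rX by (simp add: space_def space_on_ket)
  have "op_of M (ket (ref_pair i0)) = ket (ref_pair i0)"
    by (rule poly_mapping_eqI) (use rX init in \<open>auto simp: lookup_op_of lookup_ket\<close>)
  moreover have "restrict (op_of M) space \<in> End space"
    unfolding space_def by (rule restrict_End[OF lin_op_of]) (use op_of_space in \<open>simp add: space_def\<close>)
  moreover have "intertwines alg (rep xK) (rep yK) space (restrict (op_of M) space)"
  proof (rule hop_rel_imp_intertwines[OF lin_op_of op_of_space])
    show "hop_rel xK yK (\<lambda>A S. Poly_Mapping.lookup (op_of M (ket S)) A)"
      by (rule hop_rel_cong[OF _ rel]) (simp add: lookup_op_of)
    fix A S k assume *: "A \<in> X" "S \<in> X" "k \<in> {1..n}" "fst A k + snd A k \<noteq> fst S k + snd S k"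
    then have "M A S = 0" using weight unfolding preserves_weight_def by blast
    then show "Poly_Mapping.lookup (op_of M (ket S)) A = 0" using * by (simp add: lookup_op_of)
  qed
  ultimately show ?thesis using r by (simp add: is_R_def)
qed

lemma sum'_op_of:
  assumes S: "S \<in> X" and f: "f = (\<lambda>A. smul (M A S) (ket A))"
  shows "sum' f X = op_of M (ket S)"
  unfolding f by (rule poly_mapping_eqI) (simp add: lookup_sum'[OF finite_column[OF S]] lookup_op_of[OF S])

end

end

context series_model begin

sublocale O: op_model n eps aff l m by unfold_locales

lemma R_value_preserves_weight: "O.preserves_weight R_value"
  unfolding O.preserves_weight_def
proof (intro ballI impI)
  fix A S k assume *: "A \<in> K.X" "S \<in> K.X" "R_value A S \<noteq> 0" "k \<in> {1..n}"
  then show "fst A k + snd A k = fst S k + snd S k" using R_value_weight[of A S k] by metis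
qed

lemma R_characterized:
  assumes ok: "ref_ok i0"
  shows "O.is_R i0 R \<longleftrightarrow> R = restrict (O.op_of R_value) O.space"
proof -
  have "O.is_R i0 (restrict (O.op_of R_value) O.space)"
    by (rule O.op_of_is_R[OF R_value_preserves_weight ok R_value_rel[OF ok] R_value_init[OF ok]])
  then show ?thesis using O.is_R_unique[OF ok] by blast
qed

theorem Str_equals_R_A:
  assumes aff: aff and ok: "ref_ok i0"
  shows "\<forall>a\<in>states_of n eps l. \<forall>b\<in>states_of n eps m. \<forall>i\<in>states_of n eps l. \<forall>j\<in>states_of n eps m.
      rational_series (Str_elem n eps l m a b i j)"
    "\<exists>!R. is_R_A n eps l m i0 R" "Str n eps l m = R_A n eps l m i0"
proof -
  have X: "X = states_of n eps l \<times> states_of n eps m"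
    using aff unfolding X_def St_def B.St_def states_of_def by simp
  have sp: "O.space = WW_A n eps l m" unfolding O.space_def WW_A_def X ..
  have Rs: "R_series A S = Str_elem n eps l m (fst A) (snd A) (fst S) (snd S)" for A S
    using aff unfolding R_series_def by simp
  have isR: "is_R_A n eps l m i0 R \<longleftrightarrow> R = restrict (O.op_of R_value) O.space" for R
    unfolding R_characterized[OF ok, symmetric]
    unfolding is_R_A_def O.is_R_def sp O.alg_def O.rep_def ref_pair_def if_P[OF aff] ..
  show "\<forall>a\<in>states_of n eps l. \<forall>b\<in>states_of n eps m. \<forall>i\<in>states_of n eps l. \<forall>j\<in>states_of n eps m.
      rational_series (Str_elem n eps l m a b i j)"
  proof (intro ballI)
    fix a b i j assume "a \<in> states_of n eps l" "b \<in> states_of n eps m" "i \<in> states_of n eps l" "j \<in> states_of n eps m"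
    then show "rational_series (Str_elem n eps l m a b i j)"
      using R_series_rational[OF ok, of "(a, b)" "(i, j)"] unfolding X Rs by simp
  qed
  show "\<exists>!R. is_R_A n eps l m i0 R" unfolding isR by blast
  have "R_A n eps l m i0 = restrict (O.op_of R_value) O.space" unfolding R_A_def isR by simp
  also have "\<dots> = Str n eps l m"
    unfolding Str_def sp
  proof (rule restrict_ext)
    fix v assume v: "v \<in> WW_A n eps l m"
    show "O.op_of R_value v = lin_ext (\<lambda>(i, j). sum' (\<lambda>(a, b). smul (rat_value (Str_elem n eps l m a b i j)) (ket (a, b)))
        (states_of n eps l \<times> states_of n eps m)) v"
    proof (rule lin_eq_on[OF O.lin_op_of lin_lin_ext])
      show "v \<in> space_on X" using v unfolding WW_A_def X .
      fix S assume S: "S \<in> X"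
      obtain i j where e: "S = (i, j)" by force
      have "sum' (\<lambda>(a, b). smul (rat_value (Str_elem n eps l m a b i j)) (ket (a, b))) X = O.op_of R_value (ket S)"
        by (rule O.sum'_op_of[OF R_value_preserves_weight S]) (auto simp: fun_eq_iff R_value_def Rs e)
      then show "O.op_of R_value (ket S) = lin_ext (\<lambda>(i, j). sum' (\<lambda>(a, b). smul (rat_value (Str_elem n eps l m a b i j)) (ket (a, b)))
        (states_of n eps l \<times> states_of n eps m)) (ket S)"
        unfolding lin_ext_ket e prod.case X by simp
    qed
  qed
  finally show "Str n eps l m = R_A n eps l m i0" ..
qed

lemma lookup_Kinv_id: "Poly_Mapping.lookup (tens_op (Kinv_op n) id w) A = pK powi int (lsum n (fst A)) * Poly_Mapping.lookup w A"
proof -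
  have e: "tens_op (Kinv_op n) id = lin_ext (\<lambda>A. smul (pK powi int (lsum n (fst A))) (ket A))"
    unfolding tens_op_def by (rule arg_cong[of _ _ lin_ext]) (auto simp: fun_eq_iff Kinv_op_def simp del: power_int_of_nat)
  show ?thesis unfolding e lookup_diagonal ..
qed

lemma id_K_ket: "tens_op id (K_op n) (ket S) = smul (pK powi (- int (lsum n (snd S)))) (ket S)"
  by (cases S) (simp add: K_op_def)

text \<open>
  The operators \<open>K\<close> are diagonal, so the twist multiplies the entry at \<open>(a, b), (i, j)\<close> by \<open>p^(|a| - |j|)\<close>.  This
  cancels the factor in \<open>R_series\<close>, and it fixes the vacuum, so the normalizations correspond.
\<close>
theorem S11_equals_R_B:
  assumes aff: "\<not> aff"
  shows "\<forall>a\<in>states n eps. \<forall>b\<in>states n eps. \<forall>i\<in>states n eps. \<forall>j\<in>states n eps. rational_series (S11_elem n eps a b i j)"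
    "\<exists>!R. is_R_B n eps R" "S11 n eps = R_B_tilde n eps"
proof -
  have ok: "ref_ok 0" using aff unfolding ref_ok_def by simp
  have X: "X = states n eps \<times> states n eps"
    using aff unfolding X_def St_def B.St_def by simp
  have sp: "O.space = WW_B n eps" unfolding O.space_def WW_B_def X ..
  have pK: "pK \<noteq> 0" by (rule O.G.nz)
  have rp: "ref_pair 0 = (\<lambda>_. 0, \<lambda>_. 0)" using aff unfolding ref_pair_def by simp
  have kr: "ket (ref_pair 0) \<in> O.space" using ref_pair_X[OF ok] by (simp add: O.space_def space_on_ket)
  have Rs: "R_series A S = fls_const (ps powi (int (lsum n (snd S)) - int (lsum n (fst A)))) * S11_elem n eps (fst A) (snd A) (fst S) (snd S)" for A S
    using aff unfolding R_series_def by simp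
  have pLw: "fls_const (ps powi w) = pL powi w" for w
    unfolding pL_def power_int_def by (auto simp: fls_const_power fls_inverse_const)
  have pLnz: "pL \<noteq> 0" by (simp add: pL_def ps_def qhs_def)
  have rvS: "has_value (S11_elem n eps (fst A) (snd A) (fst S) (snd S)) (pK powi int (lsum n (fst A)) * (pK powi (- int (lsum n (snd S))) * R_value A S))"
    if "A \<in> X" "S \<in> X" for A S
  proof -
    have e: "S11_elem n eps (fst A) (snd A) (fst S) (snd S) = pL powi int (lsum n (fst A)) * (pL powi (- int (lsum n (snd S))) * R_series A S)"
      unfolding Rs pLw using pLnz by (simp add: power_int_diff power_int_minus del: power_int_of_nat)
    show ?thesis unfolding e by (intro has_value_simps has_value_qp has_value_R_value[OF ok] that)
  qed
  show "\<forall>a\<in>states n eps. \<forall>b\<in>states n eps. \<forall>i\<in>states n eps. \<forall>j\<in>states n eps. rational_series (S11_elem n eps a b i j)"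
  proof (intro ballI)
    fix a b i j assume "a \<in> states n eps" "b \<in> states n eps" "i \<in> states n eps" "j \<in> states n eps"
    then show "rational_series (S11_elem n eps a b i j)"
      using rvS[of "(a, b)" "(i, j)"] unfolding X has_value_def by simp
  qed
  have z: "tens_op id (K_op n) (ket (\<lambda>_. 0, \<lambda>_. 0)) = ket (\<lambda>_. 0, \<lambda>_. 0)"
    unfolding id_K_ket by (simp add: lsum_def)
  have norm: "twist_B n eps R (ket (\<lambda>_. 0, \<lambda>_. 0)) = ket (\<lambda>_. 0, \<lambda>_. 0) \<longleftrightarrow> R (ket (\<lambda>_. 0, \<lambda>_. 0)) = ket (\<lambda>_. 0, \<lambda>_. 0)" for R
  proof -
    have t: "twist_B n eps R (ket (\<lambda>_. 0, \<lambda>_. 0)) = tens_op (Kinv_op n) id (R (ket (\<lambda>_. 0, \<lambda>_. 0)))"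
      unfolding twist_B_def restrict_apply if_P[OF kr[unfolded sp rp]] z ..
    have "tens_op (Kinv_op n) id w = ket (\<lambda>_. 0, \<lambda>_. 0) \<longleftrightarrow> w = ket (\<lambda>_. 0, \<lambda>_. 0)" for w :: "label \<times> label \<Rightarrow>\<^sub>0 gfield"
    proof -
      have nrm: "pK powi int (lsum n (fst A)) * c = of_bool ((\<lambda>_. 0, \<lambda>_. 0) = A) \<longleftrightarrow> c = of_bool ((\<lambda>_. 0, \<lambda>_. 0) = A)" for c and A :: "label \<times> label"
        using pK by (cases "A = (\<lambda>_. 0, \<lambda>_. 0)") (auto simp: lsum_def)
      show ?thesis unfolding poly_mapping_eq_iff fun_eq_iff lookup_Kinv_id lookup_ket nrm ..
    qed
    then show ?thesis unfolding t .
  qed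
  have isR: "is_R_B n eps R \<longleftrightarrow> R = restrict (O.op_of R_value) O.space" for R
    unfolding R_characterized[OF ok, symmetric]
    unfolding is_R_B_def norm O.is_R_def sp rp O.alg_def O.rep_def if_not_P[OF aff] ..
  show "\<exists>!R. is_R_B n eps R" unfolding isR by blast
  have "R_B_tilde n eps = twist_B n eps (restrict (O.op_of R_value) O.space)" unfolding R_B_tilde_def isR by simp
  also have "\<dots> = S11 n eps"
    unfolding S11_def twist_B_def
  proof (rule restrict_ext)
    fix v assume v: "v \<in> WW_B n eps"
    have sK: "tens_op id (K_op n) v \<in> O.space"
      unfolding sp WW_B_def by (rule lin_space[OF lin_tens_op _ v[unfolded WW_B_def]]) (simp add: id_K_ket space_on_smul space_on_ket)
    have "tens_op (Kinv_op n) id (O.op_of R_value (tens_op id (K_op n) v)) =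
      lin_ext (\<lambda>(i, j). sum' (\<lambda>(a, b). smul (rat_value (S11_elem n eps a b i j)) (ket (a, b))) (states n eps \<times> states n eps)) v"
    proof (rule lin_eq_on[OF lin_comp[OF lin_tens_op lin_comp[OF O.lin_op_of lin_tens_op]] lin_lin_ext])
      show "v \<in> space_on X" using v unfolding WW_B_def X .
      fix S assume S: "S \<in> X"
      obtain i j where e: "S = (i, j)" by force
      define M where "M A S = rat_value (S11_elem n eps (fst A) (snd A) (fst S) (snd S))" for A S :: "label \<times> label"
      have M: "M A S = pK powi int (lsum n (fst A)) * (pK powi (- int (lsum n (snd S))) * R_value A S)" if "A \<in> X" "S \<in> X" for A S
        using rvS[OF that] unfolding has_value_def M_def by blast
      have W: "O.preserves_weight M"
        using R_value_preserves_weight M unfolding O.preserves_weight_def by fastforce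
      have "tens_op (Kinv_op n) id (O.op_of R_value (tens_op id (K_op n) (ket S))) = O.op_of M (ket S)"
      proof (rule poly_mapping_eqI)
        fix A
        show "Poly_Mapping.lookup (tens_op (Kinv_op n) id (O.op_of R_value (tens_op id (K_op n) (ket S)))) A = Poly_Mapping.lookup (O.op_of M (ket S)) A"
          unfolding lookup_Kinv_id id_K_ket linD(2)[OF O.lin_op_of] lookup_smul O.lookup_op_of[OF R_value_preserves_weight S] O.lookup_op_of[OF W S]
          using M[OF _ S] by simp
      qed
      also have "\<dots> = sum' (\<lambda>(a, b). smul (rat_value (S11_elem n eps a b i j)) (ket (a, b))) X"
        by (rule HOL.sym, rule O.sum'_op_of[OF W S]) (auto simp: fun_eq_iff M_def e)
      finally show "tens_op (Kinv_op n) id (O.op_of R_value (tens_op id (K_op n) (ket S))) =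
        lin_ext (\<lambda>(i, j). sum' (\<lambda>(a, b). smul (rat_value (S11_elem n eps a b i j)) (ket (a, b))) (states n eps \<times> states n eps)) (ket S)"
        unfolding lin_ext_ket e prod.case X .
    qed
    then show "tens_op (Kinv_op n) id (restrict (O.op_of R_value) O.space (tens_op id (K_op n) v)) =
      lin_ext (\<lambda>(i, j). sum' (\<lambda>(a, b). smul (rat_value (S11_elem n eps a b i j)) (ket (a, b))) (states n eps \<times> states n eps)) v"
      using sK by simp
  qed
  finally show "S11 n eps = R_B_tilde n eps" ..
qed

end

theorem theorem4p1:
  fixes n \<kappa> :: nat and eps :: "nat \<Rightarrow> nat"
  assumes "\<kappa> \<le> n"
    and "\<And>k. k \<in> {1..n} \<Longrightarrow> eps k = (if k \<le> \<kappa> then 1 else 0)"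
  shows
    "(n \<ge> 2 \<longrightarrow>
       (\<forall>l m i0. (\<kappa> = n \<longrightarrow> l \<le> n \<and> m \<le> n) \<longrightarrow> (\<kappa> < n \<longrightarrow> i0 \<in> {1..n} \<and> eps i0 = 0) \<longrightarrow>
          (\<forall>a\<in>states_of n eps l. \<forall>b\<in>states_of n eps m.
           \<forall>i\<in>states_of n eps l. \<forall>j\<in>states_of n eps m.
             rational_series (Str_elem n eps l m a b i j)) \<and>
          (\<exists>!R. is_R_A n eps l m i0 R) \<and>
          Str n eps l m = R_A n eps l m i0))
   \<and> (n \<ge> 1 \<longrightarrow>
       (\<forall>a\<in>states n eps. \<forall>b\<in>states n eps. \<forall>i\<in>states n eps. \<forall>j\<in>states n eps.
          rational_series (S11_elem n eps a b i j)) \<and>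
       (\<exists>!R. is_R_B n eps R) \<and>
       S11 n eps = R_B_tilde n eps)"
proof -
  have le1: "k \<in> {1..n} \<Longrightarrow> eps k \<le> 1" for k using assms(2)[of k] by simp
  have A: "(\<forall>a\<in>states_of n eps l. \<forall>b\<in>states_of n eps m. \<forall>i\<in>states_of n eps l. \<forall>j\<in>states_of n eps m.
             rational_series (Str_elem n eps l m a b i j)) \<and>
          (\<exists>!R. is_R_A n eps l m i0 R) \<and> Str n eps l m = R_A n eps l m i0"
    if n: "2 \<le> n" and lm: "\<kappa> = n \<longrightarrow> l \<le> n \<and> m \<le> n" and i0: "\<kappa> < n \<longrightarrow> i0 \<in> {1..n} \<and> eps i0 = 0" for l m i0
  proof -
    have n1: "1 \<le> n" using n by simp
    interpret series_model n eps True l m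
      by unfold_locales (erule le1 | rule n1 | rule n)+
    have all1: "(\<forall>k\<in>{1..n}. eps k = 1) \<longleftrightarrow> \<kappa> = n"
    proof
      assume h: "\<forall>k\<in>{1..n}. eps k = 1"
      have nn: "n \<in> {1..n}" using n by simp
      have "eps n = 1" using h nn by blast
      then have "n \<le> \<kappa>" using assms(2)[OF nn] by (cases "n \<le> \<kappa>") simp_all
      then show "\<kappa> = n" using assms(1) by simp
    next
      assume "\<kappa> = n"
      then show "\<forall>k\<in>{1..n}. eps k = 1" using assms(2) by simp
    qed
    have ok: "ref_ok i0" unfolding ref_ok_def all1 using lm i0 assms(1) by (cases "\<kappa> = n") simp_all
    show ?thesis by (intro conjI Str_equals_R_A[OF TrueI ok])
  qed
  have B: "(\<forall>a\<in>states n eps. \<forall>b\<in>states n eps. \<forall>i\<in>states n eps. \<forall>j\<in>states n eps. rational_series (S11_elem n eps a b i j)) \<and>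
       (\<exists>!R. is_R_B n eps R) \<and> S11 n eps = R_B_tilde n eps"
    if n: "1 \<le> n"
  proof -
    \<comment> \<open>\<open>U_B\<close> acts on states of all totals, and 0 stands in for \<open>l\<close> and \<open>m\<close>\<close>
    interpret series_model n eps False 0 0
      by unfold_locales (erule le1 | rule n | erule FalseE)+
    show ?thesis by (intro conjI S11_equals_R_B) simp_all
  qed
  show ?thesis
    by (rule conjI, intro allI impI, rule A, assumption+, intro impI, rule B, assumption)
qed

end
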